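(* Let $\omega\in\mathbf R^n$ be fixed (independent of any parameter) and satisfy, for some $\gamma>0$, $\tau>n$, $|\omega\cdot k|\ge\gamma/|k|^\tau$ for all $k\in\mathbf Z^n\setminus\{0\}$. Assume that the function $\Gamma:\mathbf T^n\to\mathbf R$, $$\Gamma(A)=\int_{\mathbf R}(\cos q_0(t)-1)\,f(\omega t+A)\,dt,\qquad q_0(t)=4\arctan(e^t),$$ possesses a non-degenerate minimum. Then, for $\mu>0$ small enough, for all $I_0,I_0'\in\mathbf R^n$ with $\omega\cdot I_0=\omega\cdot I_0'$ there is a heteroclinic orbit of $\mathcal H_\mu$ connecting the invariant tori $\mathcal T_{I_0}$ and $\mathcal T_{I_0'}$, and, for $\eta>0$ small, the diffusion time $T_d$ needed to go from an $\eta$-neighbourhood of $\mathcal T_{I_0}$ to an $\eta$-neighbourhood of $\mathcal T_{I_0'}$ satisfies, as $\mu\to0^+$ (with $I_0,I_0',\eta$ fixed), $$T_d=O\Big(\frac1\mu\log\frac1\mu\Big).$$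
   Context: $\mathbf T^m=\mathbf R^m/2\pi\mathbf Z^m$. Let $f:\mathbf T^n\to\mathbf R$ be a (sufficiently smooth) function. On $(\varphi,I,q,p)\in\mathbf T^n\times\mathbf R^n\times\mathbf T^1\times\mathbf R$ consider $$\mathcal H_\mu=\omega\cdot I+\frac{p^2}{2}+(\cos q-1)+\mu(1-\cos q)f(\varphi),$$ with equations of motion $\dot\varphi=\omega$, $\dot I=-\mu(1-\cos q)\partial_\varphi f(\varphi)$, $\dot q=p$, $\dot p=\sin q-\mu\sin q\,f(\varphi)$. For every $\mu$ and $I_0\in\mathbf R^n$ the torus $\mathcal T_{I_0}=\{(\varphi,I,q,p): I=I_0,\ q=p=0\}$ is invariant. A heteroclinic orbit connecting $\mathcal T_{I_0}$ and $\mathcal T_{I_0'}$ is an orbit whose distance to $\mathcal T_{I_0}$ tends to $0$ as $t\to-\infty$ and whose distance to $\mathcal T_{I_0'}$ tends to $0$ as $t\to+\infty$. The diffusion time is $T_d=t_2-t_1$ for times $t_1<t_2$ such that the orbit lies at time $t_1$ in the $\eta$-neighbourhood of $\mathcal T_{I_0}$ and at time $t_2$ in the $\eta$-neighbourhood of $\mathcal T_{I_0'}$. *)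

theory Defs
  imports "HOL-Analysis.Analysis" "HOL-Library.Landau_Symbols"
begin

text \<open>
  Tori are handled through their universal cover: a function on the n-torus is a function on
  \<open>real ^ 'n\<close> that is invariant under \<open>2 * pi\<close> times the integer lattice, and an orbit in the phase
  space (n-torus, n-space, circle, line) is represented by its lift \<open>(\<phi>, I, q, p)\<close> to
  \<open>real ^ 'n \<times> real ^ 'n \<times> real \<times> real\<close>. The vector field below is periodic in \<open>\<phi>\<close> and \<open>q\<close>, so orbits
  and their lifts correspond to each other.
\<close>

type_synonym 'n phase = "(real ^ 'n) \<times> (real ^ 'n) \<times> real \<times> real"

definition int_vec :: "int ^ 'n \<Rightarrow> real ^ 'n::finite" where
  "int_vec k = (\<chi> i. real_of_int (k $ i))"

definition torus_periodic :: "(real ^ 'n::finite \<Rightarrow> real) \<Rightarrow> bool" where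
  "torus_periodic f \<longleftrightarrow> (\<forall>x k. f (x + (2 * pi) *\<^sub>R int_vec k) = f x)"

definition grad :: "(real ^ 'n::finite \<Rightarrow> real) \<Rightarrow> real ^ 'n \<Rightarrow> real ^ 'n" where
  "grad f x = (\<chi> i. frechet_derivative f (at x) (axis i 1))"

primrec C_k :: "nat \<Rightarrow> (real ^ 'n::finite \<Rightarrow> real) \<Rightarrow> bool" where
  "C_k 0 f \<longleftrightarrow> continuous_on UNIV f"
| "C_k (Suc r) f \<longleftrightarrow> (\<forall>x. f differentiable (at x)) \<and> (\<forall>i. C_k r (\<lambda>x. grad f x $ i))"

definition diophantine :: "real ^ 'n::finite \<Rightarrow> real \<Rightarrow> real \<Rightarrow> bool" where
  "diophantine \<omega> \<gamma> \<tau> \<longleftrightarrow>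
     (\<forall>k :: int ^ 'n. k \<noteq> 0 \<longrightarrow> \<bar>\<omega> \<bullet> int_vec k\<bar> \<ge> \<gamma> / norm (int_vec k) powr \<tau>)"

definition hamiltonian ::
    "real ^ 'n::finite \<Rightarrow> (real ^ 'n \<Rightarrow> real) \<Rightarrow> real \<Rightarrow> 'n phase \<Rightarrow> real" where
  "hamiltonian \<omega> f \<mu> = (\<lambda>(\<phi>, I, q, p).
     \<omega> \<bullet> I + p\<^sup>2 / 2 + (cos q - 1) + \<mu> * (1 - cos q) * f \<phi>)"

definition hamiltonian_field :: "('n::finite phase \<Rightarrow> real) \<Rightarrow> 'n phase \<Rightarrow> 'n phase" where
  "hamiltonian_field H = (\<lambda>(\<phi>, I, q, p).
     (grad (\<lambda>I'. H (\<phi>, I', q, p)) I,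
      - grad (\<lambda>\<phi>'. H (\<phi>', I, q, p)) \<phi>,
      deriv (\<lambda>p'. H (\<phi>, I, q, p')) p,
      - deriv (\<lambda>q'. H (\<phi>, I, q', p)) q))"

definition is_orbit :: "('n::finite phase \<Rightarrow> real) \<Rightarrow> (real \<Rightarrow> 'n phase) \<Rightarrow> bool" where
  "is_orbit H x \<longleftrightarrow> (\<forall>t. (x has_vector_derivative hamiltonian_field H (x t)) (at t))"

lemma grad_eqI:
  assumes "(F has_derivative (\<lambda>h. D \<bullet> h)) (at x)"
  shows "grad F x = D"
  using frechet_derivative_at[OF assms, symmetric]
  by (simp add: grad_def vec_eq_iff inner_axis)

lemma has_derivative_grad:
  assumes "F differentiable (at x)"
  shows "(F has_derivative (\<lambda>h. grad F x \<bullet> h)) (at x)"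
proof -
  have D: "(F has_derivative frechet_derivative F (at x)) (at x)"
    using assms frechet_derivative_works by blast
  then have lin: "linear (frechet_derivative F (at x))"
    by (rule has_derivative_linear)
  have "frechet_derivative F (at x) h = grad F x \<bullet> h" for h
  proof -
    have "frechet_derivative F (at x) h =
        frechet_derivative F (at x) (\<Sum>i\<in>UNIV. h $ i *\<^sub>R axis i 1)"
      using basis_expansion[of h] by (simp add: scalar_mult_eq_scaleR)
    also have "\<dots> = grad F x \<bullet> h"
      by (simp add: linear_sum[OF lin] linear_scale[OF lin] grad_def inner_vec_def mult.commute)
    finally show ?thesis .
  qed
  with D show ?thesis
    by (metis (no_types, lifting) ext)
qed

text \<open>Hamilton's equations for \<open>hamiltonian\<close> in explicit form.\<close>

lemma hamiltonian_field_explicit: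
  assumes "f differentiable (at \<phi>)"
  shows "hamiltonian_field (hamiltonian \<omega> f \<mu>) (\<phi>, I, q, p) =
    (\<omega>, - (\<mu> * (1 - cos q)) *\<^sub>R grad f \<phi>, p, sin q - \<mu> * sin q * f \<phi>)"
proof -
  have 1: "grad (\<lambda>I'. hamiltonian \<omega> f \<mu> (\<phi>, I', q, p)) I = \<omega>"
    unfolding hamiltonian_def
    by (rule grad_eqI) (auto intro!: derivative_eq_intros)
  have 2: "grad (\<lambda>\<phi>'. hamiltonian \<omega> f \<mu> (\<phi>', I, q, p)) \<phi> = (\<mu> * (1 - cos q)) *\<^sub>R grad f \<phi>"
    unfolding hamiltonian_def
    by (rule grad_eqI) (auto intro!: derivative_eq_intros has_derivative_grad[OF assms])
  have 3: "deriv (\<lambda>p'. hamiltonian \<omega> f \<mu> (\<phi>, I, q, p')) p = p"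
    unfolding hamiltonian_def
    by (rule DERIV_imp_deriv) (auto intro!: derivative_eq_intros)
  have 4: "deriv (\<lambda>q'. hamiltonian \<omega> f \<mu> (\<phi>, I, q', p)) q = - sin q + \<mu> * sin q * f \<phi>"
    unfolding hamiltonian_def
    by (rule DERIV_imp_deriv) (auto intro!: derivative_eq_intros)
  show ?thesis
    by (simp add: hamiltonian_field_def 1 2 3 4)
qed

text \<open>
  Full preimage of the invariant torus in the cover, hence \<open>q\<close> ranges over all multiples of \<open>2 * pi\<close>.
  The distance from a lifted point to this set is the distance to the torus in the quotient.
\<close>

definition inv_torus :: "real ^ 'n::finite \<Rightarrow> 'n phase set" where
  "inv_torus I0 = {(\<phi>, I, q, p). I = I0 \<and> (\<exists>m::int. q = 2 * pi * of_int m) \<and> p = 0}"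

definition torus_nbhd :: "real \<Rightarrow> real ^ 'n::finite \<Rightarrow> 'n phase set" where
  "torus_nbhd \<eta> I0 = {x. infdist x (inv_torus I0) < \<eta>}"

definition heteroclinic ::
    "('n::finite phase \<Rightarrow> real) \<Rightarrow> real ^ 'n \<Rightarrow> real ^ 'n \<Rightarrow> (real \<Rightarrow> 'n phase) \<Rightarrow> bool" where
  "heteroclinic H I0 I1 x \<longleftrightarrow> is_orbit H x
     \<and> ((\<lambda>t. infdist (x t) (inv_torus I0)) \<longlongrightarrow> 0) at_bot
     \<and> ((\<lambda>t. infdist (x t) (inv_torus I1)) \<longlongrightarrow> 0) at_top"

definition separatrix :: "real \<Rightarrow> real" where
  "separatrix t = 4 * arctan (exp t)"

definition melnikov :: "real ^ 'n::finite \<Rightarrow> (real ^ 'n \<Rightarrow> real) \<Rightarrow> real ^ 'n \<Rightarrow> real" where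
  "melnikov \<omega> f A = (LINT t|lborel. (cos (separatrix t) - 1) * f (t *\<^sub>R \<omega> + A))"

text \<open>A local minimum whose Hessian matrix exists and is invertible.\<close>

definition nondegenerate_minimum :: "(real ^ 'n::finite \<Rightarrow> real) \<Rightarrow> real ^ 'n \<Rightarrow> bool" where
  "nondegenerate_minimum F A \<longleftrightarrow>
     (\<forall>\<^sub>F B in nhds A. F A \<le> F B) \<and>
     (\<forall>\<^sub>F B in nhds A. F differentiable (at B)) \<and>
     (\<exists>M :: real ^ 'n ^ 'n. (grad F has_derivative (\<lambda>h. M *v h)) (at A) \<and> invertible M)"

end

theory Submission
  imports Defs
begin

text \<open>
  The angles rotate uniformly, \<open>\<phi> = t *\<^sub>R \<omega> + A\<close>. The pair \<open>(q, p)\<close> is therefore a pendulum with the quasi-periodically modulated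
  force \<open>(1 - \<mu> * f (t *\<^sub>R \<omega> + A)) * sin q\<close>, and the momentum \<open>I\<close> is obtained by integration. Whenever \<open>q\<close> makes a turn
  along the separatrix around a time \<open>\<theta>\<close>, the momentum changes by \<open>\<mu>\<close> times the gradient of the Melnikov function
  at \<open>A + \<theta> *\<^sub>R \<omega>\<close>, up to \<open>O(\<mu>\<^sup>2)\<close>. A chain of about \<open>norm (I1 - I0) / \<mu>\<close> such crossings with suitably tuned phases can transfer the
  momentum \<open>I1 - I0\<close>. Between two crossings the pendulum rests near its unstable equilibrium for a time of order
  \<open>ln (1 / \<mu>)\<close>, after which the crossings no longer feel each other to leading order. The product of the two numbers is the diffusion time.

  To construct the chain, crossing times \<open>\<theta> i\<close> are fixed at which the linear flow is close to the lattice
  (\<open>torus_returns\<close>). A broken orbit is then built from solutions of the initial value problem on windows of length two around the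
  \<open>\<theta> i\<close> and of a boundary value problem on the gaps between them. Near the equilibrium the equation is hyperbolic,
  \<open>x'' = x + small\<close>; prescribing the stable coordinate \<open>x - p\<close> on the left and the unstable coordinate \<open>x + p\<close> on the right makes the boundary
  value problem uniquely solvable with estimates that do not depend on the length of the gap (\<open>hyperbolic_comparison\<close>,
  \<open>gap_sol_exists\<close>, \<open>gap_sol_stable\<close>). At each of the two ends of a window there remains a scalar mismatch, measured by the
  energy of the pendulum (\<open>match_right\<close>, \<open>match_left\<close>).

  The unknowns are a displacement \<open>\<alpha>\<close> of the phase from the critical point \<open>A0\<close> of the Melnikov function and, for every crossing, a
  shift of its time and a correction of its velocity. They have to annihilate two energy mismatches per crossing and to produce the
  momentum transfer. At a nondegenerate minimum the Hessian \<open>M\<close> is positive definite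
  (\<open>nondegenerate_local_minimum_positive_definite\<close>). Its invertibility determines \<open>\<alpha>\<close>, and \<open>\<omega> \<bullet> (M *v \<omega>) > 0\<close> lets the time
  shifts control the energy exchanged in the crossings. In suitable combinations every equation is a small perturbation of one
  unknown, uniformly in the number of crossings, so that the Poincare-Miranda theorem applies (\<open>poincare_miranda\<close>,
  \<open>shooting\<close>). The resonance condition \<open>\<omega> \<bullet> I0 = \<omega> \<bullet> I1\<close> enters through the conservation of energy: it is what makes the differences of the two mismatches at a crossing sum to
  zero (\<open>total_balance\<close>).
\<close>

section \<open>Simultaneous zeros on a cube\<close>

text \<open>
  Sequential compactness of a cube whose coordinates are indexed by a finite set inside an arbitrary type.
  The values outside \<open>I\<close> are left alone, so no topology on the function type is involved.
\<close>

lemma finite_coordinates_convergent_subsequence: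
  fixes X :: "nat \<Rightarrow> 'j \<Rightarrow> real"
  assumes "finite I" and "\<And>n j. j \<in> I \<Longrightarrow> X n j \<in> {-1..1}"
  shows "\<exists>r x. strict_mono (r :: nat \<Rightarrow> nat) \<and> (\<forall>j\<in>I. (\<lambda>n. X (r n) j) \<longlonglongrightarrow> x j)"
  using assms
proof (induction I rule: finite_induct)
  case empty
  show ?case by (rule exI[of _ id]) (auto simp: strict_mono_def)
next
  case (insert i I)
  then obtain r x where r: "strict_mono r" and x: "\<And>j. j \<in> I \<Longrightarrow> (\<lambda>n. X (r n) j) \<longlonglongrightarrow> x j"
    by (metis insertCI)
  have "compact {-1..1::real}" by simp
  moreover have "\<forall>n. X (r n) i \<in> {-1..1}" using insert.prems by auto
  ultimately obtain l s where s: "strict_mono s" "((\<lambda>n. X (r n) i) \<circ> s) \<longlonglongrightarrow> l"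
    unfolding compact_def by meson
  have "\<forall>j\<in>insert i I. (\<lambda>n. X ((r \<circ> s) n) j) \<longlonglongrightarrow> (x(i := l)) j"
  proof
    fix j assume "j \<in> insert i I"
    show "(\<lambda>n. X ((r \<circ> s) n) j) \<longlonglongrightarrow> (x(i := l)) j"
    proof (cases "j = i")
      case True then show ?thesis using s by (simp add: o_def)
    next
      case False
      then have "j \<in> I" using \<open>j \<in> insert i I\<close> by auto
      from LIMSEQ_subseq_LIMSEQ[OF x[OF this] s(1)] False show ?thesis by (simp add: o_def)
    qed
  qed
  then show ?case using strict_mono_o[OF r s(1)] by blast
qed

text \<open>
  The Poincare-Miranda theorem: if the \<open>i\<close>-th function has opposite signs on the two faces
  \<open>x i = \<plusminus>1\<close>, all the functions vanish simultaneously. The cube is labelled on a grid of mesh \<open>2 / p\<close> by the signs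
  of the functions, Kuhn's combinatorial lemma finds a small cell on which every function takes both signs, and
  a limit point of these cells is a common zero. The index set is a finite subset of a type and continuity is
  sequential, because the number of unknowns grows with the number of crossings and the functions are defined by
  solving differential equations.
\<close>

theorem poincare_miranda:
  fixes F :: "'j \<Rightarrow> ('j \<Rightarrow> real) \<Rightarrow> real"
  assumes fin: "finite I"
    and cont: "\<And>i X x. i \<in> I \<Longrightarrow> (\<And>n j. j \<in> I \<Longrightarrow> X n j \<in> {-1..1}) \<Longrightarrow>
        (\<And>j. j \<in> I \<Longrightarrow> (\<lambda>n. X n j) \<longlonglongrightarrow> x j) \<Longrightarrow> (\<lambda>n. F i (X n)) \<longlonglongrightarrow> F i x"
    and lo: "\<And>i x. i \<in> I \<Longrightarrow> (\<And>j. j \<in> I \<Longrightarrow> x j \<in> {-1..1}) \<Longrightarrow> x i = -1 \<Longrightarrow> F i x \<le> 0"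
    and hi: "\<And>i x. i \<in> I \<Longrightarrow> (\<And>j. j \<in> I \<Longrightarrow> x j \<in> {-1..1}) \<Longrightarrow> x i = 1 \<Longrightarrow> F i x \<ge> 0"
  shows "\<exists>x. (\<forall>j\<in>I. x j \<in> {-1..1}) \<and> (\<forall>i\<in>I. F i x = 0)"
proof -
  define N where "N = card I"
  obtain h where h: "bij_betw h {..<N} I"
    using ex_bij_betw_nat_finite[OF fin] unfolding N_def atLeast0LessThan by blast
  define k where "k = inv_into {..<N} h"
  have kN: "k j < N" "h (k j) = j" if "j \<in> I" for j
    using that h unfolding k_def
    by (metis bij_betw_imp_surj_on inv_into_into lessThan_iff, metis bij_betw_inv_into_right)
  have hI: "h i \<in> I" "k (h i) = i" if "i < N" for i
    using that h unfolding k_def by (auto simp: bij_betw_def bij_betw_inv_into_left)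
  define pt :: "nat \<Rightarrow> (nat \<Rightarrow> nat) \<Rightarrow> 'j \<Rightarrow> real"
    where "pt p z j = -1 + 2 * real (z (k j)) / real p" for p z j
  have pt: "pt p z j \<in> {-1..1}" if "j \<in> I" "p > 0" "\<And>i. i < N \<Longrightarrow> z i \<le> p" for p z j
    using that kN[of j] by (auto simp: pt_def divide_simps)
  \<comment> \<open>The labels on the two faces are forced, which is what the combinatorial lemma demands; inside, the label
    is the sign, and a zero counts as positive.\<close>
  define lab :: "nat \<Rightarrow> (nat \<Rightarrow> nat) \<Rightarrow> nat \<Rightarrow> nat"
    where "lab p z i = (if z i = 0 then 0 else if z i = p \<or> F (h i) (pt p z) \<ge> 0 then 1 else 0)" for p z i
  have lab1: "F (h i) (pt p z) \<ge> 0" if "lab p z i = 1" "i < N" "p > 0" "\<And>i. i < N \<Longrightarrow> z i \<le> p" for p z i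
  proof (cases "z i = p")
    case True
    show ?thesis by (rule hi) (use that True hI pt in \<open>auto simp: pt_def\<close>)
  qed (use that in \<open>auto simp: lab_def split: if_splits\<close>)
  have lab0: "F (h i) (pt p z) \<le> 0" if "lab p z i = 0" "i < N" "p > 0" "\<And>i. i < N \<Longrightarrow> z i \<le> p" for p z i
  proof (cases "z i = 0")
    case True
    show ?thesis by (rule lo) (use that True hI pt in \<open>auto simp: pt_def\<close>)
  qed (use that in \<open>auto simp: lab_def split: if_splits\<close>)
  \<comment> \<open>For every mesh there are a base point and, for every function, nearby points where it is nonnegative and nonpositive.\<close>
  have "\<exists>q. (\<forall>j\<in>I. q j \<in> {-1..1}) \<and> (\<forall>i\<in>I. \<exists>r s. (\<forall>j\<in>I. r j \<in> {-1..1} \<and> \<bar>r j - q j\<bar> \<le> 2 / real (Suc m)) \<and>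
      (\<forall>j\<in>I. s j \<in> {-1..1} \<and> \<bar>s j - q j\<bar> \<le> 2 / real (Suc m)) \<and> F i r \<ge> 0 \<and> F i s \<le> 0)" for m
  proof -
    define p where "p = Suc m"
    have p0: "p > 0" by (simp add: p_def)
    obtain q where q: "\<forall>i<N. q i < p"
      and rs: "\<forall>i<N. \<exists>r s. (\<forall>j<N. q j \<le> r j \<and> r j \<le> q j + 1) \<and>
         (\<forall>j<N. q j \<le> s j \<and> s j \<le> q j + 1) \<and> lab p r i \<noteq> lab p s i"
      by (rule kuhn_lemma[OF p0, of N "lab p"]) (auto simp: lab_def p_def)
    have near: "pt p r j \<in> {-1..1} \<and> \<bar>pt p r j - pt p q j\<bar> \<le> 2 / real (Suc m)"
      if "\<forall>j<N. q j \<le> r j \<and> r j \<le> q j + 1" "j \<in> I" for r j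
    proof
      show "pt p r j \<in> {-1..1}"
        by (rule pt) (use that q p0 in \<open>auto simp: Suc_le_eq intro: order_trans\<close>)
      have "pt p r j - pt p q j = 2 * (real (r (k j)) - real (q (k j))) / real p"
        by (simp add: pt_def diff_divide_distrib right_diff_distrib)
      also have "\<bar>\<dots>\<bar> \<le> 2 * 1 / real p"
        using that(1) kN(1)[OF that(2)] by (auto simp: abs_mult intro!: divide_right_mono)
      finally show "\<bar>pt p r j - pt p q j\<bar> \<le> 2 / real (Suc m)" by (simp add: p_def)
    qed
    have main: "\<exists>r s. (\<forall>j\<in>I. r j \<in> {-1..1} \<and> \<bar>r j - pt p q j\<bar> \<le> 2 / real (Suc m)) \<and>
      (\<forall>j\<in>I. s j \<in> {-1..1} \<and> \<bar>s j - pt p q j\<bar> \<le> 2 / real (Suc m)) \<and> F i r \<ge> 0 \<and> F i s \<le> 0"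
      if iI: "i \<in> I" for i
    proof -
      obtain r s where rs': "\<forall>j<N. q j \<le> r j \<and> r j \<le> q j + 1" "\<forall>j<N. q j \<le> s j \<and> s j \<le> q j + 1"
         "lab p r (k i) \<noteq> lab p s (k i)"
        using rs kN(1)[OF iI] by blast
      have b: "\<And>i. i < N \<Longrightarrow> r i \<le> p" "\<And>i. i < N \<Longrightarrow> s i \<le> p"
        using rs' q by (metis Suc_eq_plus1 Suc_leI order_trans)+
      have "lab p r (k i) = 1 \<and> lab p s (k i) = 0 \<or> lab p s (k i) = 1 \<and> lab p r (k i) = 0"
        proof -
        have "lab p z (k i) = 0 \<or> lab p z (k i) = 1" for z by (simp add: lab_def)
        then show ?thesis using rs'(3) by metis
      qed
      then show ?thesis
      proof
        assume *: "lab p r (k i) = 1 \<and> lab p s (k i) = 0"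
        show ?thesis
          by (rule exI[of _ "pt p r"], rule exI[of _ "pt p s"])
             (use near rs' lab1[of p r "k i"] lab0[of p s "k i"] * b kN[OF that] p0 in auto)
      next
        assume *: "lab p s (k i) = 1 \<and> lab p r (k i) = 0"
        show ?thesis
          by (rule exI[of _ "pt p s"], rule exI[of _ "pt p r"])
             (use near rs' lab1[of p s "k i"] lab0[of p r "k i"] * b kN[OF that] p0 in auto)
      qed
    qed
    have "pt p q j \<in> {-1..1}" if "j \<in> I" for j
      by (rule pt[OF that p0]) (use q in \<open>auto intro: less_imp_le\<close>)
    with main show ?thesis by blast
  qed
  then obtain Q where Q: "\<And>m j. j \<in> I \<Longrightarrow> Q m j \<in> {-1..1}"
    and "\<forall>m. \<forall>i\<in>I. \<exists>r s. (\<forall>j\<in>I. r j \<in> {-1..1} \<and> \<bar>r j - Q m j\<bar> \<le> 2 / real (Suc m)) \<and>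
      (\<forall>j\<in>I. s j \<in> {-1..1} \<and> \<bar>s j - Q m j\<bar> \<le> 2 / real (Suc m)) \<and> F i r \<ge> 0 \<and> F i s \<le> 0"
    by metis
  then have "\<exists>R S. \<forall>m. \<forall>i\<in>I. (\<forall>j\<in>I. R m i j \<in> {-1..1} \<and> \<bar>R m i j - Q m j\<bar> \<le> 2 / real (Suc m)) \<and>
      (\<forall>j\<in>I. S m i j \<in> {-1..1} \<and> \<bar>S m i j - Q m j\<bar> \<le> 2 / real (Suc m)) \<and>
      F i (R m i) \<ge> 0 \<and> F i (S m i) \<le> 0"
    by metis
  then obtain R S where RS: "\<And>m i j. i \<in> I \<Longrightarrow> j \<in> I \<Longrightarrow> R m i j \<in> {-1..1} \<and> \<bar>R m i j - Q m j\<bar> \<le> 2 / real (Suc m)"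
      "\<And>m i j. i \<in> I \<Longrightarrow> j \<in> I \<Longrightarrow> S m i j \<in> {-1..1} \<and> \<bar>S m i j - Q m j\<bar> \<le> 2 / real (Suc m)"
      "\<And>m i. i \<in> I \<Longrightarrow> F i (R m i) \<ge> 0" "\<And>m i. i \<in> I \<Longrightarrow> F i (S m i) \<le> 0"
    by blast
  obtain g x where g: "strict_mono (g :: nat \<Rightarrow> nat)" and x: "\<And>j. j \<in> I \<Longrightarrow> (\<lambda>n. Q (g n) j) \<longlonglongrightarrow> x j"
    using finite_coordinates_convergent_subsequence[OF fin, of Q] Q by blast
  have lim: "(\<lambda>n. T (g n) j) \<longlonglongrightarrow> x j"
    if "j \<in> I" "\<And>m. \<bar>T m j - Q m j\<bar> \<le> 2 / real (Suc m)" for T :: "nat \<Rightarrow> 'j \<Rightarrow> real" and j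
  proof -
    have "(\<lambda>n. 2 / real (Suc n)) \<longlonglongrightarrow> 0"
      using LIMSEQ_Suc[OF lim_const_over_n[of "2::real"]] by simp
    from LIMSEQ_subseq_LIMSEQ[OF this g] have "(\<lambda>n. 2 / real (Suc (g n))) \<longlonglongrightarrow> 0" by (simp add: o_def)
    then have "(\<lambda>n. T (g n) j - Q (g n) j) \<longlonglongrightarrow> 0"
      by (rule Lim_null_comparison[rotated]) (use that in auto)
    from tendsto_add[OF this x[OF that(1)]] show ?thesis by simp
  qed
  have xI: "x j \<in> {-1..1}" if "j \<in> I" for j
    using closed_sequentially[OF _ _ x[OF that], of "{-1..1}"] Q that by auto
  have "F i x = 0" if i: "i \<in> I" for i
  proof -
    have "(\<lambda>n. F i (R (g n) i)) \<longlonglongrightarrow> F i x"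
      by (rule cont[OF i]) (use RS i lim[of _ "\<lambda>m. R m i"] in auto)
    then have 1: "F i x \<ge> 0" by (rule LIMSEQ_le_const) (use RS i in auto)
    have "(\<lambda>n. F i (S (g n) i)) \<longlonglongrightarrow> F i x"
      by (rule cont[OF i]) (use RS i lim[of _ "\<lambda>m. S m i"] in auto)
    then have "F i x \<le> 0" by (rule LIMSEQ_le_const2) (use RS i in auto)
    with 1 show ?thesis by simp
  qed
  with xI show ?thesis by blast
qed

section \<open>Comparison estimates for hyperbolic second-order equations\<close>

text \<open>
  A function that is convex wherever it is positive cannot have a positive interior maximum. The sign conditions
  on the derivative at the end points push a positive value further into the interval, so the maximum cannot sit
  there either.
\<close>

lemma robin_maximum_principle:
  fixes h h1 h2 :: "real \<Rightarrow> real"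
  assumes h: "\<And>t. t \<in> {a..b} \<Longrightarrow> (h has_real_derivative h1 t) (at t within {a..b})"
    and h1: "\<And>t. t \<in> {a..b} \<Longrightarrow> (h1 has_real_derivative h2 t) (at t within {a..b})"
    and h2: "\<And>t. t \<in> {a..b} \<Longrightarrow> h t > 0 \<Longrightarrow> h2 t > 0"
    and left: "h a > 0 \<Longrightarrow> h1 a > 0" and right: "h b > 0 \<Longrightarrow> h1 b < 0"
    and t: "t \<in> {a..b}"
  shows "h t \<le> 0"
proof (rule ccontr)
  assume "\<not> h t \<le> 0"
  have ab: "a \<le> b" using t by auto
  have "continuous_on {a..b} h"
    using h by (meson DERIV_continuous continuous_on_eq_continuous_within)
  then obtain m where m: "m \<in> {a..b}" and max: "\<And>s. s \<in> {a..b} \<Longrightarrow> h s \<le> h m"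
    using continuous_attains_sup[of "{a..b}" h] ab by auto
  have pos: "h m > 0" using max[OF t] \<open>\<not> h t \<le> 0\<close> by linarith
  have le: "h1 m \<le> 0" if "m < b"
  proof (rule ccontr)
    assume "\<not> h1 m \<le> 0"
    then obtain d where "d > 0" "\<And>e. e > 0 \<Longrightarrow> m + e \<in> {a..b} \<Longrightarrow> e < d \<Longrightarrow> h m < h (m + e)"
      using has_real_derivative_pos_inc_right[OF h[OF m]] by auto
    moreover define e where "e = min (d/2) (b - m)"
    ultimately have "e > 0" "m + e \<in> {a..b}" "e < d" using that m by (auto simp: min_def)
    with \<open>\<And>e. e > 0 \<Longrightarrow> m + e \<in> {a..b} \<Longrightarrow> e < d \<Longrightarrow> h m < h (m + e)\<close> max show False
      by (meson not_le)
  qed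
  have ge: "h1 m \<ge> 0" if "a < m"
  proof (rule ccontr)
    assume "\<not> h1 m \<ge> 0"
    then obtain d where "d > 0" "\<And>e. e > 0 \<Longrightarrow> m - e \<in> {a..b} \<Longrightarrow> e < d \<Longrightarrow> h m < h (m - e)"
      using has_real_derivative_neg_dec_left[OF h[OF m]] by auto
    moreover define e where "e = min (d/2) (m - a)"
    ultimately have "e > 0" "m - e \<in> {a..b}" "e < d" using that m by (auto simp: min_def)
    with \<open>\<And>e. e > 0 \<Longrightarrow> m - e \<in> {a..b} \<Longrightarrow> e < d \<Longrightarrow> h m < h (m - e)\<close> max show False
      by (meson not_le)
  qed
  have am: "a < m" using left le pos right m ab by (cases "m = a"; cases "m = b") force+
  have mb: "m < b" using right ge pos m am by (cases "m = b") force+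
  have h10: "h1 m = 0" using le ge am mb by force
  obtain d where d: "d > 0" "\<And>e. e > 0 \<Longrightarrow> m + e \<in> {a..b} \<Longrightarrow> e < d \<Longrightarrow> h1 m < h1 (m + e)"
    using has_real_derivative_pos_inc_right[OF h1[OF m] h2[OF m pos]] by auto
  define e where "e = min (d/2) (b - m)"
  have e: "e > 0" "m + e \<in> {a..b}" "e < d" using d mb m by (auto simp: e_def min_def)
  have "\<exists>z\<in>{m<..<m+e}. h (m + e) - h m = h1 z * (m + e - m)"
    by (rule mvt_simple[where f' = "\<lambda>z y. h1 z * y"])
       (use e am m in \<open>auto simp: has_field_derivative_def[symmetric] intro: DERIV_subset[OF h]\<close>)
  then obtain z where z: "m < z" "z < m + e" "h (m + e) - h m = h1 z * e" by auto
  have "h1 z > 0" using d(2)[of "z - m"] z e h10 am by auto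
  then have "h (m + e) > h m" using z(3) e(1) by (metis diff_gt_0_iff_gt mult_pos_pos)
  with max[OF e(2)] show False by simp
qed

text \<open>
  The equation \<open>d'' = d + small\<close> has a growing and a decaying mode. Prescribing \<open>d - d'\<close> at the left end and
  \<open>d + d'\<close> at the right end controls exactly the mode that decays into the interval, so the effect of
  boundary data dies exponentially and all the constants are independent of the length of the interval. This
  uniformity is what allows arbitrarily many crossings. The barrier is the sum of the two decaying exponentials and
  the constant \<open>\<delta> / (1 - \<kappa>)\<close>; its second derivative is smaller than its value by the right amount because
  \<open>\<beta>\<^sup>2 \<le> 1 - \<kappa>\<close>.
\<close>

lemma hyperbolic_comparison_interval:
  fixes d d1 d2 :: "real \<Rightarrow> real"
  assumes d: "\<And>t. t \<in> {a..b} \<Longrightarrow> (d has_real_derivative d1 t) (at t within {a..b})"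
    and d1: "\<And>t. t \<in> {a..b} \<Longrightarrow> (d1 has_real_derivative d2 t) (at t within {a..b})"
    and d2: "\<And>t. t \<in> {a..b} \<Longrightarrow> \<bar>d2 t - d t\<bar> \<le> \<kappa> * \<bar>d t\<bar> + \<delta>"
    and va: "\<bar>d a - d1 a\<bar> \<le> va" and ub: "\<bar>d b + d1 b\<bar> \<le> ub"
    and c: "0 \<le> \<kappa>" "\<kappa> < 1" "0 < \<beta>" "\<beta> < 1" "\<beta>\<^sup>2 \<le> 1 - \<kappa>" "0 \<le> \<delta>"
    and t: "t \<in> {a..b}"
  shows "\<bar>d t\<bar> \<le> va * exp (- \<beta> * (t - a)) + ub * exp (- \<beta> * (b - t)) + \<delta> / (1 - \<kappa>)" (is "_ \<le> ?W t")
    and "\<bar>d1 t\<bar> \<le> (1 + 1 / (1 - \<beta>)) * (va * exp (- \<beta> * (t - a)) + ub * exp (- \<beta> * (b - t))) + (2 / (1 - \<kappa>) + 1) * \<delta>"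
proof -
  define W1 where "W1 = (\<lambda>t. - \<beta> * (va * exp (- \<beta> * (t - a))) + \<beta> * (ub * exp (- \<beta> * (b - t))))"
  define W2 where "W2 = (\<lambda>t. \<beta>\<^sup>2 * (va * exp (- \<beta> * (t - a)) + ub * exp (- \<beta> * (b - t))))"
  have pos: "va \<ge> 0" "ub \<ge> 0" using va ub by linarith+
  have W: "(?W has_real_derivative W1 t) (at t within S)" for t S
    unfolding W1_def by (auto intro!: derivative_eq_intros)
  have W1: "(W1 has_real_derivative W2 t) (at t within S)" for t S
    unfolding W1_def W2_def by (auto intro!: derivative_eq_intros simp: power2_eq_square algebra_simps)
  have W2: "W2 t \<le> (1 - \<kappa>) * ?W t - \<delta>" for t
  proof -
    have "(1 - \<kappa>) * ?W t - \<delta> = (1 - \<kappa>) * (va * exp (- \<beta> * (t - a)) + ub * exp (- \<beta> * (b - t)))"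
      using c by (simp add: field_simps)
    then show ?thesis unfolding W2_def using c pos by (auto intro!: mult_right_mono)
  qed
  have rest: "\<delta> / (1 - \<kappa>) \<ge> 0" using c by simp
  have W0: "?W t \<ge> 0" for t using pos rest by auto
  have Wa: "W1 a \<le> ?W a - va"
  proof -
    have "\<beta> * (ub * exp (- \<beta> * (b - a))) \<le> 1 * (ub * exp (- \<beta> * (b - a)))"
      using c pos by (intro mult_right_mono) auto
    moreover have "\<beta> * va \<ge> 0" using c pos by auto
    ultimately show ?thesis using rest unfolding W1_def by simp
  qed
  have Wb: "- W1 b \<le> ?W b - ub"
  proof -
    have "\<beta> * (va * exp (- \<beta> * (b - a))) \<le> 1 * (va * exp (- \<beta> * (b - a)))"
      using c pos by (intro mult_right_mono) auto
    moreover have "\<beta> * ub \<ge> 0" using c pos by auto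
    ultimately show ?thesis using rest unfolding W1_def by simp
  qed
  have upper: "\<sigma> * d s - ?W s \<le> 0" if \<sigma>: "\<sigma> = 1 \<or> \<sigma> = -1" and s: "s \<in> {a..b}" for \<sigma> s
  proof (rule robin_maximum_principle[where h = "\<lambda>s. \<sigma> * d s - ?W s" and ?h1.0 = "\<lambda>s. \<sigma> * d1 s - W1 s"
        and ?h2.0 = "\<lambda>s. \<sigma> * d2 s - W2 s", OF _ _ _ _ _ s])
    fix t assume t: "t \<in> {a..b}"
    show "((\<lambda>s. \<sigma> * d s - ?W s) has_real_derivative \<sigma> * d1 t - W1 t) (at t within {a..b})"
      by (intro DERIV_diff DERIV_cmult d t W)
    show "((\<lambda>s. \<sigma> * d1 s - W1 s) has_real_derivative \<sigma> * d2 t - W2 t) (at t within {a..b})"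
      by (intro DERIV_diff DERIV_cmult d1 t W1)
    assume p: "\<sigma> * d t - ?W t > 0"
    have "\<bar>d t\<bar> = \<sigma> * d t" using p W0[of t] \<sigma> by auto
    moreover have "\<sigma> * d2 t \<ge> \<sigma> * d t - \<bar>d2 t - d t\<bar>" using \<sigma> by auto
    ultimately have "\<sigma> * d2 t \<ge> (1 - \<kappa>) * (\<sigma> * d t) - \<delta>" using d2[OF t] by (simp add: algebra_simps)
    moreover have "(1 - \<kappa>) * ?W t < (1 - \<kappa>) * (\<sigma> * d t)" using p c by (intro mult_strict_left_mono) auto
    ultimately show "\<sigma> * d2 t - W2 t > 0" using W2[of t] by linarith
  next
    assume p: "\<sigma> * d a - ?W a > 0"
    have "\<sigma> * d a - \<sigma> * d1 a \<le> va" using va \<sigma> by auto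
    with p Wa show "\<sigma> * d1 a - W1 a > 0" by linarith
  next
    assume p: "\<sigma> * d b - ?W b > 0"
    have "\<sigma> * d b + \<sigma> * d1 b \<le> ub" using ub \<sigma> by auto
    with p Wb show "\<sigma> * d1 b - W1 b < 0" by linarith
  qed
  have main: "\<bar>d s\<bar> \<le> ?W s" if "s \<in> {a..b}" for s
    using upper[of 1 s] upper[of "-1" s] that by auto
  show "\<bar>d t\<bar> \<le> ?W t" by (rule main[OF t])
  \<comment> \<open>The bound on \<open>d'\<close> comes from the first-order equation of \<open>d - d'\<close>, which decays forward in time up to the
    error already controlled. \<open>Z\<close> is a supersolution of it; the factor \<open>1 / (1 - \<beta>)\<close> absorbs the resonance between
    the rate \<open>1\<close> of that equation and the rate \<open>\<beta>\<close> of the barrier.\<close>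
  define Z where "Z = (\<lambda>t. va * exp (- \<beta> * (t - a)) / (1 - \<beta>) + ub * exp (- \<beta> * (b - t)) + (1 / (1 - \<kappa>) + 1) * \<delta>)"
  define Z1 where "Z1 = (\<lambda>t. - \<beta> * (va * exp (- \<beta> * (t - a)) / (1 - \<beta>)) + \<beta> * (ub * exp (- \<beta> * (b - t))))"
  have Z: "(Z has_real_derivative Z1 t) (at t within S)" for t S
    unfolding Z1_def Z_def using c(4) by (auto intro!: derivative_eq_intros)
  have ZW: "Z t + Z1 t \<ge> ?W t + \<delta>" for t
  proof -
    have "va * exp (- \<beta> * (t - a)) / (1 - \<beta>) - \<beta> * (va * exp (- \<beta> * (t - a)) / (1 - \<beta>))
        = (1 - \<beta>) * (va * exp (- \<beta> * (t - a)) / (1 - \<beta>))" by (simp only: left_diff_distrib mult_1_left)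
    also have "\<dots> = va * exp (- \<beta> * (t - a))" using c(4) by simp
    finally have "va * exp (- \<beta> * (t - a)) / (1 - \<beta>) - \<beta> * (va * exp (- \<beta> * (t - a)) / (1 - \<beta>))
        = va * exp (- \<beta> * (t - a))" .
    moreover have "\<beta> * (ub * exp (- \<beta> * (b - t))) \<ge> 0" using c pos by auto
    ultimately show ?thesis by (simp add: Z_def Z1_def algebra_simps)
  qed
  have low: "\<sigma> * (d t - d1 t) \<le> Z t" if \<sigma>: "\<sigma> = 1 \<or> \<sigma> = -1" for \<sigma>
  proof -
    have "exp a * (Z a - \<sigma> * (d a - d1 a)) \<le> exp t * (Z t - \<sigma> * (d t - d1 t))"
    proof (rule DERIV_nonneg_imp_increasing_open[of a t "\<lambda>t. exp t * (Z t - \<sigma> * (d t - d1 t))"])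
      show "a \<le> t" using t by auto
      show "continuous_on {a..t} (\<lambda>t. exp t * (Z t - \<sigma> * (d t - d1 t)))"
      proof -
        have "continuous_on {a..t} d" "continuous_on {a..t} d1" "continuous_on {a..t} Z"
          using DERIV_continuous_on[of "{a..b}" d d1] d DERIV_continuous_on[of "{a..b}" d1 d2] d1 t
            DERIV_continuous_on[of "{a..t}" Z Z1] Z
          by (auto intro: continuous_on_subset)
        then show ?thesis by (intro continuous_intros)
      qed
      fix s assume s: "a < s" "s < t"
      have i: "(d has_real_derivative d1 s) (at s)" "(d1 has_real_derivative d2 s) (at s)"
        using d[of s] d1[of s] s t at_within_interior[of s "{a..b}"] by auto
      have "((\<lambda>t. exp t * (Z t - \<sigma> * (d t - d1 t))) has_real_derivative
          exp s * (Z s - \<sigma> * (d s - d1 s)) + exp s * (Z1 s - \<sigma> * (d1 s - d2 s))) (at s)"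
        by (auto intro!: derivative_eq_intros i Z)
      moreover have "exp s * (Z s - \<sigma> * (d s - d1 s)) + exp s * (Z1 s - \<sigma> * (d1 s - d2 s)) =
          exp s * (Z s + Z1 s + \<sigma> * (d2 s - d s))" by (simp add: algebra_simps)
      moreover have "exp s * (Z s + Z1 s + \<sigma> * (d2 s - d s)) \<ge> 0"
      proof -
        have si: "s \<in> {a..b}" using s t by auto
        have "\<kappa> * \<bar>d s\<bar> \<le> 1 * \<bar>d s\<bar>" using c by (intro mult_right_mono) auto
        then have "\<bar>d2 s - d s\<bar> \<le> ?W s + \<delta>" using d2[OF si] main[OF si] by linarith
        moreover have "\<sigma> * (d2 s - d s) \<ge> - \<bar>d2 s - d s\<bar>" using \<sigma> by auto
        ultimately show ?thesis using ZW[of s] by (intro mult_nonneg_nonneg) auto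
      qed
      ultimately show "\<exists>y. ((\<lambda>t. exp t * (Z t - \<sigma> * (d t - d1 t))) has_real_derivative y) (at s) \<and> y \<ge> 0"
        by auto
    qed
    moreover have "Z a - \<sigma> * (d a - d1 a) \<ge> 0"
    proof -
      have "va * 1 \<le> va * (1 / (1 - \<beta>))" using c pos by (intro mult_left_mono) auto
      then have "Z a \<ge> va" using c pos by (auto simp: Z_def intro!: add_increasing2)
      then show ?thesis using va \<sigma> by auto
    qed
    ultimately have "exp t * (Z t - \<sigma> * (d t - d1 t)) \<ge> 0"
      by (meson exp_ge_zero mult_nonneg_nonneg order_trans)
    then show ?thesis by (simp add: zero_le_mult_iff)
  qed
  have "\<bar>d t - d1 t\<bar> \<le> Z t" using low[of 1] low[of "-1"] by auto
  then have "\<bar>d1 t\<bar> \<le> ?W t + Z t" using main[OF t] by linarith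
  also have "\<dots> \<le> (1 + 1 / (1 - \<beta>)) * (va * exp (- \<beta> * (t - a)) + ub * exp (- \<beta> * (b - t))) + (2 / (1 - \<kappa>) + 1) * \<delta>"
  proof -
    have "ub * exp (- \<beta> * (b - t)) * 1 \<le> ub * exp (- \<beta> * (b - t)) * (1 / (1 - \<beta>))"
      using c pos by (intro mult_left_mono) auto
    then show ?thesis by (simp add: Z_def algebra_simps)
  qed
  finally show "\<bar>d1 t\<bar> \<le> (1 + 1 / (1 - \<beta>)) * (va * exp (- \<beta> * (t - a)) + ub * exp (- \<beta> * (b - t))) + (2 / (1 - \<kappa>) + 1) * \<delta>" .
qed

text \<open>
  The time intervals between crossings: compact ones in the middle, and two half-lines for the asymptotic ends.
\<close>

definition line_interval :: "real set \<Rightarrow> bool" where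
  "line_interval S \<longleftrightarrow> (\<exists>a b. a \<le> b \<and> S = {a..b}) \<or> (\<exists>a. S = {a..}) \<or> (\<exists>b. S = {..b})"

text \<open>
  The decay factor of data given at the left end. On an interval unbounded to the left there is no such datum;
  boundedness of the solution replaces it, hence the value 0.
\<close>

definition left_weight :: "real \<Rightarrow> real set \<Rightarrow> real \<Rightarrow> real" where
  "left_weight \<beta> S t = (if bdd_below S then exp (- \<beta> * (t - Inf S)) else 0)"

definition right_weight :: "real \<Rightarrow> real set \<Rightarrow> real \<Rightarrow> real" where
  "right_weight \<beta> S t = (if bdd_above S then exp (- \<beta> * (Sup S - t)) else 0)"

lemma not_bdd_half_line [simp]: "\<not> bdd_above {a::real..}" "\<not> bdd_below {..b::real}"
proof -
  show "\<not> bdd_above {a..}"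
  proof
    assume "bdd_above {a..}"
    then obtain M where "\<And>x. x \<in> {a..} \<Longrightarrow> x \<le> M" unfolding bdd_above_def by blast
    from this[of "max a (M + 1)"] show False by auto
  qed
  show "\<not> bdd_below {..b}"
  proof
    assume "bdd_below {..b}"
    then obtain M where "\<And>x. x \<in> {..b} \<Longrightarrow> M \<le> x" unfolding bdd_below_def by blast
    from this[of "min b (M - 1)"] show False by auto
  qed
qed

lemma line_interval_cases [consumes 1, case_names interval above below]:
  assumes "line_interval S"
  obtains a b where "a \<le> b" "S = {a..b}" | a where "S = {a..}" | b where "S = {..b}"
  using assms unfolding line_interval_def by blast

lemma line_interval_closed: "line_interval S \<Longrightarrow> closed S"
  and line_interval_convex: "line_interval S \<Longrightarrow> convex S"
  and line_interval_nonempty: "line_interval S \<Longrightarrow> S \<noteq> {}"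
  by (auto simp: line_interval_def)

lemma Inf_Sup_line_interval:
  assumes "line_interval S"
  shows "bdd_below S \<Longrightarrow> Inf S \<in> S" "bdd_above S \<Longrightarrow> Sup S \<in> S"
    "bdd_below S \<Longrightarrow> t \<in> S \<Longrightarrow> Inf S \<le> t" "bdd_above S \<Longrightarrow> t \<in> S \<Longrightarrow> t \<le> Sup S"
  using assms by (cases rule: line_interval_cases; auto)+

lemma weight_bounds:
  assumes "line_interval S" "t \<in> S" "\<beta> > 0"
  shows "0 \<le> left_weight \<beta> S t" "left_weight \<beta> S t \<le> 1" "0 \<le> right_weight \<beta> S t" "right_weight \<beta> S t \<le> 1"
  using Inf_Sup_line_interval[OF assms(1)] assms(2,3) by (auto simp: left_weight_def right_weight_def)

lemma exp_decay_LIMSEQ: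
  assumes "\<beta> > (0::real)" shows "(\<lambda>n. exp (- \<beta> * real n)) \<longlonglongrightarrow> 0"
proof -
  have "(\<lambda>n. exp (- \<beta>) ^ n) \<longlonglongrightarrow> 0" using assms by (intro LIMSEQ_realpow_zero) auto
  then show ?thesis by (simp add: exp_of_nat_mult[symmetric] mult.commute)
qed

lemma le_of_le_exp_decay:
  assumes "\<beta> > (0::real)" "\<And>n. z \<le> w + C * exp (- \<beta> * real n)" shows "z \<le> w"
proof -
  have "(\<lambda>n. w + C * exp (- \<beta> * real n)) \<longlonglongrightarrow> w + C * 0"
    by (intro tendsto_intros exp_decay_LIMSEQ assms)
  then have "(\<lambda>n. w + C * exp (- \<beta> * real n)) \<longlonglongrightarrow> w" by simp
  then show ?thesis by (rule LIMSEQ_le_const) (use assms(2) in auto)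
qed

text \<open>
  On a half-line a bounded solution is compared on longer and longer compact pieces. The artificial end
  contributes at most \<open>2 * B\<close> times an exponentially small factor, which disappears in the limit.
\<close>

lemma hyperbolic_comparison:
  fixes d d1 d2 :: "real \<Rightarrow> real"
  assumes S: "line_interval S"
    and d: "\<And>t. t \<in> S \<Longrightarrow> (d has_real_derivative d1 t) (at t within S)"
    and d1: "\<And>t. t \<in> S \<Longrightarrow> (d1 has_real_derivative d2 t) (at t within S)"
    and d2: "\<And>t. t \<in> S \<Longrightarrow> \<bar>d2 t - d t\<bar> \<le> \<kappa> * \<bar>d t\<bar> + \<delta>"
    and B: "\<And>t. t \<in> S \<Longrightarrow> \<bar>d t\<bar> \<le> B \<and> \<bar>d1 t\<bar> \<le> B"
    and va: "bdd_below S \<Longrightarrow> \<bar>d (Inf S) - d1 (Inf S)\<bar> \<le> va"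
    and ub: "bdd_above S \<Longrightarrow> \<bar>d (Sup S) + d1 (Sup S)\<bar> \<le> ub"
    and c: "0 \<le> \<kappa>" "\<kappa> < 1" "0 < \<beta>" "\<beta> < 1" "\<beta>\<^sup>2 \<le> 1 - \<kappa>" "0 \<le> \<delta>"
    and t: "t \<in> S"
  shows "\<bar>d t\<bar> \<le> va * left_weight \<beta> S t + ub * right_weight \<beta> S t + \<delta> / (1 - \<kappa>)"
    and "\<bar>d1 t\<bar> \<le> (1 + 1 / (1 - \<beta>)) * (va * left_weight \<beta> S t + ub * right_weight \<beta> S t) + (2 / (1 - \<kappa>) + 1) * \<delta>"
proof -
  have "\<bar>d t\<bar> \<le> va * left_weight \<beta> S t + ub * right_weight \<beta> S t + \<delta> / (1 - \<kappa>) \<and>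
    \<bar>d1 t\<bar> \<le> (1 + 1 / (1 - \<beta>)) * (va * left_weight \<beta> S t + ub * right_weight \<beta> S t) + (2 / (1 - \<kappa>) + 1) * \<delta>"
    using S
  proof (cases rule: line_interval_cases)
    case (interval a b)
    with hyperbolic_comparison_interval[of a b d d1 d2 \<kappa> \<delta> va ub \<beta> t] assms show ?thesis
      by (simp add: left_weight_def right_weight_def)
  next
    case (above a)
    have *: "\<bar>d t\<bar> \<le> va * exp (- \<beta> * (t - a)) + (2 * B) * exp (- \<beta> * (t + real n - t)) + \<delta> / (1 - \<kappa>) \<and>
      \<bar>d1 t\<bar> \<le> (1 + 1 / (1 - \<beta>)) * (va * exp (- \<beta> * (t - a)) + (2 * B) * exp (- \<beta> * (t + real n - t))) + (2 / (1 - \<kappa>) + 1) * \<delta>"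
      for n
    proof -
      have sub: "{a..t + real n} \<subseteq> S" using above by auto
      have "\<bar>d (t + real n) + d1 (t + real n)\<bar> \<le> 2 * B"
        using B[of "t + real n"] sub above t by auto
      moreover have "(d has_real_derivative d1 s) (at s within {a..t + real n})" "(d1 has_real_derivative d2 s) (at s within {a..t + real n})"
        if "s \<in> {a..t + real n}" for s using that sub DERIV_subset[OF d sub] DERIV_subset[OF d1 sub] by blast+
      ultimately show ?thesis
        using hyperbolic_comparison_interval[of a "t + real n" d d1 d2 \<kappa> \<delta> va "2 * B" \<beta> t] c d2 sub va above t
        by (simp add: subset_iff)
    qed
    have "\<bar>d t\<bar> \<le> va * exp (- \<beta> * (t - a)) + \<delta> / (1 - \<kappa>)"
      by (rule le_of_le_exp_decay[OF c(3), of _ _ "2 * B"]) (use * in \<open>simp add: algebra_simps\<close>)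
    moreover have "\<bar>d1 t\<bar> \<le> (1 + 1 / (1 - \<beta>)) * (va * exp (- \<beta> * (t - a))) + (2 / (1 - \<kappa>) + 1) * \<delta>"
      by (rule le_of_le_exp_decay[OF c(3), of _ _ "(1 + 1 / (1 - \<beta>)) * (2 * B)"]) (use * in \<open>simp add: algebra_simps\<close>)
    ultimately show ?thesis using above by (simp add: left_weight_def right_weight_def)
  next
    case (below b)
    have *: "\<bar>d t\<bar> \<le> (2 * B) * exp (- \<beta> * (t - (t - real n))) + ub * exp (- \<beta> * (b - t)) + \<delta> / (1 - \<kappa>) \<and>
      \<bar>d1 t\<bar> \<le> (1 + 1 / (1 - \<beta>)) * ((2 * B) * exp (- \<beta> * (t - (t - real n))) + ub * exp (- \<beta> * (b - t))) + (2 / (1 - \<kappa>) + 1) * \<delta>"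
      for n
    proof -
      have sub: "{t - real n..b} \<subseteq> S" using below by auto
      have "\<bar>d (t - real n) - d1 (t - real n)\<bar> \<le> 2 * B"
        using B[of "t - real n"] sub below t by auto
      moreover have "(d has_real_derivative d1 s) (at s within {t - real n..b})" "(d1 has_real_derivative d2 s) (at s within {t - real n..b})"
        if "s \<in> {t - real n..b}" for s using that sub DERIV_subset[OF d sub] DERIV_subset[OF d1 sub] by blast+
      ultimately show ?thesis
        using hyperbolic_comparison_interval[of "t - real n" b d d1 d2 \<kappa> \<delta> "2 * B" ub \<beta> t] c d2 sub ub below t
        by (simp add: subset_iff)
    qed
    have "\<bar>d t\<bar> \<le> ub * exp (- \<beta> * (b - t)) + \<delta> / (1 - \<kappa>)"
      by (rule le_of_le_exp_decay[OF c(3), of _ _ "2 * B"]) (use * in \<open>simp add: algebra_simps\<close>)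
    moreover have "\<bar>d1 t\<bar> \<le> (1 + 1 / (1 - \<beta>)) * (ub * exp (- \<beta> * (b - t))) + (2 / (1 - \<kappa>) + 1) * \<delta>"
      by (rule le_of_le_exp_decay[OF c(3), of _ _ "(1 + 1 / (1 - \<beta>)) * (2 * B)"]) (use * in \<open>simp add: algebra_simps\<close>)
    ultimately show ?thesis using below by (simp add: left_weight_def right_weight_def)
  qed
  then show "\<bar>d t\<bar> \<le> va * left_weight \<beta> S t + ub * right_weight \<beta> S t + \<delta> / (1 - \<kappa>)"
    and "\<bar>d1 t\<bar> \<le> (1 + 1 / (1 - \<beta>)) * (va * left_weight \<beta> S t + ub * right_weight \<beta> S t) + (2 / (1 - \<kappa>) + 1) * \<delta>"
    by blast+
qed

section \<open>Boundary value and initial value problems for the pendulum\<close>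

text \<open>
  Every solution of \<open>U' = U - \<phi>\<close> but one grows exponentially. The bounded one is found without improper
  integrals: \<open>exp (-t) * U t\<close> must differ from an antiderivative \<open>\<Phi>\<close> by a constant, and the constant has to lie above the
  increasing function \<open>lo\<close> and below the decreasing function \<open>up\<close>; a supremum does.
\<close>

lemma bounded_solution_unstable:
  fixes \<phi> :: "real \<Rightarrow> real"
  assumes cont: "continuous_on UNIV \<phi>" and B: "\<And>t. \<bar>\<phi> t\<bar> \<le> B"
  shows "\<exists>U. (\<forall>t. (U has_real_derivative (U t - \<phi> t)) (at t)) \<and> (\<forall>t. \<bar>U t\<bar> \<le> B)"
proof -
  have "\<exists>\<Phi>. \<forall>x::real. (-\<infinity>::ereal) < x \<longrightarrow> x < \<infinity> \<longrightarrow> (\<Phi> has_vector_derivative exp (- x) * \<phi> x) (at x)"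
    by (rule einterval_antiderivative)
       (use cont in \<open>auto intro!: continuous_intros simp: continuous_on_eq_continuous_at\<close>)
  then obtain \<Phi> where \<Phi>: "\<And>x. (\<Phi> has_real_derivative exp (- x) * \<phi> x) (at x)"
    by (auto simp: has_real_derivative_iff_has_vector_derivative)
  define lo where "lo = (\<lambda>t. \<Phi> t - B * exp (- t))"
  define up where "up = (\<lambda>t. \<Phi> t + B * exp (- t))"
  have B0: "B \<ge> 0" using B[of 0] by linarith
  have lo_mono: "lo s \<le> lo t" if "s \<le> t" for s t
  proof (rule DERIV_nonneg_imp_nondecreasing[OF that])
    fix x
    have "(lo has_real_derivative exp (- x) * (\<phi> x + B)) (at x)"
      unfolding lo_def by (auto intro!: derivative_eq_intros \<Phi> simp: algebra_simps)
    moreover have "exp (- x) * (\<phi> x + B) \<ge> 0" using B[of x] by (intro mult_nonneg_nonneg) auto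
    ultimately show "\<exists>y. (lo has_real_derivative y) (at x) \<and> y \<ge> 0" by blast
  qed
  have up_mono: "up t \<le> up s" if "s \<le> t" for s t
  proof (rule DERIV_nonpos_imp_nonincreasing[OF that])
    fix x
    have "(up has_real_derivative exp (- x) * (\<phi> x - B)) (at x)"
      unfolding up_def by (auto intro!: derivative_eq_intros \<Phi> simp: algebra_simps)
    moreover have "exp (- x) * (\<phi> x - B) \<le> 0" using B[of x] by (intro mult_nonneg_nonpos) auto
    ultimately show "\<exists>y. (up has_real_derivative y) (at x) \<and> y \<le> 0" by blast
  qed
  have lu: "lo s \<le> up t" for s t
  proof -
    have "lo s \<le> lo (max s t)" by (rule lo_mono) simp
    also have "\<dots> \<le> up (max s t)" using B0 by (simp add: lo_def up_def)
    also have "\<dots> \<le> up t" by (rule up_mono) simp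
    finally show ?thesis .
  qed
  define C where "C = (SUP t. lo t)"
  have C: "lo t \<le> C" "C \<le> up t" for t
    unfolding C_def using lu by (auto intro!: cSUP_upper cSUP_least bdd_aboveI[of _ "up 0"])
  define U where "U = (\<lambda>t. exp t * (C - \<Phi> t))"
  have "(U has_real_derivative (U t - \<phi> t)) (at t)" for t
    unfolding U_def by (auto intro!: derivative_eq_intros \<Phi> simp: algebra_simps exp_minus field_simps)
  moreover have "\<bar>U t\<bar> \<le> B" for t
  proof -
    have "exp t * (C - \<Phi> t) \<le> exp t * (B * exp (- t))" "exp t * (- (B * exp (- t))) \<le> exp t * (C - \<Phi> t)"
      using C[of t] unfolding lo_def up_def by (intro mult_left_mono; simp)+
    then show ?thesis unfolding U_def by (simp add: exp_minus field_simps abs_le_iff)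
  qed
  ultimately show ?thesis by blast
qed

text \<open>
  Bounded solutions of \<open>x'' = x + \<phi>\<close> with the boundary data of the comparison estimate, \<open>x - p\<close> on the left and
  \<open>x + p\<close> on the right, imposed only at ends that exist.
\<close>

definition linear_gap_sol :: "real set \<Rightarrow> real \<Rightarrow> real \<Rightarrow> (real \<Rightarrow> real) \<Rightarrow> (real \<Rightarrow> real) \<Rightarrow> (real \<Rightarrow> real) \<Rightarrow> bool" where
  "linear_gap_sol S va ub \<phi> x p \<longleftrightarrow>
    (\<forall>t\<in>S. (x has_real_derivative p t) (at t within S) \<and> (p has_real_derivative x t + \<phi> t) (at t within S)) \<and>
    (\<exists>B. \<forall>t\<in>S. \<bar>x t\<bar> \<le> B \<and> \<bar>p t\<bar> \<le> B) \<and>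
    (bdd_below S \<longrightarrow> x (Inf S) - p (Inf S) = va) \<and> (bdd_above S \<longrightarrow> x (Sup S) + p (Sup S) = ub)"

lemma linear_gap_sol_bounded: "linear_gap_sol S va ub \<phi> x p \<Longrightarrow> \<exists>B. \<forall>t\<in>S. \<bar>x t\<bar> \<le> B \<and> \<bar>p t\<bar> \<le> B"
  by (simp add: linear_gap_sol_def)

text \<open>
  The coordinates \<open>u = x + p\<close> and \<open>v = x - p\<close> decouple the equation into an unstable and a stable first-order equation.
  Each has a bounded solution on the whole line, and adding the homogeneous mode that decays away from the relevant end adjusts the
  boundary datum.
\<close>

lemma linear_gap_sol_exists:
  assumes S: "line_interval S" and cont: "continuous_on UNIV \<phi>" and B: "\<And>t. \<bar>\<phi> t\<bar> \<le> B"
  shows "\<exists>x p. linear_gap_sol S va ub \<phi> x p"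
proof -
  obtain U where U: "\<And>t. (U has_real_derivative (U t - \<phi> t)) (at t)" "\<And>t. \<bar>U t\<bar> \<le> B"
    using bounded_solution_unstable[OF cont B] by blast
  have "continuous_on UNIV (\<lambda>t. \<phi> (- t))" by (intro continuous_on_compose2[OF cont]) (auto intro!: continuous_intros)
  from bounded_solution_unstable[OF this, of B] B obtain V' where
    V': "\<And>t. (V' has_real_derivative (V' t - \<phi> (- t))) (at t)" "\<And>t. \<bar>V' t\<bar> \<le> B" by blast
  define V where "V = (\<lambda>t. V' (- t))"
  have V: "(V has_real_derivative (\<phi> t - V t)) (at t)" "\<bar>V t\<bar> \<le> B" for t
  proof -
    have "((\<lambda>t. V' (- t)) has_real_derivative (V' (- t) - \<phi> (- (- t))) * (- 1)) (at t)"
      by (rule DERIV_chain2[where f = V' and g = uminus and x = t, OF V'(1)]) (auto intro!: derivative_eq_intros)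
    then show "(V has_real_derivative (\<phi> t - V t)) (at t)" by (simp add: V_def[abs_def])
    show "\<bar>V t\<bar> \<le> B" using V'(2) by (simp add: V_def)
  qed
  define cu where "cu = (if bdd_above S then (ub + U (Sup S)) * exp (- Sup S) else 0)"
  define cv where "cv = (if bdd_below S then (va + V (Inf S)) * exp (Inf S) else 0)"
  define u where "u = (\<lambda>t. cu * exp t - U t)"
  define v where "v = (\<lambda>t. cv * exp (- t) - V t)"
  have u: "(u has_real_derivative u t + \<phi> t) (at t within S)" for t
    unfolding u_def by (rule DERIV_subset[of _ _ _ UNIV]) (auto intro!: derivative_eq_intros U)
  have v: "(v has_real_derivative - v t - \<phi> t) (at t within S)" for t
    unfolding v_def by (rule DERIV_subset[of _ _ _ UNIV]) (auto intro!: derivative_eq_intros V)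
  define x where "x = (\<lambda>t. (u t + v t) / 2)"
  define p where "p = (\<lambda>t. (u t - v t) / 2)"
  have "(x has_real_derivative p t) (at t within S)" "(p has_real_derivative x t + \<phi> t) (at t within S)" for t
    unfolding x_def p_def by (auto intro!: derivative_eq_intros u v simp: field_simps)
  moreover have "bdd_below S \<longrightarrow> x (Inf S) - p (Inf S) = va" "bdd_above S \<longrightarrow> x (Sup S) + p (Sup S) = ub"
    by (auto simp: x_def p_def u_def v_def cu_def cv_def exp_minus field_simps)
  moreover have "\<exists>B. \<forall>t\<in>S. \<bar>x t\<bar> \<le> B \<and> \<bar>p t\<bar> \<le> B"
  proof (intro exI ballI)
    fix t assume t: "t \<in> S"
    have "\<bar>cu * exp t\<bar> \<le> \<bar>ub\<bar> + B"
    proof (cases "bdd_above S")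
      case True
      have "cu * exp t = (ub + U (Sup S)) * exp (t - Sup S)"
        using True by (simp add: cu_def exp_diff exp_minus field_simps)
      then have "\<bar>cu * exp t\<bar> = \<bar>ub + U (Sup S)\<bar> * exp (t - Sup S)" by (simp add: abs_mult)
      also have "\<dots> \<le> \<bar>ub + U (Sup S)\<bar> * 1"
        using Inf_Sup_line_interval(4)[OF S True t] by (intro mult_left_mono) auto
      also have "\<dots> \<le> \<bar>ub\<bar> + B" using U(2)[of "Sup S"] abs_triangle_ineq[of ub "U (Sup S)"] by simp
      finally show ?thesis .
    qed (use U(2)[of 0] in \<open>auto simp: cu_def\<close>)
    moreover have "\<bar>cv * exp (- t)\<bar> \<le> \<bar>va\<bar> + B"
    proof (cases "bdd_below S")
      case True
      have "cv * exp (- t) = (va + V (Inf S)) * exp (Inf S - t)"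
        using True by (simp add: cv_def exp_diff exp_minus field_simps)
      then have "\<bar>cv * exp (- t)\<bar> = \<bar>va + V (Inf S)\<bar> * exp (Inf S - t)" by (simp add: abs_mult)
      also have "\<dots> \<le> \<bar>va + V (Inf S)\<bar> * 1"
        using Inf_Sup_line_interval(3)[OF S True t] by (intro mult_left_mono) auto
      also have "\<dots> \<le> \<bar>va\<bar> + B" using V(2)[of "Inf S"] abs_triangle_ineq[of va "V (Inf S)"] by simp
      finally show ?thesis .
    qed (use U(2)[of 0] in \<open>auto simp: cv_def\<close>)
    ultimately show "\<bar>x t\<bar> \<le> \<bar>ub\<bar> + \<bar>va\<bar> + 2 * B + 2 * B \<and> \<bar>p t\<bar> \<le> \<bar>ub\<bar> + \<bar>va\<bar> + 2 * B + 2 * B"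
      unfolding x_def p_def u_def v_def using U(2)[of t] V(2)[of t] by (auto simp: abs_le_iff field_simps)
  qed
  ultimately have "linear_gap_sol S va ub \<phi> x p" unfolding linear_gap_sol_def by simp
  then show ?thesis by blast
qed

text \<open>
  A common fixed-point scheme for the two problems below. The unknown of the contraction is the forcing term
  \<open>\<phi>\<close>, a bounded continuous function on the line, and \<open>Lin \<phi> x\<close> says that \<open>x\<close> solves the linear problem with this forcing.
  Solving on \<open>S\<close> and extending to the line by the nearest-point retraction stays in the complete space of bounded continuous
  functions.
\<close>

lemma nonlinear_fixed_point:
  fixes S :: "real set" and N :: "real \<Rightarrow> real \<Rightarrow> real"
  assumes S: "closed S" "convex S" "S \<noteq> {}"
    and Ncont: "continuous_on UNIV (\<lambda>z. N (fst z) (snd z))"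
    and Nb: "\<And>s x. \<bar>N s x\<bar> \<le> B"
    and lip: "\<And>s x y. \<bar>N s x - N s y\<bar> \<le> \<kappa> * \<bar>x - y\<bar>"
    and ex: "\<And>\<phi>. continuous_on UNIV \<phi> \<Longrightarrow> (\<And>s. \<bar>\<phi> s\<bar> \<le> B) \<Longrightarrow>
        \<exists>x. Lin \<phi> x \<and> continuous_on S x \<and> (\<exists>C. \<forall>t\<in>S. \<bar>x t\<bar> \<le> C)"
    and contr: "\<And>\<phi> \<psi> x y \<delta> t. Lin \<phi> x \<Longrightarrow> Lin \<psi> y \<Longrightarrow> (\<And>s. s \<in> S \<Longrightarrow> \<bar>\<phi> s - \<psi> s\<bar> \<le> \<delta>) \<Longrightarrow> \<delta> \<ge> 0 \<Longrightarrow> t \<in> S \<Longrightarrow> \<bar>x t - y t\<bar> \<le> c * \<delta>"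
    and c: "0 \<le> c" "0 \<le> \<kappa>" "c * \<kappa> < 1"
  shows "\<exists>\<phi> x. Lin \<phi> x \<and> (\<forall>t\<in>S. \<phi> t = N t (x t))"
proof -
  define r where "r = closest_point S"
  have r: "r t \<in> S" for t using S unfolding r_def by (simp add: closest_point_in_set)
  have rS: "r t = t" if "t \<in> S" for t using that unfolding r_def by (simp add: closest_point_self)
  have rc: "continuous_on UNIV r" unfolding r_def using S by (intro continuous_on_closest_point) auto
  define \<Phi> :: "(real \<Rightarrow>\<^sub>C real) \<Rightarrow> real \<Rightarrow> real" where "\<Phi> \<psi> s = N s (apply_bcontfun \<psi> s)" for \<psi> s
  have \<Phi>c: "continuous_on UNIV (\<Phi> \<psi>)" for \<psi>
  proof -
    have "continuous_on UNIV (\<lambda>s. (s, apply_bcontfun \<psi> s))"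
      by (intro continuous_intros continuous_on_apply_bcontfun) 
    from continuous_on_compose2[OF Ncont this] show ?thesis by (simp add: \<Phi>_def[abs_def])
  qed
  have "\<forall>\<psi>. \<exists>x. Lin (\<Phi> \<psi>) x \<and> continuous_on S x \<and> (\<exists>C. \<forall>t\<in>S. \<bar>x t\<bar> \<le> C)"
    using ex[OF \<Phi>c] Nb by (auto simp: \<Phi>_def)
  then obtain X where X: "\<And>\<psi>. Lin (\<Phi> \<psi>) (X \<psi>)" "\<And>\<psi>. continuous_on S (X \<psi>)"
    "\<And>\<psi>. \<exists>C. \<forall>t\<in>S. \<bar>X \<psi> t\<bar> \<le> C" by metis
  define T where "T \<psi> = Bcontfun (\<lambda>t. X \<psi> (r t))" for \<psi>
  have T: "apply_bcontfun (T \<psi>) t = X \<psi> (r t)" for \<psi> t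
  proof -
    obtain C where "\<forall>t\<in>S. \<bar>X \<psi> t\<bar> \<le> C" using X(3) by blast
    then have "(\<lambda>t. X \<psi> (r t)) \<in> bcontfun"
      using r continuous_on_compose2[OF X(2) rc, of \<psi>] by (intro bcontfun_normI[of _ C]) (simp_all add: image_subset_iff)
    then show ?thesis unfolding T_def by (simp add: Bcontfun_inverse)
  qed
  have "\<exists>!\<psi>. T \<psi> = \<psi>"
  proof (rule banach_fix_type[of "c * \<kappa>"])
    show "\<forall>\<psi> \<rho>. dist (T \<psi>) (T \<rho>) \<le> c * \<kappa> * dist \<psi> \<rho>"
    proof (intro allI dist_bound)
      fix \<psi> \<rho> t
      have "\<bar>X \<psi> (r t) - X \<rho> (r t)\<bar> \<le> c * (\<kappa> * dist \<psi> \<rho>)"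
      proof (rule contr[OF X(1) X(1)])
        fix s
        have "\<bar>\<Phi> \<psi> s - \<Phi> \<rho> s\<bar> \<le> \<kappa> * \<bar>apply_bcontfun \<psi> s - apply_bcontfun \<rho> s\<bar>"
          unfolding \<Phi>_def by (rule lip)
        also have "\<dots> \<le> \<kappa> * dist \<psi> \<rho>"
          using dist_bounded[of \<psi> s \<rho>] c by (intro mult_left_mono) (auto simp: dist_real_def)
        finally show "\<bar>\<Phi> \<psi> s - \<Phi> \<rho> s\<bar> \<le> \<kappa> * dist \<psi> \<rho>" .
      qed (use c r in auto)
      then show "dist (apply_bcontfun (T \<psi>) t) (apply_bcontfun (T \<rho>) t) \<le> c * \<kappa> * dist \<psi> \<rho>"
        by (simp add: T dist_real_def mult.assoc)
    qed
  qed (use c in auto)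
  then obtain \<psi> where \<psi>: "T \<psi> = \<psi>" by blast
  have "\<Phi> \<psi> t = N t (X \<psi> t)" if "t \<in> S" for t
    using T[of \<psi> t] rS[OF that] \<psi> by (simp add: \<Phi>_def)
  with X(1) show ?thesis by blast
qed

text \<open>
  The restoring force is only hyperbolic near the equilibrium. Replacing the position by its truncation to
  \<open>[-3/2, 3/2]\<close> makes the force differ from the linear one by a function whose Lipschitz constant is below 1; the solutions used in the end
  stay in the region where the truncation does nothing.
\<close>

definition clip :: "real \<Rightarrow> real" where "clip x = max (- 3 / 2) (min x (3 / 2))"

lemma clip_id: "\<bar>x\<bar> \<le> 3 / 2 \<Longrightarrow> clip x = x" by (auto simp: clip_def)

text \<open>
  A quantitative form of \<open>3/2 < pi / 2\<close>, obtained by doubling the angle three times from the estimate \<open>\<bar>sin x\<bar> \<le> \<bar>x\<bar>\<close>.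
\<close>

lemma cos_ge_small: "\<bar>z\<bar> \<le> 3 / 2 \<Longrightarrow> cos z \<ge> 3 / 50" for z :: real
proof -
  assume z: "\<bar>z\<bar> \<le> 3 / 2"
  have "\<bar>sin (z / 8)\<bar> \<le> 3 / 16" using abs_sin_x_le_abs_x[of "z / 8"] z by (simp add: field_simps)
  then have "\<bar>sin (z / 8)\<bar>\<^sup>2 \<le> (3 / 16)\<^sup>2" by (intro power_mono) auto
  then have "(sin (z / 8))\<^sup>2 \<le> 9 / 256" by (simp add: power2_eq_square)
  then have 1: "cos (z / 4) \<ge> 119 / 128" using cos_double_sin[of "z / 8"] by simp
  then have "(119 / 128)\<^sup>2 \<le> (cos (z / 4))\<^sup>2" by (intro power_mono) auto
  then have 2: "cos (z / 2) \<ge> 3643 / 5000" using cos_double_cos[of "z / 4"] by (simp add: power2_eq_square)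
  then have "(3643 / 5000)\<^sup>2 \<le> (cos (z / 2))\<^sup>2" by (intro power_mono) auto
  then have "cos z \<ge> 2 * (3643 / 5000)\<^sup>2 - 1" using cos_double_cos[of "z / 2"] by simp
  then show ?thesis by (simp add: power2_eq_square)
qed

text \<open>
  The derivative \<open>g * cos z - 1\<close> lies between \<open>99/100 * 3/50 - 1\<close> and \<open>1/100\<close>. The resulting constant \<open>19/20\<close>
  is below 1, and \<open>1 - 19/20 = 1/20\<close> leaves room for the decay rate \<open>\<beta> = 1/5\<close> used throughout, as \<open>(1/5)\<^sup>2 \<le> 1/20\<close>.
\<close>

lemma sin_minus_id_lipschitz:
  fixes a b g :: real
  assumes "\<bar>g - 1\<bar> \<le> 1 / 100" "\<bar>a\<bar> \<le> 3 / 2" "\<bar>b\<bar> \<le> 3 / 2"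
  shows "\<bar>(g * sin a - a) - (g * sin b - b)\<bar> \<le> 19 / 20 * \<bar>a - b\<bar>"
proof -
  have "norm ((g * sin a - a) - (g * sin b - b)) \<le> 19 / 20 * norm (a - b)"
  proof (rule field_differentiable_bound[where S = "{- 3 / 2..3 / 2}" and f' = "\<lambda>z. g * cos z - 1"])
    fix z :: real assume z: "z \<in> {- 3 / 2..3 / 2}"
    show "((\<lambda>z. g * sin z - z) has_field_derivative g * cos z - 1) (at z within {- 3 / 2..3 / 2})"
      by (auto intro!: derivative_eq_intros)
    have c: "cos z \<ge> 3 / 50" "cos z \<le> 1" using cos_ge_small[of z] z by auto
    have g: "99 / 100 \<le> g" "g \<le> 101 / 100" using assms(1) by linarith+
    have "99 / 100 * (3 / 50) \<le> g * cos z" using g c by (intro mult_mono) auto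
    moreover have "g * cos z \<le> 101 / 100 * 1" using g c by (intro mult_mono) auto
    ultimately show "norm (g * cos z - 1) \<le> 19 / 20" unfolding real_norm_def by linarith
  qed (use assms in auto)
  then show ?thesis by simp
qed

lemma clipped_force_lipschitz:
  fixes x y g h :: real
  assumes g: "\<bar>g - 1\<bar> \<le> 1 / 100" and \<delta>: "\<bar>g - h\<bar> \<le> \<delta>"
  shows "\<bar>(g * sin (clip x) - clip x) - (h * sin (clip y) - clip y)\<bar> \<le> 19 / 20 * \<bar>x - y\<bar> + \<delta>"
proof -
  have "\<bar>(g * sin (clip x) - clip x) - (g * sin (clip y) - clip y)\<bar> \<le> 19 / 20 * \<bar>clip x - clip y\<bar>"
    by (rule sin_minus_id_lipschitz[OF g]) (auto simp: clip_def)
  also have "\<dots> \<le> 19 / 20 * \<bar>x - y\<bar>"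
  proof -
    have "\<bar>clip x - clip y\<bar> \<le> \<bar>x - y\<bar>" unfolding clip_def by linarith
    then show ?thesis by simp
  qed
  finally have 1: "\<bar>(g * sin (clip x) - clip x) - (g * sin (clip y) - clip y)\<bar> \<le> 19 / 20 * \<bar>x - y\<bar>" .
  have "\<bar>g - h\<bar> * \<bar>sin (clip y)\<bar> \<le> \<delta> * 1" using \<delta> by (intro mult_mono) auto
  then have "\<bar>g * sin (clip y) - h * sin (clip y)\<bar> \<le> \<delta>" by (simp add: abs_mult[symmetric] left_diff_distrib)
  with 1 show ?thesis by linarith
qed

text \<open>
  Motion between two crossings: a bounded solution of the truncated pendulum equation with force factor \<open>g\<close>,
  measured from the equilibrium, and with one datum at each existing end.
\<close>

definition gap_sol :: "(real \<Rightarrow> real) \<Rightarrow> real set \<Rightarrow> real \<Rightarrow> real \<Rightarrow> (real \<Rightarrow> real) \<Rightarrow> (real \<Rightarrow> real) \<Rightarrow> bool" where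
  "gap_sol g S va ub x p \<longleftrightarrow>
    (\<forall>t\<in>S. (x has_real_derivative p t) (at t within S) \<and>
        (p has_real_derivative g t * sin (clip (x t)) + (x t - clip (x t))) (at t within S)) \<and>
    (\<exists>B. \<forall>t\<in>S. \<bar>x t\<bar> \<le> B \<and> \<bar>p t\<bar> \<le> B) \<and>
    (bdd_below S \<longrightarrow> x (Inf S) - p (Inf S) = va) \<and> (bdd_above S \<longrightarrow> x (Sup S) + p (Sup S) = ub)"

lemma gap_sol_bounded: "gap_sol g S va ub x p \<Longrightarrow> \<exists>B. \<forall>t\<in>S. \<bar>x t\<bar> \<le> B \<and> \<bar>p t\<bar> \<le> B"
  by (simp add: gap_sol_def)

lemma gap_sol_deriv:
  assumes "gap_sol g S va ub x p" "t \<in> S"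
  shows "(x has_real_derivative p t) (at t within S)"
    "(p has_real_derivative g t * sin (clip (x t)) + (x t - clip (x t))) (at t within S)"
  using assms by (simp_all add: gap_sol_def)

lemma gap_sol_boundary:
  assumes "gap_sol g S va ub x p"
  shows "bdd_below S \<Longrightarrow> x (Inf S) - p (Inf S) = va" "bdd_above S \<Longrightarrow> x (Sup S) + p (Sup S) = ub"
  using assms by (simp_all add: gap_sol_def)

text \<open>
  The difference of two solutions satisfies the comparison estimate with \<open>\<kappa> = 19/20\<close> and \<open>\<beta> = 1/5\<close>. This gives
  uniqueness, continuity in the data and the exponential approach to the equilibrium at one stroke.
\<close>

lemma gap_sol_stable:
  assumes S: "line_interval S" and X: "gap_sol g S va ub x p" and Y: "gap_sol h S vc ud y q"
    and g: "\<And>t. t \<in> S \<Longrightarrow> \<bar>g t - 1\<bar> \<le> 1 / 100" and \<delta>: "\<And>t. t \<in> S \<Longrightarrow> \<bar>g t - h t\<bar> \<le> \<delta>"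
    and t: "t \<in> S"
  shows "\<bar>x t - y t\<bar> \<le> \<bar>va - vc\<bar> * left_weight (1/5) S t + \<bar>ub - ud\<bar> * right_weight (1/5) S t + 20 * \<delta>"
    and "\<bar>p t - q t\<bar> \<le> 9 / 4 * (\<bar>va - vc\<bar> * left_weight (1/5) S t + \<bar>ub - ud\<bar> * right_weight (1/5) S t) + 41 * \<delta>"
proof -
  obtain B where B: "\<And>t. t \<in> S \<Longrightarrow> \<bar>x t\<bar> \<le> B \<and> \<bar>p t\<bar> \<le> B" using gap_sol_bounded[OF X] by blast
  obtain C where C: "\<And>t. t \<in> S \<Longrightarrow> \<bar>y t\<bar> \<le> C \<and> \<bar>q t\<bar> \<le> C" using gap_sol_bounded[OF Y] by blast
  have \<delta>0: "\<delta> \<ge> 0" using \<delta>[OF t] by linarith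
  define d2 where "d2 = (\<lambda>t. (g t * sin (clip (x t)) + (x t - clip (x t))) - (h t * sin (clip (y t)) + (y t - clip (y t))))"
  note H = hyperbolic_comparison[OF S, of "\<lambda>t. x t - y t" "\<lambda>t. p t - q t" d2 "19/20" \<delta> "B + C" "\<bar>va - vc\<bar>" "\<bar>ub - ud\<bar>" "1/5" t]
  have D: "((\<lambda>t. x t - y t) has_real_derivative p t - q t) (at t within S)"
    "((\<lambda>t. p t - q t) has_real_derivative d2 t) (at t within S)"
    "\<bar>d2 t - (x t - y t)\<bar> \<le> 19 / 20 * \<bar>x t - y t\<bar> + \<delta>"
    "\<bar>x t - y t\<bar> \<le> B + C \<and> \<bar>p t - q t\<bar> \<le> B + C" if "t \<in> S" for t
  proof -
    show "((\<lambda>t. x t - y t) has_real_derivative p t - q t) (at t within S)"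
      "((\<lambda>t. p t - q t) has_real_derivative d2 t) (at t within S)"
      unfolding d2_def using gap_sol_deriv[OF X that] gap_sol_deriv[OF Y that] by (blast intro: DERIV_diff)+
    show "\<bar>d2 t - (x t - y t)\<bar> \<le> 19 / 20 * \<bar>x t - y t\<bar> + \<delta>"
      using clipped_force_lipschitz[OF g[OF that] \<delta>[OF that], of "x t" "y t"] unfolding d2_def
      by (simp add: algebra_simps)
    show "\<bar>x t - y t\<bar> \<le> B + C \<and> \<bar>p t - q t\<bar> \<le> B + C"
      using B[OF that] C[OF that] by linarith
  qed
  have E: "bdd_below S \<Longrightarrow> \<bar>(x (Inf S) - y (Inf S)) - (p (Inf S) - q (Inf S))\<bar> \<le> \<bar>va - vc\<bar>"
      "bdd_above S \<Longrightarrow> \<bar>(x (Sup S) - y (Sup S)) + (p (Sup S) - q (Sup S))\<bar> \<le> \<bar>ub - ud\<bar>"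
  proof -
    show "\<bar>(x (Inf S) - y (Inf S)) - (p (Inf S) - q (Inf S))\<bar> \<le> \<bar>va - vc\<bar>" if "bdd_below S"
    proof -
      have "x (Inf S) - p (Inf S) = va" "y (Inf S) - q (Inf S) = vc" 
        by (rule gap_sol_boundary(1)[OF X that] gap_sol_boundary(1)[OF Y that])+
      then show ?thesis by linarith
    qed
    show "\<bar>(x (Sup S) - y (Sup S)) + (p (Sup S) - q (Sup S))\<bar> \<le> \<bar>ub - ud\<bar>" if "bdd_above S"
    proof -
      have "x (Sup S) + p (Sup S) = ub" "y (Sup S) + q (Sup S) = ud" 
        by (rule gap_sol_boundary(2)[OF X that] gap_sol_boundary(2)[OF Y that])+
      then show ?thesis by linarith
    qed
  qed
  show "\<bar>x t - y t\<bar> \<le> \<bar>va - vc\<bar> * left_weight (1/5) S t + \<bar>ub - ud\<bar> * right_weight (1/5) S t + 20 * \<delta>"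
    using H(1)[OF D E] \<delta>0 t by (simp add: power2_eq_square)
  show "\<bar>p t - q t\<bar> \<le> 9 / 4 * (\<bar>va - vc\<bar> * left_weight (1/5) S t + \<bar>ub - ud\<bar> * right_weight (1/5) S t) + 41 * \<delta>"
    using H(2)[OF D E] \<delta>0 t by (simp add: power2_eq_square)
qed

lemma linear_gap_sol_deriv:
  assumes "linear_gap_sol S va ub \<phi> x p" "t \<in> S"
  shows "(x has_real_derivative p t) (at t within S)" "(p has_real_derivative x t + \<phi> t) (at t within S)"
  using assms by (simp_all add: linear_gap_sol_def)

lemma linear_gap_sol_boundary:
  assumes "linear_gap_sol S va ub \<phi> x p"
  shows "bdd_below S \<Longrightarrow> x (Inf S) - p (Inf S) = va" "bdd_above S \<Longrightarrow> x (Sup S) + p (Sup S) = ub"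
  using assms by (simp_all add: linear_gap_sol_def)

text \<open>
  The linear problem responds to a change of the forcing with gain at most 1, and the nonlinear remainder has
  Lipschitz constant \<open>19/20\<close>, so the composition contracts on intervals of every length.
\<close>

lemma gap_sol_exists:
  assumes S: "line_interval S" and gc: "continuous_on UNIV g" and g: "\<And>t. \<bar>g t - 1\<bar> \<le> 1 / 100"
  shows "\<exists>x p. gap_sol g S va ub x p"
proof -
  define N where "N = (\<lambda>s x. g s * sin (clip x) - clip x)"
  have "\<exists>\<phi> x. (\<exists>p. linear_gap_sol S va ub \<phi> x p) \<and> (\<forall>t\<in>S. \<phi> t = N t (x t))"
  proof (rule nonlinear_fixed_point[where B = 4 and \<kappa> = "19/20" and c = 1])
    show "continuous_on UNIV (\<lambda>z. N (fst z) (snd z))"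
      unfolding N_def clip_def by (intro continuous_intros continuous_on_compose2[OF gc]) auto
    show "\<bar>N s x\<bar> \<le> 4" for s x
    proof -
      have "\<bar>g s * sin (clip x)\<bar> \<le> 2 * 1" unfolding abs_mult
      proof (rule mult_mono)
        show "\<bar>g s\<bar> \<le> 2" using g[of s] by linarith
      qed auto
      then show ?thesis unfolding N_def clip_def by (auto simp: abs_le_iff)
    qed
    show "\<bar>N s x - N s y\<bar> \<le> 19 / 20 * \<bar>x - y\<bar>" for s x y
      unfolding N_def using clipped_force_lipschitz[OF g, of s "g s" 0 x y] by simp
    fix \<phi> :: "real \<Rightarrow> real" assume \<phi>: "continuous_on UNIV \<phi>" "\<And>s. \<bar>\<phi> s\<bar> \<le> 4"
    obtain x p where xp: "linear_gap_sol S va ub \<phi> x p" using linear_gap_sol_exists[OF S \<phi>] by blast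
    have "continuous_on S x" by (rule DERIV_continuous_on[OF linear_gap_sol_deriv(1)[OF xp]])
    with xp linear_gap_sol_bounded[OF xp]
    show "\<exists>x. (\<exists>p. linear_gap_sol S va ub \<phi> x p) \<and> continuous_on S x \<and> (\<exists>C. \<forall>t\<in>S. \<bar>x t\<bar> \<le> C)" by blast
  next
    fix \<phi> \<psi> x y :: "real \<Rightarrow> real" and \<delta> t :: real
    assume "\<exists>p. linear_gap_sol S va ub \<phi> x p" "\<exists>p. linear_gap_sol S va ub \<psi> y p"
      and \<delta>: "\<And>s. s \<in> S \<Longrightarrow> \<bar>\<phi> s - \<psi> s\<bar> \<le> \<delta>" "\<delta> \<ge> 0" and t: "t \<in> S"
    then obtain p q where X: "linear_gap_sol S va ub \<phi> x p" and Y: "linear_gap_sol S va ub \<psi> y q" by blast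
    obtain B where B: "\<And>t. t \<in> S \<Longrightarrow> \<bar>x t\<bar> \<le> B \<and> \<bar>p t\<bar> \<le> B" using linear_gap_sol_bounded[OF X] by blast
    obtain C where C: "\<And>t. t \<in> S \<Longrightarrow> \<bar>y t\<bar> \<le> C \<and> \<bar>q t\<bar> \<le> C" using linear_gap_sol_bounded[OF Y] by blast
    have "\<bar>x t - y t\<bar> \<le> 0 * left_weight (1/2) S t + 0 * right_weight (1/2) S t + \<delta> / (1 - 0)"
    proof (rule hyperbolic_comparison(1)[OF S, where ?d1.0 = "\<lambda>t. p t - q t" and ?d2.0 = "\<lambda>t. (x t + \<phi> t) - (y t + \<psi> t)" and B = "B + C"])
      fix t assume t: "t \<in> S"
      show "((\<lambda>t. x t - y t) has_real_derivative p t - q t) (at t within S)"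
        "((\<lambda>t. p t - q t) has_real_derivative (x t + \<phi> t) - (y t + \<psi> t)) (at t within S)"
        using linear_gap_sol_deriv[OF X t] linear_gap_sol_deriv[OF Y t] by (blast intro: DERIV_diff)+
      show "\<bar>x t + \<phi> t - (y t + \<psi> t) - (x t - y t)\<bar> \<le> 0 * \<bar>x t - y t\<bar> + \<delta>" using \<delta>(1)[OF t] by simp
      show "\<bar>x t - y t\<bar> \<le> B + C \<and> \<bar>p t - q t\<bar> \<le> B + C" using B[OF t] C[OF t] by linarith
    next
      show "bdd_below S \<Longrightarrow> \<bar>x (Inf S) - y (Inf S) - (p (Inf S) - q (Inf S))\<bar> \<le> 0"
        "bdd_above S \<Longrightarrow> \<bar>x (Sup S) - y (Sup S) + (p (Sup S) - q (Sup S))\<bar> \<le> 0"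
      proof -
        show "\<bar>x (Inf S) - y (Inf S) - (p (Inf S) - q (Inf S))\<bar> \<le> 0" if "bdd_below S"
        proof -
          have "x (Inf S) - p (Inf S) = va" "y (Inf S) - q (Inf S) = va" 
            by (rule linear_gap_sol_boundary(1)[OF X that] linear_gap_sol_boundary(1)[OF Y that])+
          then show ?thesis by linarith
        qed
        show "\<bar>x (Sup S) - y (Sup S) + (p (Sup S) - q (Sup S))\<bar> \<le> 0" if "bdd_above S"
        proof -
          have "x (Sup S) + p (Sup S) = ub" "y (Sup S) + q (Sup S) = ub" 
            by (rule linear_gap_sol_boundary(2)[OF X that] linear_gap_sol_boundary(2)[OF Y that])+
          then show ?thesis by linarith
        qed
      qed
    qed (use \<delta> t in \<open>auto simp: power2_eq_square\<close>)
    then show "\<bar>x t - y t\<bar> \<le> 1 * \<delta>" by simp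
  qed (use S line_interval_closed line_interval_convex line_interval_nonempty in auto)
  then obtain \<phi> x p where xp: "linear_gap_sol S va ub \<phi> x p" and \<phi>: "\<And>t. t \<in> S \<Longrightarrow> \<phi> t = N t (x t)" by blast
  have "gap_sol g S va ub x p"
    unfolding gap_sol_def
  proof (intro conjI ballI)
    fix t assume t: "t \<in> S"
    show "(x has_real_derivative p t) (at t within S)" by (rule linear_gap_sol_deriv[OF xp t])
    have "x t + \<phi> t = g t * sin (clip (x t)) + (x t - clip (x t))" using \<phi>[OF t] by (simp add: N_def)
    with linear_gap_sol_deriv(2)[OF xp t]
    show "(p has_real_derivative g t * sin (clip (x t)) + (x t - clip (x t))) (at t within S)" by simp
  qed (use linear_gap_sol_bounded[OF xp] linear_gap_sol_boundary[OF xp] in blast)+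
  then show ?thesis by blast
qed

text \<open>
  Taylor estimates to first and second order from the left end of the interval, with one-sided derivatives at its ends.
\<close>

lemma quadratic_bound_right:
  fixes d d1 d2 :: "real \<Rightarrow> real"
  assumes d: "\<And>s. s \<in> {a..b} \<Longrightarrow> (d has_real_derivative d1 s) (at s within {a..b})"
    and d1: "\<And>s. s \<in> {a..b} \<Longrightarrow> (d1 has_real_derivative d2 s) (at s within {a..b})"
    and d2: "\<And>s. s \<in> {a..b} \<Longrightarrow> \<bar>d2 s\<bar> \<le> D" and t: "t \<in> {a..b}"
  shows "\<bar>d1 t - d1 a\<bar> \<le> D * (t - a)" "\<bar>d t - d a - d1 a * (t - a)\<bar> \<le> D / 2 * (t - a)\<^sup>2"
proof -
  have bnd: "norm (d1 s - d1 a) \<le> D * norm (s - a)" if "s \<in> {a..b}" for s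
    by (rule field_differentiable_bound[of "{a..b}" d1 d2]) (use d1 d2 that in auto)
  from bnd[OF t] t show "\<bar>d1 t - d1 a\<bar> \<le> D * (t - a)" by auto
  have "\<sigma> * (d t - d a - d1 a * (t - a)) \<le> D / 2 * (t - a)\<^sup>2" if \<sigma>: "\<sigma> = 1 \<or> \<sigma> = -1" for \<sigma>
  proof -
    let ?h = "\<lambda>s. D / 2 * (s - a)\<^sup>2 - \<sigma> * (d s - d a - d1 a * (s - a))"
    have "?h a \<le> ?h t"
    proof (rule DERIV_nonneg_imp_increasing_open[of a t ?h])
      show "continuous_on {a..t} ?h"
        using DERIV_continuous_on[of "{a..b}" d d1] d t
        by (intro continuous_intros) (auto intro: continuous_on_subset)
      fix s assume s: "a < s" "s < t"
      have "(d has_real_derivative d1 s) (at s)"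
        using d[of s] s t at_within_interior[of s "{a..b}"] by auto
      hence "(?h has_real_derivative D * (s - a) - \<sigma> * (d1 s - d1 a)) (at s)"
        by (auto intro!: derivative_eq_intros)
      moreover have "D * (s - a) - \<sigma> * (d1 s - d1 a) \<ge> 0" using bnd[of s] s t \<sigma> by auto
      ultimately show "\<exists>y. (?h has_real_derivative y) (at s) \<and> 0 \<le> y" by blast
    qed (use t in auto)
    then show ?thesis by simp
  qed
  from this[of 1] this[of "-1"] show "\<bar>d t - d a - d1 a * (t - a)\<bar> \<le> D / 2 * (t - a)\<^sup>2"
    by (intro abs_leI) auto
qed

text \<open>
  On a window of half-length one a second derivative bounded by \<open>D\<close> moves the position by at most \<open>D / 2\<close>. The factor
  one half makes the initial value problem on the window a contraction.
\<close>

lemma second_order_bound: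
  fixes d d1 d2 :: "real \<Rightarrow> real"
  assumes d: "\<And>s. s \<in> {\<theta>-1..\<theta>+1} \<Longrightarrow> (d has_real_derivative d1 s) (at s within {\<theta>-1..\<theta>+1})"
    and d1: "\<And>s. s \<in> {\<theta>-1..\<theta>+1} \<Longrightarrow> (d1 has_real_derivative d2 s) (at s within {\<theta>-1..\<theta>+1})"
    and d2: "\<And>s. s \<in> {\<theta>-1..\<theta>+1} \<Longrightarrow> \<bar>d2 s\<bar> \<le> D" and t: "t \<in> {\<theta>-1..\<theta>+1}"
  shows "\<bar>d1 t\<bar> \<le> \<bar>d1 \<theta>\<bar> + D" "\<bar>d t\<bar> \<le> \<bar>d \<theta>\<bar> + \<bar>d1 \<theta>\<bar> + D / 2"
proof -
  have D0: "D \<ge> 0" using d2[OF t] by linarith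
  have "\<bar>d1 t - d1 \<theta>\<bar> \<le> D * \<bar>t - \<theta>\<bar> \<and> \<bar>d t - d \<theta> - d1 \<theta> * (t - \<theta>)\<bar> \<le> D / 2 * (t - \<theta>)\<^sup>2"
  proof (cases "t \<ge> \<theta>")
    case True
    have sub: "{\<theta>..\<theta>+1} \<subseteq> {\<theta>-1..\<theta>+1}" by auto
    have "t \<in> {\<theta>..\<theta>+1}" using True t by auto
    from quadratic_bound_right[of \<theta> "\<theta>+1" d d1 d2 D t, OF DERIV_subset[OF d sub] DERIV_subset[OF d1 sub] d2 this] sub True
    show ?thesis by auto
  next
    case False
    \<comment> \<open>The left half of the window is reduced to the right half by reversing time.\<close>
    have "\<bar>- d1 (- (- t)) - - d1 (- (- \<theta>))\<bar> \<le> D * (- t - (- \<theta>)) \<and>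
       \<bar>d (- (- t)) - d (- (- \<theta>)) - - d1 (- (- \<theta>)) * (- t - - \<theta>)\<bar> \<le> D / 2 * (- t - - \<theta>)\<^sup>2"
    proof -
      have refl: "((\<lambda>s. F (- s)) has_real_derivative - F' (- s)) (at s within {- \<theta>..- \<theta> + 1})"
        if "\<And>s. s \<in> {\<theta>-1..\<theta>+1} \<Longrightarrow> (F has_real_derivative F' s) (at s within {\<theta>-1..\<theta>+1})" "s \<in> {- \<theta>..- \<theta> + 1}" for F F' s
      proof -
        have "((F \<circ> uminus) has_real_derivative F' (- s) * - 1) (at s within {- \<theta>..- \<theta> + 1})"
        proof (rule DERIV_image_chain)
          show "(F has_real_derivative F' (- s)) (at (- s) within uminus ` {- \<theta>..- \<theta> + 1})"
            by (rule DERIV_subset[OF that(1)]) (use that(2) in auto)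
        qed (auto intro!: derivative_eq_intros)
        then show ?thesis by (simp add: o_def)
      qed
      have a1: "((\<lambda>s. d (- s)) has_real_derivative - d1 (- s)) (at s within {- \<theta>..- \<theta> + 1})"
        if "s \<in> {- \<theta>..- \<theta> + 1}" for s using refl[OF d that] .
      have a2: "((\<lambda>s. - d1 (- s)) has_real_derivative d2 (- s)) (at s within {- \<theta>..- \<theta> + 1})"
        if "s \<in> {- \<theta>..- \<theta> + 1}" for s using DERIV_minus[OF refl[OF d1 that]] by simp
      have a3: "\<bar>d2 (- s)\<bar> \<le> D" if "s \<in> {- \<theta>..- \<theta> + 1}" for s by (rule d2) (use that in auto)
      have a4: "- t \<in> {- \<theta>..- \<theta> + 1}" using False t by auto
      show ?thesis
        using quadratic_bound_right[of "- \<theta>" "- \<theta> + 1" "\<lambda>s. d (- s)" "\<lambda>s. - d1 (- s)" "\<lambda>s. d2 (- s)" D "- t", OF a1 a2 a3 a4] by blast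
    qed
    then show ?thesis using False by (auto simp: algebra_simps power2_commute abs_minus_commute)
  qed
  moreover have "D * \<bar>t - \<theta>\<bar> \<le> D * 1" using D0 t by (intro mult_left_mono) (auto simp: abs_le_iff)
  moreover have "D / 2 * (t - \<theta>)\<^sup>2 \<le> D / 2 * 1"
    using D0 t by (intro mult_left_mono) (auto simp: abs_square_le_1 abs_le_iff)
  moreover have "\<bar>d1 \<theta> * (t - \<theta>)\<bar> \<le> \<bar>d1 \<theta>\<bar> * 1"
    unfolding abs_mult using t by (intro mult_left_mono) (auto simp: abs_le_iff)
  ultimately show "\<bar>d1 t\<bar> \<le> \<bar>d1 \<theta>\<bar> + D" "\<bar>d t\<bar> \<le> \<bar>d \<theta>\<bar> + \<bar>d1 \<theta>\<bar> + D / 2" by linarith+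
qed

text \<open>
  Motion during a crossing: the pendulum equation on a window of half-length one with position and velocity
  given at its centre.
\<close>

definition win_sol :: "(real \<Rightarrow> real) \<Rightarrow> real \<Rightarrow> real \<Rightarrow> real \<Rightarrow> (real \<Rightarrow> real) \<Rightarrow> (real \<Rightarrow> real) \<Rightarrow> bool" where
  "win_sol g \<theta> \<xi> \<eta> y p \<longleftrightarrow>
    (\<forall>t\<in>{\<theta>-1..\<theta>+1}. (y has_real_derivative p t) (at t within {\<theta>-1..\<theta>+1}) \<and>
        (p has_real_derivative g t * sin (y t)) (at t within {\<theta>-1..\<theta>+1})) \<and> y \<theta> = \<xi> \<and> p \<theta> = \<eta>"

lemma sin_force_lipschitz:
  fixes g h x y :: real
  assumes g: "\<bar>g - 1\<bar> \<le> 1 / 100" and \<delta>: "\<bar>g - h\<bar> \<le> \<delta>"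
  shows "\<bar>g * sin x - h * sin y\<bar> \<le> 101 / 100 * \<bar>x - y\<bar> + \<delta>"
proof -
  have lip: "\<bar>sin x - sin y\<bar> \<le> \<bar>x - y\<bar>"
    using field_differentiable_bound[of UNIV sin cos 1 x y] by (auto intro: derivative_eq_intros)
  have "\<bar>g\<bar> * \<bar>sin x - sin y\<bar> \<le> 101 / 100 * \<bar>x - y\<bar>"
  proof (rule mult_mono)
    show "\<bar>g\<bar> \<le> 101 / 100" using g by linarith
  qed (use lip in auto)
  moreover have "\<bar>g - h\<bar> * \<bar>sin y\<bar> \<le> \<delta> * 1" using \<delta> by (intro mult_mono) auto
  ultimately have "\<bar>g * (sin x - sin y)\<bar> \<le> 101 / 100 * \<bar>x - y\<bar>" "\<bar>(g - h) * sin y\<bar> \<le> \<delta>" by (auto simp: abs_mult)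
  moreover have "g * sin x - h * sin y = g * (sin x - sin y) + (g - h) * sin y" by (simp add: algebra_simps)
  ultimately show ?thesis by linarith
qed

lemma win_sol_stable:
  assumes X: "win_sol g \<theta> \<xi> \<eta> x p" and Y: "win_sol h \<theta> \<xi>' \<eta>' y q"
    and g: "\<And>t. t \<in> {\<theta>-1..\<theta>+1} \<Longrightarrow> \<bar>g t - 1\<bar> \<le> 1 / 100"
    and \<delta>: "\<And>t. t \<in> {\<theta>-1..\<theta>+1} \<Longrightarrow> \<bar>g t - h t\<bar> \<le> \<delta>"
    and t: "t \<in> {\<theta>-1..\<theta>+1}"
  shows "\<bar>x t - y t\<bar> \<le> 3 * (\<bar>\<xi> - \<xi>'\<bar> + \<bar>\<eta> - \<eta>'\<bar> + \<delta>)" "\<bar>p t - q t\<bar> \<le> 5 * (\<bar>\<xi> - \<xi>'\<bar> + \<bar>\<eta> - \<eta>'\<bar> + \<delta>)"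
proof -
  let ?S = "{\<theta>-1..\<theta>+1}"
  define d where "d = (\<lambda>t. x t - y t)"
  have D: "(d has_real_derivative p s - q s) (at s within ?S)"
    "((\<lambda>t. p t - q t) has_real_derivative g s * sin (x s) - h s * sin (y s)) (at s within ?S)" if "s \<in> ?S" for s
    using X Y that unfolding win_sol_def d_def by (auto intro!: DERIV_diff)
  have "continuous_on ?S (\<lambda>s. \<bar>d s\<bar>)"
    using D(1) by (intro continuous_on_rabs DERIV_continuous_on[of ?S d]) auto
  then obtain m where m: "m \<in> ?S" "\<And>s. s \<in> ?S \<Longrightarrow> \<bar>d s\<bar> \<le> \<bar>d m\<bar>"
    using continuous_attains_sup[of ?S "\<lambda>s. \<bar>d s\<bar>"] by auto
  have \<delta>0: "\<delta> \<ge> 0" using \<delta>[OF t] by linarith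
  have b: "\<bar>g s * sin (x s) - h s * sin (y s)\<bar> \<le> 101 / 100 * \<bar>d m\<bar> + \<delta>" if "s \<in> ?S" for s
  proof -
    have "\<bar>x s - y s\<bar> \<le> \<bar>d m\<bar>" using m(2)[OF that] by (simp add: d_def)
    from order_trans[OF sin_force_lipschitz[OF g[OF that] \<delta>[OF that], of "x s" "y s"]
        add_right_mono[OF mult_left_mono[OF this, of "101/100"]]]
    show ?thesis by simp
  qed
  note Q = second_order_bound[of \<theta> d "\<lambda>t. p t - q t" "\<lambda>s. g s * sin (x s) - h s * sin (y s)", OF D b]
  have e: "d \<theta> = \<xi> - \<xi>'" "p \<theta> - q \<theta> = \<eta> - \<eta>'" using X Y unfolding win_sol_def d_def by auto
  have dm: "\<bar>d m\<bar> \<le> 3 * (\<bar>\<xi> - \<xi>'\<bar> + \<bar>\<eta> - \<eta>'\<bar> + \<delta>)" 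
  proof -
    have "\<bar>d m\<bar> \<le> \<bar>\<xi> - \<xi>'\<bar> + \<bar>\<eta> - \<eta>'\<bar> + (101 / 100 * \<bar>d m\<bar> + \<delta>) / 2" using Q(2)[OF _ _ _ m(1)] e by simp
    moreover have "\<bar>\<xi> - \<xi>'\<bar> \<ge> 0" "\<bar>\<eta> - \<eta>'\<bar> \<ge> 0" by simp_all
    ultimately show ?thesis using \<delta>0 by argo
  qed
  show "\<bar>x t - y t\<bar> \<le> 3 * (\<bar>\<xi> - \<xi>'\<bar> + \<bar>\<eta> - \<eta>'\<bar> + \<delta>)" using m(2)[OF t] dm unfolding d_def by linarith
  show "\<bar>p t - q t\<bar> \<le> 5 * (\<bar>\<xi> - \<xi>'\<bar> + \<bar>\<eta> - \<eta>'\<bar> + \<delta>)" 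
  proof -
    have "\<bar>p t - q t\<bar> \<le> \<bar>\<eta> - \<eta>'\<bar> + (101 / 100 * \<bar>d m\<bar> + \<delta>)" using Q(1)[OF _ _ _ t] e by simp
    moreover have "\<bar>\<xi> - \<xi>'\<bar> \<ge> 0" "\<bar>\<eta> - \<eta>'\<bar> \<ge> 0" by simp_all
    ultimately show ?thesis using dm \<delta>0 by argo
  qed
qed

lemma win_sol_exists:
  assumes gc: "continuous_on UNIV g" and g: "\<And>t. \<bar>g t - 1\<bar> \<le> 1 / 100"
  shows "\<exists>y p. win_sol g \<theta> \<xi> \<eta> y p"
proof -
  let ?S = "{\<theta>-1..\<theta>+1}"
  define Lin where "Lin = (\<lambda>\<phi> y. \<exists>p. (\<forall>t\<in>?S. (y has_real_derivative p t) (at t within ?S) \<and>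
        (p has_real_derivative \<phi> t) (at t within ?S)) \<and> y \<theta> = \<xi> \<and> p \<theta> = (\<eta> :: real))"
  define N where "N = (\<lambda>s x. g s * sin x)"
  have anti: "\<exists>\<Phi>. \<forall>x. (\<Phi> has_real_derivative \<phi> x) (at x)" if "continuous_on UNIV \<phi>" for \<phi> :: "real \<Rightarrow> real"
  proof -
    have "\<exists>\<Phi>. \<forall>x::real. (-\<infinity>::ereal) < x \<longrightarrow> x < \<infinity> \<longrightarrow> (\<Phi> has_vector_derivative \<phi> x) (at x)"
      by (rule einterval_antiderivative) (use that in \<open>auto simp: continuous_on_eq_continuous_at\<close>)
    then show ?thesis by (auto simp: has_real_derivative_iff_has_vector_derivative)
  qed
  have "\<exists>\<phi> y. Lin \<phi> y \<and> (\<forall>t\<in>?S. \<phi> t = N t (y t))"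
  proof (rule nonlinear_fixed_point[where B = 2 and \<kappa> = "101/100" and c = "1/2"])
    show "continuous_on UNIV (\<lambda>z. N (fst z) (snd z))"
      unfolding N_def by (intro continuous_intros continuous_on_compose2[OF gc]) auto
    show "\<bar>N s x\<bar> \<le> 2" for s x
    proof -
      have "\<bar>g s * sin x\<bar> \<le> 2 * 1" unfolding abs_mult
      proof (rule mult_mono)
        show "\<bar>g s\<bar> \<le> 2" using g[of s] by linarith
      qed auto
      then show ?thesis unfolding N_def by simp
    qed
    show "\<bar>N s x - N s y\<bar> \<le> 101 / 100 * \<bar>x - y\<bar>" for s x y
      unfolding N_def using sin_force_lipschitz[OF g, of s "g s" 0 x y] by simp
    fix \<phi> :: "real \<Rightarrow> real" assume \<phi>: "continuous_on UNIV \<phi>" "\<And>s. \<bar>\<phi> s\<bar> \<le> 2"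
    obtain P where P: "\<And>x. (P has_real_derivative \<phi> x) (at x)" using anti[OF \<phi>(1)] by blast
    then have "continuous_on UNIV P" by (meson DERIV_continuous_on has_field_derivative_at_within)
    then obtain Y where Y: "\<And>x. (Y has_real_derivative P x) (at x)" using anti by blast
    define p where "p = (\<lambda>t. \<eta> + (P t - P \<theta>))"
    define y where "y = (\<lambda>t. \<xi> + (Y t - Y \<theta>) + (\<eta> - P \<theta>) * (t - \<theta>))"
    have y: "(y has_real_derivative p t) (at t)" for t
      unfolding y_def p_def by (auto intro!: derivative_eq_intros Y)
    have p: "(p has_real_derivative \<phi> t) (at t)" for t
      unfolding p_def by (auto intro!: derivative_eq_intros P)
    have "Lin \<phi> y" unfolding Lin_def
      by (rule exI[of _ p]) (auto simp: y_def p_def intro: has_field_derivative_at_within y[unfolded y_def p_def] p[unfolded p_def])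
    moreover have c: "continuous_on ?S y" using y by (meson DERIV_continuous_on has_field_derivative_at_within)
    moreover have "\<exists>C. \<forall>t\<in>?S. \<bar>y t\<bar> \<le> C"
      using compact_imp_bounded[OF compact_continuous_image[OF c]] by (auto simp: bounded_iff)
    ultimately show "\<exists>x. Lin \<phi> x \<and> continuous_on ?S x \<and> (\<exists>C. \<forall>t\<in>?S. \<bar>x t\<bar> \<le> C)" by blast
  next
    fix \<phi> \<psi> x y :: "real \<Rightarrow> real" and \<delta> t :: real
    assume "Lin \<phi> x" "Lin \<psi> y"
      and \<delta>: "\<And>s. s \<in> ?S \<Longrightarrow> \<bar>\<phi> s - \<psi> s\<bar> \<le> \<delta>" and t: "t \<in> ?S"
    then obtain p q where X: "(\<forall>t\<in>?S. (x has_real_derivative p t) (at t within ?S) \<and>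
        (p has_real_derivative \<phi> t) (at t within ?S)) \<and> x \<theta> = \<xi> \<and> p \<theta> = (\<eta> :: real)"
      and Y: "(\<forall>t\<in>?S. (y has_real_derivative q t) (at t within ?S) \<and>
        (q has_real_derivative \<psi> t) (at t within ?S)) \<and> y \<theta> = \<xi> \<and> q \<theta> = (\<eta> :: real)"
      unfolding Lin_def by blast
    have "\<bar>x t - y t\<bar> \<le> \<bar>x \<theta> - y \<theta>\<bar> + \<bar>p \<theta> - q \<theta>\<bar> + \<delta> / 2"
      by (rule second_order_bound(2)[where ?d2.0 = "\<lambda>s. \<phi> s - \<psi> s", OF _ _ \<delta> t]) (use X Y in \<open>auto intro!: DERIV_diff\<close>)
    then show "\<bar>x t - y t\<bar> \<le> 1 / 2 * \<delta>" using X Y by simp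
  qed auto
  then obtain \<phi> y where yp: "Lin \<phi> y" and \<phi>: "\<And>t. t \<in> ?S \<Longrightarrow> \<phi> t = N t (y t)" by blast
  then obtain p where "win_sol g \<theta> \<xi> \<eta> y p"
    unfolding Lin_def win_sol_def N_def by auto
  then show ?thesis by blast
qed

section \<open>The separatrix\<close>

text \<open>
  The time derivative \<open>2 / cosh t\<close> of the separatrix.
\<close>

definition separatrix_velocity :: "real \<Rightarrow> real" where
  "separatrix_velocity t = 4 * exp t / (1 + (exp t)\<^sup>2)"

text \<open>
  The second identity says that the separatrix has energy zero; the first is its equation of motion.
\<close>

lemma sin_cos_separatrix:
  "sin (separatrix t) = 4 * exp t * (1 - (exp t)\<^sup>2) / (1 + (exp t)\<^sup>2)\<^sup>2"
  "1 - cos (separatrix t) = (separatrix_velocity t)\<^sup>2 / 2"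
proof -
  define u a where "u = exp t" and "a = arctan u"
  have D: "1 + u\<^sup>2 > 0" by (simp add: add_pos_nonneg)
  have s: "separatrix t = 2 * (2 * a)" by (simp add: separatrix_def a_def u_def)
  have "sin a = u / sqrt (1 + u\<^sup>2)" "cos a = 1 / sqrt (1 + u\<^sup>2)"
    by (simp_all add: a_def sin_arctan cos_arctan)
  then have 1: "sin (2 * a) = 2 * u / (1 + u\<^sup>2)" "cos (2 * a) = (1 - u\<^sup>2) / (1 + u\<^sup>2)"
    using D by (simp_all add: sin_double cos_double power_divide diff_divide_distrib abs_of_pos)
  show "sin (separatrix t) = 4 * exp t * (1 - (exp t)\<^sup>2) / (1 + (exp t)\<^sup>2)\<^sup>2"
    unfolding s sin_double[of "2 * a"] 1 by (simp add: u_def power2_eq_square)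
  show "1 - cos (separatrix t) = (separatrix_velocity t)\<^sup>2 / 2"
    unfolding s cos_double_sin[of "2 * a"] 1
    by (simp add: u_def separatrix_velocity_def power_divide power_mult_distrib)
qed

lemma separatrix_deriv [derivative_intros]:
  assumes "(h has_real_derivative h') (at t within S)"
  shows "((\<lambda>t. separatrix (h t)) has_real_derivative separatrix_velocity (h t) * h') (at t within S)"
proof -
  have "(separatrix has_real_derivative separatrix_velocity x) (at x)" for x
    unfolding separatrix_def[abs_def] separatrix_velocity_def
    by (auto intro!: derivative_eq_intros simp: field_simps)
  from DERIV_chain2[OF this assms] show ?thesis .
qed

lemma separatrix_velocity_deriv [derivative_intros]:
  assumes "(h has_real_derivative h') (at t within S)"
  shows "((\<lambda>t. separatrix_velocity (h t)) has_real_derivative sin (separatrix (h t)) * h') (at t within S)"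
proof -
  have "(separatrix_velocity has_real_derivative sin (separatrix x)) (at x)" for x
  proof -
    have D: "1 + (exp x)\<^sup>2 \<noteq> 0" by (metis add_pos_nonneg less_numeral_extra(1,3) zero_le_power2)
    show ?thesis
      unfolding separatrix_velocity_def[abs_def] sin_cos_separatrix
      by (rule derivative_eq_intros refl D)+ (simp add: power2_eq_square algebra_simps)
  qed
  from DERIV_chain2[OF this assms] show ?thesis .
qed

lemma separatrix_velocity_bounds:
  "0 < separatrix_velocity t" "separatrix_velocity t \<le> 4 * exp (- \<bar>t\<bar>)" "separatrix_velocity t \<le> 2"
proof -
  define u where "u = exp t"
  have u: "u > 0" by (simp add: u_def)
  then have D: "1 + u\<^sup>2 > 0" by (simp add: add_pos_nonneg)
  have v: "separatrix_velocity t = 4 * u / (1 + u\<^sup>2)" by (simp add: separatrix_velocity_def u_def)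
  show "0 < separatrix_velocity t" unfolding v using u D by simp
  show "separatrix_velocity t \<le> 2"
  proof -
    have "0 \<le> 2 * (u - 1)\<^sup>2" by simp
    then have "4 * u \<le> 2 * (1 + u\<^sup>2)" by (simp add: power2_eq_square algebra_simps)
    then show ?thesis unfolding v using D by (simp add: divide_le_eq)
  qed
  show "separatrix_velocity t \<le> 4 * exp (- \<bar>t\<bar>)"
  proof (cases "t \<ge> 0")
    case True
    have "4 * u / (1 + u\<^sup>2) \<le> 4 / u" using u D by (simp add: field_simps power2_eq_square)
    then show ?thesis using True by (simp add: v u_def exp_minus divide_inverse)
  next
    case False
    have "4 * u / (1 + u\<^sup>2) \<le> 4 * u" using u D by (simp add: field_simps power2_eq_square)
    then show ?thesis using False by (simp add: v u_def)
  qed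
qed

lemma arctan_le_self: "x \<ge> 0 \<Longrightarrow> arctan x \<le> x"
proof -
  assume x: "x \<ge> 0"
  have "arctan x - x \<le> arctan 0 - 0"
  proof (rule DERIV_nonpos_imp_nonincreasing[OF x])
    fix y :: real
    have "((\<lambda>y. arctan y - y) has_real_derivative inverse (1 + y\<^sup>2) - 1) (at y)"
      by (auto intro!: derivative_eq_intros)
    moreover have "inverse (1 + y\<^sup>2) - 1 \<le> 0" by (simp add: inverse_le_1_iff)
    ultimately show "\<exists>z. ((\<lambda>y. arctan y - y) has_real_derivative z) (at y) \<and> z \<le> 0" by blast
  qed
  then show ?thesis by simp
qed

lemma separatrix_bounds:
  "0 < separatrix t" "separatrix t \<le> 4 * exp t" "separatrix t < 2 * pi" "2 * pi - separatrix t \<le> 4 * exp (- t)"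
proof -
  show "0 < separatrix t" by (simp add: separatrix_def)
  show "separatrix t \<le> 4 * exp t" by (simp add: separatrix_def arctan_le_self)
  show "separatrix t < 2 * pi" using arctan_ubound[of "exp t"] by (simp add: separatrix_def)
  have "arctan (exp (- t)) = pi / 2 - arctan (exp t)"
    using arctan_inverse[of "exp t"] by (simp add: exp_minus inverse_eq_divide)
  moreover have "arctan (exp (- t)) \<le> exp (- t)" by (simp add: arctan_le_self)
  ultimately show "2 * pi - separatrix t \<le> 4 * exp (- t)" by (simp add: separatrix_def)
qed

lemma one_minus_cos_bounds: "0 \<le> 1 - cos (x::real)" "1 - cos x \<le> x\<^sup>2 / 2"
proof -
  show "0 \<le> 1 - cos x" by simp
  have "(sin (x / 2))\<^sup>2 \<le> (x / 2)\<^sup>2" using power_mono[OF abs_sin_x_le_abs_x[of "x / 2"], of 2] by (simp add: power_divide)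
  then show "1 - cos x \<le> x\<^sup>2 / 2" using cos_double_sin[of "x / 2"] by (simp add: power2_eq_square)
qed

text \<open>
  A little more than one time unit around the crossing the velocity is still bounded below. This is the range of times
  at which window and gap solutions are joined, shifts included.
\<close>

lemma separatrix_velocity_ge_1:
  assumes "\<bar>t\<bar> \<le> 11 / 10" shows "separatrix_velocity t \<ge> 1"
proof -
  have e1: "exp (11 / 10 :: real) \<le> 7 / 2"
  proof -
    have "exp (- (1 / 10) :: real) \<ge> 9 / 10" using exp_ge_add_one_self[of "- (1/10)"] by simp
    then have "exp (1 / 10 :: real) \<le> 10 / 9" by (simp add: exp_minus field_simps)
    moreover have "exp (11 / 10 :: real) = exp 1 * exp (1 / 10)" by (simp add: exp_add[symmetric])
    moreover have "exp 1 * exp (1 / 10 :: real) \<le> 3 * (10 / 9)"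
      using calculation exp_le by (intro mult_mono) auto
    ultimately show ?thesis by simp
  qed
  define u where "u = exp t"
  have t: "exp t \<le> exp (11 / 10)" "exp (- t) \<le> exp (11 / 10)" using assms by (simp_all add: abs_le_iff)
  have u: "u \<le> 7 / 2" using t(1) e1 unfolding u_def by linarith
  have u2: "u \<ge> 2 / 7"
  proof -
    have "exp (- t) \<le> 7 / 2" using t(2) e1 by linarith
    then show ?thesis by (simp add: u_def exp_minus field_simps)
  qed
  have "(u - 2 / 7) * (7 / 2 - u) \<ge> 0" using u u2 by simp
  then have "1 + u\<^sup>2 \<le> 4 * u" using u2 by (simp add: power2_eq_square algebra_simps)
  moreover have "1 + u\<^sup>2 > 0" by (simp add: add_pos_nonneg)
  ultimately show ?thesis unfolding separatrix_velocity_def u_def by (simp add: le_divide_eq)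
qed

text \<open>
  From \<open>99/100\<close> on the separatrix is within \<open>299/200 < 3/2\<close> of the equilibrium, which is inside the range where the
  truncation is the identity.
\<close>

lemma separatrix_tail_small:
  fixes t :: real assumes "t \<ge> 99 / 100" shows "4 * exp (- t) \<le> 299 / 200"
proof -
  have "1 + 33 / 200 + (33 / 200)\<^sup>2 / 2 \<le> exp (33 / 200 :: real)" by (rule exp_lower_Taylor_quadratic) simp
  then have "(11786 / 10000) ^ 6 \<le> exp (33 / 200 :: real) ^ 6" by (intro power_mono) (auto simp: power2_eq_square)
  also have "\<dots> = exp (99 / 100)" by (simp add: exp_of_nat_mult[symmetric])
  also have "\<dots> \<le> exp t" using assms by simp
  finally have "(11786 / 10000) ^ 6 \<le> exp t" .
  moreover have "(800 / 299 :: real) \<le> (11786 / 10000) ^ 6" by (simp add: power_divide)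
  ultimately have "800 / 299 \<le> exp t" by linarith
  then show ?thesis by (simp add: exp_minus field_simps)
qed

lemma integrable_exp_abs:
  assumes "c > 0"
  shows "integrable lborel (\<lambda>t. exp (- c * \<bar>t - \<theta>\<bar>))" "(LINT t|lborel. exp (- c * \<bar>t - \<theta>\<bar>)) = 2 / (c::real)"
proof -
  define g where "g = (\<lambda>x::real. exp (- c * x) * indicator {0..} x)"
  have N: "(\<integral>\<^sup>+x. ennreal (exp (- c * x)) * indicator {0..} x \<partial>lborel) = 0 - (- exp (- c * 0) / c)"
  proof (rule nn_integral_FTC_atLeast)
    show "((\<lambda>x. - exp (- c * x) / c) \<longlongrightarrow> 0) at_top"
    proof -
      have "filterlim (\<lambda>x. c * x) at_top at_top" by (rule filterlim_tendsto_pos_mult_at_top[OF tendsto_const assms filterlim_ident])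
      then have "filterlim (\<lambda>x. - c * x) at_bot at_top" by (simp add: filterlim_uminus_at_top)
      from filterlim_compose[OF exp_at_bot this] have "((\<lambda>x. exp (- c * x)) \<longlongrightarrow> 0) at_top" .
      from tendsto_divide[OF tendsto_minus[OF this] tendsto_const] assms show ?thesis by force
    qed
  qed (use assms in \<open>auto intro!: derivative_eq_intros\<close>)
  have "has_bochner_integral lborel g (1 / c)"
  proof (rule has_bochner_integral_nn_integral)
    have "(\<integral>\<^sup>+x. ennreal (g x) \<partial>lborel) = (\<integral>\<^sup>+x. ennreal (exp (- c * x)) * indicator {0..} x \<partial>lborel)"
      by (intro nn_integral_cong) (auto simp: g_def indicator_def)
    with N show "(\<integral>\<^sup>+x. ennreal (g x) \<partial>lborel) = ennreal (1 / c)" by simp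
  qed (use assms in \<open>auto simp: g_def\<close>)
  then have g: "integrable lborel g" "integral\<^sup>L lborel g = 1 / c"
    by (auto simp: has_bochner_integral_iff)
  have g1: "integrable lborel (\<lambda>x. g (- \<theta> + 1 * x))" "(LINT x|lborel. g (- \<theta> + 1 * x)) = 1 / c"
    using lborel_integrable_real_affine[OF g(1), of 1 "- \<theta>"] lborel_integral_real_affine[of 1 g "- \<theta>"] g(2) by auto
  have g2: "integrable lborel (\<lambda>x. g (\<theta> + (-1) * x))" "(LINT x|lborel. g (\<theta> + (-1) * x)) = 1 / c"
    using lborel_integrable_real_affine[OF g(1), of "-1" "\<theta>"] lborel_integral_real_affine[of "-1" g "\<theta>"] g(2) by auto
  have eq: "AE x in lborel. g (- \<theta> + 1 * x) + g (\<theta> + (-1) * x) = exp (- c * \<bar>x - \<theta>\<bar>)"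
    using AE_lborel_singleton[of \<theta>] by eventually_elim (auto simp: g_def indicator_def)
  have I: "integrable lborel (\<lambda>x. g (- \<theta> + 1 * x) + g (\<theta> + (-1) * x))"
    using g1(1) g2(1) by (rule Bochner_Integration.integrable_add)
  show i: "integrable lborel (\<lambda>t. exp (- c * \<bar>t - \<theta>\<bar>))"
    by (rule integrable_cong_AE_imp[OF I]) (use eq in auto)
  have "(LINT t|lborel. exp (- c * \<bar>t - \<theta>\<bar>)) = (LINT x|lborel. g (- \<theta> + 1 * x) + g (\<theta> + (-1) * x))"
    by (rule integral_cong_AE) (use eq I i in auto)
  also have "\<dots> = 2 / c" using g1 g2 by (subst Bochner_Integration.integral_add) auto
  finally show "(LINT t|lborel. exp (- c * \<bar>t - \<theta>\<bar>)) = 2 / c" .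
qed

section \<open>Uniform bounds for smooth functions on the torus\<close>

text \<open>
  Translation by the lattice reduces every point to a compact cube.
\<close>

lemma periodic_continuous_bounded:
  fixes g :: "real ^ 'n::finite \<Rightarrow> real"
  assumes per: "torus_periodic g" and cont: "continuous_on UNIV g"
  shows "\<exists>B. \<forall>x. \<bar>g x\<bar> \<le> B"
proof -
  define K :: "(real ^ 'n) set" where "K = cbox 0 (\<chi> i. 2 * pi)"
  have "bounded (g ` K)"
    unfolding K_def by (intro compact_imp_bounded compact_continuous_image continuous_on_subset[OF cont]) auto
  then obtain B where B: "\<And>x. x \<in> K \<Longrightarrow> \<bar>g x\<bar> \<le> B" by (auto simp: bounded_iff)
  have "\<bar>g x\<bar> \<le> B" for x
  proof -
    define k :: "int ^ 'n" where "k = (\<chi> i. - \<lfloor>x $ i / (2 * pi)\<rfloor>)"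
    have "0 \<le> x $ i + 2 * pi * - of_int \<lfloor>x $ i / (2 * pi)\<rfloor> \<and> x $ i + 2 * pi * - of_int \<lfloor>x $ i / (2 * pi)\<rfloor> \<le> 2 * pi" for i
    proof -
      have "of_int \<lfloor>x $ i / (2 * pi)\<rfloor> \<le> x $ i / (2 * pi)" "x $ i / (2 * pi) \<le> of_int \<lfloor>x $ i / (2 * pi)\<rfloor> + 1" by linarith+
      then have "of_int \<lfloor>x $ i / (2 * pi)\<rfloor> * (2 * pi) \<le> x $ i" "x $ i \<le> (of_int \<lfloor>x $ i / (2 * pi)\<rfloor> + 1) * (2 * pi)"
        using mult_right_mono[of "of_int \<lfloor>x $ i / (2 * pi)\<rfloor>" "x $ i / (2 * pi)" "2 * pi"]
          mult_right_mono[of "x $ i / (2 * pi)" "of_int \<lfloor>x $ i / (2 * pi)\<rfloor> + 1" "2 * pi"] by simp_all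
      then show ?thesis by (simp add: algebra_simps)
    qed
    then have "x + (2 * pi) *\<^sub>R int_vec k \<in> K"
      unfolding K_def mem_box_cart by (simp add: int_vec_def k_def)
    from B[OF this] show ?thesis using per by (simp add: torus_periodic_def)
  qed
  then show ?thesis by blast
qed

lemma torus_periodic_grad:
  fixes f :: "real ^ 'n::finite \<Rightarrow> real"
  assumes per: "torus_periodic f" and diff: "\<And>x. f differentiable (at x)"
  shows "grad f (x + (2 * pi) *\<^sub>R int_vec k) = grad f x"
proof -
  define c where "c = (2 * pi) *\<^sub>R int_vec k"
  have "((\<lambda>y. f (y + c)) has_derivative (\<lambda>h. grad f (x + c) \<bullet> h)) (at x)"
    by (rule has_derivative_compose[of "\<lambda>y. y + c" "\<lambda>h. h" x UNIV f, OF _ has_derivative_grad[OF diff]])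
       (auto intro!: derivative_eq_intros)
  moreover have "(\<lambda>y. f (y + c)) = f" using per by (auto simp: torus_periodic_def c_def)
  ultimately show ?thesis using grad_eqI[of f "grad f (x + c)" x] by (simp add: c_def)
qed

lemma grad_bound_imp_lipschitz:
  fixes f :: "real ^ 'n::finite \<Rightarrow> real"
  assumes diff: "\<And>x. f differentiable (at x)" and B: "\<And>x. norm (grad f x) \<le> B"
  shows "\<bar>f x - f y\<bar> \<le> B * norm (x - y)"
proof -
  have "norm (f x - f y) \<le> B * norm (x - y)"
  proof (rule differentiable_bound[of UNIV f "\<lambda>x h. grad f x \<bullet> h"])
    show "(f has_derivative (\<lambda>h. grad f z \<bullet> h)) (at z within UNIV)" for z using has_derivative_grad[OF diff] by simp
    show "onorm (\<lambda>h. grad f z \<bullet> h) \<le> B" for z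
    proof (rule onorm_le)
      fix h :: "real ^ 'n"
      have "norm (grad f z \<bullet> h) \<le> norm (grad f z) * norm h" using Cauchy_Schwarz_ineq2[of "grad f z" h] by simp
      also have "\<dots> \<le> B * norm h" using B by (intro mult_right_mono) auto
      finally show "norm (grad f z \<bullet> h) \<le> B * norm h" .
    qed
  qed auto
  then show ?thesis by simp
qed

text \<open>
  One constant bounds the function, its gradient and the Lipschitz constant of the gradient. The choice \<open>F \<ge> 1\<close>
  lets a bound by \<open>\<mu> * F\<close> serve also as a bound by \<open>\<mu>\<close>.
\<close>

lemma C_k_2_bounds:
  fixes f :: "real ^ 'n::finite \<Rightarrow> real"
  assumes C: "C_k 2 f" and per: "torus_periodic f"
  shows "\<exists>F\<ge>1. (\<forall>x. f differentiable (at x)) \<and> (\<forall>x. \<bar>f x\<bar> \<le> F) \<and> (\<forall>x. norm (grad f x) \<le> F) \<and>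
    (\<forall>x y. norm (grad f x - grad f y) \<le> F * norm (x - y))"
proof -
  have d: "\<And>x. f differentiable (at x)" and d2: "\<And>x i. (\<lambda>x. grad f x $ i) differentiable (at x)"
    and c: "\<And>i j. continuous_on UNIV (\<lambda>x. grad (\<lambda>x. grad f x $ i) x $ j)"
    using C by (auto simp: numeral_2_eq_2)
  have cont: "continuous_on UNIV h" if "\<And>x. h differentiable (at x)" for h :: "real ^ 'n \<Rightarrow> real"
    using that by (intro differentiable_imp_continuous_on) (auto simp: differentiable_on_def differentiable_at_withinI)
  obtain B0 where B0: "\<And>x. \<bar>f x\<bar> \<le> B0" using periodic_continuous_bounded[OF per cont[OF d]] by blast
  have per1: "torus_periodic (\<lambda>x. grad f x $ i)" for i
    using torus_periodic_grad[OF per d] by (simp add: torus_periodic_def)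
  have "\<forall>i. \<exists>B. \<forall>x. \<bar>grad f x $ i\<bar> \<le> B" using periodic_continuous_bounded[OF per1 cont[OF d2]] by blast
  then obtain B1 where B1: "\<And>i x. \<bar>grad f x $ i\<bar> \<le> B1 i" by metis
  have per2: "torus_periodic (\<lambda>x. grad (\<lambda>x. grad f x $ i) x $ j)" for i j
    using torus_periodic_grad[OF per1 d2] by (simp add: torus_periodic_def)
  have "\<forall>i j. \<exists>B. \<forall>x. \<bar>grad (\<lambda>x. grad f x $ i) x $ j\<bar> \<le> B" using periodic_continuous_bounded[OF per2 c] by blast
  then obtain B2 where B2: "\<And>i j x. \<bar>grad (\<lambda>x. grad f x $ i) x $ j\<bar> \<le> B2 i j" by metis
  have lip: "\<bar>grad f x $ i - grad f y $ i\<bar> \<le> (\<Sum>j\<in>UNIV. B2 i j) * norm (x - y)" for x y i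
  proof (rule grad_bound_imp_lipschitz[OF d2])
    fix x show "norm (grad (\<lambda>x. grad f x $ i) x) \<le> (\<Sum>j\<in>UNIV. B2 i j)"
      by (rule order_trans[OF norm_le_l1_cart]) (intro sum_mono B2)
  qed
  define F where "F = max 1 (max B0 (max (\<Sum>i\<in>UNIV. B1 i) (\<Sum>i\<in>UNIV. \<Sum>j\<in>UNIV. B2 i j)))"
  have "\<bar>f x\<bar> \<le> F" for x using B0[of x] by (simp add: F_def)
  moreover have "norm (grad f x) \<le> F" for x
  proof -
    have "norm (grad f x) \<le> (\<Sum>i\<in>UNIV. B1 i)" by (rule order_trans[OF norm_le_l1_cart]) (intro sum_mono B1)
    then show ?thesis by (simp add: F_def)
  qed
  moreover have "norm (grad f x - grad f y) \<le> F * norm (x - y)" for x y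
  proof -
    have "norm (grad f x - grad f y) \<le> (\<Sum>i\<in>UNIV. \<bar>(grad f x - grad f y) $ i\<bar>)" by (rule norm_le_l1_cart)
    also have "\<dots> \<le> (\<Sum>i\<in>UNIV. (\<Sum>j\<in>UNIV. B2 i j) * norm (x - y))" by (intro sum_mono) (simp add: lip)
    also have "\<dots> = (\<Sum>i\<in>UNIV. \<Sum>j\<in>UNIV. B2 i j) * norm (x - y)" by (simp add: sum_distrib_right)
    also have "\<dots> \<le> F * norm (x - y)" by (intro mult_right_mono) (auto simp: F_def)
    finally show ?thesis .
  qed
  moreover have "F \<ge> 1" by (simp add: F_def)
  ultimately show ?thesis using d by blast
qed

section \<open>The Melnikov function and its nondegenerate minimum\<close>

definition melnikov_grad :: "real ^ 'n::finite \<Rightarrow> (real ^ 'n \<Rightarrow> real) \<Rightarrow> real ^ 'n \<Rightarrow> real ^ 'n" where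
  "melnikov_grad \<omega> f A = (LINT t|lborel. (cos (separatrix t) - 1) *\<^sub>R grad f (t *\<^sub>R \<omega> + A))"

lemma abs_cos_separatrix_le: "\<bar>cos (separatrix t) - 1\<bar> \<le> 8 * exp (- 2 * \<bar>t\<bar>)"
proof -
  have "(separatrix_velocity t)\<^sup>2 \<le> (4 * exp (- \<bar>t\<bar>))\<^sup>2"
    using separatrix_velocity_bounds(1,2)[of t] by (intro power_mono) auto
  also have "\<dots> = 16 * exp (- 2 * \<bar>t\<bar>)" by (simp add: power_mult_distrib exp_of_nat_mult[symmetric] exp_double)
  finally show ?thesis using sin_cos_separatrix(2)[of t] by (simp add: abs_le_iff)
qed

lemma continuous_separatrix: "continuous_on UNIV separatrix"
  unfolding separatrix_def[abs_def] by (intro continuous_intros)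

text \<open>
  The weight \<open>1 - cos (separatrix t)\<close> is at most \<open>8 * exp (-2 * \<bar>t\<bar>)\<close>, whose integral is 8.
\<close>

lemma separatrix_weight_integral:
  fixes h :: "real \<Rightarrow> 'b::{banach, second_countable_topology}"
  assumes c: "continuous_on UNIV h" and K: "\<And>t. norm (h t) \<le> K"
  shows "integrable lborel (\<lambda>t. (cos (separatrix t) - 1) *\<^sub>R h t)"
    "norm (LINT t|lborel. (cos (separatrix t) - 1) *\<^sub>R h t) \<le> 8 * K"
proof -
  have K0: "K \<ge> 0" using K[of 0] norm_ge_zero order_trans by blast
  have b: "norm ((cos (separatrix t) - 1) *\<^sub>R h t) \<le> 8 * K * exp (- 2 * \<bar>t - 0\<bar>)" for t
  proof -
    have "\<bar>cos (separatrix t) - 1\<bar> * norm (h t) \<le> 8 * exp (- 2 * \<bar>t\<bar>) * K"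
      by (intro mult_mono abs_cos_separatrix_le K) auto
    then show ?thesis unfolding norm_scaleR by (simp add: mult_ac)
  qed
  have i: "integrable lborel (\<lambda>t. 8 * K * exp (- 2 * \<bar>t - 0\<bar>))"
    using integrable_exp_abs(1)[of 2 0] by simp
  show I: "integrable lborel (\<lambda>t. (cos (separatrix t) - 1) *\<^sub>R h t)"
  proof (rule Bochner_Integration.integrable_bound[OF i])
    show "(\<lambda>t. (cos (separatrix t) - 1) *\<^sub>R h t) \<in> borel_measurable lborel"
    proof -
      have "(\<lambda>t. (cos (separatrix t) - 1) *\<^sub>R h t) \<in> borel_measurable borel"
        by (intro borel_measurable_continuous_onI continuous_intros c continuous_separatrix)
      then show ?thesis by simp
    qed
    show "AE t in lborel. norm ((cos (separatrix t) - 1) *\<^sub>R h t) \<le> norm (8 * K * exp (- 2 * \<bar>t - 0\<bar>))"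
      using b K0 by (auto intro!: AE_I2)
  qed
  have "norm (LINT t|lborel. (cos (separatrix t) - 1) *\<^sub>R h t) \<le> (LINT t|lborel. 8 * K * exp (- 2 * \<bar>t - 0\<bar>))"
    by (rule Bochner_Integration.integral_norm_bound_integral[OF I i b])
  also have "\<dots> = 8 * K" using integrable_exp_abs(2)[of 2 0] by simp
  finally show "norm (LINT t|lborel. (cos (separatrix t) - 1) *\<^sub>R h t) \<le> 8 * K" .
qed

text \<open>
  The mean value theorem along the segment from \<open>x\<close> to \<open>x + h\<close>.
\<close>

lemma gradient_remainder:
  fixes f :: "real ^ 'n::finite \<Rightarrow> real"
  assumes d: "\<And>x. f differentiable (at x)" and lip: "\<And>x y. norm (grad f x - grad f y) \<le> F * norm (x - y)"
  shows "\<bar>f (x + h) - f x - grad f x \<bullet> h\<bar> \<le> F * (norm h)\<^sup>2"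
proof -
  have "\<exists>s\<in>{0<..<1}. f (x + 1 *\<^sub>R h) - f (x + 0 *\<^sub>R h) = (1 - 0) * (grad f (x + s *\<^sub>R h) \<bullet> h)"
  proof (rule mvt_simple[of 0 1 "\<lambda>s. f (x + s *\<^sub>R h)" "\<lambda>s r. r * (grad f (x + s *\<^sub>R h) \<bullet> h)"])
    fix s :: real
    show "((\<lambda>s. f (x + s *\<^sub>R h)) has_derivative (\<lambda>r. r * (grad f (x + s *\<^sub>R h) \<bullet> h))) (at s within {0..1})"
    proof -
      have "((\<lambda>s. f (x + s *\<^sub>R h)) has_derivative (\<lambda>r. grad f (x + s *\<^sub>R h) \<bullet> (r *\<^sub>R h))) (at s within {0..1})"
        by (rule has_derivative_compose[of "\<lambda>s. x + s *\<^sub>R h" "\<lambda>r. r *\<^sub>R h" s _ f, OF _ has_derivative_grad[OF d]])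
           (auto intro!: derivative_eq_intros)
      then show ?thesis by simp
    qed
  qed simp
  then obtain s where s: "0 < s" "s < 1" "f (x + h) - f x = grad f (x + s *\<^sub>R h) \<bullet> h" by auto
  have "\<bar>f (x + h) - f x - grad f x \<bullet> h\<bar> = \<bar>(grad f (x + s *\<^sub>R h) - grad f x) \<bullet> h\<bar>"
    using s(3) by (simp add: inner_diff_left)
  also have "\<dots> \<le> norm (grad f (x + s *\<^sub>R h) - grad f x) * norm h" by (rule Cauchy_Schwarz_ineq2)
  also have "\<dots> \<le> (F * norm h) * norm h"
  proof (rule mult_right_mono)
    have F0: "F * norm h \<ge> 0" using order_trans[OF norm_ge_zero lip[of "x + h" x]] by simp
    have "norm (grad f (x + s *\<^sub>R h) - grad f x) \<le> F * norm (x + s *\<^sub>R h - x)" by (rule lip)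
    also have "\<dots> = s * (F * norm h)" using s by simp
    also have "\<dots> \<le> F * norm h" using s F0 by (intro mult_left_le_one_le) auto
    finally show "norm (grad f (x + s *\<^sub>R h) - grad f x) \<le> F * norm h" .
  qed simp
  finally show ?thesis by (simp add: power2_eq_square)
qed

lemma continuous_on_grad:
  fixes f :: "real ^ 'n::finite \<Rightarrow> real"
  assumes lip: "\<And>x y. norm (grad f x - grad f y) \<le> F * norm (x - y)" and F: "F > 0"
  shows "continuous_on UNIV (grad f)"
proof (rule continuous_onI)
  fix x :: "real ^ 'n" and e :: real assume "e > 0"
  show "\<exists>d>0. \<forall>x'\<in>UNIV. dist x' x < d \<longrightarrow> dist (grad f x') (grad f x) \<le> e"
  proof (intro exI[of _ "e / F"] conjI ballI impI)
    fix y assume "dist y x < e / F"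
    then have "F * norm (y - x) \<le> e" using F by (simp add: dist_norm field_simps)
    with lip[of y x] show "dist (grad f y) (grad f x) \<le> e" by (simp add: dist_norm)
  qed (use \<open>e > 0\<close> F in auto)
qed

text \<open>
  Differentiation under the integral sign. With a Lipschitz gradient the remainder of \<open>f\<close> is quadratic uniformly in \<open>t\<close>, so
  integrating it against the weight needs no limit theorem.
\<close>

lemma melnikov_has_derivative:
  fixes f :: "real ^ 'n::finite \<Rightarrow> real"
  assumes d: "\<And>x. f differentiable (at x)" and b: "\<And>x. \<bar>f x\<bar> \<le> F" and g: "\<And>x. norm (grad f x) \<le> F"
    and lip: "\<And>x y. norm (grad f x - grad f y) \<le> F * norm (x - y)" and F: "F \<ge> 1"
  shows "(melnikov \<omega> f has_derivative (\<lambda>h. melnikov_grad \<omega> f A \<bullet> h)) (at A)"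
proof -
  have fc: "continuous_on UNIV f"
    using d by (intro differentiable_imp_continuous_on) (auto simp: differentiable_on_def differentiable_at_withinI)
  have gc: "continuous_on UNIV (grad f)" by (rule continuous_on_grad[OF lip]) (use F in auto)
  have fi: "integrable lborel (\<lambda>t. (cos (separatrix t) - 1) *\<^sub>R f (t *\<^sub>R \<omega> + B))" for B
    by (rule separatrix_weight_integral) (auto intro!: continuous_on_compose2[OF fc] continuous_intros b)
  have gi: "integrable lborel (\<lambda>t. (cos (separatrix t) - 1) *\<^sub>R grad f (t *\<^sub>R \<omega> + B))" for B
    by (rule separatrix_weight_integral) (auto intro!: continuous_on_compose2[OF gc] continuous_intros g)
  have rem: "\<bar>melnikov \<omega> f (A + h) - melnikov \<omega> f A - melnikov_grad \<omega> f A \<bullet> h\<bar> \<le> 8 * F * (norm h)\<^sup>2" for h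
  proof -
    have "melnikov_grad \<omega> f A \<bullet> h = (LINT t|lborel. ((cos (separatrix t) - 1) *\<^sub>R grad f (t *\<^sub>R \<omega> + A)) \<bullet> h)"
      unfolding melnikov_grad_def by (rule integral_inner_left[OF gi, symmetric])
    moreover have "integrable lborel (\<lambda>t. ((cos (separatrix t) - 1) *\<^sub>R grad f (t *\<^sub>R \<omega> + A)) \<bullet> h)"
      using gi by (rule integrable_inner_left)
    moreover have "melnikov \<omega> f B = (LINT t|lborel. (cos (separatrix t) - 1) *\<^sub>R f (t *\<^sub>R \<omega> + B))" for B
      by (simp add: melnikov_def)
    ultimately have "melnikov \<omega> f (A + h) - melnikov \<omega> f A - melnikov_grad \<omega> f A \<bullet> h =
      (LINT t|lborel. (cos (separatrix t) - 1) *\<^sub>R f (t *\<^sub>R \<omega> + (A + h)) - (cos (separatrix t) - 1) *\<^sub>R f (t *\<^sub>R \<omega> + A)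
        - ((cos (separatrix t) - 1) *\<^sub>R grad f (t *\<^sub>R \<omega> + A)) \<bullet> h)"
      using fi[of A] fi[of "A + h"] by (simp del: real_scaleR_def inner_scaleR_left)
    also have "\<dots> = (LINT t|lborel. (cos (separatrix t) - 1) *\<^sub>R (f (t *\<^sub>R \<omega> + A + h) - f (t *\<^sub>R \<omega> + A) - grad f (t *\<^sub>R \<omega> + A) \<bullet> h))"
      by (intro Bochner_Integration.integral_cong) (simp_all add: algebra_simps)
    also have "\<bar>\<dots>\<bar> \<le> 8 * (F * (norm h)\<^sup>2)"
      unfolding real_norm_def[symmetric]
    proof (rule separatrix_weight_integral(2))
      show "norm (f (t *\<^sub>R \<omega> + A + h) - f (t *\<^sub>R \<omega> + A) - grad f (t *\<^sub>R \<omega> + A) \<bullet> h) \<le> F * (norm h)\<^sup>2" for t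
        using gradient_remainder[OF d lip, of "t *\<^sub>R \<omega> + A" h] by simp
    qed (auto intro!: continuous_intros continuous_on_compose2[OF fc] continuous_on_compose2[OF gc])
    finally show ?thesis by simp
  qed
  show ?thesis unfolding has_derivative_at_alt
  proof (intro conjI allI impI)
    show "bounded_linear (\<lambda>h. melnikov_grad \<omega> f A \<bullet> h)" by (rule bounded_linear_inner_right)
    fix e :: real assume e: "e > 0"
    show "\<exists>d>0. \<forall>y. norm (y - A) < d \<longrightarrow> norm (melnikov \<omega> f y - melnikov \<omega> f A - melnikov_grad \<omega> f A \<bullet> (y - A)) \<le> e * norm (y - A)"
    proof (intro exI[of _ "e / (8 * F)"] conjI allI impI)
      fix y assume "norm (y - A) < e / (8 * F)"
      then have "8 * F * norm (y - A) \<le> e" using F by (simp add: field_simps)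
      then have "8 * F * norm (y - A) * norm (y - A) \<le> e * norm (y - A)" by (intro mult_right_mono) auto
      with rem[of "y - A"] show "norm (melnikov \<omega> f y - melnikov \<omega> f A - melnikov_grad \<omega> f A \<bullet> (y - A)) \<le> e * norm (y - A)"
        by (simp add: power2_eq_square)
    qed (use e F in auto)
  qed
qed

lemma melnikov_grad_periodic:
  assumes "\<And>x k. grad f (x + (2 * pi) *\<^sub>R int_vec k) = grad f x"
  shows "melnikov_grad \<omega> f (A + (2 * pi) *\<^sub>R int_vec k) = melnikov_grad \<omega> f A"
  unfolding melnikov_grad_def using assms by (simp add: add.assoc[symmetric])

lemma melnikov_grad_lipschitz:
  fixes f :: "real ^ 'n::finite \<Rightarrow> real"
  assumes g: "\<And>x. norm (grad f x) \<le> F"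
    and lip: "\<And>x y. norm (grad f x - grad f y) \<le> F * norm (x - y)" and F: "F \<ge> 1"
  shows "norm (melnikov_grad \<omega> f A - melnikov_grad \<omega> f B) \<le> 8 * F * norm (A - B)"
proof -
  have gc: "continuous_on UNIV (grad f)" by (rule continuous_on_grad[OF lip]) (use F in auto)
  have gi: "integrable lborel (\<lambda>t. (cos (separatrix t) - 1) *\<^sub>R grad f (t *\<^sub>R \<omega> + B))" for B
    by (rule separatrix_weight_integral) (auto intro!: continuous_on_compose2[OF gc] continuous_intros g)
  have "melnikov_grad \<omega> f A - melnikov_grad \<omega> f B =
     (LINT t|lborel. (cos (separatrix t) - 1) *\<^sub>R (grad f (t *\<^sub>R \<omega> + A) - grad f (t *\<^sub>R \<omega> + B)))"
    unfolding melnikov_grad_def using gi[of A] gi[of B] by (simp add: scaleR_diff_right)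
  also have "norm \<dots> \<le> 8 * (F * norm (A - B))"
    using lip[of "t *\<^sub>R \<omega> + A" "t *\<^sub>R \<omega> + B" for t]
    by (intro separatrix_weight_integral(2)) (auto intro!: continuous_intros continuous_on_compose2[OF gc])
  finally show ?thesis by simp
qed

text \<open>
  The mean value theorem applied to one of the two increments leaves a difference of gradients, which the
  derivative of the gradient at \<open>A\<close> describes.
\<close>

lemma second_difference:
  fixes \<Gamma> :: "'a::euclidean_space \<Rightarrow> real" and G L :: "'a \<Rightarrow> 'a"
  assumes G: "\<And>B. (\<Gamma> has_derivative (\<lambda>h. G B \<bullet> h)) (at B)" and L: "linear L"
    and e: "\<And>z. norm z < d \<Longrightarrow> norm (G (A + z) - G A - L z) \<le> e * norm z" "e \<ge> 0"
    and t: "t > 0" "t * (norm x + norm y) < d"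
  shows "\<bar>\<Gamma> (A + t *\<^sub>R x + t *\<^sub>R y) - \<Gamma> (A + t *\<^sub>R x) - \<Gamma> (A + t *\<^sub>R y) + \<Gamma> A - t\<^sup>2 * (x \<bullet> L y)\<bar>
    \<le> 2 * e * t\<^sup>2 * (norm x + norm y)\<^sup>2"
proof -
  let ?\<phi> = "\<lambda>s. \<Gamma> (A + s *\<^sub>R (t *\<^sub>R x) + t *\<^sub>R y) - \<Gamma> (A + s *\<^sub>R (t *\<^sub>R x))"
  let ?\<phi>' = "\<lambda>s. G (A + s *\<^sub>R (t *\<^sub>R x) + t *\<^sub>R y) \<bullet> (t *\<^sub>R x) - G (A + s *\<^sub>R (t *\<^sub>R x)) \<bullet> (t *\<^sub>R x)"
  have "\<exists>s\<in>{0<..<1}. ?\<phi> 1 - ?\<phi> 0 = (1 - 0) * ?\<phi>' s"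
  proof (rule mvt_simple[of 0 1 ?\<phi> "\<lambda>s r. r * ?\<phi>' s"])
    fix s :: real
    have 1: "((\<lambda>s. \<Gamma> (B + s *\<^sub>R (t *\<^sub>R x))) has_derivative (\<lambda>r. G (B + s *\<^sub>R (t *\<^sub>R x)) \<bullet> (r *\<^sub>R (t *\<^sub>R x)))) (at s within {0..1})" for B
      by (rule has_derivative_compose[of "\<lambda>s. B + s *\<^sub>R (t *\<^sub>R x)" "\<lambda>r. r *\<^sub>R (t *\<^sub>R x)" s _ \<Gamma>, OF _ G])
         (auto intro!: derivative_eq_intros)
    from has_derivative_diff[OF 1[of "A + t *\<^sub>R y"] 1[of A]]
    show "(?\<phi> has_derivative (\<lambda>r. r * ?\<phi>' s)) (at s within {0..1})"
      by (simp add: algebra_simps)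
  qed simp
  then obtain s where s: "0 < s" "s < 1" "?\<phi> 1 - ?\<phi> 0 = ?\<phi>' s" by auto
  define R where "R z = G (A + z) - G A - L z" for z
  define z1 z2 where "z1 = s *\<^sub>R (t *\<^sub>R x) + t *\<^sub>R y" and "z2 = s *\<^sub>R (t *\<^sub>R x)"
  have st: "s * t * norm x \<le> t * norm x" using s t by (simp add: mult_left_le_one_le mult_right_mono)
  have z1: "norm z1 \<le> t * (norm x + norm y)"
  proof -
    have "norm z1 \<le> norm (s *\<^sub>R (t *\<^sub>R x)) + norm (t *\<^sub>R y)" unfolding z1_def by (rule norm_triangle_ineq)
    also have "\<dots> = s * t * norm x + t * norm y" using s t by simp
    finally show ?thesis using st by (simp add: distrib_left)
  qed
  have z2: "norm z2 \<le> t * (norm x + norm y)" using st s t by (simp add: z2_def distrib_left add_increasing2)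
  have R: "norm (R z) \<le> e * (t * (norm x + norm y))" if "norm z \<le> t * (norm x + norm y)" for z
    using e(1)[of z] that t(2) mult_left_mono[OF that e(2)] unfolding R_def by linarith
  have "L z1 - L z2 = t *\<^sub>R L y"
    using linear_diff[OF L, of z1 z2] linear_scale[OF L, of t y] by (simp add: z1_def z2_def)
  then have "G (A + z1) - G (A + z2) = t *\<^sub>R L y + (R z1 - R z2)" by (simp add: R_def algebra_simps)
  moreover have "?\<phi>' s = t * ((G (A + z1) - G (A + z2)) \<bullet> x)"
    by (simp add: z1_def z2_def add.assoc inner_diff_left right_diff_distrib)
  ultimately have "?\<phi>' s = t * ((t *\<^sub>R L y + (R z1 - R z2)) \<bullet> x)" by simp
  then have "?\<phi>' s - t\<^sup>2 * (x \<bullet> L y) = t * ((R z1 - R z2) \<bullet> x)"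
    by (simp add: inner_add_left inner_commute[of x "L y"] power2_eq_square distrib_left)
  moreover have "\<bar>t * ((R z1 - R z2) \<bullet> x)\<bar> \<le> 2 * e * t\<^sup>2 * (norm x + norm y)\<^sup>2"
  proof -
    have "\<bar>(R z1 - R z2) \<bullet> x\<bar> \<le> norm (R z1 - R z2) * norm x" by (rule Cauchy_Schwarz_ineq2)
    also have "\<dots> \<le> (2 * (e * (t * (norm x + norm y)))) * (norm x + norm y)"
      using norm_triangle_ineq4[of "R z1" "R z2"] R[OF z1] R[OF z2] order_trans[OF norm_ge_zero R[OF z1]]
      by (intro mult_mono) auto
    finally have "t * \<bar>(R z1 - R z2) \<bullet> x\<bar> \<le> t * ((2 * (e * (t * (norm x + norm y)))) * (norm x + norm y))"
      using t by (intro mult_left_mono) auto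
    then show ?thesis using t unfolding abs_mult by (simp add: power2_eq_square mult_ac)
  qed
  moreover have "\<Gamma> (A + t *\<^sub>R x + t *\<^sub>R y) - \<Gamma> (A + t *\<^sub>R x) - \<Gamma> (A + t *\<^sub>R y) + \<Gamma> A = ?\<phi> 1 - ?\<phi> 0" by simp
  ultimately show ?thesis using s(3) by simp
qed

text \<open>
  The mixed second difference is symmetric in the two directions, and after division by \<open>t\<^sup>2\<close> it tends to both bilinear
  expressions. Only the existence of the second derivative at the single point \<open>A\<close> enters.
\<close>

lemma second_derivative_symmetric:
  fixes \<Gamma> :: "'a::euclidean_space \<Rightarrow> real" and G L :: "'a \<Rightarrow> 'a"
  assumes G: "\<And>B. (\<Gamma> has_derivative (\<lambda>h. G B \<bullet> h)) (at B)" and L: "(G has_derivative L) (at A)"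
  shows "x \<bullet> L y = y \<bullet> L x"
proof -
  have lin: "linear L" using L by (rule has_derivative_linear)
  define N where "N = (norm x + norm y)\<^sup>2"
  have "\<bar>x \<bullet> L y - y \<bullet> L x\<bar> \<le> 0 + e" if "e > 0" for e
  proof -
    define e' where "e' = e / (4 * (N + 1))"
    have N: "N \<ge> 0" by (simp add: N_def)
    have e': "e' > 0" using that N by (simp add: e'_def)
    obtain d where d: "d > 0" "\<And>y. norm (y - A) < d \<Longrightarrow> norm (G y - G A - L (y - A)) \<le> e' * norm (y - A)"
      using L e' unfolding has_derivative_at_alt by blast
    have D: "norm (G (A + z) - G A - L z) \<le> e' * norm z" if "norm z < d" for z using d(2)[of "A + z"] that by simp
    define p where "p = norm x + norm y + 1"
    define t where "t = d / (2 * p)"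
    have pos: "p > 0" by (simp add: add_nonneg_pos p_def)
    have t: "t > 0" using d pos by (simp add: t_def)
    have "t * (norm x + norm y) \<le> t * p" using t unfolding p_def by (intro mult_left_mono) auto
    also have "\<dots> = d / 2" using pos by (simp add: t_def)
    finally have td: "t * (norm x + norm y) < d" "t * (norm y + norm x) < d" using d by (auto simp: add.commute)
    have 1: "\<bar>\<Gamma> (A + t *\<^sub>R x + t *\<^sub>R y) - \<Gamma> (A + t *\<^sub>R x) - \<Gamma> (A + t *\<^sub>R y) + \<Gamma> A - t\<^sup>2 * (x \<bullet> L y)\<bar>
        \<le> 2 * e' * t\<^sup>2 * (norm x + norm y)\<^sup>2"
      by (rule second_difference[OF G lin D less_imp_le[OF e'] t td(1)])
    have 2: "\<bar>\<Gamma> (A + t *\<^sub>R y + t *\<^sub>R x) - \<Gamma> (A + t *\<^sub>R y) - \<Gamma> (A + t *\<^sub>R x) + \<Gamma> A - t\<^sup>2 * (y \<bullet> L x)\<bar>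
        \<le> 2 * e' * t\<^sup>2 * (norm y + norm x)\<^sup>2"
      by (rule second_difference[OF G lin D less_imp_le[OF e'] t td(2)])
    have diff: "\<bar>a - b\<bar> \<le> c + c'" if "\<bar>u - v - w + z - a\<bar> \<le> c" "\<bar>u - w - v + z - b\<bar> \<le> c'" for a b c c' u v w z :: real
      using that by linarith
    have "\<bar>t\<^sup>2 * (x \<bullet> L y) - t\<^sup>2 * (y \<bullet> L x)\<bar> \<le> 4 * e' * t\<^sup>2 * N"
    proof -
      have "A + t *\<^sub>R y + t *\<^sub>R x = A + t *\<^sub>R x + t *\<^sub>R y" "norm y + norm x = norm x + norm y" by (simp_all add: algebra_simps)
      with 2 have "\<bar>\<Gamma> (A + t *\<^sub>R x + t *\<^sub>R y) - \<Gamma> (A + t *\<^sub>R y) - \<Gamma> (A + t *\<^sub>R x) + \<Gamma> A - t\<^sup>2 * (y \<bullet> L x)\<bar>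
        \<le> 2 * e' * t\<^sup>2 * (norm x + norm y)\<^sup>2" by simp
      moreover have "4 * e' * t\<^sup>2 * N = 2 * e' * t\<^sup>2 * (norm x + norm y)\<^sup>2 + 2 * e' * t\<^sup>2 * (norm x + norm y)\<^sup>2"
        by (simp add: N_def)
      ultimately show ?thesis using diff[OF 1] by metis
    qed
    moreover have "t\<^sup>2 * (x \<bullet> L y) - t\<^sup>2 * (y \<bullet> L x) = t\<^sup>2 * (x \<bullet> L y - y \<bullet> L x)" by (rule right_diff_distrib[symmetric])
    ultimately have "t\<^sup>2 * \<bar>x \<bullet> L y - y \<bullet> L x\<bar> \<le> t\<^sup>2 * (4 * e' * N)"
      by (simp only: abs_mult) (simp add: mult_ac)
    then have "\<bar>x \<bullet> L y - y \<bullet> L x\<bar> \<le> 4 * e' * N" 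
      by (rule mult_left_le_imp_le) (use t in simp)
    also have "\<dots> \<le> 4 * e' * (N + 1)" using e' by simp
    also have "\<dots> = e" 
    proof -
      have "4 * N + 4 \<noteq> 0" using N by linarith
      then show ?thesis by (simp add: e'_def divide_eq_eq algebra_simps)
    qed
    finally show ?thesis by simp
  qed
  then have "\<bar>x \<bullet> L y - y \<bullet> L x\<bar> \<le> 0" by (rule field_le_epsilon)
  then show ?thesis by simp
qed

text \<open>
  A minimum makes the Hessian positive semidefinite. If \<open>x \<bullet> L x = 0\<close>, the quadratic form at \<open>x + s y\<close> can only stay
  nonnegative for all \<open>s\<close> if \<open>y \<bullet> L x = 0\<close> for all \<open>y\<close>, hence \<open>L x = 0\<close>, which invertibility excludes.
  Definiteness is used in the direction of the frequency vector: a shift of a crossing time then changes the energy exchanged in the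
  crossing at a nonzero rate.
\<close>

lemma nondegenerate_local_minimum_positive_definite:
  fixes \<Gamma> :: "'a::euclidean_space \<Rightarrow> real" and G L :: "'a \<Rightarrow> 'a"
  assumes G: "\<And>B. (\<Gamma> has_derivative (\<lambda>h. G B \<bullet> h)) (at B)" and L: "(G has_derivative L) (at A)"
    and min: "\<forall>\<^sub>F B in nhds A. \<Gamma> A \<le> \<Gamma> B" and inj: "\<And>x. L x = 0 \<Longrightarrow> x = 0"
  shows "G A = 0" "x \<noteq> 0 \<Longrightarrow> x \<bullet> L x > 0"
proof -
  have lin: "linear L" using L by (rule has_derivative_linear)
  obtain \<rho> where \<rho>: "\<rho> > 0" "\<And>B. dist B A < \<rho> \<Longrightarrow> \<Gamma> A \<le> \<Gamma> B"
    using min unfolding eventually_nhds_metric by blast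
  have "(\<lambda>h. G A \<bullet> h) = (\<lambda>h. 0)"
    by (rule differential_zero_maxmin[OF _ _ G, of A "ball A \<rho>"]) (use \<rho> in \<open>auto simp: dist_commute\<close>)
  then show GA: "G A = 0" by (metis inner_eq_zero_iff)
  have psd: "x \<bullet> L x \<ge> 0" for x
  proof (rule ccontr)
    assume neg: "\<not> x \<bullet> L x \<ge> 0"
    then have x0: "x \<noteq> 0" by auto
    define e where "e = - (x \<bullet> L x) / (2 * (norm x)\<^sup>2)"
    have e: "e > 0" using neg x0 by (simp add: e_def field_simps)
    obtain d where d: "d > 0" "\<And>y. norm (y - A) < d \<Longrightarrow> norm (G y - G A - L (y - A)) \<le> e * norm (y - A)"
      using L e unfolding has_derivative_at_alt by blast
    define t where "t = min d \<rho> / (2 * norm x)"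
    have t: "t > 0" "t * norm x < d" "t * norm x < \<rho>" using d \<rho> x0 by (auto simp: t_def min_def field_simps)
    have "\<exists>s\<in>{0<..<t}. \<Gamma> (A + t *\<^sub>R x) - \<Gamma> (A + 0 *\<^sub>R x) = (t - 0) * (G (A + s *\<^sub>R x) \<bullet> x)"
    proof (rule mvt_simple[of 0 t "\<lambda>s. \<Gamma> (A + s *\<^sub>R x)" "\<lambda>s r. r * (G (A + s *\<^sub>R x) \<bullet> x)"])
      fix s
      have "((\<lambda>s. \<Gamma> (A + s *\<^sub>R x)) has_derivative (\<lambda>r. G (A + s *\<^sub>R x) \<bullet> (r *\<^sub>R x))) (at s within {0..t})"
        by (rule has_derivative_compose[of "\<lambda>s. A + s *\<^sub>R x" "\<lambda>r. r *\<^sub>R x" s _ \<Gamma>, OF _ G]) (auto intro!: derivative_eq_intros)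
      then show "((\<lambda>s. \<Gamma> (A + s *\<^sub>R x)) has_derivative (\<lambda>r. r * (G (A + s *\<^sub>R x) \<bullet> x))) (at s within {0..t})" by simp
    qed (use t in auto)
    then obtain s where s: "0 < s" "s < t" "\<Gamma> (A + t *\<^sub>R x) - \<Gamma> A = t * (G (A + s *\<^sub>R x) \<bullet> x)" by auto
    have "\<Gamma> A \<le> \<Gamma> (A + t *\<^sub>R x)" using t by (intro \<rho>(2)) (simp add: dist_norm)
    then have "0 \<le> t * (G (A + s *\<^sub>R x) \<bullet> x)" using s(3) by linarith
    then have "G (A + s *\<^sub>R x) \<bullet> x \<ge> 0" using t(1) by (simp add: zero_le_mult_iff)
    moreover have "G (A + s *\<^sub>R x) \<bullet> x \<le> s * (x \<bullet> L x) + e * (s * norm x) * norm x"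
    proof -
      have "s * norm x < d" using s t by (meson le_less_trans less_imp_le mult_right_mono norm_ge_zero)
      then have "norm (G (A + s *\<^sub>R x) - L (s *\<^sub>R x)) \<le> e * (s * norm x)" using d(2)[of "A + s *\<^sub>R x"] GA s by simp
      then have "norm (G (A + s *\<^sub>R x) - L (s *\<^sub>R x)) * norm x \<le> e * (s * norm x) * norm x" by (intro mult_right_mono) auto
      moreover have "(G (A + s *\<^sub>R x) - L (s *\<^sub>R x)) \<bullet> x \<le> norm (G (A + s *\<^sub>R x) - L (s *\<^sub>R x)) * norm x"
        by (rule norm_cauchy_schwarz)
      ultimately show ?thesis using linear_scale[OF lin, of s x]
        by (simp add: inner_diff_left inner_commute[of "L x" x])
    qed
    moreover have "e * (s * norm x) * norm x = - (s * (x \<bullet> L x) / 2)"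
      using x0 by (simp add: e_def power2_eq_square)
    ultimately have "0 \<le> s * (x \<bullet> L x) / 2" by simp
    then show False using neg s by (simp add: zero_le_mult_iff)
  qed
  show "x \<bullet> L x > 0" if "x \<noteq> 0"
  proof (rule ccontr)
    assume "\<not> x \<bullet> L x > 0"
    then have x: "x \<bullet> L x = 0" using psd[of x] by simp
    have "y \<bullet> L x = 0" for y
    proof (rule ccontr)
      assume ne: "y \<bullet> L x \<noteq> 0"
      \<comment> \<open>The minimiser of the parabola in \<open>s\<close>, with \<open>1\<close> added to the denominator to keep it positive.\<close>
      define s where "s = - (y \<bullet> L x) / (y \<bullet> L y + 1)"
      have D: "y \<bullet> L y + 1 > 0" using psd[of y] by simp
      have "0 \<le> (x + s *\<^sub>R y) \<bullet> L (x + s *\<^sub>R y)" by (rule psd)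
      also have "\<dots> = 2 * s * (y \<bullet> L x) + s\<^sup>2 * (y \<bullet> L y)"
        using linear_add[OF lin, of x "s *\<^sub>R y"] linear_scale[OF lin, of s y] x second_derivative_symmetric[OF G L, of x y]
        by (simp add: inner_add_left inner_add_right power2_eq_square algebra_simps)
      also have "\<dots> \<le> 2 * s * (y \<bullet> L x) + s\<^sup>2 * (y \<bullet> L y + 1)" by (simp add: algebra_simps)
      also have "\<dots> = - ((y \<bullet> L x)\<^sup>2 / (y \<bullet> L y + 1))"
      proof -
        have "s * (y \<bullet> L y + 1) = - (y \<bullet> L x)" using D by (simp add: s_def)
        then have "s\<^sup>2 * (y \<bullet> L y + 1) = - (s * (y \<bullet> L x))" by (simp add: power2_eq_square mult.assoc)
        moreover have "s * (y \<bullet> L x) = - ((y \<bullet> L x)\<^sup>2 / (y \<bullet> L y + 1))" by (simp add: s_def power2_eq_square)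
        ultimately show ?thesis by simp
      qed
      also have "\<dots> < 0" using ne D by simp
      finally show False by simp
    qed
    then have "L x = 0" by (metis inner_eq_zero_iff)
    with inj that show False by blast
  qed
qed

section \<open>Recurrence of the linear flow\<close>

text \<open>
  Almost periodicity of the linear flow. Finitely many balls of radius \<open>\<delta> / 2\<close> cover the torus, and each ball that is ever visited
  is assigned one time of visit. The ball occupied at time \<open>t + T0\<close> was also occupied at its assigned time; the difference of the two
  times is a return time in the required range. The bound \<open>T\<close> depends on \<open>\<delta>\<close> alone, so waiting for a return costs a time independent of
  \<open>\<mu>\<close>.
\<close>

lemma torus_returns:
  fixes \<omega> :: "real ^ 'n::finite"
  assumes \<delta>: "\<delta> > 0"
  shows "\<exists>T>0. \<forall>t. \<exists>s\<in>{t..t + T}. \<exists>k. norm (s *\<^sub>R \<omega> - (2 * pi) *\<^sub>R int_vec k) < \<delta>"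
proof -
  define K :: "(real ^ 'n) set" where "K = cbox 0 (\<chi> i. 2 * pi)"
  define fl :: "real \<Rightarrow> int ^ 'n" where "fl t = (\<chi> i. \<lfloor>(t *\<^sub>R \<omega>) $ i / (2 * pi)\<rfloor>)" for t
  define red where "red t = t *\<^sub>R \<omega> - (2 * pi) *\<^sub>R int_vec (fl t)" for t
  have redK: "red t \<in> K" for t
  proof -
    have "0 \<le> x - 2 * pi * of_int \<lfloor>x / (2 * pi)\<rfloor> \<and> x - 2 * pi * of_int \<lfloor>x / (2 * pi)\<rfloor> \<le> 2 * pi" for x :: real
    proof -
      have "of_int \<lfloor>x / (2 * pi)\<rfloor> \<le> x / (2 * pi)" "x / (2 * pi) \<le> of_int \<lfloor>x / (2 * pi)\<rfloor> + 1" by linarith+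
      then have "of_int \<lfloor>x / (2 * pi)\<rfloor> * (2 * pi) \<le> x" "x \<le> (of_int \<lfloor>x / (2 * pi)\<rfloor> + 1) * (2 * pi)"
        using mult_right_mono[of "of_int \<lfloor>x / (2 * pi)\<rfloor>" "x / (2 * pi)" "2 * pi"]
          mult_right_mono[of "x / (2 * pi)" "of_int \<lfloor>x / (2 * pi)\<rfloor> + 1" "2 * pi"] by simp_all
      then show ?thesis by (simp add: algebra_simps)
    qed
    then show ?thesis unfolding K_def mem_box_cart by (simp add: red_def int_vec_def fl_def)
  qed
  have K: "compact K" "K \<subseteq> (\<Union>c\<in>K. ball c (\<delta> / 2))" using \<delta> by (auto simp: K_def)
  obtain C where "C \<subseteq> K" and C: "finite C" "K \<subseteq> (\<Union>c\<in>C. ball c (\<delta> / 2))"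
    by (rule compactE_image[OF K(1) open_ball K(2)])
  define \<tau> where "\<tau> c = (SOME t. red t \<in> ball c (\<delta> / 2))" for c
  define T0 where "T0 = (\<Sum>c\<in>C. \<bar>\<tau> c\<bar>)"
  have T0: "\<bar>\<tau> c\<bar> \<le> T0" if "c \<in> C" for c
    unfolding T0_def using C(1) that by (intro member_le_sum) auto
  have T00: "T0 \<ge> 0" by (simp add: T0_def sum_nonneg)
  have "\<exists>s\<in>{t..t + (2 * T0 + 1)}. \<exists>k. norm (s *\<^sub>R \<omega> - (2 * pi) *\<^sub>R int_vec k) < \<delta>" for t
  proof -
    obtain c where c: "c \<in> C" "red (t + T0) \<in> ball c (\<delta> / 2)" using redK C(2) by blast
    then have \<tau>: "red (\<tau> c) \<in> ball c (\<delta> / 2)" unfolding \<tau>_def by (rule_tac someI)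
    define s where "s = t + T0 - \<tau> c"
    have "s *\<^sub>R \<omega> - (2 * pi) *\<^sub>R int_vec (fl (t + T0) - fl (\<tau> c)) = red (t + T0) - red (\<tau> c)"
      by (simp add: s_def red_def int_vec_def vec_eq_iff algebra_simps)
    moreover have "norm (red (t + T0) - red (\<tau> c)) < \<delta>"
      using dist_triangle_half_r[of c "red (t + T0)" \<delta> "red (\<tau> c)"] c(2) \<tau> by (simp add: dist_norm norm_minus_commute)
    ultimately show ?thesis using T0[OF c(1)] T00 by (intro bexI[of _ s]) (metis, auto simp: s_def abs_le_iff)
  qed
  then show ?thesis using T00 by (intro exI[of _ "2 * T0 + 1"]) auto
qed

section \<open>Gap solutions near the separatrix\<close>

lemma tendsto_exp_abs:
  assumes "c > 0"
  shows "((\<lambda>t::real. exp (- c * \<bar>t - \<theta>\<bar>)) \<longlongrightarrow> 0) at_top" "((\<lambda>t::real. exp (- c * \<bar>t - \<theta>\<bar>)) \<longlongrightarrow> 0) at_bot"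
proof -
  have "filterlim (\<lambda>t::real. t - \<theta>) at_top at_top"
    using filterlim_tendsto_add_at_top[OF tendsto_const[of "- \<theta>"] filterlim_ident] by simp
  then have 1: "filterlim (\<lambda>t::real. \<bar>t - \<theta>\<bar>) at_top at_top"
    by (rule filterlim_at_top_mono) (auto intro!: always_eventually)
  have "filterlim (\<lambda>t::real. \<theta> + - t) at_top at_bot"
    by (rule filterlim_tendsto_add_at_top[OF tendsto_const filterlim_uminus_at_top_at_bot])
  then have 2: "filterlim (\<lambda>t::real. \<bar>t - \<theta>\<bar>) at_top at_bot"
    by (rule filterlim_at_top_mono) (auto intro!: always_eventually)
  have *: "((\<lambda>t. exp (- c * \<bar>t - \<theta>\<bar>)) \<longlongrightarrow> 0) F" if "filterlim (\<lambda>t::real. \<bar>t - \<theta>\<bar>) at_top F" for F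
  proof -
    have "filterlim (\<lambda>t. c * \<bar>t - \<theta>\<bar>) at_top F" by (rule filterlim_tendsto_pos_mult_at_top[OF tendsto_const assms that])
    then have "filterlim (\<lambda>t. - c * \<bar>t - \<theta>\<bar>) at_bot F" by (simp add: filterlim_uminus_at_top)
    from filterlim_compose[OF exp_at_bot this] show ?thesis .
  qed
  show "((\<lambda>t::real. exp (- c * \<bar>t - \<theta>\<bar>)) \<longlongrightarrow> 0) at_top" "((\<lambda>t::real. exp (- c * \<bar>t - \<theta>\<bar>)) \<longlongrightarrow> 0) at_bot"
    by (rule *[OF 1], rule *[OF 2])
qed

text \<open>
  At an infinite end the antiderivative tends to zero, so only finite ends contribute.
\<close>

lemma line_interval_FTC:
  fixes e \<phi> :: "real \<Rightarrow> real"
  assumes T: "line_interval T" and e: "\<And>t. t \<in> T \<Longrightarrow> (e has_real_derivative \<phi> t) (at t within T)"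
    and small: "\<And>t. t \<in> T \<Longrightarrow> \<bar>e t\<bar> \<le> C * exp (- c * \<bar>t - \<theta>\<bar>)" and c: "c > 0" and int: "set_integrable lborel T \<phi>"
  shows "(LINT t:T|lborel. \<phi> t) = (if bdd_above T then e (Sup T) else 0) - (if bdd_below T then e (Inf T) else 0)"
proof -
  have fin: "(LINT t:{a..b}|lborel. \<phi> t) = e b - e a" if "a \<le> b" "{a..b} \<subseteq> T" for a b
  proof -
    have "set_integrable lborel {a..b} \<phi>" using int that by (rule_tac set_integrable_subset) auto
    then have "(LINT t:{a..b}|lborel. \<phi> t) = integral {a..b} \<phi>" by (rule set_borel_integral_eq_integral)
    also have "\<dots> = e b - e a"
      by (intro integral_unique fundamental_theorem_of_calculus that(1))
         (use that in \<open>auto simp: has_real_derivative_iff_has_vector_derivative[symmetric] intro!: DERIV_subset[OF e]\<close>)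
    finally show ?thesis .
  qed
  have C: "((\<lambda>t. C * exp (- c * \<bar>t - \<theta>\<bar>)) \<longlongrightarrow> 0) at_top" "((\<lambda>t. C * exp (- c * \<bar>t - \<theta>\<bar>)) \<longlongrightarrow> 0) at_bot"
    using tendsto_mult[OF tendsto_const[of C] tendsto_exp_abs(1)[OF c, of \<theta>]]
      tendsto_mult[OF tendsto_const[of C] tendsto_exp_abs(2)[OF c, of \<theta>]] by simp_all
  show ?thesis using T
  proof (cases rule: line_interval_cases)
    case (interval a b)
    then show ?thesis using fin[of a b] by simp
  next
    case (above a)
    have lim: "((\<lambda>b. LINT t:{a..b}|lborel. \<phi> t) \<longlongrightarrow> (LINT t:{a..}|lborel. \<phi> t)) at_top"
      by (rule tendsto_set_lebesgue_integral_at_top) (use int above in auto)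
    have "\<forall>\<^sub>F b in at_top. (LINT t:{a..b}|lborel. \<phi> t) = e b - e a"
      using eventually_ge_at_top[of a] by eventually_elim (use fin above in auto)
    with lim have "((\<lambda>b. e b - e a) \<longlongrightarrow> (LINT t:{a..}|lborel. \<phi> t)) at_top" by (simp cong: tendsto_cong)
    moreover have "(e \<longlongrightarrow> 0) at_top"
    proof (rule Lim_null_comparison[OF _ C(1)])
      show "\<forall>\<^sub>F t in at_top. norm (e t) \<le> C * exp (- c * \<bar>t - \<theta>\<bar>)"
        using eventually_ge_at_top[of a] by eventually_elim (use small above in auto)
    qed
    then have "((\<lambda>b. e b - e a) \<longlongrightarrow> 0 - e a) at_top" by (intro tendsto_intros)
    ultimately have "(LINT t:{a..}|lborel. \<phi> t) = 0 - e a" using tendsto_unique by force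
    then show ?thesis using above by simp
  next
    case (below b)
    have lim: "((\<lambda>a. LINT t:{a..b}|lborel. \<phi> t) \<longlongrightarrow> (LINT t:{..b}|lborel. \<phi> t)) at_bot"
      by (rule tendsto_set_lebesgue_integral_at_bot) (use int below in auto)
    have "\<forall>\<^sub>F a in at_bot. (LINT t:{a..b}|lborel. \<phi> t) = e b - e a"
      using eventually_le_at_bot[of b] by eventually_elim (use fin below in auto)
    with lim have "((\<lambda>a. e b - e a) \<longlongrightarrow> (LINT t:{..b}|lborel. \<phi> t)) at_bot" by (simp cong: tendsto_cong)
    moreover have "(e \<longlongrightarrow> 0) at_bot"
    proof (rule Lim_null_comparison[OF _ C(2)])
      show "\<forall>\<^sub>F t in at_bot. norm (e t) \<le> C * exp (- c * \<bar>t - \<theta>\<bar>)"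
        using eventually_le_at_bot[of b] by eventually_elim (use small below in auto)
    qed
    then have "((\<lambda>a. e b - e a) \<longlongrightarrow> e b - 0) at_bot" by (intro tendsto_intros)
    ultimately have "(LINT t:{..b}|lborel. \<phi> t) = e b - 0" using tendsto_unique by force
    then show ?thesis using below by simp
  qed
qed

lemma gap_sol_zero: "gap_sol g S 0 0 (\<lambda>_. 0) (\<lambda>_. 0)"
  unfolding gap_sol_def by (auto simp: clip_def intro!: exI[of _ 0] derivative_eq_intros)

lemma neg_fifth_mono: "a \<le> b \<Longrightarrow> - (1 / 5) * b \<le> - a / 5" for a b :: real by simp

text \<open>
  In the half of a gap that is nearer to its left end the influence of the far datum is at most \<open>exp (-l / 5)\<close>, where \<open>l\<close> is a lower bound
  for the distance to the far end. Comparing with an unperturbed solution whose near datum is close by gives the first two bounds,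
  comparing with the zero solution gives the decay.
\<close>

lemma half_gap_right:
  assumes S: "line_interval S" "bdd_below S" and X: "gap_sol g S va ub x p" and Y: "gap_sol (\<lambda>_. 1) S va' ub' x' p'"
    and g: "\<And>t. t \<in> S \<Longrightarrow> \<bar>g t - 1\<bar> \<le> \<epsilon>" "\<epsilon> \<le> 1 / 100"
    and b: "\<bar>va\<bar> \<le> 5" "\<bar>ub\<bar> \<le> 5" "\<bar>ub'\<bar> \<le> 5" "\<bar>va - va'\<bar> \<le> D"
    and t: "t \<in> S" "bdd_above S \<longrightarrow> l \<le> Sup S - t" "bdd_above S \<longrightarrow> t - Inf S \<le> Sup S - t"
  shows "\<bar>x t - x' t\<bar> \<le> 3 * D + 23 * exp (- l / 5) + 41 * \<epsilon>" "\<bar>p t - p' t\<bar> \<le> 3 * D + 23 * exp (- l / 5) + 41 * \<epsilon>"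
    "\<bar>x t\<bar> \<le> 23 * exp (- (t - Inf S) / 5)" "\<bar>p t\<bar> \<le> 23 * exp (- (t - Inf S) / 5)"
proof -
  have g1: "\<bar>g t - 1\<bar> \<le> 1 / 100" if "t \<in> S" for t using g(1)[OF that] g(2) by linarith
  define lw rw where "lw = left_weight (1/5) S t" and "rw = right_weight (1/5) S t"
  have st: "\<bar>x t - x' t\<bar> \<le> \<bar>va - va'\<bar> * lw + \<bar>ub - ub'\<bar> * rw + 20 * \<epsilon>"
    "\<bar>p t - p' t\<bar> \<le> 9 / 4 * (\<bar>va - va'\<bar> * lw + \<bar>ub - ub'\<bar> * rw) + 41 * \<epsilon>"
    unfolding lw_def rw_def by (rule gap_sol_stable[OF S(1) X Y g1 g(1) t(1)]; assumption)+
  have sz: "\<bar>x t - 0\<bar> \<le> \<bar>va - 0\<bar> * lw + \<bar>ub - 0\<bar> * rw + 20 * 0"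
    "\<bar>p t - 0\<bar> \<le> 9 / 4 * (\<bar>va - 0\<bar> * lw + \<bar>ub - 0\<bar> * rw) + 41 * 0"
    unfolding lw_def rw_def by (rule gap_sol_stable[OF S(1) X gap_sol_zero[of g] g1 _ t(1)]; simp)+
  have w: "0 \<le> lw" "lw \<le> 1" "0 \<le> rw" "rw \<le> 1" using weight_bounds[OF S(1) t(1), of "1/5"] by (auto simp: lw_def rw_def)
  have "- (1 / 5) * (t - Inf S) = - (t - Inf S) / 5" by linarith
  then have lw: "lw = exp (- (t - Inf S) / 5)" using S(2) unfolding lw_def left_weight_def by (simp only: if_True)
  have rwE: "rw \<le> exp (- l / 5)" using t(2) by (auto simp: rw_def right_weight_def)
  have rwl: "rw \<le> lw"
  proof (cases "bdd_above S")
    case True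
    have "- (1 / 5) * (Sup S - t) \<le> - (t - Inf S) / 5" by (rule neg_fifth_mono[OF t(3)[rule_format, OF True]])
    then show ?thesis by (simp only: rw_def right_weight_def True if_True lw exp_le_cancel_iff)
  qed (use w in \<open>simp add: rw_def right_weight_def\<close>)
  have \<epsilon>0: "\<epsilon> \<ge> 0" using g(1)[OF t(1)] by linarith
  have D0: "D \<ge> 0" using b(4) by linarith
  have 1: "\<bar>va - va'\<bar> * lw \<le> D * 1" using b(4) w by (intro mult_mono) auto
  have 2: "\<bar>ub - ub'\<bar> * rw \<le> 10 * exp (- l / 5)" using b rwE w by (intro mult_mono) auto
  have e0: "exp (- l / 5) > 0" by simp
  show "\<bar>x t - x' t\<bar> \<le> 3 * D + 23 * exp (- l / 5) + 41 * \<epsilon>"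
    using st(1) 1 2 \<epsilon>0 e0 D0 by linarith
  have lin: "z \<le> 3 * D + 23 * E + 41 * \<epsilon>" if "z \<le> 9 / 4 * (a + b) + 41 * \<epsilon>" "a + b \<le> D + 10 * E" "E > 0" for z a b E
    using that D0 by argo
  show "\<bar>p t - p' t\<bar> \<le> 3 * D + 23 * exp (- l / 5) + 41 * \<epsilon>"
    by (rule lin[OF st(2) _ e0]) (use add_mono[OF 1 2] in simp)
  have 3: "\<bar>va\<bar> * lw \<le> 5 * lw" using b w by (intro mult_right_mono) auto
  have 4: "\<bar>ub\<bar> * rw \<le> 5 * lw" using b rwl w by (intro mult_mono) auto
  show "\<bar>x t\<bar> \<le> 23 * exp (- (t - Inf S) / 5)"
    using sz(1) 3 4 w unfolding lw[symmetric] by simp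
  show "\<bar>p t\<bar> \<le> 23 * exp (- (t - Inf S) / 5)"
    using sz(2) 3 4 w unfolding lw[symmetric] by simp
qed

text \<open>
  The mirror image of the preceding estimate, for the half of the gap next to its right end.
\<close>

lemma half_gap_left:
  assumes S: "line_interval S" "bdd_above S" and X: "gap_sol g S va ub x p" and Y: "gap_sol (\<lambda>_. 1) S va' ub' x' p'"
    and g: "\<And>t. t \<in> S \<Longrightarrow> \<bar>g t - 1\<bar> \<le> \<epsilon>" "\<epsilon> \<le> 1 / 100"
    and b: "\<bar>va\<bar> \<le> 5" "\<bar>ub\<bar> \<le> 5" "\<bar>va'\<bar> \<le> 5" "\<bar>ub - ub'\<bar> \<le> D"
    and t: "t \<in> S" "bdd_below S \<longrightarrow> l \<le> t - Inf S" "bdd_below S \<longrightarrow> Sup S - t \<le> t - Inf S"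
  shows "\<bar>x t - x' t\<bar> \<le> 3 * D + 23 * exp (- l / 5) + 41 * \<epsilon>" "\<bar>p t - p' t\<bar> \<le> 3 * D + 23 * exp (- l / 5) + 41 * \<epsilon>"
    "\<bar>x t\<bar> \<le> 23 * exp (- (Sup S - t) / 5)" "\<bar>p t\<bar> \<le> 23 * exp (- (Sup S - t) / 5)"
proof -
  have g1: "\<bar>g t - 1\<bar> \<le> 1 / 100" if "t \<in> S" for t using g(1)[OF that] g(2) by linarith
  define lw rw where "lw = left_weight (1/5) S t" and "rw = right_weight (1/5) S t"
  have st: "\<bar>x t - x' t\<bar> \<le> \<bar>va - va'\<bar> * lw + \<bar>ub - ub'\<bar> * rw + 20 * \<epsilon>"
    "\<bar>p t - p' t\<bar> \<le> 9 / 4 * (\<bar>va - va'\<bar> * lw + \<bar>ub - ub'\<bar> * rw) + 41 * \<epsilon>"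
    unfolding lw_def rw_def by (rule gap_sol_stable[OF S(1) X Y g1 g(1) t(1)]; assumption)+
  have sz: "\<bar>x t - 0\<bar> \<le> \<bar>va - 0\<bar> * lw + \<bar>ub - 0\<bar> * rw + 20 * 0"
    "\<bar>p t - 0\<bar> \<le> 9 / 4 * (\<bar>va - 0\<bar> * lw + \<bar>ub - 0\<bar> * rw) + 41 * 0"
    unfolding lw_def rw_def by (rule gap_sol_stable[OF S(1) X gap_sol_zero[of g] g1 _ t(1)]; simp)+
  have w: "0 \<le> lw" "lw \<le> 1" "0 \<le> rw" "rw \<le> 1" using weight_bounds[OF S(1) t(1), of "1/5"] by (auto simp: lw_def rw_def)
  have "- (1 / 5) * (Sup S - t) = - (Sup S - t) / 5" by linarith
  then have rw: "rw = exp (- (Sup S - t) / 5)" using S(2) unfolding rw_def right_weight_def by (simp only: if_True)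
  have lwE: "lw \<le> exp (- l / 5)" using t(2) by (auto simp: lw_def left_weight_def)
  have lwr: "lw \<le> rw"
  proof (cases "bdd_below S")
    case True
    have "- (1 / 5) * (t - Inf S) \<le> - (Sup S - t) / 5" by (rule neg_fifth_mono[OF t(3)[rule_format, OF True]])
    then show ?thesis by (simp only: lw_def left_weight_def True if_True rw exp_le_cancel_iff)
  qed (use w in \<open>simp add: lw_def left_weight_def\<close>)
  have \<epsilon>0: "\<epsilon> \<ge> 0" using g(1)[OF t(1)] by linarith
  have D0: "D \<ge> 0" using b(4) by linarith
  have 1: "\<bar>ub - ub'\<bar> * rw \<le> D * 1" using b(4) w by (intro mult_mono) auto
  have 2: "\<bar>va - va'\<bar> * lw \<le> 10 * exp (- l / 5)" using b lwE w by (intro mult_mono) auto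
  have e0: "exp (- l / 5) > 0" by simp
  show "\<bar>x t - x' t\<bar> \<le> 3 * D + 23 * exp (- l / 5) + 41 * \<epsilon>"
    using st(1) 1 2 \<epsilon>0 e0 D0 by linarith
  have lin: "z \<le> 3 * D + 23 * E + 41 * \<epsilon>" if "z \<le> 9 / 4 * (a + b) + 41 * \<epsilon>" "a + b \<le> D + 10 * E" "E > 0" for z a b E
    using that D0 by argo
  show "\<bar>p t - p' t\<bar> \<le> 3 * D + 23 * exp (- l / 5) + 41 * \<epsilon>"
    by (rule lin[OF st(2) _ e0]) (use add_mono[OF 2 1] in simp)
  have 3: "\<bar>ub\<bar> * rw \<le> 5 * rw" using b w by (intro mult_right_mono) auto
  have 4: "\<bar>va\<bar> * lw \<le> 5 * rw" using b lwr w by (intro mult_mono) auto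
  show "\<bar>x t\<bar> \<le> 23 * exp (- (Sup S - t) / 5)"
    using sz(1) 3 4 w unfolding rw[symmetric] by simp
  show "\<bar>p t\<bar> \<le> 23 * exp (- (Sup S - t) / 5)"
    using sz(2) 3 4 w unfolding rw[symmetric] by simp
qed

text \<open>
  After a crossing the shifted separatrix, measured from the equilibrium \<open>2 * pi\<close> that it approaches, is
  itself a gap solution of the unperturbed equation for its own boundary values.
\<close>

lemma shifted_separatrix_gap_sol_right:
  assumes S: "line_interval S" "bdd_below S" "Inf S = \<theta> + 1" and s: "\<bar>s\<bar> \<le> 1 / 100"
  defines "x \<equiv> \<lambda>t. separatrix (t - \<theta> - s) - 2 * pi" and "p \<equiv> \<lambda>t. separatrix_velocity (t - \<theta> - s)"
  shows "gap_sol (\<lambda>_. 1) S (x (Inf S) - p (Inf S)) (x (Sup S) + p (Sup S)) x p"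
    "\<And>t. t \<in> S \<Longrightarrow> \<bar>x t\<bar> \<le> 299 / 200" "\<bar>x (Sup S) + p (Sup S)\<bar> \<le> 5 \<or> \<not> bdd_above S"
proof -
  have xb: "\<bar>x t\<bar> \<le> 299 / 200" if "t \<in> S" for t
  proof -
    have "\<theta> + 1 \<le> t" using Inf_Sup_line_interval(3)[OF S(1,2) that] S(3) by simp
    then have "4 * exp (- (t - \<theta> - s)) \<le> 299 / 200" using s by (intro separatrix_tail_small) auto
    then show ?thesis using separatrix_bounds(3,4)[of "t - \<theta> - s"] unfolding x_def by linarith
  qed
  then show "\<And>t. t \<in> S \<Longrightarrow> \<bar>x t\<bar> \<le> 299 / 200" .
  have pb: "\<bar>p t\<bar> \<le> 2" for t using separatrix_velocity_bounds[of "t - \<theta> - s"] by (simp add: p_def)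
  show "gap_sol (\<lambda>_. 1) S (x (Inf S) - p (Inf S)) (x (Sup S) + p (Sup S)) x p"
    unfolding gap_sol_def
  proof (intro conjI ballI)
    fix t assume t: "t \<in> S"
    show "(x has_real_derivative p t) (at t within S)"
      unfolding x_def p_def by (auto intro!: derivative_eq_intros)
    have "sin (x t) = sin (separatrix (t - \<theta> - s))" by (simp add: x_def sin_diff)
    moreover have "clip (x t) = x t" using xb[OF t] by (intro clip_id) simp
    ultimately show "(p has_real_derivative 1 * sin (clip (x t)) + (x t - clip (x t))) (at t within S)"
      unfolding p_def by (auto intro!: derivative_eq_intros)
  next
    show "\<exists>B. \<forall>t\<in>S. \<bar>x t\<bar> \<le> B \<and> \<bar>p t\<bar> \<le> B"
    proof (intro exI ballI conjI)
      fix t assume "t \<in> S" show "\<bar>x t\<bar> \<le> 2" using xb[OF \<open>t \<in> S\<close>] by simp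
    qed (rule pb)
  qed auto
  show "\<bar>x (Sup S) + p (Sup S)\<bar> \<le> 5 \<or> \<not> bdd_above S"
    using xb[OF Inf_Sup_line_interval(2)[OF S(1)]] pb[of "Sup S"] by (auto simp: abs_le_iff)
qed

text \<open>
  The same before the crossing, where the separatrix leaves the equilibrium 0.
\<close>

lemma shifted_separatrix_gap_sol_left:
  assumes S: "line_interval S" "bdd_above S" "Sup S = \<theta> - 1" and s: "\<bar>s\<bar> \<le> 1 / 100"
  defines "x \<equiv> \<lambda>t. separatrix (t - \<theta> - s)" and "p \<equiv> \<lambda>t. separatrix_velocity (t - \<theta> - s)"
  shows "gap_sol (\<lambda>_. 1) S (x (Inf S) - p (Inf S)) (x (Sup S) + p (Sup S)) x p"
    "\<And>t. t \<in> S \<Longrightarrow> \<bar>x t\<bar> \<le> 299 / 200" "\<bar>x (Inf S) - p (Inf S)\<bar> \<le> 5 \<or> \<not> bdd_below S"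
proof -
  have xb: "\<bar>x t\<bar> \<le> 299 / 200" if "t \<in> S" for t
  proof -
    have "t \<le> \<theta> - 1" using Inf_Sup_line_interval(4)[OF S(1,2) that] S(3) by simp
    then have "4 * exp (- (- (t - \<theta> - s))) \<le> 299 / 200" using s by (intro separatrix_tail_small) auto
    then show ?thesis using separatrix_bounds(1,2)[of "t - \<theta> - s"] unfolding x_def by simp
  qed
  then show "\<And>t. t \<in> S \<Longrightarrow> \<bar>x t\<bar> \<le> 299 / 200" .
  have pb: "\<bar>p t\<bar> \<le> 2" for t using separatrix_velocity_bounds[of "t - \<theta> - s"] by (simp add: p_def)
  show "gap_sol (\<lambda>_. 1) S (x (Inf S) - p (Inf S)) (x (Sup S) + p (Sup S)) x p"
    unfolding gap_sol_def
  proof (intro conjI ballI)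
    fix t assume t: "t \<in> S"
    show "(x has_real_derivative p t) (at t within S)"
      unfolding x_def p_def by (auto intro!: derivative_eq_intros)
    have "clip (x t) = x t" using xb[OF t] by (intro clip_id) simp
    then show "(p has_real_derivative 1 * sin (clip (x t)) + (x t - clip (x t))) (at t within S)"
      unfolding p_def by (auto simp: x_def intro!: derivative_eq_intros)
  next
    show "\<exists>B. \<forall>t\<in>S. \<bar>x t\<bar> \<le> B \<and> \<bar>p t\<bar> \<le> B"
    proof (intro exI ballI conjI)
      fix t assume "t \<in> S" show "\<bar>x t\<bar> \<le> 2" using xb[OF \<open>t \<in> S\<close>] by simp
    qed (rule pb)
  qed auto
  show "\<bar>x (Inf S) - p (Inf S)\<bar> \<le> 5 \<or> \<not> bdd_below S"
    using xb[OF Inf_Sup_line_interval(1)[OF S(1)]] pb[of "Inf S"] by (auto simp: abs_le_iff)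
qed

lemma shifted_separatrix_win_sol:
  "win_sol (\<lambda>_. 1) \<theta> (separatrix (- s)) (separatrix_velocity (- s)) (\<lambda>t. separatrix (t - \<theta> - s)) (\<lambda>t. separatrix_velocity (t - \<theta> - s))"
  unfolding win_sol_def by (auto intro!: derivative_eq_intros)

section \<open>The perturbed pendulum at a single crossing\<close>

text \<open>
  Along an orbit \<open>\<phi> = t *\<^sub>R \<omega> + A\<close>, so the angles and momenta can be eliminated: what remains is the equation
  \<open>q'' = coef \<mu> A t * sin q\<close> of a pendulum forced quasi-periodically, and the momentum grows at the rate
  \<open>\<mu> *\<^sub>R kick A q t\<close>.
\<close>

locale pendulum =
  fixes f :: "real ^ 'n::finite \<Rightarrow> real" and \<omega> :: "real ^ 'n" and F :: real
  assumes diff: "\<And>x. f differentiable (at x)" and f_le: "\<And>x. \<bar>f x\<bar> \<le> F" and grad_le: "\<And>x. norm (grad f x) \<le> F"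
    and grad_lip: "\<And>x y. norm (grad f x - grad f y) \<le> F * norm (x - y)" and F1: "F \<ge> 1"
    and periodic: "torus_periodic f"
begin

definition coef :: "real \<Rightarrow> real ^ 'n \<Rightarrow> real \<Rightarrow> real" where
  "coef \<mu> A t = 1 - \<mu> * f (t *\<^sub>R \<omega> + A)"

definition energy :: "real \<Rightarrow> real ^ 'n \<Rightarrow> real \<Rightarrow> real \<Rightarrow> real \<Rightarrow> real" where
  "energy \<mu> A t x p = p\<^sup>2 / 2 - (1 - cos x) * coef \<mu> A t"

definition kick :: "real ^ 'n \<Rightarrow> (real \<Rightarrow> real) \<Rightarrow> real \<Rightarrow> real ^ 'n" where
  "kick A x t = (cos (x t) - 1) *\<^sub>R grad f (t *\<^sub>R \<omega> + A)"

lemma continuous_f: "continuous_on UNIV f"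
  using diff by (intro differentiable_imp_continuous_on) (auto simp: differentiable_on_def differentiable_at_withinI)

lemma continuous_grad: "continuous_on UNIV (grad f)"
  by (rule continuous_on_grad[OF grad_lip]) (use F1 in auto)

lemma f_lip: "\<bar>f x - f y\<bar> \<le> F * norm (x - y)"
  by (rule grad_bound_imp_lipschitz[OF diff grad_le])

lemma coef_bound: "\<mu> > 0 \<Longrightarrow> \<bar>coef \<mu> A t - 1\<bar> \<le> \<mu> * F"
  using f_le by (simp add: coef_def abs_mult)

lemma continuous_coef: "continuous_on UNIV (coef \<mu> A)"
  unfolding coef_def[abs_def] by (intro continuous_intros continuous_on_compose2[OF continuous_f]) auto

lemma coef_lip: "\<mu> > 0 \<Longrightarrow> \<bar>coef \<mu> A t - coef \<mu> B t\<bar> \<le> \<mu> * F * norm (A - B)"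
proof -
  assume \<mu>: "\<mu> > 0"
  have "coef \<mu> A t - coef \<mu> B t = \<mu> * (f (t *\<^sub>R \<omega> + B) - f (t *\<^sub>R \<omega> + A))"
    by (simp add: coef_def right_diff_distrib)
  then have "\<bar>coef \<mu> A t - coef \<mu> B t\<bar> = \<mu> * \<bar>f (t *\<^sub>R \<omega> + B) - f (t *\<^sub>R \<omega> + A)\<bar>"
    using \<mu> by (simp add: abs_mult)
  also have "\<dots> \<le> \<mu> * (F * norm (t *\<^sub>R \<omega> + B - (t *\<^sub>R \<omega> + A)))" 
    using \<mu> f_lip[of "t *\<^sub>R \<omega> + B" "t *\<^sub>R \<omega> + A"] by (intro mult_left_mono) auto
  also have "\<dots> = \<mu> * F * norm (A - B)" by (simp add: norm_minus_commute)
  finally show ?thesis .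
qed

text \<open>
  The total Hamiltonian is conserved, so the pendulum energy can only change at the expense of \<open>\<omega> \<bullet> I\<close>. This identity links energy
  mismatches to momentum transfer and makes one of the matching equations redundant.
\<close>

lemma energy_deriv:
  assumes x: "(x has_real_derivative p t) (at t within T)"
    and p: "(p has_real_derivative coef \<mu> A t * sin (x t)) (at t within T)"
  shows "((\<lambda>t. energy \<mu> A t (x t) (p t)) has_real_derivative - \<mu> * (\<omega> \<bullet> kick A x t)) (at t within T)"
proof -
  have "((\<lambda>t. f (t *\<^sub>R \<omega> + A)) has_derivative (\<lambda>h. grad f (t *\<^sub>R \<omega> + A) \<bullet> (h *\<^sub>R \<omega>))) (at t within T)"
    by (rule has_derivative_compose[of "\<lambda>t. t *\<^sub>R \<omega> + A" "\<lambda>h. h *\<^sub>R \<omega>" t T f, OF _ has_derivative_grad[OF diff]])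
       (auto intro!: derivative_eq_intros)
  moreover have "(\<lambda>h. grad f (t *\<^sub>R \<omega> + A) \<bullet> (h *\<^sub>R \<omega>)) = (*) (\<omega> \<bullet> grad f (t *\<^sub>R \<omega> + A))"
    by (auto simp: inner_commute mult.commute)
  ultimately have f': "((\<lambda>t. f (t *\<^sub>R \<omega> + A)) has_real_derivative \<omega> \<bullet> grad f (t *\<^sub>R \<omega> + A)) (at t within T)"
    unfolding has_field_derivative_def by simp
  have P: "((\<lambda>t. (p t)\<^sup>2 / 2) has_real_derivative p t * (coef \<mu> A t * sin (x t))) (at t within T)"
    by (auto intro!: derivative_eq_intros p)
  have C: "((\<lambda>t. 1 - cos (x t)) has_real_derivative sin (x t) * p t) (at t within T)"
    by (auto intro!: derivative_eq_intros x)
  have K: "((\<lambda>t. coef \<mu> A t) has_real_derivative - (\<mu> * (\<omega> \<bullet> grad f (t *\<^sub>R \<omega> + A)))) (at t within T)"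
    unfolding coef_def by (auto intro!: derivative_eq_intros f')
  have "((\<lambda>t. energy \<mu> A t (x t) (p t)) has_real_derivative p t * (coef \<mu> A t * sin (x t)) -
      (sin (x t) * p t * coef \<mu> A t + - (\<mu> * (\<omega> \<bullet> grad f (t *\<^sub>R \<omega> + A))) * (1 - cos (x t)))) (at t within T)"
    unfolding energy_def by (rule DERIV_diff[OF P DERIV_mult[OF C K]])
  then show ?thesis by (simp add: kick_def algebra_simps)
qed

lemma kick_norm: "norm (kick A x t) \<le> F * \<bar>1 - cos (x t)\<bar>"
proof -
  have "norm (kick A x t) = \<bar>1 - cos (x t)\<bar> * norm (grad f (t *\<^sub>R \<omega> + A))"
    by (simp only: kick_def norm_scaleR abs_minus_commute)
  also have "\<dots> \<le> \<bar>1 - cos (x t)\<bar> * F" by (intro mult_left_mono grad_le) simp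
  finally show ?thesis by (simp only: mult.commute)
qed

lemma continuous_kick: "continuous_on T x \<Longrightarrow> continuous_on T (kick A x)"
  unfolding kick_def[abs_def] by (intro continuous_intros continuous_on_compose2[OF continuous_grad]) auto

end

context pendulum begin

text \<open>
  The data at the centre of the window are those of the separatrix shifted by \<open>s\<close>, with the velocity corrected by
  \<open>c0 * \<mu> * e\<close>. The parameter \<open>e\<close> tunes the energy of the crossing, the parameter \<open>s\<close> its time.
\<close>

lemma window_close:
  assumes \<mu>: "\<mu> > 0" "\<mu> * F \<le> 1 / 100" and c0: "c0 \<ge> 0" and e: "\<bar>e\<bar> \<le> 1"
    and W: "win_sol (coef \<mu> A) \<theta> (separatrix (- s)) (separatrix_velocity (- s) + c0 * \<mu> * e) y q"
    and t: "t \<in> {\<theta>-1..\<theta>+1}"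
  shows "\<bar>y t - separatrix (t - \<theta> - s)\<bar> \<le> 5 * (c0 + F) * \<mu>"
    "\<bar>q t - separatrix_velocity (t - \<theta> - s)\<bar> \<le> 5 * (c0 + F) * \<mu>"
proof -
  have c: "\<bar>coef \<mu> A t - 1\<bar> \<le> \<mu> * F" for t by (rule coef_bound[OF \<mu>(1)])
  have c': "\<bar>coef \<mu> A t - 1\<bar> \<le> 1 / 100" for t using c[of t] \<mu>(2) by linarith
  have d: "\<bar>separatrix_velocity (- s) + c0 * \<mu> * e - separatrix_velocity (- s)\<bar> \<le> c0 * \<mu>"
    using e c0 \<mu>(1) mult_left_mono[OF e, of "c0 * \<mu>"] by (simp add: abs_mult)
  have p: "c0 * \<mu> \<ge> 0" "F * \<mu> \<ge> 0" using c0 \<mu> F1 by auto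
  note st = win_sol_stable[OF W shifted_separatrix_win_sol[of \<theta> s] c' c t]
  show "\<bar>y t - separatrix (t - \<theta> - s)\<bar> \<le> 5 * (c0 + F) * \<mu>"
    using st(1) d p by (simp add: algebra_simps)
  show "\<bar>q t - separatrix_velocity (t - \<theta> - s)\<bar> \<le> 5 * (c0 + F) * \<mu>"
    using st(2) d p by (simp add: algebra_simps)
qed

lemma window_data_bound:
  assumes \<mu>: "\<mu> > 0" "\<mu> * F \<le> 1 / 100" "(c0 + F) * \<mu> \<le> 1 / 20" and c0: "c0 \<ge> 0" and e: "\<bar>e\<bar> \<le> 1" and s: "\<bar>s\<bar> \<le> 1 / 100"
    and W: "win_sol (coef \<mu> A) \<theta> (separatrix (- s)) (separatrix_velocity (- s) + c0 * \<mu> * e) y q"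
  shows "\<bar>y (\<theta> - 1) + q (\<theta> - 1)\<bar> \<le> 5" "\<bar>(y (\<theta> + 1) - 2 * pi) - q (\<theta> + 1)\<bar> \<le> 5"
proof -
  note w = window_close[OF \<mu>(1,2) c0 e W]
  have b: "4 * exp (- (1 - s)) \<le> 299 / 200" "4 * exp (- (1 + s)) \<le> 299 / 200"
    by (rule separatrix_tail_small; use s in linarith)+
  then have b': "4 * exp (- 1 - s) \<le> 299 / 200" by simp
  have k: "5 * (c0 + F) * \<mu> \<le> 1 / 4" using \<mu>(3) by (simp add: algebra_simps)
  have 1: "\<bar>y (\<theta> - 1) - separatrix (- 1 - s)\<bar> \<le> 1 / 4" "\<bar>q (\<theta> - 1) - separatrix_velocity (- 1 - s)\<bar> \<le> 1 / 4"
    using w[of "\<theta> - 1"] k by simp_all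
  have 2: "\<bar>y (\<theta> + 1) - separatrix (1 - s)\<bar> \<le> 1 / 4" "\<bar>q (\<theta> + 1) - separatrix_velocity (1 - s)\<bar> \<le> 1 / 4"
    using w[of "\<theta> + 1"] k by simp_all
  show "\<bar>y (\<theta> - 1) + q (\<theta> - 1)\<bar> \<le> 5"
    using 1 b' separatrix_bounds(1,2)[of "- 1 - s"] separatrix_velocity_bounds(1,3)[of "- 1 - s"] by linarith
  show "\<bar>(y (\<theta> + 1) - 2 * pi) - q (\<theta> + 1)\<bar> \<le> 5"
    using 2 b(1) separatrix_bounds(3,4)[of "1 - s"] separatrix_velocity_bounds(1,3)[of "1 - s"] by linarith
qed

end

text \<open>
  One crossing near time \<open>\<theta>\<close>: a window solution \<open>(y, q)\<close> around \<open>\<theta>\<close> and the gap solutions \<open>(xl, pl)\<close> and \<open>(xr, pr)\<close> on the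
  intervals \<open>SL\<close> and \<open>SR\<close> before and after it. The gap solutions take one of their data from the window: \<open>x + p\<close> at time
  \<open>\<theta> - 1\<close> and \<open>x - p\<close> at time \<open>\<theta> + 1\<close>. So at each junction one combination of position and velocity already agrees, and one scalar
  mismatch remains. After the crossing, positions are measured from \<open>2 * pi\<close>. The half gaps have length at least \<open>l \<ge> 5 * ln (1 / \<mu>)\<close>,
  which makes the influence of the neighbouring crossings of order \<open>\<mu>\<close>.
\<close>

locale crossing = pendulum f \<omega> F for f :: "real ^ 'n::finite \<Rightarrow> real" and \<omega> F +
  fixes \<mu> :: real and A :: "real ^ 'n" and \<theta> s e c0 l :: real and SL SR :: "real set" and vl ur :: real
    and y q xl pl xr pr :: "real \<Rightarrow> real"
  assumes mu: "0 < \<mu>" "(30 * c0 + 110 * F) * \<mu> \<le> 1 / 200" and c0: "c0 \<ge> 0"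
    and s: "\<bar>s\<bar> \<le> 1 / 100" and e: "\<bar>e\<bar> \<le> 1" and l: "exp (- l / 5) \<le> \<mu>" "l \<ge> 0"
    and SL: "line_interval SL" "bdd_above SL" "Sup SL = \<theta> - 1" "bdd_below SL \<Longrightarrow> 2 * l \<le> \<theta> - 1 - Inf SL"
    and SR: "line_interval SR" "bdd_below SR" "Inf SR = \<theta> + 1" "bdd_above SR \<Longrightarrow> 2 * l \<le> Sup SR - (\<theta> + 1)"
    and W: "win_sol (coef \<mu> A) \<theta> (separatrix (- s)) (separatrix_velocity (- s) + c0 * \<mu> * e) y q"
    and XL: "gap_sol (coef \<mu> A) SL vl (y (\<theta> - 1) + q (\<theta> - 1)) xl pl"
    and XR: "gap_sol (coef \<mu> A) SR ((y (\<theta> + 1) - 2 * pi) - q (\<theta> + 1)) ur xr pr"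
    and vu: "\<bar>vl\<bar> \<le> 5" "\<bar>ur\<bar> \<le> 5"
begin

text \<open>
  The distance of the crossing from the shifted separatrix, in units of \<open>\<mu>\<close>.
\<close>

definition K1 :: real where "K1 = 30 * c0 + 110 * F"

text \<open>
  The halves of the adjacent gaps that belong to this crossing; a half-line is not divided.
\<close>

definition L :: "real set" where "L = (if bdd_below SL then {(Inf SL + \<theta> - 1) / 2..\<theta> - 1} else {..\<theta> - 1})"
definition R :: "real set" where "R = (if bdd_above SR then {\<theta> + 1..(Sup SR + \<theta> + 1) / 2} else {\<theta> + 1..})"

lemma mu_facts: "\<mu> * F \<le> 1 / 22000" "c0 * \<mu> \<le> 1 / 6000" "K1 * \<mu> \<le> 1 / 200" "K1 \<ge> 110" "\<mu> \<le> 1 / 22000" "\<mu> * F \<le> 1 / 100"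
proof -
  have p: "c0 * \<mu> \<ge> 0" "F * \<mu> \<ge> 0" using c0 mu F1 by auto
  have "30 * (c0 * \<mu>) + 110 * (F * \<mu>) \<le> 1 / 200" using mu(2) by (simp add: algebra_simps)
  then show 1: "\<mu> * F \<le> 1 / 22000" and "c0 * \<mu> \<le> 1 / 6000" using p by (simp_all add: mult.commute)
  show "K1 * \<mu> \<le> 1 / 200" using mu(2) by (simp add: K1_def)
  show "K1 \<ge> 110" using c0 F1 by (simp add: K1_def)
  have "\<mu> * 1 \<le> \<mu> * F" using mu F1 by (intro mult_left_mono) auto
  with 1 show "\<mu> \<le> 1 / 22000" by simp
  show "\<mu> * F \<le> 1 / 100" using 1 by simp
qed

lemma coef_near_1: "\<bar>coef \<mu> A t - 1\<bar> \<le> 1 / 100"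
  using coef_bound[OF mu(1), of A t] mu_facts(6) by linarith

lemma window_bounds:
  assumes "t \<in> {\<theta>-1..\<theta>+1}"
  shows "\<bar>y t - separatrix (t - \<theta> - s)\<bar> \<le> K1 * \<mu>" "\<bar>q t - separatrix_velocity (t - \<theta> - s)\<bar> \<le> K1 * \<mu>"
    "\<bar>y t - separatrix (t - \<theta> - s)\<bar> \<le> 5 * (c0 + F) * \<mu>" "\<bar>q t - separatrix_velocity (t - \<theta> - s)\<bar> \<le> 5 * (c0 + F) * \<mu>"
proof -
  note w = window_close[OF mu(1) mu_facts(6) c0 e W assms]
  have "5 * (c0 + F) * \<mu> \<le> K1 * \<mu>" using mu c0 F1 by (intro mult_right_mono) (auto simp: K1_def)
  with w show "\<bar>y t - separatrix (t - \<theta> - s)\<bar> \<le> K1 * \<mu>" "\<bar>q t - separatrix_velocity (t - \<theta> - s)\<bar> \<le> K1 * \<mu>"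
    "\<bar>y t - separatrix (t - \<theta> - s)\<bar> \<le> 5 * (c0 + F) * \<mu>" "\<bar>q t - separatrix_velocity (t - \<theta> - s)\<bar> \<le> 5 * (c0 + F) * \<mu>" by linarith+
qed

lemma window_data: "\<bar>y (\<theta> - 1) + q (\<theta> - 1)\<bar> \<le> 5" "\<bar>(y (\<theta> + 1) - 2 * pi) - q (\<theta> + 1)\<bar> \<le> 5"
proof -
  have "(c0 + F) * \<mu> \<le> 1 / 20" using mu_facts by (simp add: algebra_simps)
  from window_data_bound[OF mu(1) mu_facts(6) this c0 e s W]
  show "\<bar>y (\<theta> - 1) + q (\<theta> - 1)\<bar> \<le> 5" "\<bar>(y (\<theta> + 1) - 2 * pi) - q (\<theta> + 1)\<bar> \<le> 5" by auto
qed

lemma total_error: "3 * (10 * (c0 + F) * \<mu>) + 23 * exp (- l / 5) + 41 * (\<mu> * F) \<le> K1 * \<mu>"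
proof -
  have "23 * \<mu> \<le> 23 * F * \<mu>" using mu F1 by simp
  then have "23 * exp (- l / 5) \<le> 23 * F * \<mu>" using l by linarith
  moreover have "F * \<mu> \<ge> 0" using mu F1 by auto
  ultimately show ?thesis by (simp add: K1_def algebra_simps)
qed

lemma exp_shift: "exp (- (u - 1) / 5) \<le> 5 / 4 * exp (- (1 / 5) * u)" for u :: real
proof -
  have "exp (- (1 / 5) :: real) \<ge> 4 / 5" using exp_ge_add_one_self[of "- (1/5)"] by simp
  then have "exp (1 / 5 :: real) \<le> 5 / 4" by (simp add: exp_minus field_simps)
  then have "exp (- (1 / 5) * u) * exp (1 / 5) \<le> exp (- (1 / 5) * u) * (5 / 4)" by (intro mult_left_mono) auto
  moreover have "exp (- (u - 1) / 5) = exp (- (1 / 5) * u) * exp (1 / 5)" by (simp add: exp_add[symmetric] field_simps)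
  ultimately show ?thesis by simp
qed

text \<open>
  The unperturbed comparison solution is the separatrix shifted by the same \<open>s\<close>. Besides the closeness, the estimate shows that the
  truncation of the force is inactive and that the solution decays at the rate \<open>1/5\<close> away from the crossing.
\<close>

lemma R_facts:
  assumes t: "t \<in> R"
  shows "t \<in> SR" "t \<ge> \<theta> + 1" "\<bar>xr t - (separatrix (t - \<theta> - s) - 2 * pi)\<bar> \<le> K1 * \<mu>"
    "\<bar>pr t - separatrix_velocity (t - \<theta> - s)\<bar> \<le> K1 * \<mu>" "\<bar>xr t\<bar> \<le> 3 / 2"
    "\<bar>xr t\<bar> \<le> 30 * exp (- (1/5) * \<bar>t - \<theta>\<bar>)" "\<bar>pr t\<bar> \<le> 30 * exp (- (1/5) * \<bar>t - \<theta>\<bar>)"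
proof -
  have S: "u \<in> SR \<longleftrightarrow> \<theta> + 1 \<le> u \<and> (bdd_above SR \<longrightarrow> u \<le> Sup SR)" for u
    using SR(1)
  proof (cases rule: line_interval_cases)
    case (interval a b)
    then show ?thesis using SR(3) by simp
  next
    case (above a)
    then show ?thesis using SR(3) by simp
  next
    case (below b)
    then show ?thesis using SR(2) by simp
  qed
  show t2: "t \<ge> \<theta> + 1" using t by (auto simp: R_def split: if_splits)
  have mid: "t \<le> (Sup SR + \<theta> + 1) / 2" if "bdd_above SR" using t that by (simp add: R_def)
  have up: "bdd_above SR \<longrightarrow> t \<le> Sup SR"
  proof
    assume b: "bdd_above SR"
    show "t \<le> Sup SR" using mid[OF b] SR(4)[OF b] l(2) by argo
  qed
  show t1: "t \<in> SR" by (rule iffD2[OF S conjI[OF t2 up]])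
  note tS = t1 t2
  have b: "bdd_above SR \<longrightarrow> l \<le> Sup SR - t" "bdd_above SR \<longrightarrow> t - Inf SR \<le> Sup SR - t"
  proof -
    have "l \<le> Sup SR - t \<and> t - Inf SR \<le> Sup SR - t" if b: "bdd_above SR"
      unfolding SR(3) using mid[OF b] SR(4)[OF b] by argo
    then show "bdd_above SR \<longrightarrow> l \<le> Sup SR - t" "bdd_above SR \<longrightarrow> t - Inf SR \<le> Sup SR - t" by blast+
  qed
  note ref = shifted_separatrix_gap_sol_right[OF SR(1-3) s]
  define ur' where "ur' = separatrix (Sup SR - \<theta> - s) - 2 * pi + separatrix_velocity (Sup SR - \<theta> - s)"
  define ud where "ud = (if bdd_above SR then ur' else 0)"
  have Y: "gap_sol (\<lambda>_. 1) SR (separatrix (Inf SR - \<theta> - s) - 2 * pi - separatrix_velocity (Inf SR - \<theta> - s)) ud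
      (\<lambda>t. separatrix (t - \<theta> - s) - 2 * pi) (\<lambda>t. separatrix_velocity (t - \<theta> - s))"
    using ref(1) unfolding gap_sol_def ud_def ur'_def by simp
  have ud: "\<bar>ud\<bar> \<le> 5" using ref(3) unfolding ud_def ur'_def by auto
  have D: "\<bar>(y (\<theta> + 1) - 2 * pi) - q (\<theta> + 1) - (separatrix (Inf SR - \<theta> - s) - 2 * pi - separatrix_velocity (Inf SR - \<theta> - s))\<bar>
      \<le> 10 * (c0 + F) * \<mu>"
  proof -
    have "(y (\<theta> + 1) - 2 * pi) - q (\<theta> + 1) - (separatrix (Inf SR - \<theta> - s) - 2 * pi - separatrix_velocity (Inf SR - \<theta> - s))
      = (y (\<theta> + 1) - separatrix (\<theta> + 1 - \<theta> - s)) - (q (\<theta> + 1) - separatrix_velocity (\<theta> + 1 - \<theta> - s))"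
      unfolding SR(3) by simp
    also have "\<bar>\<dots>\<bar> \<le> 5 * (c0 + F) * \<mu> + 5 * (c0 + F) * \<mu>"
      by (intro order_trans[OF abs_triangle_ineq4] add_mono window_bounds) auto
    finally show ?thesis by (simp add: algebra_simps)
  qed
  note h = half_gap_right[OF SR(1,2) XR Y coef_bound[OF mu(1)] mu_facts(6) window_data(2) vu(2) ud D tS(1) b]
  show 1: "\<bar>xr t - (separatrix (t - \<theta> - s) - 2 * pi)\<bar> \<le> K1 * \<mu>" using h(1) total_error by linarith
  show "\<bar>pr t - separatrix_velocity (t - \<theta> - s)\<bar> \<le> K1 * \<mu>" using h(2) total_error by linarith
  show "\<bar>xr t\<bar> \<le> 3 / 2" 
  proof -
    have "\<bar>xr t\<bar> \<le> \<bar>xr t - (separatrix (t - \<theta> - s) - 2 * pi)\<bar> + \<bar>separatrix (t - \<theta> - s) - 2 * pi\<bar>" by linarith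
    then show ?thesis using 1 ref(2)[OF tS(1)] mu_facts(3) by linarith
  qed
  have "exp (- (t - Inf SR) / 5) \<le> 5 / 4 * exp (- (1/5) * \<bar>t - \<theta>\<bar>)"
    using exp_shift[of "t - \<theta>"] tS(2) by (simp add: SR(3) algebra_simps)
  then have "23 * exp (- (t - Inf SR) / 5) \<le> 30 * exp (- (1/5) * \<bar>t - \<theta>\<bar>)"
    using exp_gt_zero[of "- (1/5) * \<bar>t - \<theta>\<bar>"] by linarith
  then show "\<bar>xr t\<bar> \<le> 30 * exp (- (1/5) * \<bar>t - \<theta>\<bar>)" "\<bar>pr t\<bar> \<le> 30 * exp (- (1/5) * \<bar>t - \<theta>\<bar>)"
    using h(3,4) by linarith+
qed

lemma L_facts:
  assumes t: "t \<in> L"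
  shows "t \<in> SL" "t \<le> \<theta> - 1" "\<bar>xl t - separatrix (t - \<theta> - s)\<bar> \<le> K1 * \<mu>"
    "\<bar>pl t - separatrix_velocity (t - \<theta> - s)\<bar> \<le> K1 * \<mu>" "\<bar>xl t\<bar> \<le> 3 / 2"
    "\<bar>xl t\<bar> \<le> 30 * exp (- (1/5) * \<bar>t - \<theta>\<bar>)" "\<bar>pl t\<bar> \<le> 30 * exp (- (1/5) * \<bar>t - \<theta>\<bar>)"
proof -
  have S: "u \<in> SL \<longleftrightarrow> u \<le> \<theta> - 1 \<and> (bdd_below SL \<longrightarrow> Inf SL \<le> u)" for u
    using SL(1)
  proof (cases rule: line_interval_cases)
    case (interval a b)
    then show ?thesis using SL(3) by auto
  next
    case (above a)
    then show ?thesis using SL(2) by simp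
  next
    case (below b)
    then show ?thesis using SL(3) by simp
  qed
  show t2: "t \<le> \<theta> - 1" using t by (auto simp: L_def split: if_splits)
  have mid: "(Inf SL + \<theta> - 1) / 2 \<le> t" if "bdd_below SL" using t that by (simp add: L_def)
  have up: "bdd_below SL \<longrightarrow> Inf SL \<le> t"
  proof
    assume b: "bdd_below SL"
    show "Inf SL \<le> t" using mid[OF b] SL(4)[OF b] l(2) by argo
  qed
  show t1: "t \<in> SL" by (rule iffD2[OF S conjI[OF t2 up]])
  note tS = t1 t2
  have b: "bdd_below SL \<longrightarrow> l \<le> t - Inf SL" "bdd_below SL \<longrightarrow> Sup SL - t \<le> t - Inf SL"
  proof -
    have "l \<le> t - Inf SL \<and> Sup SL - t \<le> t - Inf SL" if b: "bdd_below SL"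
      unfolding SL(3) using mid[OF b] SL(4)[OF b] by argo
    then show "bdd_below SL \<longrightarrow> l \<le> t - Inf SL" "bdd_below SL \<longrightarrow> Sup SL - t \<le> t - Inf SL" by blast+
  qed
  note ref = shifted_separatrix_gap_sol_left[OF SL(1-3) s]
  define vl' where "vl' = separatrix (Inf SL - \<theta> - s) - separatrix_velocity (Inf SL - \<theta> - s)"
  define vd where "vd = (if bdd_below SL then vl' else 0)"
  have Y: "gap_sol (\<lambda>_. 1) SL vd (separatrix (Sup SL - \<theta> - s) + separatrix_velocity (Sup SL - \<theta> - s))
      (\<lambda>t. separatrix (t - \<theta> - s)) (\<lambda>t. separatrix_velocity (t - \<theta> - s))"
    using ref(1) unfolding gap_sol_def vd_def vl'_def by simp
  have vd: "\<bar>vd\<bar> \<le> 5" using ref(3) unfolding vd_def vl'_def by auto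
  have D: "\<bar>y (\<theta> - 1) + q (\<theta> - 1) - (separatrix (Sup SL - \<theta> - s) + separatrix_velocity (Sup SL - \<theta> - s))\<bar>
      \<le> 10 * (c0 + F) * \<mu>"
  proof -
    have "y (\<theta> - 1) + q (\<theta> - 1) - (separatrix (Sup SL - \<theta> - s) + separatrix_velocity (Sup SL - \<theta> - s))
      = (y (\<theta> - 1) - separatrix (\<theta> - 1 - \<theta> - s)) + (q (\<theta> - 1) - separatrix_velocity (\<theta> - 1 - \<theta> - s))"
      unfolding SL(3) by simp
    also have "\<bar>\<dots>\<bar> \<le> 5 * (c0 + F) * \<mu> + 5 * (c0 + F) * \<mu>"
      by (intro order_trans[OF abs_triangle_ineq] add_mono window_bounds) auto
    finally show ?thesis by (simp add: algebra_simps)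
  qed
  note h = half_gap_left[OF SL(1,2) XL Y coef_bound[OF mu(1)] mu_facts(6) vu(1) window_data(1) vd D tS(1) b]
  show 1: "\<bar>xl t - separatrix (t - \<theta> - s)\<bar> \<le> K1 * \<mu>" using h(1) total_error by linarith
  show "\<bar>pl t - separatrix_velocity (t - \<theta> - s)\<bar> \<le> K1 * \<mu>" using h(2) total_error by linarith
  show "\<bar>xl t\<bar> \<le> 3 / 2" 
  proof -
    have "\<bar>xl t\<bar> \<le> \<bar>xl t - separatrix (t - \<theta> - s)\<bar> + \<bar>separatrix (t - \<theta> - s)\<bar>" by linarith
    then show ?thesis using 1 ref(2)[OF tS(1)] mu_facts(3) by linarith
  qed
  have "exp (- (Sup SL - t) / 5) \<le> 5 / 4 * exp (- (1/5) * \<bar>t - \<theta>\<bar>)"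
    using exp_shift[of "\<theta> - t"] tS(2) by (simp add: SL(3) algebra_simps)
  then have "23 * exp (- (Sup SL - t) / 5) \<le> 30 * exp (- (1/5) * \<bar>t - \<theta>\<bar>)"
    using exp_gt_zero[of "- (1/5) * \<bar>t - \<theta>\<bar>"] by linarith
  then show "\<bar>xl t\<bar> \<le> 30 * exp (- (1/5) * \<bar>t - \<theta>\<bar>)" "\<bar>pl t\<bar> \<le> 30 * exp (- (1/5) * \<bar>t - \<theta>\<bar>)"
    using h(3,4) by linarith+
qed

lemma theta_in: "\<theta> + 1 \<in> R" "\<theta> - 1 \<in> L" "\<theta> + 1 \<in> SR" "\<theta> - 1 \<in> SL"
proof -
  show "\<theta> + 1 \<in> R" "\<theta> - 1 \<in> L" using SR(4) SL(4) l(2) by (auto simp: R_def L_def)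
  then show "\<theta> + 1 \<in> SR" "\<theta> - 1 \<in> SL" using R_facts(1) L_facts(1) by blast+
qed

lemma R_line: "line_interval R" "R \<subseteq> SR" "bdd_below R" "Inf R = \<theta> + 1" "bdd_above R \<longleftrightarrow> bdd_above SR"
proof -
  have "line_interval R \<and> bdd_below R \<and> Inf R = \<theta> + 1 \<and> (bdd_above R \<longleftrightarrow> bdd_above SR)"
  proof (cases "bdd_above SR")
    case True
    have le: "\<theta> + 1 \<le> (Sup SR + \<theta> + 1) / 2" using SR(4)[OF True] l(2) by argo
    have *: "R = {\<theta> + 1..(Sup SR + \<theta> + 1) / 2}" using True by (simp add: R_def)
    have "line_interval R" using le * unfolding line_interval_def by blast
    then show ?thesis using True le unfolding * by simp
  qed (auto simp: R_def line_interval_def)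
  then show "line_interval R" "bdd_below R" "Inf R = \<theta> + 1" "bdd_above R \<longleftrightarrow> bdd_above SR" by simp_all
  show "R \<subseteq> SR" using R_facts(1) by blast
qed

lemma L_line: "line_interval L" "L \<subseteq> SL" "bdd_above L" "Sup L = \<theta> - 1" "bdd_below L \<longleftrightarrow> bdd_below SL"
proof -
  have "line_interval L \<and> bdd_above L \<and> Sup L = \<theta> - 1 \<and> (bdd_below L \<longleftrightarrow> bdd_below SL)"
  proof (cases "bdd_below SL")
    case True
    have le: "(Inf SL + \<theta> - 1) / 2 \<le> \<theta> - 1" using SL(4)[OF True] l(2) by argo
    have *: "L = {(Inf SL + \<theta> - 1) / 2..\<theta> - 1}" using True by (simp add: L_def)
    have "line_interval L" using le * unfolding line_interval_def by blast
    then show ?thesis using True le unfolding * by simp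
  qed (auto simp: L_def line_interval_def)
  then show "line_interval L" "bdd_above L" "Sup L = \<theta> - 1" "bdd_below L \<longleftrightarrow> bdd_below SL" by simp_all
  show "L \<subseteq> SL" using L_facts(1) by blast
qed

lemma deriv_R:
  assumes "t \<in> R"
  shows "(xr has_real_derivative pr t) (at t within R)" "(pr has_real_derivative coef \<mu> A t * sin (xr t)) (at t within R)"
proof -
  have "clip (xr t) = xr t" by (rule clip_id[OF R_facts(5)[OF assms]])
  then show "(xr has_real_derivative pr t) (at t within R)" "(pr has_real_derivative coef \<mu> A t * sin (xr t)) (at t within R)"
    using gap_sol_deriv[OF XR R_facts(1)[OF assms]] DERIV_subset[OF _ R_line(2)] by fastforce+
qed

lemma deriv_L:
  assumes "t \<in> L"
  shows "(xl has_real_derivative pl t) (at t within L)" "(pl has_real_derivative coef \<mu> A t * sin (xl t)) (at t within L)"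
proof -
  have "clip (xl t) = xl t" by (rule clip_id[OF L_facts(5)[OF assms]])
  then show "(xl has_real_derivative pl t) (at t within L)" "(pl has_real_derivative coef \<mu> A t * sin (xl t)) (at t within L)"
    using gap_sol_deriv[OF XL L_facts(1)[OF assms]] DERIV_subset[OF _ L_line(2)] by fastforce+
qed

lemma deriv_W:
  assumes "t \<in> {\<theta>-1..\<theta>+1}"
  shows "(y has_real_derivative q t) (at t within {\<theta>-1..\<theta>+1})"
    "(q has_real_derivative coef \<mu> A t * sin (y t)) (at t within {\<theta>-1..\<theta>+1})"
  using W assms by (simp_all add: win_sol_def)

text \<open>
  The momentum transfer of the broken orbit during its stay near this crossing. The three time sets overlap only in their end points.
\<close>

definition cell_kick :: "real \<Rightarrow> real ^ 'n" where
  "cell_kick t = indicator L t *\<^sub>R kick A xl t + indicator {\<theta>-1..\<theta>+1} t *\<^sub>R kick A y t + indicator R t *\<^sub>R kick A xr t"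

definition J :: "real ^ 'n" where "J = (LINT t|lborel. cell_kick t)"

lemma square_exp: "(30 * exp (- (1/5) * u))\<^sup>2 \<le> 900 * exp (- (1/5) * u)" if "u \<ge> 0" for u :: real
proof -
  have "exp (- (1/5) * u) * exp (- (1/5) * u) \<le> 1 * exp (- (1/5) * u)" using that by (intro mult_right_mono) auto
  then show ?thesis by (simp add: power2_eq_square)
qed

lemma one_minus_cos_decay:
  assumes "\<bar>x\<bar> \<le> 30 * exp (- (1/5) * \<bar>t - \<theta>\<bar>)" shows "\<bar>1 - cos x\<bar> \<le> 450 * exp (- (1/5) * \<bar>t - \<theta>\<bar>)"
proof -
  have "x\<^sup>2 \<le> (30 * exp (- (1/5) * \<bar>t - \<theta>\<bar>))\<^sup>2" using power_mono[OF assms abs_ge_zero, of 2] by simp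
  also have "\<dots> \<le> 900 * exp (- (1/5) * \<bar>t - \<theta>\<bar>)" by (rule square_exp) simp
  finally show ?thesis using one_minus_cos_bounds[of x] by simp
qed

lemma window_exp: "t \<in> {\<theta>-1..\<theta>+1} \<Longrightarrow> 1 \<le> 2 * exp (- (1/5) * \<bar>t - \<theta>\<bar>)"
proof -
  assume "t \<in> {\<theta>-1..\<theta>+1}"
  then have "\<bar>t - \<theta>\<bar> \<le> 1" by (auto simp: abs_le_iff)
  then have "1 + - (1/5) * \<bar>t - \<theta>\<bar> \<ge> 4 / 5" by simp
  with exp_ge_add_one_self[of "- (1/5) * \<bar>t - \<theta>\<bar>"] show ?thesis by linarith
qed

lemma kick_bounds:
  "t \<in> R \<Longrightarrow> norm (kick A xr t) \<le> 450 * F * exp (- (1/5) * \<bar>t - \<theta>\<bar>)"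
  "t \<in> L \<Longrightarrow> norm (kick A xl t) \<le> 450 * F * exp (- (1/5) * \<bar>t - \<theta>\<bar>)"
  "t \<in> {\<theta>-1..\<theta>+1} \<Longrightarrow> norm (kick A y t) \<le> 450 * F * exp (- (1/5) * \<bar>t - \<theta>\<bar>)"
proof -
  have *: "norm (kick A x t) \<le> 450 * F * exp (- (1/5) * \<bar>t - \<theta>\<bar>)" if "\<bar>1 - cos (x t)\<bar> \<le> 450 * exp (- (1/5) * \<bar>t - \<theta>\<bar>)" for x
    using order_trans[OF kick_norm[of A x t] mult_left_mono[OF that, of F]] F1 by (simp add: mult_ac)
  show "t \<in> R \<Longrightarrow> norm (kick A xr t) \<le> 450 * F * exp (- (1/5) * \<bar>t - \<theta>\<bar>)"
    by (intro * one_minus_cos_decay R_facts)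
  show "t \<in> L \<Longrightarrow> norm (kick A xl t) \<le> 450 * F * exp (- (1/5) * \<bar>t - \<theta>\<bar>)"
    by (intro * one_minus_cos_decay L_facts)
  assume "t \<in> {\<theta>-1..\<theta>+1}"
  from window_exp[OF this] have "\<bar>1 - cos (y t)\<bar> \<le> 450 * exp (- (1/5) * \<bar>t - \<theta>\<bar>)"
    using cos_le_one[of "y t"] cos_ge_minus_one[of "y t"] by linarith
  then show "norm (kick A y t) \<le> 450 * F * exp (- (1/5) * \<bar>t - \<theta>\<bar>)" by (rule *)
qed

lemma set_integrable_kicks:
  "set_integrable lborel R (kick A xr)" "set_integrable lborel L (kick A xl)" "set_integrable lborel {\<theta>-1..\<theta>+1} (kick A y)"
proof -
  have *: "set_integrable lborel T (kick A x)"
    if "closed T" "continuous_on T x" "\<And>t. t \<in> T \<Longrightarrow> norm (kick A x t) \<le> 450 * F * exp (- (1/5) * \<bar>t - \<theta>\<bar>)" for T x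
    unfolding set_integrable_def
  proof (rule Bochner_Integration.integrable_bound)
    show "integrable lborel (\<lambda>t. 450 * F * exp (- (1/5) * \<bar>t - \<theta>\<bar>))" using integrable_exp_abs(1)[of "1/5" \<theta>] by simp
    have "(\<lambda>t. indicator T t *\<^sub>R kick A x t) \<in> borel_measurable borel"
      using that by (intro borel_measurable_continuous_on_indicator continuous_kick) auto
    then show "(\<lambda>t. indicator T t *\<^sub>R kick A x t) \<in> borel_measurable lborel" by simp
    show "AE t in lborel. norm (indicator T t *\<^sub>R kick A x t) \<le> norm (450 * F * exp (- (1/5) * \<bar>t - \<theta>\<bar>))"
      using that(3) F1 by (auto intro!: AE_I2 simp: indicator_def)
  qed
  show "set_integrable lborel R (kick A xr)"
    by (intro * kick_bounds line_interval_closed R_line DERIV_continuous_on[OF deriv_R(1)])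
  show "set_integrable lborel L (kick A xl)"
    by (intro * kick_bounds line_interval_closed L_line DERIV_continuous_on[OF deriv_L(1)])
  show "set_integrable lborel {\<theta>-1..\<theta>+1} (kick A y)"
    by (intro * kick_bounds DERIV_continuous_on[OF deriv_W(1)]) auto
qed

lemma cell_kick_integrable: "integrable lborel cell_kick"
  using set_integrable_kicks unfolding cell_kick_def[abs_def] set_integrable_def by (intro Bochner_Integration.integrable_add)

lemma cell_kick_bound: "norm (cell_kick t) \<le> 1350 * F * exp (- (1/5) * \<bar>t - \<theta>\<bar>)"
proof -
  let ?b = "450 * F * exp (- (1/5) * \<bar>t - \<theta>\<bar>)"
  have b0: "?b \<ge> 0" using F1 by simp
  have "norm (indicator L t *\<^sub>R kick A xl t) \<le> ?b" "norm (indicator {\<theta>-1..\<theta>+1} t *\<^sub>R kick A y t) \<le> ?b"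
    "norm (indicator R t *\<^sub>R kick A xr t) \<le> ?b"
    using kick_bounds[of t] b0 by (simp_all add: indicator_def)
  then have "norm (cell_kick t) \<le> ?b + ?b + ?b"
    unfolding cell_kick_def by (intro norm_triangle_le add_mono) auto
  then show ?thesis by simp
qed

lemma J_split: "\<omega> \<bullet> J = (LINT t:L|lborel. \<omega> \<bullet> kick A xl t) + (LINT t:{\<theta>-1..\<theta>+1}|lborel. \<omega> \<bullet> kick A y t) + (LINT t:R|lborel. \<omega> \<bullet> kick A xr t)"
proof -
  have i: "set_integrable lborel T h \<Longrightarrow> (LINT t:T|lborel. \<omega> \<bullet> h t) = \<omega> \<bullet> (LINT t:T|lborel. h t)" for T and h :: "real \<Rightarrow> real ^ 'n"
    unfolding set_integrable_def set_lebesgue_integral_def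
    by (subst integral_inner_right[symmetric]) (auto simp: inner_scaleR_right)
  have "J = (LINT t:L|lborel. kick A xl t) + (LINT t:{\<theta>-1..\<theta>+1}|lborel. kick A y t) + (LINT t:R|lborel. kick A xr t)"
    using set_integrable_kicks unfolding J_def cell_kick_def set_integrable_def set_lebesgue_integral_def by simp
  then show ?thesis using i set_integrable_kicks by (simp add: inner_add_right)
qed

lemma abs_cos_diff_le: "\<bar>cos a - cos b\<bar> \<le> \<bar>a - b\<bar> * (\<bar>a\<bar> + \<bar>b\<bar>)" "\<bar>cos a - cos b\<bar> \<le> \<bar>a - b\<bar>" for a b :: real
proof -
  have e: "cos a - cos b = 2 * sin ((a + b) / 2) * sin ((b - a) / 2)" by (rule cos_diff_cos)
  have 1: "\<bar>sin ((b - a) / 2)\<bar> \<le> \<bar>a - b\<bar> / 2" using abs_sin_x_le_abs_x[of "(b - a) / 2"] by (simp add: abs_minus_commute)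
  have 2: "\<bar>sin ((a + b) / 2)\<bar> \<le> \<bar>a\<bar> + \<bar>b\<bar>" 

  proof -
    have "\<bar>(a + b) / 2\<bar> \<le> \<bar>a\<bar> + \<bar>b\<bar>"
      using abs_triangle_ineq[of a b] abs_ge_zero[of a] abs_ge_zero[of b] by simp
    then show ?thesis by (rule order_trans[OF abs_sin_x_le_abs_x])
  qed
  have "\<bar>sin ((a + b) / 2)\<bar> * \<bar>sin ((b - a) / 2)\<bar> \<le> (\<bar>a\<bar> + \<bar>b\<bar>) * (\<bar>a - b\<bar> / 2)" using 1 2 by (intro mult_mono) auto
  then show "\<bar>cos a - cos b\<bar> \<le> \<bar>a - b\<bar> * (\<bar>a\<bar> + \<bar>b\<bar>)" unfolding e by (simp add: abs_mult mult_ac)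
  have "\<bar>sin ((a + b) / 2)\<bar> * \<bar>sin ((b - a) / 2)\<bar> \<le> 1 * (\<bar>a - b\<bar> / 2)" using 1 by (intro mult_mono) auto
  then show "\<bar>cos a - cos b\<bar> \<le> \<bar>a - b\<bar>" unfolding e by (simp add: abs_mult)
qed

lemma ref_decay:
  "t \<ge> \<theta> + 1 \<Longrightarrow> \<bar>separatrix (t - \<theta> - s) - 2 * pi\<bar> \<le> 5 * exp (- (1/5) * \<bar>t - \<theta>\<bar>)"
  "t \<le> \<theta> - 1 \<Longrightarrow> \<bar>separatrix (t - \<theta> - s)\<bar> \<le> 5 * exp (- (1/5) * \<bar>t - \<theta>\<bar>)"
proof -
  have e: "4 * exp (- u - 1/100 + 2/100) \<le> 5 * exp (- (1/5) * u)" if "u \<ge> 0" for u :: real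
  proof -
    have "exp (- (1/100) :: real) \<ge> 99/100" using exp_ge_add_one_self[of "- (1/100)"] by simp
    then have "exp (1/100 :: real) \<le> 100 / 99" by (simp add: exp_minus field_simps)
    moreover have "exp (- u) \<le> exp (- (1/5) * u)" using that by simp
    ultimately have "exp (- u) * exp (1/100) \<le> exp (- (1/5) * u) * (100/99)" by (intro mult_mono) auto
    moreover have "exp (- u - 1/100 + 2/100) = exp (- u) * exp (1/100)" by (simp add: exp_add[symmetric])
    ultimately show ?thesis using exp_gt_zero[of "- (1/5) * u"] by linarith
  qed
  show "\<bar>separatrix (t - \<theta> - s) - 2 * pi\<bar> \<le> 5 * exp (- (1/5) * \<bar>t - \<theta>\<bar>)" if "t \<ge> \<theta> + 1"
  proof -
    have "exp (- (t - \<theta> - s)) \<le> exp (- (t - \<theta>) - 1/100 + 2/100)" using s by simp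
    moreover have u: "\<bar>t - \<theta>\<bar> = t - \<theta>" "0 \<le> t - \<theta>" using that by auto
    ultimately show ?thesis unfolding u(1) using e[OF u(2)] separatrix_bounds(3,4)[of "t - \<theta> - s"] by linarith
  qed
  show "\<bar>separatrix (t - \<theta> - s)\<bar> \<le> 5 * exp (- (1/5) * \<bar>t - \<theta>\<bar>)" if "t \<le> \<theta> - 1"
  proof -
    have "exp (t - \<theta> - s) \<le> exp (- (\<theta> - t) - 1/100 + 2/100)" using s by simp
    moreover have u: "\<bar>t - \<theta>\<bar> = \<theta> - t" "0 \<le> \<theta> - t" using that by auto
    ultimately show ?thesis unfolding u(1) using e[OF u(2)] separatrix_bounds(1,2)[of "t - \<theta> - s"] by linarith
  qed
qed

text \<open>
  Times beyond the half gaps: there the separatrix has already lost a factor \<open>exp (-l / 5) \<le> \<mu>\<close>, so cutting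
  off its contribution is an error of order \<open>\<mu>\<close>.
\<close>

lemma outside_cell:
  assumes "\<bar>t - \<theta>\<bar> \<ge> l" shows "\<bar>cos (separatrix (t - \<theta> - s)) - 1\<bar> \<le> 16 * \<mu> * exp (- (1/5) * \<bar>t - \<theta>\<bar>)"
proof -
  have "\<bar>cos (separatrix (t - \<theta> - s)) - 1\<bar> \<le> 8 * exp (- 2 * \<bar>t - \<theta> - s\<bar>)" by (rule abs_cos_separatrix_le)
  also have "\<dots> \<le> 8 * (2 * exp (- 2 * \<bar>t - \<theta>\<bar>))"
  proof -
    have "\<bar>t - \<theta>\<bar> \<le> \<bar>t - \<theta> - s\<bar> + 1 / 100" using s by linarith
    then have "exp (- 2 * \<bar>t - \<theta> - s\<bar>) \<le> exp (1/50 + - 2 * \<bar>t - \<theta>\<bar>)" by simp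
    also have "\<dots> = exp (1/50) * exp (- 2 * \<bar>t - \<theta>\<bar>)" by (rule exp_add)
    also have "exp (1/50 :: real) \<le> 2"
      using exp_ge_add_one_self[of "- (1/50)"] by (simp add: exp_minus field_simps)
    finally show ?thesis by simp
  qed
  also have "exp (- 2 * \<bar>t - \<theta>\<bar>) \<le> exp (- l / 5 + - (1/5) * \<bar>t - \<theta>\<bar>)" using assms l(2) by simp
  also have "\<dots> = exp (- l / 5) * exp (- (1/5) * \<bar>t - \<theta>\<bar>)" by (rule exp_add)
  also have "\<dots> \<le> \<mu> * exp (- (1/5) * \<bar>t - \<theta>\<bar>)" using l(1) by (intro mult_right_mono) auto
  finally show ?thesis by simp
qed

lemma cell_kick_close:
  assumes t: "t \<noteq> \<theta> - 1" "t \<noteq> \<theta> + 1"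
  shows "norm (cell_kick t - (cos (separatrix (t - \<theta> - s)) - 1) *\<^sub>R grad f (t *\<^sub>R \<omega> + A)) \<le> 36 * K1 * F * \<mu> * exp (- (1/5) * \<bar>t - \<theta>\<bar>)"
proof -
  let ?E = "exp (- (1/5) * \<bar>t - \<theta>\<bar>)"
  have E: "?E > 0" by simp
  have KE: "K1 * \<mu> * ?E \<ge> 0" using mu_facts(4) mu(1) by simp
  have fin: "norm (cell_kick t - (cos (separatrix (t - \<theta> - s)) - 1) *\<^sub>R grad f (t *\<^sub>R \<omega> + A)) \<le> 36 * K1 * F * \<mu> * ?E"
    if "cell_kick t = (c - 1) *\<^sub>R grad f (t *\<^sub>R \<omega> + A)" "\<bar>c - cos (separatrix (t - \<theta> - s))\<bar> \<le> 36 * (K1 * \<mu> * ?E)" for c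
  proof -
    have "cell_kick t - (cos (separatrix (t - \<theta> - s)) - 1) *\<^sub>R grad f (t *\<^sub>R \<omega> + A) = (c - cos (separatrix (t - \<theta> - s))) *\<^sub>R grad f (t *\<^sub>R \<omega> + A)"
      unfolding that(1) by (simp add: scaleR_diff_left)
    then have "norm (cell_kick t - (cos (separatrix (t - \<theta> - s)) - 1) *\<^sub>R grad f (t *\<^sub>R \<omega> + A))
        = \<bar>c - cos (separatrix (t - \<theta> - s))\<bar> * norm (grad f (t *\<^sub>R \<omega> + A))" by simp
    also have "\<dots> \<le> (36 * (K1 * \<mu> * ?E)) * F" using that(2) grad_le KE by (intro mult_mono) auto
    finally show ?thesis by (simp add: mult_ac)
  qed
  consider "t \<in> R" "t > \<theta> + 1" | "t \<in> L" "t < \<theta> - 1" | "t \<in> {\<theta>-1<..<\<theta>+1}" | "t \<notin> R" "t > \<theta> + 1" | "t \<notin> L" "t < \<theta> - 1"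
    using t by force
  then show ?thesis
  proof cases
    case 1
    then have "t \<notin> L" "t \<notin> {\<theta>-1..\<theta>+1}" using L_facts(2)[of t] by auto
    then have c: "cell_kick t = (cos (xr t) - 1) *\<^sub>R grad f (t *\<^sub>R \<omega> + A)" using 1 by (simp add: cell_kick_def kick_def)
    have "\<bar>cos (xr t) - cos (separatrix (t - \<theta> - s) - 2 * pi)\<bar> \<le> (K1 * \<mu>) * (30 * ?E + 5 * ?E)"
      using R_facts[OF 1(1)] ref_decay(1)[of t] 1(2) by (intro order_trans[OF abs_cos_diff_le(1)] mult_mono add_mono) auto
    also have "\<dots> \<le> 36 * (K1 * \<mu> * ?E)" using KE by (simp add: algebra_simps)
    finally show ?thesis by (intro fin[OF c]) (simp add: cos_diff)
  next
    case 2
    then have "t \<notin> R" "t \<notin> {\<theta>-1..\<theta>+1}" using R_facts(2)[of t] by auto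
    then have c: "cell_kick t = (cos (xl t) - 1) *\<^sub>R grad f (t *\<^sub>R \<omega> + A)" using 2 by (simp add: cell_kick_def kick_def)
    have "\<bar>cos (xl t) - cos (separatrix (t - \<theta> - s))\<bar> \<le> (K1 * \<mu>) * (30 * ?E + 5 * ?E)"
      using L_facts[OF 2(1)] ref_decay(2)[of t] 2(2) by (intro order_trans[OF abs_cos_diff_le(1)] mult_mono add_mono) auto
    also have "\<dots> \<le> 36 * (K1 * \<mu> * ?E)" using KE by (simp add: algebra_simps)
    finally show ?thesis by (intro fin[OF c])
  next
    case 3
    then have "t \<notin> R" "t \<notin> L" and tW: "t \<in> {\<theta>-1..\<theta>+1}" using R_facts(2)[of t] L_facts(2)[of t] by auto
    then have c: "cell_kick t = (cos (y t) - 1) *\<^sub>R grad f (t *\<^sub>R \<omega> + A)" by (simp add: cell_kick_def kick_def)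
    have "\<bar>cos (y t) - cos (separatrix (t - \<theta> - s))\<bar> \<le> (K1 * \<mu>) * 1"
      using order_trans[OF abs_cos_diff_le(2) window_bounds(1)[OF tW]] by simp
    also have "\<dots> \<le> (K1 * \<mu>) * (2 * ?E)" using window_exp[OF tW] mu_facts(4) mu(1) by (intro mult_left_mono) auto
    also have "\<dots> = 2 * (K1 * \<mu> * ?E)" by (simp only: mult_ac)
    also have "\<dots> \<le> 36 * (K1 * \<mu> * ?E)" using KE by linarith
    finally show ?thesis by (intro fin[OF c])
  next
    case 4
    then have "t \<notin> L" "t \<notin> {\<theta>-1..\<theta>+1}" using L_facts(2)[of t] by auto
    then have c: "cell_kick t = (1 - 1) *\<^sub>R grad f (t *\<^sub>R \<omega> + A)" using 4 by (simp add: cell_kick_def)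
    have "\<bar>t - \<theta>\<bar> \<ge> l" using 4 SR(4) by (auto simp: R_def split: if_splits)
    from outside_cell[OF this] have "\<bar>1 - cos (separatrix (t - \<theta> - s))\<bar> \<le> 16 * \<mu> * ?E" by (simp add: abs_minus_commute)
    also have "\<dots> \<le> 36 * (K1 * \<mu> * ?E)"
      using mult_right_mono[of 1 K1 "\<mu> * ?E"] mu_facts(4) mu(1) by simp
    finally show ?thesis by (intro fin[OF c])
  next
    case 5
    then have "t \<notin> R" "t \<notin> {\<theta>-1..\<theta>+1}" using R_facts(2)[of t] by auto
    then have c: "cell_kick t = (1 - 1) *\<^sub>R grad f (t *\<^sub>R \<omega> + A)" using 5 by (simp add: cell_kick_def)
    have "\<bar>t - \<theta>\<bar> \<ge> l" using 5 SL(4) by (auto simp: L_def split: if_splits)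
    from outside_cell[OF this] have "\<bar>1 - cos (separatrix (t - \<theta> - s))\<bar> \<le> 16 * \<mu> * ?E" by (simp add: abs_minus_commute)
    also have "\<dots> \<le> 36 * (K1 * \<mu> * ?E)"
      using mult_right_mono[of 1 K1 "\<mu> * ?E"] mu_facts(4) mu(1) by simp
    finally show ?thesis by (intro fin[OF c])
  qed
qed

text \<open>
  The momentum transfer of a crossing at time \<open>\<theta> + s\<close> is \<open>\<mu>\<close> times the gradient of the Melnikov function, evaluated at the
  phase of the crossing, up to \<open>O(\<mu>\<^sup>2)\<close>. The error bound is integrable in time and independent of the other
  crossings.
\<close>

lemma J_close: "norm (J - melnikov_grad \<omega> f (A + (\<theta> + s) *\<^sub>R \<omega>)) \<le> 360 * K1 * F * \<mu>"
proof -
  let ?m = "\<lambda>t. (cos (separatrix (t - \<theta> - s)) - 1) *\<^sub>R grad f (t *\<^sub>R \<omega> + A)"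
  let ?ref = "\<lambda>t. (cos (separatrix t) - 1) *\<^sub>R grad f (t *\<^sub>R \<omega> + (A + (\<theta> + s) *\<^sub>R \<omega>))"
  have sh: "?ref (- (\<theta> + s) + 1 * t) = ?m t" for t by (simp add: algebra_simps)
  have i0: "integrable lborel ?ref"
    by (rule separatrix_weight_integral) (auto intro!: continuous_on_compose2[OF continuous_grad] continuous_intros grad_le)
  have mi: "integrable lborel ?m" using lborel_integrable_real_affine[OF i0, of 1 "- (\<theta> + s)"] unfolding sh by simp
  have "melnikov_grad \<omega> f (A + (\<theta> + s) *\<^sub>R \<omega>) = (LINT t|lborel. ?m t)"
    unfolding melnikov_grad_def using lborel_integral_real_affine[of 1 ?ref "- (\<theta> + s)"] unfolding sh by simp
  then have eq: "J - melnikov_grad \<omega> f (A + (\<theta> + s) *\<^sub>R \<omega>) = (LINT t|lborel. cell_kick t - ?m t)"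
    using mi cell_kick_integrable by (simp add: J_def)
  have 1: "norm (LINT t|lborel. cell_kick t - ?m t) \<le> (LINT t|lborel. norm (cell_kick t - ?m t))" by (rule integral_norm_bound)
  have 2: "(LINT t|lborel. norm (cell_kick t - ?m t)) \<le> (LINT t|lborel. 36 * K1 * F * \<mu> * exp (- (1/5) * \<bar>t - \<theta>\<bar>))"
  proof (rule integral_mono_AE)
    show "integrable lborel (\<lambda>t. norm (cell_kick t - ?m t))" using mi cell_kick_integrable by simp
    show "integrable lborel (\<lambda>t. 36 * K1 * F * \<mu> * exp (- (1/5) * \<bar>t - \<theta>\<bar>))" using integrable_exp_abs(1)[of "1/5" \<theta>] by simp
    show "AE t in lborel. norm (cell_kick t - ?m t) \<le> 36 * K1 * F * \<mu> * exp (- (1/5) * \<bar>t - \<theta>\<bar>)"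
      using AE_lborel_singleton[of "\<theta> - 1"] AE_lborel_singleton[of "\<theta> + 1"]
      by eventually_elim (rule cell_kick_close)
  qed
  have 3: "(LINT t|lborel. 36 * K1 * F * \<mu> * exp (- (1/5) * \<bar>t - \<theta>\<bar>)) = 360 * K1 * F * \<mu>"
    using integrable_exp_abs(2)[of "1/5" \<theta>] by simp
  show ?thesis unfolding eq using order_trans[OF 1 2] unfolding 3 .
qed

end

context crossing begin

text \<open>
  The energy mismatch at the junction after the crossing, at time \<open>\<theta> + 1\<close>.
\<close>

definition Ep :: real where
  "Ep = energy \<mu> A (\<theta> + 1) (y (\<theta> + 1)) (q (\<theta> + 1)) - energy \<mu> A (\<theta> + 1) (xr (\<theta> + 1)) (pr (\<theta> + 1))"

text \<open>
  The energy mismatch at the junction before the crossing, at time \<open>\<theta> - 1\<close>.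
\<close>

definition Em :: real where
  "Em = energy \<mu> A (\<theta> - 1) (y (\<theta> - 1)) (q (\<theta> - 1)) - energy \<mu> A (\<theta> - 1) (xl (\<theta> - 1)) (pl (\<theta> - 1))"

text \<open>
  The energy in the middle of the following gap; at an asymptotic end it is the energy 0 of the equilibrium.
\<close>

definition eR :: real where
  "eR = (if bdd_above R then energy \<mu> A (Sup R) (xr (Sup R)) (pr (Sup R)) else 0)"

definition eL :: real where
  "eL = (if bdd_below L then energy \<mu> A (Inf L) (xl (Inf L)) (pl (Inf L)) else 0)"

lemma energy_small:
  assumes "\<bar>x\<bar> \<le> 30 * D" "\<bar>p\<bar> \<le> 30 * D" shows "\<bar>energy \<mu> A t x p\<bar> \<le> 1350 * D\<^sup>2"
proof -
  have p: "p\<^sup>2 \<le> 900 * D\<^sup>2" using power_mono[OF assms(2) abs_ge_zero, of 2] by (simp add: power_mult_distrib)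
  have x: "x\<^sup>2 \<le> 900 * D\<^sup>2" using power_mono[OF assms(1) abs_ge_zero, of 2] by (simp add: power_mult_distrib)
  have c: "\<bar>coef \<mu> A t\<bar> \<le> 2" using coef_near_1[of t] by linarith
  have "\<bar>(1 - cos x) * coef \<mu> A t\<bar> \<le> (x\<^sup>2 / 2) * 2"
    unfolding abs_mult using one_minus_cos_bounds[of x] c by (intro mult_mono) auto
  moreover have "\<bar>energy \<mu> A t x p\<bar> \<le> p\<^sup>2 / 2 + \<bar>(1 - cos x) * coef \<mu> A t\<bar>"
    unfolding energy_def by (rule order_trans[OF abs_triangle_ineq4]) simp
  ultimately show ?thesis using p x by simp
qed

lemma energy_decay:
  assumes "\<bar>x\<bar> \<le> 30 * exp (- (1/5) * \<bar>t - \<theta>\<bar>)" "\<bar>p\<bar> \<le> 30 * exp (- (1/5) * \<bar>t - \<theta>\<bar>)"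
  shows "\<bar>energy \<mu> A t x p\<bar> \<le> 1350 * exp (- (1/5) * \<bar>t - \<theta>\<bar>)"
    "\<bar>t - \<theta>\<bar> \<ge> l \<Longrightarrow> \<bar>energy \<mu> A t x p\<bar> \<le> 1350 * \<mu>\<^sup>2"
proof -
  have s: "\<bar>energy \<mu> A t x p\<bar> \<le> 1350 * (exp (- (1/5) * \<bar>t - \<theta>\<bar>))\<^sup>2" by (rule energy_small[OF assms])
  have "(exp (- (1/5) * \<bar>t - \<theta>\<bar>))\<^sup>2 \<le> 1 * exp (- (1/5) * \<bar>t - \<theta>\<bar>)"
    unfolding power2_eq_square by (intro mult_right_mono) auto
  with s show "\<bar>energy \<mu> A t x p\<bar> \<le> 1350 * exp (- (1/5) * \<bar>t - \<theta>\<bar>)" by linarith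
  assume "\<bar>t - \<theta>\<bar> \<ge> l"
  then have "exp (- (1/5) * \<bar>t - \<theta>\<bar>) \<le> exp (- l / 5)" by simp
  then have "exp (- (1/5) * \<bar>t - \<theta>\<bar>) \<le> \<mu>" using l(1) by linarith
  then have "(exp (- (1/5) * \<bar>t - \<theta>\<bar>))\<^sup>2 \<le> \<mu>\<^sup>2" by (intro power_mono) auto
  with s show "\<bar>energy \<mu> A t x p\<bar> \<le> 1350 * \<mu>\<^sup>2" by linarith
qed

text \<open>
  Each of position and velocity in the middle of a gap is of order \<open>exp (-l / 5) \<le> \<mu>\<close>, and the energy is quadratic in them.
\<close>

lemma end_energies: "\<bar>eR\<bar> \<le> 1350 * \<mu>\<^sup>2" "\<bar>eL\<bar> \<le> 1350 * \<mu>\<^sup>2"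
proof -
  show "\<bar>eR\<bar> \<le> 1350 * \<mu>\<^sup>2"
  proof (cases "bdd_above R")
    case True
    then have b: "bdd_above SR" using R_line(5) by simp
    have m: "Sup R \<in> R" by (rule Inf_Sup_line_interval(2)[OF R_line(1) True])
    have "R = {\<theta> + 1..(Sup SR + \<theta> + 1) / 2}" using b by (simp add: R_def)
    moreover have "\<theta> + 1 \<le> (Sup SR + \<theta> + 1) / 2" using SR(4)[OF b] l(2) by argo
    ultimately have "Sup R = (Sup SR + \<theta> + 1) / 2" by simp
    then have "\<bar>Sup R - \<theta>\<bar> \<ge> l" using SR(4)[OF b] by (simp add: field_simps)
    from energy_decay(2)[OF R_facts(6,7)[OF m] this] show ?thesis using True by (simp add: eR_def)
  qed (simp add: eR_def)
  show "\<bar>eL\<bar> \<le> 1350 * \<mu>\<^sup>2"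
  proof (cases "bdd_below L")
    case True
    then have b: "bdd_below SL" using L_line(5) by simp
    have m: "Inf L \<in> L" by (rule Inf_Sup_line_interval(1)[OF L_line(1) True])
    have "L = {(Inf SL + \<theta> - 1) / 2..\<theta> - 1}" using b by (simp add: L_def)
    moreover have "(Inf SL + \<theta> - 1) / 2 \<le> \<theta> - 1" using SL(4)[OF b] l(2) by argo
    ultimately have I: "Inf L = (Inf SL + \<theta> - 1) / 2" by simp
    have "\<theta> - Inf L \<ge> l" unfolding I using SL(4)[OF b] by (simp add: field_simps)
    then have "\<bar>Inf L - \<theta>\<bar> \<ge> l" by linarith
    from energy_decay(2)[OF L_facts(6,7)[OF m] this] show ?thesis using True by (simp add: eL_def)
  qed (simp add: eL_def)
qed

lemma set_integrable_power:
  "set_integrable lborel R (\<lambda>t. - \<mu> * (\<omega> \<bullet> kick A xr t))" "set_integrable lborel L (\<lambda>t. - \<mu> * (\<omega> \<bullet> kick A xl t))"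
  "set_integrable lborel {\<theta>-1..\<theta>+1} (\<lambda>t. - \<mu> * (\<omega> \<bullet> kick A y t))"
proof -
  have *: "set_integrable lborel T (\<lambda>t. - \<mu> * (\<omega> \<bullet> h t))" if "set_integrable lborel T h" for T and h :: "real \<Rightarrow> real ^ 'n"
  proof -
    have "integrable lborel (\<lambda>t. \<omega> \<bullet> (indicator T t *\<^sub>R h t))" using that unfolding set_integrable_def by (rule integrable_inner_right)
    then have "integrable lborel (\<lambda>t. - \<mu> * (\<omega> \<bullet> (indicator T t *\<^sub>R h t)))" by (rule integrable_mult_right)
    then show ?thesis unfolding set_integrable_def by (simp add: mult_ac)
  qed
  show "set_integrable lborel R (\<lambda>t. - \<mu> * (\<omega> \<bullet> kick A xr t))" "set_integrable lborel L (\<lambda>t. - \<mu> * (\<omega> \<bullet> kick A xl t))"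
    "set_integrable lborel {\<theta>-1..\<theta>+1} (\<lambda>t. - \<mu> * (\<omega> \<bullet> kick A y t))"
    by (rule *[OF set_integrable_kicks(1)], rule *[OF set_integrable_kicks(2)], rule *[OF set_integrable_kicks(3)])
qed

lemma power_R: "(LINT t:R|lborel. - \<mu> * (\<omega> \<bullet> kick A xr t)) = eR - energy \<mu> A (\<theta> + 1) (xr (\<theta> + 1)) (pr (\<theta> + 1))"
proof -
  have "(LINT t:R|lborel. - \<mu> * (\<omega> \<bullet> kick A xr t)) =
    (if bdd_above R then energy \<mu> A (Sup R) (xr (Sup R)) (pr (Sup R)) else 0) -
    (if bdd_below R then energy \<mu> A (Inf R) (xr (Inf R)) (pr (Inf R)) else 0)"
    by (rule line_interval_FTC[where c = "1/5", OF R_line(1) energy_deriv[OF deriv_R] energy_decay(1)[OF R_facts(6,7)] _ set_integrable_power(1)]) auto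
  then show ?thesis using R_line by (simp add: eR_def)
qed

lemma power_L: "(LINT t:L|lborel. - \<mu> * (\<omega> \<bullet> kick A xl t)) = energy \<mu> A (\<theta> - 1) (xl (\<theta> - 1)) (pl (\<theta> - 1)) - eL"
proof -
  have "(LINT t:L|lborel. - \<mu> * (\<omega> \<bullet> kick A xl t)) =
    (if bdd_above L then energy \<mu> A (Sup L) (xl (Sup L)) (pl (Sup L)) else 0) -
    (if bdd_below L then energy \<mu> A (Inf L) (xl (Inf L)) (pl (Inf L)) else 0)"
    by (rule line_interval_FTC[where c = "1/5", OF L_line(1) energy_deriv[OF deriv_L] energy_decay(1)[OF L_facts(6,7)] _ set_integrable_power(2)]) auto
  then show ?thesis using L_line by (simp add: eL_def)
qed

lemma power_W: "(LINT t:{\<theta>-1..\<theta>+1}|lborel. - \<mu> * (\<omega> \<bullet> kick A y t)) =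
    energy \<mu> A (\<theta> + 1) (y (\<theta> + 1)) (q (\<theta> + 1)) - energy \<mu> A (\<theta> - 1) (y (\<theta> - 1)) (q (\<theta> - 1))"
proof -
  let ?e = "\<lambda>t. energy \<mu> A t (y t) (q t)"
  have d: "(?e has_real_derivative - \<mu> * (\<omega> \<bullet> kick A y t)) (at t within {\<theta>-1..\<theta>+1})" if "t \<in> {\<theta>-1..\<theta>+1}" for t
    by (rule energy_deriv[OF deriv_W[OF that]])
  have "(LINT t:{\<theta>-1..\<theta>+1}|lborel. - \<mu> * (\<omega> \<bullet> kick A y t)) = integral {\<theta>-1..\<theta>+1} (\<lambda>t. - \<mu> * (\<omega> \<bullet> kick A y t))"
    by (rule set_borel_integral_eq_integral[OF set_integrable_power(3)])
  also have "\<dots> = ?e (\<theta> + 1) - ?e (\<theta> - 1)"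
    by (intro integral_unique fundamental_theorem_of_calculus)
       (use d in \<open>auto simp: has_real_derivative_iff_has_vector_derivative[symmetric]\<close>)
  finally show ?thesis .
qed

text \<open>
  Integrating the energy identity over the window and the two half gaps: the two mismatches differ by the work of the kicks,
  apart from the energies in the middles of the gaps.
\<close>

theorem energy_balance: "Ep - Em = - \<mu> * (\<omega> \<bullet> J) - eR + eL"
proof -
  have m: "(LINT t:T|lborel. - \<mu> * h t) = - \<mu> * (LINT t:T|lborel. h t)" for T h by (rule set_integral_mult_right)
  show ?thesis
    unfolding J_split Ep_def Em_def using power_L power_W power_R unfolding m by (simp add: algebra_simps)
qed

lemma energy_gap_start: "\<bar>energy \<mu> A (\<theta> + 1) (xr (\<theta> + 1)) (pr (\<theta> + 1))\<bar> \<le> 1350 * \<mu>\<^sup>2 + 4500 * \<mu> * norm \<omega> * F"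
proof -
  have "norm (LINT t:R|lborel. - \<mu> * (\<omega> \<bullet> kick A xr t)) \<le> (LINT t|lborel. \<mu> * norm \<omega> * 450 * F * exp (- (1/5) * \<bar>t - \<theta>\<bar>))"
    unfolding set_lebesgue_integral_def
  proof (rule Bochner_Integration.integral_norm_bound_integral)
    show "integrable lborel (\<lambda>t. indicator R t *\<^sub>R (- \<mu> * (\<omega> \<bullet> kick A xr t)))"
      using set_integrable_power(1) unfolding set_integrable_def .
    show "integrable lborel (\<lambda>t. \<mu> * norm \<omega> * 450 * F * exp (- (1/5) * \<bar>t - \<theta>\<bar>))" using integrable_exp_abs(1)[of "1/5" \<theta>] by simp
    fix t
    show "norm (indicator R t *\<^sub>R (- \<mu> * (\<omega> \<bullet> kick A xr t))) \<le> \<mu> * norm \<omega> * 450 * F * exp (- (1/5) * \<bar>t - \<theta>\<bar>)"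
    proof (cases "t \<in> R")
      case True
      have "\<bar>\<omega> \<bullet> kick A xr t\<bar> \<le> norm \<omega> * norm (kick A xr t)" by (rule Cauchy_Schwarz_ineq2)
      also have "\<dots> \<le> norm \<omega> * (450 * F * exp (- (1/5) * \<bar>t - \<theta>\<bar>))" by (intro mult_left_mono kick_bounds True) auto
      finally have "\<mu> * \<bar>\<omega> \<bullet> kick A xr t\<bar> \<le> \<mu> * (norm \<omega> * (450 * F * exp (- (1/5) * \<bar>t - \<theta>\<bar>)))"
        using mu(1) by (intro mult_left_mono) auto
      then show ?thesis using True mu(1) by (simp add: abs_mult mult_ac)
    next
      case False
      then show ?thesis using mu(1) F1 by simp
    qed
  qed
  also have "\<dots> = 4500 * \<mu> * norm \<omega> * F" using integrable_exp_abs(2)[of "1/5" \<theta>] by simp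
  finally show ?thesis using power_R end_energies(1) unfolding real_norm_def by linarith
qed

lemma energy_window_half: "\<bar>energy \<mu> A (\<theta> + 1) (y (\<theta> + 1)) (q (\<theta> + 1)) - energy \<mu> A \<theta> (y \<theta>) (q \<theta>)\<bar> \<le> 2 * \<mu> * norm \<omega> * F"
proof -
  let ?e = "\<lambda>t. energy \<mu> A t (y t) (q t)"
  have "norm (?e (\<theta> + 1) - ?e \<theta>) \<le> (2 * \<mu> * norm \<omega> * F) * norm (\<theta> + 1 - \<theta>)"
  proof (rule field_differentiable_bound[of "{\<theta>-1..\<theta>+1}" ?e "\<lambda>t. - \<mu> * (\<omega> \<bullet> kick A y t)"])
    show "(?e has_field_derivative - \<mu> * (\<omega> \<bullet> kick A y t)) (at t within {\<theta>-1..\<theta>+1})" if "t \<in> {\<theta>-1..\<theta>+1}" for t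
      by (rule energy_deriv[OF deriv_W[OF that]])
    fix t
    have "\<bar>1 - cos (y t)\<bar> \<le> 2" using cos_le_one[of "y t"] cos_ge_minus_one[of "y t"] by linarith
    then have k: "norm (kick A y t) \<le> F * 2" using order_trans[OF kick_norm[of A y t] mult_left_mono[of _ _ F]] F1 by simp
    have "\<bar>\<omega> \<bullet> kick A y t\<bar> \<le> norm \<omega> * norm (kick A y t)" by (rule Cauchy_Schwarz_ineq2)
    also have "\<dots> \<le> norm \<omega> * (F * 2)" by (intro mult_left_mono k) auto
    finally have "\<mu> * \<bar>\<omega> \<bullet> kick A y t\<bar> \<le> \<mu> * (norm \<omega> * (F * 2))" using mu(1) by (intro mult_left_mono) auto
    then show "norm (- \<mu> * (\<omega> \<bullet> kick A y t)) \<le> 2 * \<mu> * norm \<omega> * F" using mu(1) by (simp add: abs_mult mult_ac)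
  qed auto
  then show ?thesis by simp
qed

text \<open>
  On the separatrix the energy is zero, and a change \<open>c0 * \<mu> * e\<close> of the velocity changes the energy to first order by
  velocity times change.
\<close>

lemma energy_crossing:
  "\<bar>energy \<mu> A \<theta> (y \<theta>) (q \<theta>) - separatrix_velocity (- s) * (c0 * \<mu> * e)\<bar> \<le> (c0 * \<mu>)\<^sup>2 / 2 + 2 * \<mu> * F"
proof -
  define v where "v = separatrix_velocity (- s)"
  have y: "y \<theta> = separatrix (- s)" "q \<theta> = v + c0 * \<mu> * e" using W by (simp_all add: win_sol_def v_def)
  have "energy \<mu> A \<theta> (y \<theta>) (q \<theta>) = (v + c0 * \<mu> * e)\<^sup>2 / 2 - (v\<^sup>2 / 2) * coef \<mu> A \<theta>"
    by (simp add: energy_def y sin_cos_separatrix(2) v_def)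
  then have "energy \<mu> A \<theta> (y \<theta>) (q \<theta>) - v * (c0 * \<mu> * e) = (c0 * \<mu> * e)\<^sup>2 / 2 + (v\<^sup>2 / 2) * (1 - coef \<mu> A \<theta>)"
    by (simp add: power2_eq_square algebra_simps add_divide_distrib)
  also have "\<bar>\<dots>\<bar> \<le> (c0 * \<mu>)\<^sup>2 / 2 + 2 * (\<mu> * F)"
  proof -
    have "\<bar>c0 * \<mu> * e\<bar> \<le> c0 * \<mu>" using mult_left_mono[OF e, of "c0 * \<mu>"] c0 mu(1) by (simp add: abs_mult)
    from power_mono[OF this abs_ge_zero, of 2] have 1: "(c0 * \<mu> * e)\<^sup>2 \<le> (c0 * \<mu>)\<^sup>2" by simp
    have "v\<^sup>2 \<le> 2\<^sup>2" unfolding v_def using separatrix_velocity_bounds[of "- s"] by (intro power_mono) auto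
    then have "\<bar>(v\<^sup>2 / 2) * (1 - coef \<mu> A \<theta>)\<bar> \<le> 2 * (\<mu> * F)"
      unfolding abs_mult using coef_bound[OF mu(1), of A \<theta>] by (intro mult_mono) (auto simp: abs_minus_commute)
    moreover have "\<bar>(c0 * \<mu> * e)\<^sup>2 / 2\<bar> \<le> (c0 * \<mu>)\<^sup>2 / 2" using 1 by simp
    ultimately show ?thesis by (intro order_trans[OF abs_triangle_ineq] add_mono)
  qed
  finally show ?thesis by (simp add: v_def mult.assoc)
qed

text \<open>
  The mismatch after the crossing is dominated by the term linear in \<open>e\<close>: the energy drift in half a window
  and in the following half gap is at most \<open>4502 * \<mu> * norm \<omega> * F\<close> up to smaller terms. This determines the size required of \<open>c0\<close>.
\<close>

theorem Ep_estimate: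
  assumes "c0 \<ge> 5000 * (norm \<omega> + 1) * F"
  shows "\<bar>Ep - separatrix_velocity (- s) * (c0 * \<mu> * e)\<bar> \<le> c0 * \<mu>"
proof -
  have 1: "\<bar>Ep - separatrix_velocity (- s) * (c0 * \<mu> * e)\<bar>
      \<le> ((c0 * \<mu>)\<^sup>2 / 2 + 2 * \<mu> * F) + 2 * \<mu> * norm \<omega> * F + (1350 * \<mu>\<^sup>2 + 4500 * \<mu> * norm \<omega> * F)"
    unfolding Ep_def using energy_crossing energy_window_half energy_gap_start by linarith
  have 2: "(c0 * \<mu>)\<^sup>2 / 2 \<le> (c0 * \<mu>) / 12000"
  proof -
    have "c0 * \<mu> * (c0 * \<mu>) \<le> c0 * \<mu> * (1 / 6000)" by (rule mult_left_mono[OF mu_facts(2)]) (use c0 mu(1) in simp)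
    then show ?thesis unfolding power2_eq_square by linarith
  qed
  have 3: "1350 * \<mu>\<^sup>2 \<le> \<mu> * F"
  proof -
    have "1350 * \<mu> * \<mu> \<le> 1 * \<mu>" using mu_facts(5) mu(1) by (intro mult_right_mono) auto
    moreover have "\<mu> * 1 \<le> \<mu> * F" using F1 mu(1) by (intro mult_left_mono) auto
    ultimately show ?thesis by (simp add: power2_eq_square)
  qed
  have 4: "5000 * (\<mu> * norm \<omega> * F) + 5000 * (\<mu> * F) \<le> c0 * \<mu>"
    using mult_right_mono[OF assms, of \<mu>] mu(1) by (simp add: algebra_simps)
  have 5: "\<mu> * norm \<omega> * F \<ge> 0" "\<mu> * F \<ge> 0" "c0 * \<mu> \<ge> 0" using mu(1) F1 c0 by auto
  have "((c0 * \<mu>)\<^sup>2 / 2 + 2 * \<mu> * F) + 2 * \<mu> * norm \<omega> * F + (1350 * \<mu>\<^sup>2 + 4500 * \<mu> * norm \<omega> * F)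
    \<le> (c0 * \<mu>) / 12000 + 3 * (\<mu> * F) + 4502 * (\<mu> * norm \<omega> * F)"
  proof -
    have "2 * \<mu> * F = 2 * (\<mu> * F)" "2 * \<mu> * norm \<omega> * F = 2 * (\<mu> * norm \<omega> * F)"
      "4500 * \<mu> * norm \<omega> * F = 4500 * (\<mu> * norm \<omega> * F)" by simp_all
    then show ?thesis using 2 3 by linarith
  qed
  also have "\<dots> \<le> c0 * \<mu>" using 4 5 by argo
  finally show ?thesis using 1 by linarith
qed

lemma Ep_sign:
  assumes "c0 \<ge> 5000 * (norm \<omega> + 1) * F"
  shows "e = 1 \<Longrightarrow> Ep \<ge> 0" "e = -1 \<Longrightarrow> Ep \<le> 0"
proof -
  have v: "separatrix_velocity (- s) \<ge> 1" by (rule separatrix_velocity_ge_1) (use s in auto)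
  have "1 * (c0 * \<mu>) \<le> separatrix_velocity (- s) * (c0 * \<mu>)" using v c0 mu(1) by (intro mult_right_mono) auto
  then show "e = 1 \<Longrightarrow> Ep \<ge> 0" "e = -1 \<Longrightarrow> Ep \<le> 0" using Ep_estimate[OF assms] by (auto simp: abs_le_iff)
qed

text \<open>
  At the junction the combination \<open>x - p = v\<close> agrees, and along this line the energy \<open>\<phi>\<close> is strictly monotone near the actual
  position because the velocity is bounded below and \<open>sin\<close> is negative there. Equal energies therefore force equal
  position and velocity.
\<close>

lemma match_right:
  assumes "Ep = 0" shows "xr (\<theta> + 1) = y (\<theta> + 1) - 2 * pi" "pr (\<theta> + 1) = q (\<theta> + 1)"
proof -
  define v g where "v = (y (\<theta> + 1) - 2 * pi) - q (\<theta> + 1)" and "g = coef \<mu> A (\<theta> + 1)"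
  have v: "xr (\<theta> + 1) - pr (\<theta> + 1) = v" using gap_sol_boundary(1)[OF XR SR(2)] unfolding SR(3) by (simp add: v_def)
  define \<phi> where "\<phi> = (\<lambda>z. (z - v)\<^sup>2 / 2 - (1 - cos z) * g)"
  have d: "(\<phi> has_real_derivative (z - v) - sin z * g) (at z)" for z
    unfolding \<phi>_def by (auto intro!: derivative_eq_intros)
  have vv: "separatrix_velocity (1 - s) \<ge> 1" by (rule separatrix_velocity_ge_1) (use s in auto)
  define c where "c = separatrix (1 - s) - 2 * pi"
  have c: "- 3 / 2 \<le> c" "c \<le> -1"
  proof -
    have "4 * exp (- (1 - s)) \<le> 299 / 200" by (rule separatrix_tail_small) (use s in linarith)
    then show "- 3 / 2 \<le> c" using separatrix_bounds(4)[of "1 - s"] unfolding c_def by linarith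
    have neg: "c < 0" using separatrix_bounds(3)[of "1 - s"] by (simp add: c_def)
    have "1\<^sup>2 \<le> (separatrix_velocity (1 - s))\<^sup>2" using vv by (intro power_mono) auto
    also have "\<dots> = 2 * (1 - cos c)" using sin_cos_separatrix(2)[of "1 - s"] by (simp add: c_def cos_diff)
    also have "\<dots> \<le> c\<^sup>2" using one_minus_cos_bounds(2)[of c] by simp
    finally have "1 \<le> \<bar>c\<bar>" by (simp add: abs_le_square_iff[of 1 c, simplified])
    with neg show "c \<le> -1" by simp
  qed
  have near: "\<bar>xr (\<theta> + 1) - c\<bar> \<le> 1/200" "\<bar>pr (\<theta> + 1) - separatrix_velocity (1 - s)\<bar> \<le> 1/200"
    "\<bar>(y (\<theta> + 1) - 2 * pi) - c\<bar> \<le> 1/200" "\<bar>q (\<theta> + 1) - separatrix_velocity (1 - s)\<bar> \<le> 1/200"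
    using R_facts(3,4)[OF theta_in(1)] window_bounds(1,2)[of "\<theta> + 1"] mu_facts(3) by (simp_all add: c_def)
  have pos: "(z - v) - sin z * g > 0"
    if z: "min (xr (\<theta> + 1)) (y (\<theta> + 1) - 2 * pi) \<le> z" "z \<le> max (xr (\<theta> + 1)) (y (\<theta> + 1) - 2 * pi)" for z
  proof -
    have "pr (\<theta> + 1) \<ge> 1 / 2" "q (\<theta> + 1) \<ge> 1 / 2" using near vv by linarith+
    moreover have "xr (\<theta> + 1) \<le> z \<or> y (\<theta> + 1) - 2 * pi \<le> z" using z(1) by (auto simp: min_def split: if_splits)
    ultimately have "z - v \<ge> 1 / 2" using v v_def by argo
    moreover have "- 2 < z" "z < 0"
    proof -
      have "- 2 < xr (\<theta> + 1)" "xr (\<theta> + 1) < 0" "- 2 < y (\<theta> + 1) - 2 * pi" "y (\<theta> + 1) - 2 * pi < 0" using near c by linarith+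
      then show "- 2 < z" "z < 0" using z by (simp_all add: min_def max_def split: if_splits)
    qed
    then have "sin z < 0" using sin_gt_zero[of "- z"] pi_gt3 by simp
    moreover have "g > 0" using coef_near_1[of "\<theta> + 1"] unfolding g_def by linarith
    ultimately have "z - v \<ge> 1 / 2" "sin z * g < 0" by (simp_all add: mult_neg_pos)
    then show ?thesis by linarith
  qed
  have eq: "\<phi> (xr (\<theta> + 1)) = \<phi> (y (\<theta> + 1) - 2 * pi)"
  proof -
    have "pr (\<theta> + 1) = xr (\<theta> + 1) - v" using v by simp
    moreover have "q (\<theta> + 1) = (y (\<theta> + 1) - 2 * pi) - v" by (simp add: v_def)
    ultimately show ?thesis using assms unfolding Ep_def energy_def \<phi>_def g_def by (simp add: cos_diff)
  qed
  have mono: "a = b" if "\<phi> a = \<phi> b" "a \<le> b" "\<And>z. a \<le> z \<Longrightarrow> z \<le> b \<Longrightarrow> (z - v) - sin z * g > 0" for a b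
  proof (rule ccontr)
    assume "a \<noteq> b"
    then have "a < b" using that by simp
    then have "\<phi> a < \<phi> b" by (rule DERIV_pos_imp_increasing) (use d that(3) in blast)
    then show False using that by simp
  qed
  show x: "xr (\<theta> + 1) = y (\<theta> + 1) - 2 * pi"
  proof (cases "xr (\<theta> + 1) \<le> y (\<theta> + 1) - 2 * pi")
    case True
    show ?thesis by (rule mono[OF eq True]) (use pos True in \<open>auto simp: min_def max_def\<close>)
  next
    case False
    then show ?thesis using mono[OF eq[symmetric]] pos by (auto simp: min_def max_def)
  qed
  show "pr (\<theta> + 1) = q (\<theta> + 1)" using v x by (simp add: v_def)
qed

text \<open>
  The same argument before the crossing along the line \<open>x + p = u\<close>.
\<close>

lemma match_left:
  assumes "Em = 0" shows "xl (\<theta> - 1) = y (\<theta> - 1)" "pl (\<theta> - 1) = q (\<theta> - 1)"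
proof -
  define u g where "u = y (\<theta> - 1) + q (\<theta> - 1)" and "g = coef \<mu> A (\<theta> - 1)"
  have u: "xl (\<theta> - 1) + pl (\<theta> - 1) = u" using gap_sol_boundary(2)[OF XL SL(2)] unfolding SL(3) by (simp add: u_def)
  define \<phi> where "\<phi> = (\<lambda>z. (u - z)\<^sup>2 / 2 - (1 - cos z) * g)"
  have d: "(\<phi> has_real_derivative - (u - z) - sin z * g) (at z)" for z
    unfolding \<phi>_def by (auto intro!: derivative_eq_intros)
  have vv: "separatrix_velocity (- 1 - s) \<ge> 1" by (rule separatrix_velocity_ge_1) (use s in auto)
  define c where "c = separatrix (- 1 - s)"
  have c: "c \<le> 3 / 2" "1 \<le> c"
  proof -
    have "4 * exp (- (1 + s)) \<le> 299 / 200" by (rule separatrix_tail_small) (use s in linarith)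
    then show "c \<le> 3 / 2" using separatrix_bounds(2)[of "- 1 - s"] unfolding c_def by simp
    have neg: "c > 0" using separatrix_bounds(1)[of "- 1 - s"] by (simp add: c_def)
    have "1\<^sup>2 \<le> (separatrix_velocity (- 1 - s))\<^sup>2" using vv by (intro power_mono) auto
    also have "\<dots> = 2 * (1 - cos c)" using sin_cos_separatrix(2)[of "- 1 - s"] by (simp add: c_def)
    also have "\<dots> \<le> c\<^sup>2" using one_minus_cos_bounds(2)[of c] by simp
    finally have "1 \<le> \<bar>c\<bar>" by (simp add: abs_le_square_iff[of 1 c, simplified])
    with neg show "1 \<le> c" by simp
  qed
  have near: "\<bar>xl (\<theta> - 1) - c\<bar> \<le> 1/200" "\<bar>pl (\<theta> - 1) - separatrix_velocity (- 1 - s)\<bar> \<le> 1/200"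
    "\<bar>y (\<theta> - 1) - c\<bar> \<le> 1/200" "\<bar>q (\<theta> - 1) - separatrix_velocity (- 1 - s)\<bar> \<le> 1/200"
    using L_facts(3,4)[OF theta_in(2)] window_bounds(1,2)[of "\<theta> - 1"] mu_facts(3) by (simp_all add: c_def)
  have pos: "- (u - z) - sin z * g < 0"
    if z: "min (xl (\<theta> - 1)) (y (\<theta> - 1)) \<le> z" "z \<le> max (xl (\<theta> - 1)) (y (\<theta> - 1))" for z
  proof -
    have "pl (\<theta> - 1) \<ge> 1 / 2" "q (\<theta> - 1) \<ge> 1 / 2" using near vv by linarith+
    moreover have "z \<le> xl (\<theta> - 1) \<or> z \<le> y (\<theta> - 1)" using z(2) by (auto simp: max_def split: if_splits)
    ultimately have "u - z \<ge> 1 / 2" using u u_def by argo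
    moreover have "z < 2" "0 < z"
    proof -
      have "xl (\<theta> - 1) < 2" "0 < xl (\<theta> - 1)" "y (\<theta> - 1) < 2" "0 < y (\<theta> - 1)" using near c by linarith+
      then show "z < 2" "0 < z" using z by (simp_all add: min_def max_def split: if_splits)
    qed
    then have "sin z > 0" using sin_gt_zero[of z] pi_gt3 by simp
    moreover have "g > 0" using coef_near_1[of "\<theta> - 1"] unfolding g_def by linarith
    ultimately have "u - z \<ge> 1 / 2" "sin z * g > 0" by simp_all
    then show ?thesis by linarith
  qed
  have eq: "\<phi> (xl (\<theta> - 1)) = \<phi> (y (\<theta> - 1))"
  proof -
    have "pl (\<theta> - 1) = u - xl (\<theta> - 1)" using u by simp
    moreover have "q (\<theta> - 1) = u - y (\<theta> - 1)" by (simp add: u_def)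
    ultimately show ?thesis using assms unfolding Em_def energy_def \<phi>_def g_def by simp
  qed
  have mono: "a = b" if "\<phi> a = \<phi> b" "a \<le> b" "\<And>z. a \<le> z \<Longrightarrow> z \<le> b \<Longrightarrow> - (u - z) - sin z * g < 0" for a b
  proof (rule ccontr)
    assume "a \<noteq> b"
    then have "a < b" using that by simp
    then have "\<phi> a > \<phi> b" by (rule DERIV_neg_imp_decreasing) (use d that(3) in blast)
    then show False using that by simp
  qed
  show x: "xl (\<theta> - 1) = y (\<theta> - 1)"
  proof (cases "xl (\<theta> - 1) \<le> y (\<theta> - 1)")
    case True
    show ?thesis by (rule mono[OF eq True]) (use pos True in \<open>auto simp: min_def max_def\<close>)
  next
    case False
    then show ?thesis using mono[OF eq[symmetric]] pos by (auto simp: min_def max_def)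
  qed
  show "pl (\<theta> - 1) = q (\<theta> - 1)" using u x by (simp add: u_def)
qed

end

section \<open>Chains of crossings\<close>

text \<open>
  A sequence of \<open>k\<close> crossings near prescribed times \<open>\<theta> i\<close> that are separated by long gaps. The parameters of a broken orbit are the
  initial phase \<open>A\<close>, the time shifts \<open>s i\<close> and the velocity corrections \<open>e i\<close>.
\<close>

locale chain = pendulum f \<omega> F for f :: "real ^ 'n::finite \<Rightarrow> real" and \<omega> F +
  fixes \<mu> c0 l :: real and k :: nat and \<theta> :: "nat \<Rightarrow> real"
  assumes mu: "0 < \<mu>" "(30 * c0 + 110 * F) * \<mu> \<le> 1 / 200"
    and c0: "c0 \<ge> 5000 * (norm \<omega> + 1) * F" and l: "exp (- l / 5) \<le> \<mu>" "l > 0"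
    and k: "k \<ge> 1" and gaps: "\<And>i. Suc i < k \<Longrightarrow> \<theta> i + 2 + 2 * l \<le> \<theta> (Suc i)"
begin

text \<open>
  Gap \<open>j\<close> lies between the crossings \<open>j - 1\<close> and \<open>j\<close>; the gaps \<open>0\<close> and \<open>k\<close> are the asymptotic half-lines.
\<close>

definition gap_dom :: "nat \<Rightarrow> real set" where
  "gap_dom j = (if j = 0 then {..\<theta> 0 - 1} else if j = k then {\<theta> (j - 1) + 1..} else {\<theta> (j - 1) + 1..\<theta> j - 1})"

definition win :: "real ^ 'n \<Rightarrow> (nat \<Rightarrow> real) \<Rightarrow> (nat \<Rightarrow> real) \<Rightarrow> nat \<Rightarrow> (real \<Rightarrow> real) \<times> (real \<Rightarrow> real)" where
  "win A s e i = (SOME z. win_sol (coef \<mu> A) (\<theta> i) (separatrix (- s i)) (separatrix_velocity (- s i) + c0 * \<mu> * e i) (fst z) (snd z))"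

definition Y where "Y A s e i = fst (win A s e i)"
definition Q where "Q A s e i = snd (win A s e i)"

text \<open>
  The data of gap \<open>j\<close>, read off from the windows on its two sides. At the asymptotic ends there is no window and the
  value is a placeholder.
\<close>

definition va where "va A s e j = (if j = 0 then 0 else (Y A s e (j - 1) (\<theta> (j - 1) + 1) - 2 * pi) - Q A s e (j - 1) (\<theta> (j - 1) + 1))"
definition ub where "ub A s e j = (if j < k then Y A s e j (\<theta> j - 1) + Q A s e j (\<theta> j - 1) else 0)"

definition gap :: "real ^ 'n \<Rightarrow> (nat \<Rightarrow> real) \<Rightarrow> (nat \<Rightarrow> real) \<Rightarrow> nat \<Rightarrow> (real \<Rightarrow> real) \<times> (real \<Rightarrow> real)" where
  "gap A s e j = (SOME z. gap_sol (coef \<mu> A) (gap_dom j) (va A s e j) (ub A s e j) (fst z) (snd z))"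

definition X where "X A s e j = fst (gap A s e j)"
definition P where "P A s e j = snd (gap A s e j)"

lemma mu_small: "\<mu> * F \<le> 1 / 100" "(c0 + F) * \<mu> \<le> 1 / 20" "c0 \<ge> 0" "\<mu> \<le> 1"
proof -
  show c0': "c0 \<ge> 0" using c0 F1 by (smt (verit) mult_nonneg_nonneg norm_ge_zero)
  have p: "c0 * \<mu> \<ge> 0" "F * \<mu> \<ge> 0" using c0' mu F1 by auto
  have "30 * (c0 * \<mu>) + 110 * (F * \<mu>) \<le> 1 / 200" using mu(2) by (simp add: algebra_simps)
  then have 1: "F * \<mu> \<le> 1 / 22000" "c0 * \<mu> \<le> 1 / 6000" using p by linarith+
  then show "\<mu> * F \<le> 1 / 100" "(c0 + F) * \<mu> \<le> 1 / 20" by (simp_all add: algebra_simps)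
  have "1 * \<mu> \<le> F * \<mu>" using mu F1 by (intro mult_right_mono) auto
  with 1 show "\<mu> \<le> 1" by linarith
qed

lemma coef_near: "\<bar>coef \<mu> A t - 1\<bar> \<le> 1 / 100"
  using coef_bound[OF mu(1), of A t] mu_small(1) by linarith

lemma win: "win_sol (coef \<mu> A) (\<theta> i) (separatrix (- s i)) (separatrix_velocity (- s i) + c0 * \<mu> * e i) (Y A s e i) (Q A s e i)"
proof -
  have "\<exists>z. win_sol (coef \<mu> A) (\<theta> i) (separatrix (- s i)) (separatrix_velocity (- s i) + c0 * \<mu> * e i) (fst z) (snd z)"
    using win_sol_exists[OF continuous_coef coef_near] by fastforce
  then show ?thesis unfolding Y_def Q_def win_def by (rule someI_ex)
qed

lemma gap_dom_line: "j \<le> k \<Longrightarrow> line_interval (gap_dom j)"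
proof -
  assume j: "j \<le> k"
  show ?thesis
  proof (cases "j = 0 \<or> j = k")
    case False
    then have "\<theta> (j - 1) + 2 + 2 * l \<le> \<theta> j" using gaps[of "j - 1"] j by simp
    then have "\<theta> (j - 1) + 1 \<le> \<theta> j - 1" using l(2) by linarith
    then show ?thesis using False unfolding gap_dom_def line_interval_def by auto
  qed (auto simp: gap_dom_def line_interval_def)
qed

lemma gap: "j \<le> k \<Longrightarrow> gap_sol (coef \<mu> A) (gap_dom j) (va A s e j) (ub A s e j) (X A s e j) (P A s e j)"
proof -
  assume j: "j \<le> k"
  have "\<exists>z. gap_sol (coef \<mu> A) (gap_dom j) (va A s e j) (ub A s e j) (fst z) (snd z)"
    using gap_sol_exists[OF gap_dom_line[OF j] continuous_coef coef_near] by fastforce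
  then show ?thesis unfolding X_def P_def gap_def by (rule someI_ex)
qed

lemma gap_dom_ends:
  assumes "i < k"
  shows "bdd_above (gap_dom i)" "Sup (gap_dom i) = \<theta> i - 1" "bdd_below (gap_dom i) \<Longrightarrow> 2 * l \<le> \<theta> i - 1 - Inf (gap_dom i)"
    "bdd_below (gap_dom (Suc i))" "Inf (gap_dom (Suc i)) = \<theta> i + 1" "bdd_above (gap_dom (Suc i)) \<Longrightarrow> 2 * l \<le> Sup (gap_dom (Suc i)) - (\<theta> i + 1)"
    "bdd_below (gap_dom i) \<longleftrightarrow> i \<noteq> 0" "bdd_above (gap_dom (Suc i)) \<longleftrightarrow> Suc i \<noteq> k"
proof -
  have g: "\<theta> (i - 1) + 2 + 2 * l \<le> \<theta> i" if "i \<noteq> 0" using gaps[of "i - 1"] assms that by simp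
  have g': "\<theta> i + 2 + 2 * l \<le> \<theta> (Suc i)" if "Suc i \<noteq> k" using gaps[of i] assms that by simp
  show "bdd_above (gap_dom i)" using assms by (auto simp: gap_dom_def)
  show b: "bdd_below (gap_dom i) \<longleftrightarrow> i \<noteq> 0" using assms by (auto simp: gap_dom_def)
  show "Sup (gap_dom i) = \<theta> i - 1" using assms g l(2) by (cases "i = 0") (auto simp: gap_dom_def)
  show "2 * l \<le> \<theta> i - 1 - Inf (gap_dom i)" if "bdd_below (gap_dom i)"
    using assms g l(2) that b by (auto simp: gap_dom_def)
  show "bdd_below (gap_dom (Suc i))" by (auto simp: gap_dom_def)
  show b': "bdd_above (gap_dom (Suc i)) \<longleftrightarrow> Suc i \<noteq> k" by (auto simp: gap_dom_def)
  show "Inf (gap_dom (Suc i)) = \<theta> i + 1" using g' l(2) by (cases "Suc i = k") (auto simp: gap_dom_def)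
  show "2 * l \<le> Sup (gap_dom (Suc i)) - (\<theta> i + 1)" if "bdd_above (gap_dom (Suc i))"
    using g' l(2) that b' by (auto simp: gap_dom_def)
qed

definition admissible :: "(nat \<Rightarrow> real) \<Rightarrow> (nat \<Rightarrow> real) \<Rightarrow> bool" where
  "admissible s e \<longleftrightarrow> (\<forall>i<k. \<bar>s i\<bar> \<le> 1 / 100 \<and> \<bar>e i\<bar> \<le> 1)"

lemma data_bounds:
  assumes "admissible s e"
  shows "\<bar>va A s e j\<bar> \<le> 5 \<or> j > k" "\<bar>ub A s e j\<bar> \<le> 5"
proof -
  have w: "\<bar>Y A s e i (\<theta> i - 1) + Q A s e i (\<theta> i - 1)\<bar> \<le> 5" "\<bar>(Y A s e i (\<theta> i + 1) - 2 * pi) - Q A s e i (\<theta> i + 1)\<bar> \<le> 5" if "i < k" for i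
    using window_data_bound[OF mu(1) mu_small(1-3) _ _ win[of A i s e]] assms that by (auto simp: admissible_def)
  show "\<bar>va A s e j\<bar> \<le> 5 \<or> j > k" using w(2)[of "j - 1"] by (cases "j = 0") (auto simp: va_def)
  show "\<bar>ub A s e j\<bar> \<le> 5" using w(1)[of j] by (auto simp: ub_def)
qed

lemma crossing_instance:
  assumes "admissible s e" "i < k"
  shows "crossing f \<omega> F \<mu> A (\<theta> i) (s i) (e i) c0 l (gap_dom i) (gap_dom (Suc i)) (va A s e i) (ub A s e (Suc i))
    (Y A s e i) (Q A s e i) (X A s e i) (P A s e i) (X A s e (Suc i)) (P A s e (Suc i))"
proof unfold_locales
  show "0 < \<mu>" "(30 * c0 + 110 * F) * \<mu> \<le> 1 / 200" "exp (- l / 5) \<le> \<mu>" using mu l by auto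
  show "c0 \<ge> 0" by (rule mu_small)
  show "\<bar>s i\<bar> \<le> 1 / 100" "\<bar>e i\<bar> \<le> 1" using assms by (auto simp: admissible_def)
  show "l \<ge> 0" using l by simp
  show "line_interval (gap_dom i)" "line_interval (gap_dom (Suc i))" using assms(2) by (auto intro: gap_dom_line)
  show "win_sol (coef \<mu> A) (\<theta> i) (separatrix (- s i)) (separatrix_velocity (- s i) + c0 * \<mu> * e i) (Y A s e i) (Q A s e i)"
    by (rule win)
  show "gap_sol (coef \<mu> A) (gap_dom i) (va A s e i) (Y A s e i (\<theta> i - 1) + Q A s e i (\<theta> i - 1)) (X A s e i) (P A s e i)"
    using gap[of i A s e] assms(2) by (simp add: ub_def)
  show "gap_sol (coef \<mu> A) (gap_dom (Suc i)) (Y A s e i (\<theta> i + 1) - 2 * pi - Q A s e i (\<theta> i + 1)) (ub A s e (Suc i)) (X A s e (Suc i)) (P A s e (Suc i))"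
    using gap[of "Suc i" A s e] assms(2) by (simp add: va_def)
  show "\<bar>va A s e i\<bar> \<le> 5" "\<bar>ub A s e (Suc i)\<bar> \<le> 5" using data_bounds[OF assms(1)] assms(2) by (meson not_less_iff_gr_or_eq, blast)
qed (use gap_dom_ends[OF assms(2)] in auto)

text \<open>
  The momentum transfer and the two energy mismatches of crossing \<open>i\<close>.
\<close>

definition cellJ where "cellJ A s e i = crossing.J f \<omega> A (\<theta> i) (gap_dom i) (gap_dom (Suc i)) (Y A s e i) (X A s e i) (X A s e (Suc i))"
definition cellEp where "cellEp A s e i = crossing.Ep f \<omega> \<mu> A (\<theta> i) (Y A s e i) (Q A s e i) (X A s e (Suc i)) (P A s e (Suc i))"
definition cellEm where "cellEm A s e i = crossing.Em f \<omega> \<mu> A (\<theta> i) (Y A s e i) (Q A s e i) (X A s e i) (P A s e i)"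

lemma cell_balance:
  assumes "admissible s e" "i < k"
  shows "\<bar>(cellEm A s e i - cellEp A s e i) - \<mu> * (\<omega> \<bullet> cellJ A s e i)\<bar> \<le> 2700 * \<mu>\<^sup>2"
proof -
  interpret c: crossing f \<omega> F \<mu> A "\<theta> i" "s i" "e i" c0 l "gap_dom i" "gap_dom (Suc i)" "va A s e i" "ub A s e (Suc i)"
    "Y A s e i" "Q A s e i" "X A s e i" "P A s e i" "X A s e (Suc i)" "P A s e (Suc i)" by (rule crossing_instance[OF assms])
  show ?thesis using c.energy_balance c.end_energies unfolding cellEm_def cellEp_def cellJ_def by linarith
qed

text \<open>
  In the sum over all the crossings the energies in the middles of the gaps telescope, and at the two asymptotic ends they vanish. The
  identity is exact. If the total momentum transfer is orthogonal to \<open>\<omega>\<close>, the energy defects \<open>cellEm - cellEp\<close> sum to zero. So the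
  matching equations are dependent, which corresponds to the freedom of shifting the origin of time.
\<close>

lemma total_balance:
  assumes adm: "admissible s e"
  shows "(\<Sum>i<k. cellEm A s e i - cellEp A s e i) = \<mu> * (\<omega> \<bullet> (\<Sum>i<k. cellJ A s e i))"
proof -
  define E where "E j = (if j = 0 \<or> j = k then 0 else energy \<mu> A ((\<theta> (j - 1) + \<theta> j) / 2) (X A s e j ((\<theta> (j - 1) + \<theta> j) / 2)) (P A s e j ((\<theta> (j - 1) + \<theta> j) / 2)))" for j
  have "cellEm A s e i - cellEp A s e i = \<mu> * (\<omega> \<bullet> cellJ A s e i) + (E (Suc i) - E i)" if i: "i < k" for i
  proof -
    interpret c: crossing f \<omega> F \<mu> A "\<theta> i" "s i" "e i" c0 l "gap_dom i" "gap_dom (Suc i)" "va A s e i" "ub A s e (Suc i)"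
      "Y A s e i" "Q A s e i" "X A s e i" "P A s e i" "X A s e (Suc i)" "P A s e (Suc i)" by (rule crossing_instance[OF adm i])
    note g = gap_dom_ends[OF i]
    have 1: "c.eR = E (Suc i)"
    proof (cases "Suc i = k")
      case True
      then have "\<not> bdd_above c.R" using g(8) c.R_line(5) by simp
      then have "c.eR = 0" unfolding c.eR_def by (rule if_not_P)
      then show ?thesis using True by (simp add: E_def)
    next
      case False
      then have gd: "gap_dom (Suc i) = {\<theta> i + 1..\<theta> (Suc i) - 1}" "\<theta> i + 2 + 2 * l \<le> \<theta> (Suc i)" using gaps[of i] i by (auto simp: gap_dom_def)
      have "bdd_above (gap_dom (Suc i))" using g(8) False by simp
      then have "c.R = {\<theta> i + 1..(Sup (gap_dom (Suc i)) + \<theta> i + 1) / 2}" unfolding c.R_def by (rule if_P)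
      moreover have "Sup (gap_dom (Suc i)) = \<theta> (Suc i) - 1" using gd(2) l(2) unfolding gd(1) by simp
      ultimately have "c.R = {\<theta> i + 1..(\<theta> i + \<theta> (Suc i)) / 2}" by (simp add: add.commute)
      then have S: "Sup c.R = (\<theta> i + \<theta> (Suc i)) / 2" and b: "bdd_above c.R" using gd(2) l(2) by simp_all
      show ?thesis unfolding c.eR_def S using b False by (simp add: E_def)
    qed
    have 2: "c.eL = E i"
    proof (cases "i = 0")
      case True
      then have "\<not> bdd_below c.L" using g(7) c.L_line(5) by simp
      then have "c.eL = 0" unfolding c.eL_def by (rule if_not_P)
      then show ?thesis using True by (simp add: E_def)
    next
      case False
      then have gd: "gap_dom i = {\<theta> (i - 1) + 1..\<theta> i - 1}" "\<theta> (i - 1) + 2 + 2 * l \<le> \<theta> i" using gaps[of "i - 1"] i by (auto simp: gap_dom_def)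
      have "bdd_below (gap_dom i)" using g(7) False by simp
      then have "c.L = {(Inf (gap_dom i) + \<theta> i - 1) / 2..\<theta> i - 1}" unfolding c.L_def by (rule if_P)
      moreover have "Inf (gap_dom i) = \<theta> (i - 1) + 1" using gd(2) l(2) unfolding gd(1) by simp
      ultimately have "c.L = {(\<theta> (i - 1) + \<theta> i) / 2..\<theta> i - 1}" by (simp add: add.commute)
      then have S: "Inf c.L = (\<theta> (i - 1) + \<theta> i) / 2" and b: "bdd_below c.L" using gd(2) l(2) by simp_all
      show ?thesis unfolding c.eL_def S using b False i by (simp add: E_def)
    qed
    show ?thesis using c.energy_balance 1 2 unfolding cellEm_def cellEp_def cellJ_def by (simp add: algebra_simps)
  qed
  then have "(\<Sum>i<k. cellEm A s e i - cellEp A s e i) = (\<Sum>i<k. \<mu> * (\<omega> \<bullet> cellJ A s e i) + (E (Suc i) - E i))" by simp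
  also have "\<dots> = (\<Sum>i<k. \<mu> * (\<omega> \<bullet> cellJ A s e i)) + (E k - E 0)" by (simp only: sum.distrib sum_lessThan_telescope)
  also have "\<dots> = \<mu> * (\<omega> \<bullet> (\<Sum>i<k. cellJ A s e i))" by (simp add: E_def sum_distrib_left inner_sum_right)
  finally show ?thesis .
qed

context
  fixes An :: "nat \<Rightarrow> real ^ 'n" and sn en :: "nat \<Rightarrow> nat \<Rightarrow> real" and A s e
  assumes adm: "admissible s e" "\<And>n. admissible (sn n) (en n)"
    and lim: "An \<longlonglongrightarrow> A" "\<And>i. i < k \<Longrightarrow> (\<lambda>n. sn n i) \<longlonglongrightarrow> s i" "\<And>i. i < k \<Longrightarrow> (\<lambda>n. en n i) \<longlonglongrightarrow> e i"
begin

lemma coef_lim: "(\<lambda>n. \<mu> * F * norm (An n - A)) \<longlonglongrightarrow> 0" "(\<lambda>n. coef \<mu> (An n) t) \<longlonglongrightarrow> coef \<mu> A t"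
proof -
  have "(\<lambda>n. norm (An n - A)) \<longlonglongrightarrow> 0" using lim(1) by (simp add: LIM_zero tendsto_norm_zero)
  from tendsto_mult[OF tendsto_const[of "\<mu> * F"] this] show 1: "(\<lambda>n. \<mu> * F * norm (An n - A)) \<longlonglongrightarrow> 0" by simp
  show "(\<lambda>n. coef \<mu> (An n) t) \<longlonglongrightarrow> coef \<mu> A t"
    by (rule LIM_zero_cancel, rule Lim_null_comparison[OF _ 1]) (use coef_lip[OF mu(1)] in \<open>auto intro!: always_eventually\<close>)
qed

lemma win_lim:
  assumes i: "i < k" and t: "t \<in> {\<theta> i - 1..\<theta> i + 1}"
  shows "(\<lambda>n. Y (An n) (sn n) (en n) i t) \<longlonglongrightarrow> Y A s e i t" "(\<lambda>n. Q (An n) (sn n) (en n) i t) \<longlonglongrightarrow> Q A s e i t"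
proof -
  have cs: "isCont separatrix x" "isCont separatrix_velocity x" for x
    using separatrix_deriv[of "\<lambda>x. x" 1 x UNIV] separatrix_velocity_deriv[of "\<lambda>x. x" 1 x UNIV]
    by (auto intro!: DERIV_isCont)
  have 1: "(\<lambda>n. separatrix (- sn n i)) \<longlonglongrightarrow> separatrix (- s i)" "(\<lambda>n. separatrix_velocity (- sn n i)) \<longlonglongrightarrow> separatrix_velocity (- s i)"
    by (rule isCont_tendsto_compose[OF cs(1)] isCont_tendsto_compose[OF cs(2)], intro tendsto_intros lim i)+
  then have 2: "(\<lambda>n. separatrix_velocity (- sn n i) + c0 * \<mu> * en n i) \<longlonglongrightarrow> separatrix_velocity (- s i) + c0 * \<mu> * e i"
    by (intro tendsto_intros lim i)
  define d where "d n = \<bar>separatrix (- sn n i) - separatrix (- s i)\<bar> + \<bar>(separatrix_velocity (- sn n i) + c0 * \<mu> * en n i) - (separatrix_velocity (- s i) + c0 * \<mu> * e i)\<bar> + \<mu> * F * norm (An n - A)" for n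
  have d: "d \<longlonglongrightarrow> 0"
    unfolding d_def using tendsto_add[OF tendsto_add[OF tendsto_rabs_zero[OF LIM_zero[OF 1(1)]] tendsto_rabs_zero[OF LIM_zero[OF 2]]] coef_lim(1)] by simp
  note st = win_sol_stable[OF win[of "An n" i "sn n" "en n" for n] win[of A i s e] coef_near coef_lip[OF mu(1)] t, folded d_def]
  have 3: "(\<lambda>n. 3 * d n) \<longlonglongrightarrow> 0" "(\<lambda>n. 5 * d n) \<longlonglongrightarrow> 0"
    using tendsto_mult[OF tendsto_const[of 3] d] tendsto_mult[OF tendsto_const[of 5] d] by simp_all
  show "(\<lambda>n. Y (An n) (sn n) (en n) i t) \<longlonglongrightarrow> Y A s e i t"
    by (rule LIM_zero_cancel, rule Lim_null_comparison[OF _ 3(1)]) (use st(1) in \<open>auto intro!: always_eventually\<close>)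
  show "(\<lambda>n. Q (An n) (sn n) (en n) i t) \<longlonglongrightarrow> Q A s e i t"
    by (rule LIM_zero_cancel, rule Lim_null_comparison[OF _ 3(2)]) (use st(2) in \<open>auto intro!: always_eventually\<close>)
qed

lemma gap_lim:
  assumes j: "j \<le> k" and t: "t \<in> gap_dom j"
  shows "(\<lambda>n. X (An n) (sn n) (en n) j t) \<longlonglongrightarrow> X A s e j t" "(\<lambda>n. P (An n) (sn n) (en n) j t) \<longlonglongrightarrow> P A s e j t"
proof -
  have 1: "(\<lambda>n. va (An n) (sn n) (en n) j) \<longlonglongrightarrow> va A s e j"
    unfolding va_def using j by (cases "j = 0") (auto intro!: tendsto_intros win_lim)
  have 2: "(\<lambda>n. ub (An n) (sn n) (en n) j) \<longlonglongrightarrow> ub A s e j"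
    unfolding ub_def using j by (cases "j < k") (auto intro!: tendsto_intros win_lim)
  define d where "d n = \<bar>va (An n) (sn n) (en n) j - va A s e j\<bar> * left_weight (1/5) (gap_dom j) t + \<bar>ub (An n) (sn n) (en n) j - ub A s e j\<bar> * right_weight (1/5) (gap_dom j) t" for n
  have d: "d \<longlonglongrightarrow> 0"
    unfolding d_def using tendsto_add[OF tendsto_mult[OF tendsto_rabs_zero[OF LIM_zero[OF 1]] tendsto_const]
      tendsto_mult[OF tendsto_rabs_zero[OF LIM_zero[OF 2]] tendsto_const]] by fastforce
  have st: "\<bar>X (An n) (sn n) (en n) j t - X A s e j t\<bar> \<le> d n + 20 * (\<mu> * F * norm (An n - A))"
    "\<bar>P (An n) (sn n) (en n) j t - P A s e j t\<bar> \<le> 9 / 4 * d n + 41 * (\<mu> * F * norm (An n - A))" for n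
    unfolding d_def
    by (rule gap_sol_stable[OF gap_dom_line[OF j] gap[OF j] gap[OF j] coef_near coef_lip[OF mu(1)] t])+
  have 3: "(\<lambda>n. d n + 20 * (\<mu> * F * norm (An n - A))) \<longlonglongrightarrow> 0" "(\<lambda>n. 9 / 4 * d n + 41 * (\<mu> * F * norm (An n - A))) \<longlonglongrightarrow> 0"
    using tendsto_add[OF d tendsto_mult[OF tendsto_const[of 20] coef_lim(1)]]
      tendsto_add[OF tendsto_mult[OF tendsto_const[of "9/4"] d] tendsto_mult[OF tendsto_const[of 41] coef_lim(1)]] by simp_all
  show "(\<lambda>n. X (An n) (sn n) (en n) j t) \<longlonglongrightarrow> X A s e j t"
    by (rule LIM_zero_cancel, rule Lim_null_comparison[OF _ 3(1)]) (use st(1) in \<open>auto intro!: always_eventually\<close>)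
  show "(\<lambda>n. P (An n) (sn n) (en n) j t) \<longlonglongrightarrow> P A s e j t"
    by (rule LIM_zero_cancel, rule Lim_null_comparison[OF _ 3(2)]) (use st(2) in \<open>auto intro!: always_eventually\<close>)
qed

lemma energy_lim:
  assumes "xn \<longlonglongrightarrow> x" "pn \<longlonglongrightarrow> p" shows "(\<lambda>n. energy \<mu> (An n) t (xn n) (pn n)) \<longlonglongrightarrow> energy \<mu> A t x p"
  unfolding energy_def by (intro tendsto_intros assms coef_lim) auto

text \<open>
  Continuous dependence on the parameters: pointwise for the solutions by the stability estimates, and for the
  momentum transfer by dominated convergence with the uniform exponential bound.
\<close>

lemma cell_lim:
  assumes i: "i < k"
  shows "(\<lambda>n. cellEp (An n) (sn n) (en n) i) \<longlonglongrightarrow> cellEp A s e i" "(\<lambda>n. cellEm (An n) (sn n) (en n) i) \<longlonglongrightarrow> cellEm A s e i"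
    "(\<lambda>n. cellJ (An n) (sn n) (en n) i) \<longlonglongrightarrow> cellJ A s e i"
proof -
  interpret c: crossing f \<omega> F \<mu> A "\<theta> i" "s i" "e i" c0 l "gap_dom i" "gap_dom (Suc i)" "va A s e i" "ub A s e (Suc i)"
    "Y A s e i" "Q A s e i" "X A s e i" "P A s e i" "X A s e (Suc i)" "P A s e (Suc i)" by (rule crossing_instance[OF adm(1) i])
  have inst: "crossing f \<omega> F \<mu> (An n) (\<theta> i) (sn n i) (en n i) c0 l (gap_dom i) (gap_dom (Suc i)) (va (An n) (sn n) (en n) i) (ub (An n) (sn n) (en n) (Suc i))
    (Y (An n) (sn n) (en n) i) (Q (An n) (sn n) (en n) i) (X (An n) (sn n) (en n) i) (P (An n) (sn n) (en n) i) (X (An n) (sn n) (en n) (Suc i)) (P (An n) (sn n) (en n) (Suc i))" for n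
    by (rule crossing_instance[OF adm(2) i])
  have w: "\<theta> i + 1 \<in> {\<theta> i - 1..\<theta> i + 1}" "\<theta> i - 1 \<in> {\<theta> i - 1..\<theta> i + 1}" by auto
  have ik: "Suc i \<le> k" "i \<le> k" using i by auto
  show "(\<lambda>n. cellEp (An n) (sn n) (en n) i) \<longlonglongrightarrow> cellEp A s e i"
    unfolding cellEp_def crossing.Ep_def[OF inst] c.Ep_def
    by (intro tendsto_intros energy_lim win_lim[OF i w(1)] gap_lim[OF ik(1) c.theta_in(3)])
  show "(\<lambda>n. cellEm (An n) (sn n) (en n) i) \<longlonglongrightarrow> cellEm A s e i"
    unfolding cellEm_def crossing.Em_def[OF inst] c.Em_def
    by (intro tendsto_intros energy_lim win_lim[OF i w(2)] gap_lim[OF ik(2) c.theta_in(4)])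
  have kick_lim: "(\<lambda>n. kick (An n) (xn n) t) \<longlonglongrightarrow> kick A x t" if "(\<lambda>n. xn n t) \<longlonglongrightarrow> x t" for xn x t
  proof -
    have "isCont (grad f) z" for z using continuous_grad by (simp add: continuous_on_eq_continuous_at)
    then have "(\<lambda>n. grad f (t *\<^sub>R \<omega> + An n)) \<longlonglongrightarrow> grad f (t *\<^sub>R \<omega> + A)"
      by (rule isCont_tendsto_compose) (intro tendsto_intros lim)
    then show ?thesis unfolding kick_def by (intro tendsto_intros that)
  qed
  show "(\<lambda>n. cellJ (An n) (sn n) (en n) i) \<longlonglongrightarrow> cellJ A s e i"
    unfolding cellJ_def crossing.J_def[OF inst] c.J_def
  proof (rule integral_dominated_convergence[where w = "\<lambda>t. 1350 * F * exp (- (1/5) * \<bar>t - \<theta> i\<bar>)"])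
    show "c.cell_kick \<in> borel_measurable lborel" using c.cell_kick_integrable by (rule borel_measurable_integrable)
    show "crossing.cell_kick f \<omega> (An n) (\<theta> i) (gap_dom i) (gap_dom (Suc i)) (Y (An n) (sn n) (en n) i) (X (An n) (sn n) (en n) i) (X (An n) (sn n) (en n) (Suc i)) \<in> borel_measurable lborel" for n
      using crossing.cell_kick_integrable[OF inst] by (rule borel_measurable_integrable)
    show "integrable lborel (\<lambda>t. 1350 * F * exp (- (1/5) * \<bar>t - \<theta> i\<bar>))" using integrable_exp_abs(1)[of "1/5" "\<theta> i"] by simp
    show "AE t in lborel. norm (crossing.cell_kick f \<omega> (An n) (\<theta> i) (gap_dom i) (gap_dom (Suc i)) (Y (An n) (sn n) (en n) i) (X (An n) (sn n) (en n) i) (X (An n) (sn n) (en n) (Suc i)) t) \<le> 1350 * F * exp (- (1/5) * \<bar>t - \<theta> i\<bar>)" for n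
      using crossing.cell_kick_bound[OF inst] by (intro AE_I2)
    show "AE t in lborel. (\<lambda>n. crossing.cell_kick f \<omega> (An n) (\<theta> i) (gap_dom i) (gap_dom (Suc i)) (Y (An n) (sn n) (en n) i) (X (An n) (sn n) (en n) i) (X (An n) (sn n) (en n) (Suc i)) t) \<longlonglongrightarrow> c.cell_kick t"
    proof (intro AE_I2)
      fix t
      have RL: "crossing.R (\<theta> i) (gap_dom (Suc i)) = c.R" "crossing.L (\<theta> i) (gap_dom i) = c.L" by auto
      have "(\<lambda>n. indicator c.L t *\<^sub>R kick (An n) (X (An n) (sn n) (en n) i) t) \<longlonglongrightarrow> indicator c.L t *\<^sub>R kick A (X A s e i) t"
        using kick_lim[where xn = "\<lambda>n. X (An n) (sn n) (en n) i" and x = "X A s e i" and t = t, OF gap_lim(1)[OF ik(2)]] c.L_facts(1)[of t] by (cases "t \<in> c.L") auto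
      moreover have "(\<lambda>n. indicator c.R t *\<^sub>R kick (An n) (X (An n) (sn n) (en n) (Suc i)) t) \<longlonglongrightarrow> indicator c.R t *\<^sub>R kick A (X A s e (Suc i)) t"
        using kick_lim[where xn = "\<lambda>n. X (An n) (sn n) (en n) (Suc i)" and x = "X A s e (Suc i)" and t = t, OF gap_lim(1)[OF ik(1)]] c.R_facts(1)[of t] by (cases "t \<in> c.R") auto
      moreover have "(\<lambda>n. indicator {\<theta> i - 1..\<theta> i + 1} t *\<^sub>R kick (An n) (Y (An n) (sn n) (en n) i) t) \<longlonglongrightarrow> indicator {\<theta> i - 1..\<theta> i + 1} t *\<^sub>R kick A (Y A s e i) t"
        using kick_lim[where xn = "\<lambda>n. Y (An n) (sn n) (en n) i" and x = "Y A s e i" and t = t, OF win_lim(1)[OF i]] by (cases "t \<in> {\<theta> i - 1..\<theta> i + 1}") auto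
      ultimately show "(\<lambda>n. crossing.cell_kick f \<omega> (An n) (\<theta> i) (gap_dom i) (gap_dom (Suc i)) (Y (An n) (sn n) (en n) i) (X (An n) (sn n) (en n) i) (X (An n) (sn n) (en n) (Suc i)) t) \<longlonglongrightarrow> c.cell_kick t"
        unfolding crossing.cell_kick_def[OF inst] c.cell_kick_def by (intro tendsto_add)
    qed
  qed
qed

end

end

section \<open>Gluing the pieces to a heteroclinic orbit\<close>

text \<open>
  A point outside a closed set is not in its closure, so the other set decides there; at a common point the
  derivatives along the two sets agree by assumption.
\<close>

lemma DERIV_Un_closed:
  fixes f :: "real \<Rightarrow> real"
  assumes "closed S" "closed T" and "t \<in> S \<Longrightarrow> (f has_real_derivative D) (at t within S)"
    and "t \<in> T \<Longrightarrow> (f has_real_derivative D) (at t within T)"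
  shows "(f has_real_derivative D) (at t within S \<union> T)"
proof -
  have *: "((\<lambda>y. (f y - f t) / (y - t)) \<longlongrightarrow> D) (at t within U)"
    if "closed U" "t \<in> U \<Longrightarrow> (f has_real_derivative D) (at t within U)" for U
  proof (cases "t \<in> U")
    case False
    then have "trivial_limit (at t within U)" using that(1) by (auto simp: trivial_limit_within closed_limpt)
    then have "at t within U = bot" by (simp add: trivial_limit_def)
    then show ?thesis by simp
  qed (use that in \<open>simp add: has_field_derivative_iff\<close>)
  show ?thesis unfolding has_field_derivative_iff Lim_within_Un using *[of S] *[of T] assms by blast
qed

lemma DERIV_UN_closed:
  fixes f :: "real \<Rightarrow> real"
  assumes "finite I" "\<And>i. i \<in> I \<Longrightarrow> closed (T i)" "\<And>i. i \<in> I \<Longrightarrow> t \<in> T i \<Longrightarrow> (f has_real_derivative D) (at t within T i)"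
  shows "(f has_real_derivative D) (at t within (\<Union>i\<in>I. T i))"
  using assms
proof (induction I rule: finite_induct)
  case (insert i I)
  have "(f has_real_derivative D) (at t within T i \<union> (\<Union>i\<in>I. T i))"
    using insert by (intro DERIV_Un_closed closed_UN) auto
  then show ?case by simp
qed (simp add: has_field_derivative_iff)

lemma integral_upto_has_derivative:
  fixes h :: "real \<Rightarrow> 'a::euclidean_space"
  assumes i: "integrable lborel h" and c: "continuous_on UNIV h"
  shows "((\<lambda>t. LINT s:{..t}|lborel. h s) has_vector_derivative h t) (at t)"
proof -
  have si: "set_integrable lborel T h" if "T \<in> sets borel" for T
    using i that integrable_mult_indicator[of T lborel h] by (simp add: set_integrable_def)
  have eq: "(LINT s:{..u}|lborel. h s) = (LINT s:{..t - 1}|lborel. h s) + integral {t - 1..u} h" if "u \<in> {t - 1..t + 1}" for u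
  proof -
    have "{..u} = {..t - 1} \<union> {t - 1<..u}" using that by auto
    then have "(LINT s:{..u}|lborel. h s) = (LINT s:{..t - 1}|lborel. h s) + (LINT s:{t - 1<..u}|lborel. h s)"
      using set_integral_Un[OF _ si[of "{..t - 1}"] si[of "{t - 1<..u}"]] by (simp add: disjoint_iff)
    also have "(LINT s:{t - 1<..u}|lborel. h s) = (LINT s:{t - 1..u}|lborel. h s)"
      unfolding set_lebesgue_integral_def
    proof (rule integral_cong_AE)
      show "AE s in lborel. indicator {t - 1<..u} s *\<^sub>R h s = indicator {t - 1..u} s *\<^sub>R h s"
        using AE_lborel_singleton[of "t - 1"] by eventually_elim (auto simp: indicator_def)
    qed (use borel_measurable_integrable[OF i] in \<open>measurable\<close>)
    also have "\<dots> = integral {t - 1..u} h" by (rule set_borel_integral_eq_integral[OF si]) simp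
    finally show ?thesis .
  qed
  have "((\<lambda>u. integral {t - 1..u} h) has_vector_derivative h t) (at t within {t - 1..t + 1})"
    by (rule integral_has_vector_derivative) (auto intro: continuous_on_subset[OF c])
  then have "((\<lambda>u. (LINT s:{..t - 1}|lborel. h s) + integral {t - 1..u} h) has_vector_derivative h t) (at t within {t - 1..t + 1})"
    by (auto intro!: derivative_eq_intros)
  then have "((\<lambda>u. LINT s:{..u}|lborel. h s) has_vector_derivative h t) (at t within {t - 1..t + 1})"
    by (rule has_vector_derivative_transform[rotated 2]) (simp, rule eq)
  moreover have "at t within {t - 1..t + 1} = at t" by (rule at_within_interior) simp
  ultimately show ?thesis by simp
qed

lemma tail_integral_bound:
  fixes h :: "real \<Rightarrow> 'a::euclidean_space"
  assumes i: "integrable lborel h" and T: "T \<in> sets borel"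
    and b: "\<And>s. s \<in> T \<Longrightarrow> norm (h s) \<le> C * exp (- (1/5) * \<bar>s - \<theta>\<bar>)"
    and d: "\<And>s. s \<in> T \<Longrightarrow> \<bar>s - \<theta>\<bar> = \<bar>s - t\<bar> + \<bar>t - \<theta>\<bar>" and C: "C \<ge> 0"
  shows "norm (LINT s:T|lborel. h s) \<le> 10 * C * exp (- (1/5) * \<bar>t - \<theta>\<bar>)"
proof -
  have "norm (LINT s:T|lborel. h s) \<le> (LINT s|lborel. C * exp (- (1/5) * \<bar>t - \<theta>\<bar>) * exp (- (1/5) * \<bar>s - t\<bar>))"
    unfolding set_lebesgue_integral_def
  proof (rule Bochner_Integration.integral_norm_bound_integral)
    show "integrable lborel (\<lambda>s. indicator T s *\<^sub>R h s)" using i T by (simp add: integrable_mult_indicator)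
    show "integrable lborel (\<lambda>s. C * exp (- (1/5) * \<bar>t - \<theta>\<bar>) * exp (- (1/5) * \<bar>s - t\<bar>))"
      using integrable_exp_abs(1)[of "1/5" t] by simp
    fix s
    show "norm (indicator T s *\<^sub>R h s) \<le> C * exp (- (1/5) * \<bar>t - \<theta>\<bar>) * exp (- (1/5) * \<bar>s - t\<bar>)"
    proof (cases "s \<in> T")
      case True
      have "exp (- (1/5) * \<bar>s - \<theta>\<bar>) = exp (- (1/5) * \<bar>t - \<theta>\<bar>) * exp (- (1/5) * \<bar>s - t\<bar>)"
        unfolding d[OF True] by (simp add: exp_add[symmetric] algebra_simps)
      then show ?thesis using b[OF True] True by (simp add: mult.assoc)
    qed (use C in auto)
  qed
  also have "\<dots> = 10 * C * exp (- (1/5) * \<bar>t - \<theta>\<bar>)" using integrable_exp_abs(2)[of "1/5" t] by simp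
  finally show ?thesis .
qed

text \<open>
  All the points of the torus have the same momentum, hence the angle \<open>\<phi>\<close> does not contribute to the distance.
\<close>

lemma infdist_inv_torus_le:
  fixes \<phi> I I0 :: "real ^ 'n::finite" and q p :: real
  shows "infdist (\<phi>, I, q, p) (inv_torus I0) \<le> norm (I - I0) + \<bar>q - 2 * real m * pi\<bar> + \<bar>p\<bar>"
proof -
  have "(\<phi>, I0, 2 * real m * pi, 0) \<in> inv_torus I0"
    unfolding inv_torus_def by (auto intro!: exI[of _ "int m"])
  then have "infdist (\<phi>, I, q, p) (inv_torus I0) \<le> dist (\<phi>, I, q, p) (\<phi>, I0, 2 * real m * pi, 0)" by (rule infdist_le)
  also have "dist (\<phi>, I, q, p) (\<phi>, I0, 2 * real m * pi, 0) = norm (I - I0, q - 2 * real m * pi, p)"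
    by (simp add: dist_norm norm_Pair)
  also have "\<dots> \<le> norm (I - I0) + norm (q - 2 * real m * pi, p)" by (rule norm_Pair_le)
  also have "norm (q - 2 * real m * pi, p) \<le> \<bar>q - 2 * real m * pi\<bar> + \<bar>p\<bar>"
    using norm_Pair_le[of "q - 2 * real m * pi" p] by simp
  finally show ?thesis by simp
qed

lemma cos_sin_plus_turns: "cos (x + 2 * real j * pi) = cos x" "sin (x + 2 * real j * pi) = sin x"
  using sin_2npi[of j] cos_2npi[of j] by (simp_all add: cos_add sin_add)

context chain begin

lemma theta_order: "i < j \<Longrightarrow> j < k \<Longrightarrow> \<theta> i + 2 + 2 * l \<le> \<theta> j"
proof (induction j)
  case (Suc j)
  show ?case
  proof (cases "i = j")
    case True then show ?thesis using gaps[of j] Suc by simp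
  next
    case False
    then show ?thesis using Suc gaps[of j] l(2) by simp
  qed
qed simp

lemma theta_mono: "i \<le> j \<Longrightarrow> j < k \<Longrightarrow> \<theta> i \<le> \<theta> j"
  using theta_order[of i j] l(2) by (cases "i = j") auto

lemma gap_dom_mem: "t \<in> gap_dom j \<Longrightarrow> j \<le> k \<Longrightarrow> (j < k \<longrightarrow> t \<le> \<theta> j - 1) \<and> (j > 0 \<longrightarrow> \<theta> (j - 1) + 1 \<le> t)"
  using k by (auto simp: gap_dom_def split: if_splits)

end

text \<open>
  A broken orbit without energy mismatches is an orbit.
\<close>

locale matched_chain = chain f \<omega> F \<mu> c0 l k \<theta> for f :: "real ^ 'n::finite \<Rightarrow> real" and \<omega> F \<mu> c0 l k \<theta> +
  fixes A :: "real ^ 'n" and s e :: "nat \<Rightarrow> real"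
  assumes adm: "admissible s e" and match: "\<And>i. i < k \<Longrightarrow> cellEp A s e i = 0" "\<And>i. i < k \<Longrightarrow> cellEm A s e i = 0"
begin

abbreviation "XX \<equiv> X A s e"
abbreviation "PP \<equiv> P A s e"
abbreviation "YY \<equiv> Y A s e"
abbreviation "QQ \<equiv> Q A s e"
abbreviation "Lc i \<equiv> crossing.L (\<theta> i) (gap_dom i)"
abbreviation "Rc i \<equiv> crossing.R (\<theta> i) (gap_dom (Suc i))"
abbreviation "ck i \<equiv> crossing.cell_kick f \<omega> A (\<theta> i) (gap_dom i) (gap_dom (Suc i)) (YY i) (XX i) (XX (Suc i))"

lemma inst: "i < k \<Longrightarrow> crossing f \<omega> F \<mu> A (\<theta> i) (s i) (e i) c0 l (gap_dom i) (gap_dom (Suc i)) (va A s e i) (ub A s e (Suc i))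
    (YY i) (QQ i) (XX i) (PP i) (XX (Suc i)) (PP (Suc i))"
  by (rule crossing_instance[OF adm])

lemma Rc_eq: "i < k \<Longrightarrow> Rc i = (if Suc i = k then {\<theta> i + 1..} else {\<theta> i + 1..(\<theta> i + \<theta> (Suc i)) / 2})"
proof -
  assume i: "i < k"
  note d = crossing.R_def[OF inst[OF i]]
  show ?thesis
  proof (cases "Suc i = k")
    case True
    then have "\<not> bdd_above (gap_dom (Suc i))" using gap_dom_ends(8)[OF i] by simp
    then show ?thesis using True unfolding d by simp
  next
    case False
    then have b: "bdd_above (gap_dom (Suc i))" using gap_dom_ends(8)[OF i] by simp
    have "Suc i < k" using False i by simp
    from gap_dom_ends(2)[OF this] have S: "Sup (gap_dom (Suc i)) = \<theta> (Suc i) - 1" .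
    show ?thesis using False b unfolding d S by (simp add: add.commute)
  qed
qed

lemma Lc_eq: "i < k \<Longrightarrow> Lc i = (if i = 0 then {..\<theta> i - 1} else {(\<theta> (i - 1) + \<theta> i) / 2..\<theta> i - 1})"
proof -
  assume i: "i < k"
  note d = crossing.L_def[OF inst[OF i]]
  show ?thesis
  proof (cases "i = 0")
    case True
    then have "\<not> bdd_below (gap_dom i)" using gap_dom_ends(7)[OF i] by simp
    then show ?thesis using True unfolding d by simp
  next
    case False
    then have b: "bdd_below (gap_dom i)" using gap_dom_ends(7)[OF i] by simp
    have "i - 1 < k" "Suc (i - 1) = i" using False i by simp_all
    from gap_dom_ends(5)[OF this(1)] this(2) have S: "Inf (gap_dom i) = \<theta> (i - 1) + 1" by simp
    show ?thesis using False b unfolding d S by (simp add: add.commute)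
  qed
qed

lemma gap_split:
  assumes j: "j \<le> k" and t: "t \<in> gap_dom j"
  shows "(j < k \<and> t \<in> Lc j) \<or> (\<exists>i. j = Suc i \<and> i < k \<and> t \<in> Rc i)"
proof (cases j)
  case 0
  then show ?thesis using Lc_eq[of 0] k t by (auto simp: gap_dom_def)
next
  case (Suc i)
  then have i: "i < k" using j by simp
  show ?thesis
  proof (cases "j = k")
    case True
    then show ?thesis using Suc i t Rc_eq[OF i] by (auto simp: gap_dom_def)
  next
    case False
    then have jk: "j < k" using j by simp
    have "t \<in> {\<theta> i + 1..\<theta> j - 1}" using t Suc False by (auto simp: gap_dom_def)
    then show ?thesis using Rc_eq[OF i] Lc_eq[OF jk] Suc jk i by (auto simp: not_le)
  qed
qed

lemma unclipped: "j \<le> k \<Longrightarrow> t \<in> gap_dom j \<Longrightarrow> \<bar>XX j t\<bar> \<le> 3 / 2"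
  using gap_split[of j t] crossing.R_facts(5)[OF inst] crossing.L_facts(5)[OF inst] by blast

text \<open>
  The time line is covered by the gaps, tagged \<open>Inl\<close>, and the windows, tagged \<open>Inr\<close>. On gap or window number \<open>j\<close> the
  pendulum has already made \<open>j\<close> turns.
\<close>

definition piece :: "nat + nat \<Rightarrow> real set" where
  "piece m = (case m of Inl j \<Rightarrow> gap_dom j | Inr i \<Rightarrow> {\<theta> i - 1..\<theta> i + 1})"
definition piece_q :: "nat + nat \<Rightarrow> real \<Rightarrow> real" where
  "piece_q m t = (case m of Inl j \<Rightarrow> XX j t + 2 * real j * pi | Inr i \<Rightarrow> YY i t + 2 * real i * pi)"
definition piece_p :: "nat + nat \<Rightarrow> real \<Rightarrow> real" where
  "piece_p m t = (case m of Inl j \<Rightarrow> PP j t | Inr i \<Rightarrow> QQ i t)"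
definition pieces :: "(nat + nat) set" where "pieces = Inl ` {..k} \<union> Inr ` {..<k}"

lemma pieces_cover: "\<exists>m\<in>pieces. t \<in> piece m"
proof (cases "t \<le> \<theta> 0 - 1")
  case True
  then show ?thesis by (intro bexI[of _ "Inl 0"]) (auto simp: pieces_def piece_def gap_dom_def)
next
  case False
  define i where "i = Max {i. i < k \<and> \<theta> i - 1 \<le> t}"
  have fin: "finite {i. i < k \<and> \<theta> i - 1 \<le> t}" by auto
  have "0 \<in> {i. i < k \<and> \<theta> i - 1 \<le> t}" using False k by auto
  then have "i \<in> {i. i < k \<and> \<theta> i - 1 \<le> t}" unfolding i_def by (intro Max_in[OF fin]) blast
  then have i: "i < k" "\<theta> i - 1 \<le> t" by blast+
  show ?thesis
  proof (cases "t \<le> \<theta> i + 1")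
    case True
    then show ?thesis using i by (intro bexI[of _ "Inr i"]) (auto simp: pieces_def piece_def)
  next
    case False
    have "t < \<theta> (Suc i) - 1" if "Suc i < k"
    proof (rule ccontr)
      assume "\<not> t < \<theta> (Suc i) - 1"
      then have "Suc i \<in> {i. i < k \<and> \<theta> i - 1 \<le> t}" using that by simp
      from Max_ge[OF fin this] have "Suc i \<le> i" unfolding i_def .
      then show False by simp
    qed
    then have "t \<in> gap_dom (Suc i)" using False i by (auto simp: gap_dom_def not_le intro: less_imp_le)
    then show ?thesis using i by (intro bexI[of _ "Inl (Suc i)"]) (auto simp: pieces_def piece_def)
  qed
qed

lemma match_at:
  assumes i: "i < k"
  shows "XX (Suc i) (\<theta> i + 1) = YY i (\<theta> i + 1) - 2 * pi" "PP (Suc i) (\<theta> i + 1) = QQ i (\<theta> i + 1)"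
    "XX i (\<theta> i - 1) = YY i (\<theta> i - 1)" "PP i (\<theta> i - 1) = QQ i (\<theta> i - 1)"
  using crossing.match_right[OF inst[OF i] match(1)[OF i, unfolded cellEp_def]]
    crossing.match_left[OF inst[OF i] match(2)[OF i, unfolded cellEm_def]] by auto

lemma gap_window_meet:
  assumes j: "j \<le> k" and i: "i < k" and t: "t \<in> gap_dom j" "t \<in> {\<theta> i - 1..\<theta> i + 1}"
  shows "(j = i \<and> t = \<theta> i - 1) \<or> (j = Suc i \<and> t = \<theta> i + 1)"
proof (cases "j \<le> i")
  case True
  then have 1: "t \<le> \<theta> j - 1" using gap_dom_mem[OF t(1) j] i by simp
  have "j = i" using theta_order[of j i] True i 1 t(2) l(2) by (cases "j = i") auto
  then show ?thesis using 1 t(2) by auto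
next
  case False
  then have 1: "\<theta> (j - 1) + 1 \<le> t" using gap_dom_mem[OF t(1) j] by simp
  have "j - 1 = i"
  proof (rule ccontr)
    assume "j - 1 \<noteq> i"
    then have "i < j - 1" "j - 1 < k" using False j by auto
    from theta_order[OF this] show False using 1 t(2) l(2) by auto
  qed
  then show ?thesis using 1 t(2) False by auto
qed

lemma gap_gap_disjoint: "j < j' \<Longrightarrow> j' \<le> k \<Longrightarrow> t \<in> gap_dom j \<Longrightarrow> t \<in> gap_dom j' \<Longrightarrow> False"
  using gap_dom_mem[of t j] gap_dom_mem[of t j'] theta_mono[of j "j' - 1"] by fastforce

lemma window_window_disjoint: "i < i' \<Longrightarrow> i' < k \<Longrightarrow> t \<in> {\<theta> i - 1..\<theta> i + 1} \<Longrightarrow> t \<in> {\<theta> i' - 1..\<theta> i' + 1} \<Longrightarrow> False"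
  using theta_order[of i i'] l(2) by auto

text \<open>
  Gaps and windows meet only at the junctions, where vanishing energy mismatch means that positions and
  velocities agree; the turn made in the crossing is the difference \<open>2 * pi\<close> between the two normalisations.
\<close>

lemma pieces_consistent:
  assumes m: "m \<in> pieces" "m' \<in> pieces" and t: "t \<in> piece m" "t \<in> piece m'"
  shows "piece_q m t = piece_q m' t" "piece_p m t = piece_p m' t"
proof -
  have mixed: "piece_q (Inl j) t = piece_q (Inr i) t \<and> piece_p (Inl j) t = piece_p (Inr i) t"
    if "j \<le> k" "i < k" "t \<in> gap_dom j" "t \<in> {\<theta> i - 1..\<theta> i + 1}" for i j
    using gap_window_meet[OF that]
  proof (elim disjE conjE)
    assume "j = i" and t: "t = \<theta> i - 1"
    show ?thesis unfolding \<open>j = i\<close> t piece_q_def piece_p_def using match_at[OF that(2)] by simp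
  next
    assume "j = Suc i" and t: "t = \<theta> i + 1"
    show ?thesis unfolding \<open>j = Suc i\<close> t piece_q_def piece_p_def using match_at(1,2)[OF that(2)]
      by (simp add: algebra_simps)
  qed
  have "piece_q m t = piece_q m' t \<and> piece_p m t = piece_p m' t"
  proof (cases m)
    case mj: (Inl j)
    then have j: "j \<le> k" "t \<in> gap_dom j" using m t by (auto simp: pieces_def piece_def)
    show ?thesis
    proof (cases m')
      case m'j: (Inl j')
      then have j': "j' \<le> k" "t \<in> gap_dom j'" using m t by (auto simp: pieces_def piece_def)
      have "j = j'" using gap_gap_disjoint[of j j' t] gap_gap_disjoint[of j' j t] j j' by (meson linorder_neqE_nat)
      then show ?thesis using mj m'j by simp
    next
      case m'i: (Inr i)
      then have "i < k" "t \<in> {\<theta> i - 1..\<theta> i + 1}" using m t by (auto simp: pieces_def piece_def)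
      then show ?thesis using mixed j mj m'i by blast
    qed
  next
    case mi: (Inr i)
    then have i: "i < k" "t \<in> {\<theta> i - 1..\<theta> i + 1}" using m t by (auto simp: pieces_def piece_def)
    show ?thesis
    proof (cases m')
      case m'j: (Inl j)
      then have "j \<le> k" "t \<in> gap_dom j" using m t by (auto simp: pieces_def piece_def)
      then show ?thesis using mixed i mi m'j by metis
    next
      case m'i: (Inr i')
      then have i': "i' < k" "t \<in> {\<theta> i' - 1..\<theta> i' + 1}" using m t by (auto simp: pieces_def piece_def)
      have "i = i'" using window_window_disjoint[of i i' t] window_window_disjoint[of i' i t] i i' by (meson linorder_neqE_nat)
      then show ?thesis using mi m'i by simp
    qed
  qed
  then show "piece_q m t = piece_q m' t" "piece_p m t = piece_p m' t" by auto
qed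

definition q where "q t = piece_q (SOME m. m \<in> pieces \<and> t \<in> piece m) t"
definition p where "p t = piece_p (SOME m. m \<in> pieces \<and> t \<in> piece m) t"

lemma qp_eq:
  assumes "m \<in> pieces" "t \<in> piece m" shows "q t = piece_q m t" "p t = piece_p m t"
proof -
  have "(SOME m. m \<in> pieces \<and> t \<in> piece m) \<in> pieces \<and> t \<in> piece (SOME m. m \<in> pieces \<and> t \<in> piece m)"
    by (rule someI[of _ m]) (use assms in simp)
  then show "q t = piece_q m t" "p t = piece_p m t"
    unfolding q_def p_def using assms by (auto intro: pieces_consistent)
qed

lemma q_gap: "j \<le> k \<Longrightarrow> t \<in> gap_dom j \<Longrightarrow> q t = XX j t + 2 * real j * pi" "j \<le> k \<Longrightarrow> t \<in> gap_dom j \<Longrightarrow> p t = PP j t"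
  using qp_eq[of "Inl j" t] by (auto simp: pieces_def piece_def piece_q_def piece_p_def)

lemma q_window: "i < k \<Longrightarrow> t \<in> {\<theta> i - 1..\<theta> i + 1} \<Longrightarrow> q t = YY i t + 2 * real i * pi"
  using qp_eq[of "Inr i" t] by (auto simp: pieces_def piece_def piece_q_def)

lemma piece_deriv:
  assumes m: "m \<in> pieces" and t: "t \<in> piece m"
  shows "(piece_q m has_real_derivative piece_p m t) (at t within piece m)"
    "(piece_p m has_real_derivative coef \<mu> A t * sin (piece_q m t)) (at t within piece m)"
proof -
  have "(piece_q m has_real_derivative piece_p m t) (at t within piece m) \<and>
    (piece_p m has_real_derivative coef \<mu> A t * sin (piece_q m t)) (at t within piece m)"
  proof (cases m)
    case (Inl j)
    then have j: "j \<le> k" "t \<in> gap_dom j" using m t by (auto simp: pieces_def piece_def)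
    have "clip (XX j t) = XX j t" by (rule clip_id[OF unclipped[OF j]])
    then show ?thesis
      using gap_sol_deriv[OF gap[OF j(1), of A s e] j(2)] Inl
      by (auto simp: piece_q_def[abs_def] piece_p_def[abs_def] piece_def cos_sin_plus_turns intro!: derivative_eq_intros)
  next
    case (Inr i)
    then have i: "i < k" "t \<in> {\<theta> i - 1..\<theta> i + 1}" using m t by (auto simp: pieces_def piece_def)
    show ?thesis
      using win[of A i s e] i Inr
      by (auto simp: win_sol_def piece_q_def[abs_def] piece_p_def[abs_def] piece_def cos_sin_plus_turns intro!: derivative_eq_intros)
  qed
  then show "(piece_q m has_real_derivative piece_p m t) (at t within piece m)"
    "(piece_p m has_real_derivative coef \<mu> A t * sin (piece_q m t)) (at t within piece m)" by auto
qed

lemma piece_closed: "m \<in> pieces \<Longrightarrow> closed (piece m)"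
  using gap_dom_line line_interval_closed by (auto simp: pieces_def piece_def)

lemma qp_deriv: "(q has_real_derivative p t) (at t)" "(p has_real_derivative coef \<mu> A t * sin (q t)) (at t)"
proof -
  have fin: "finite pieces" by (simp add: pieces_def)
  have U: "(\<Union>m\<in>pieces. piece m) = UNIV" using pieces_cover by auto
  have "(q has_real_derivative p t) (at t within (\<Union>m\<in>pieces. piece m))"
  proof (rule DERIV_UN_closed[OF fin piece_closed])
    fix m assume m: "m \<in> pieces" "t \<in> piece m"
    show "(q has_real_derivative p t) (at t within piece m)"
      by (rule has_field_derivative_transform_within[OF _ zero_less_one m(2)])
         (use piece_deriv(1)[OF m] qp_eq[OF m] qp_eq(1)[OF m(1)] in auto)
  qed
  then show "(q has_real_derivative p t) (at t)" unfolding U .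
  have "(p has_real_derivative coef \<mu> A t * sin (q t)) (at t within (\<Union>m\<in>pieces. piece m))"
  proof (rule DERIV_UN_closed[OF fin piece_closed])
    fix m assume m: "m \<in> pieces" "t \<in> piece m"
    show "(p has_real_derivative coef \<mu> A t * sin (q t)) (at t within piece m)"
      by (rule has_field_derivative_transform_within[OF _ zero_less_one m(2)])
         (use piece_deriv(2)[OF m] qp_eq[OF m] qp_eq(2)[OF m(1)] in auto)
  qed
  then show "(p has_real_derivative coef \<mu> A t * sin (q t)) (at t)" unfolding U .
qed

lemma kick_q_gap: "j \<le> k \<Longrightarrow> t \<in> gap_dom j \<Longrightarrow> kick A q t = kick A (XX j) t"
  by (simp add: kick_def q_gap cos_sin_plus_turns)

lemma kick_q_window: "i < k \<Longrightarrow> t \<in> {\<theta> i - 1..\<theta> i + 1} \<Longrightarrow> kick A q t = kick A (YY i) t"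
  using q_window[of i t] by (simp add: kick_def cos_sin_plus_turns)

text \<open>
  The finitely many times at which two cells, or two pieces of one cell, meet.
\<close>

definition breakpoints :: "real set" where
  "breakpoints = (\<Union>i\<in>{..k}. {\<theta> i - 1, \<theta> i + 1, (\<theta> i + \<theta> (Suc i)) / 2})"

definition cell :: "nat \<Rightarrow> real set" where "cell i = Lc i \<union> {\<theta> i - 1..\<theta> i + 1} \<union> Rc i"

lemma cell_mem:
  assumes "i < k" "t \<in> cell i"
  shows "Suc i < k \<Longrightarrow> t \<le> (\<theta> i + \<theta> (Suc i)) / 2" "i > 0 \<Longrightarrow> (\<theta> (i - 1) + \<theta> i) / 2 \<le> t"
proof -
  have g: "\<theta> i + 2 + 2 * l \<le> \<theta> (Suc i)" if "Suc i < k" using gaps that by simp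
  have g': "\<theta> (i - 1) + 2 + 2 * l \<le> \<theta> i" if "i > 0" using gaps[of "i - 1"] that assms by simp
  show "t \<le> (\<theta> i + \<theta> (Suc i)) / 2" if "Suc i < k"
    using assms(2) g[OF that] l(2) that unfolding cell_def Lc_eq[OF assms(1)] Rc_eq[OF assms(1)] by (auto split: if_splits)
  show "(\<theta> (i - 1) + \<theta> i) / 2 \<le> t" if "i > 0"
    using assms(2) g'[OF that] l(2) that unfolding cell_def Lc_eq[OF assms(1)] Rc_eq[OF assms(1)] by (auto split: if_splits)
qed

lemma cells_disjoint:
  assumes "i < i'" "i' < k" "t \<in> cell i" "t \<in> cell i'" shows "t \<in> breakpoints"
proof -
  have 1: "t \<le> (\<theta> i + \<theta> (Suc i)) / 2" by (rule cell_mem(1)) (use assms in auto)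
  have 2: "(\<theta> (i' - 1) + \<theta> i') / 2 \<le> t" by (rule cell_mem(2)) (use assms in auto)
  have "\<theta> i \<le> \<theta> (i' - 1)" "\<theta> (Suc i) \<le> \<theta> i'" using assms by (auto intro: theta_mono)
  then have "t = (\<theta> i + \<theta> (Suc i)) / 2" using 1 2 by argo
  then show ?thesis using assms unfolding breakpoints_def by (intro UN_I[of i]) auto
qed

text \<open>
  The cells divide the time line at the middles of the gaps, so away from the breakpoints exactly one of them contributes.
\<close>

lemma sum_cell_kick:
  assumes t: "t \<notin> breakpoints" shows "(\<Sum>i<k. ck i t) = kick A q t"
proof -
  obtain m where m: "m \<in> pieces" "t \<in> piece m" using pieces_cover by blast
  have "\<exists>i<k. t \<in> cell i"
  proof (cases m)
    case (Inl j)
    then have "j \<le> k" "t \<in> gap_dom j" using m by (auto simp: pieces_def piece_def)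
    from gap_split[OF this] show ?thesis unfolding cell_def by auto
  next
    case (Inr i)
    then show ?thesis using m unfolding cell_def by (auto simp: pieces_def piece_def)
  qed
  then obtain i where i: "i < k" "t \<in> cell i" by blast
  interpret c: crossing f \<omega> F \<mu> A "\<theta> i" "s i" "e i" c0 l "gap_dom i" "gap_dom (Suc i)" "va A s e i" "ub A s e (Suc i)"
    "YY i" "QQ i" "XX i" "PP i" "XX (Suc i)" "PP (Suc i)" by (rule inst[OF i(1)])
  have "ck i' t = 0" if "i' < k" "i' \<noteq> i" for i'
  proof -
    have "t \<notin> cell i'" using cells_disjoint[of i i' t] cells_disjoint[of i' i t] that i t by (meson linorder_neqE_nat)
    then show ?thesis unfolding crossing.cell_kick_def[OF inst[OF that(1)]] cell_def by simp
  qed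
  then have "(\<Sum>i<k. ck i t) = (\<Sum>i'<k. if i' = i then ck i t else 0)" by (intro sum.cong) auto
  also have "\<dots> = ck i t" using i(1) by simp
  also have "\<dots> = kick A q t"
  proof -
    have ne: "t \<noteq> \<theta> i - 1" "t \<noteq> \<theta> i + 1" using t i(1) unfolding breakpoints_def by auto
    consider "t \<in> c.R" "t > \<theta> i + 1" | "t \<in> c.L" "t < \<theta> i - 1" | "t \<in> {\<theta> i - 1<..<\<theta> i + 1}"
      using i(2) ne c.R_facts(2)[of t] c.L_facts(2)[of t] unfolding cell_def by force
    then show ?thesis
    proof cases
      case 1
      then have "t \<notin> c.L" "t \<notin> {\<theta> i - 1..\<theta> i + 1}" using c.L_facts(2)[of t] by auto
      then show ?thesis using 1 kick_q_gap[of "Suc i" t] c.R_facts(1)[of t] i by (simp add: c.cell_kick_def)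
    next
      case 2
      then have "t \<notin> c.R" "t \<notin> {\<theta> i - 1..\<theta> i + 1}" using c.R_facts(2)[of t] by auto
      then show ?thesis using 2 kick_q_gap[of i t] c.L_facts(1)[of t] i by (simp add: c.cell_kick_def)
    next
      case 3
      then have "t \<notin> c.R" "t \<notin> c.L" "t \<in> {\<theta> i - 1..\<theta> i + 1}" using c.R_facts(2)[of t] c.L_facts(2)[of t] by auto
      then show ?thesis using kick_q_window[of i t] i by (simp add: c.cell_kick_def)
    qed
  qed
  finally show ?thesis .
qed

lemma continuous_kick_q: "continuous_on UNIV (kick A q)"
  by (intro continuous_kick DERIV_continuous_on) (use qp_deriv in auto)

lemma kick_q_integral: "integrable lborel (kick A q)" "(LINT t|lborel. kick A q t) = (\<Sum>i<k. cellJ A s e i)"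
proof -
  have AE: "AE t in lborel. (\<Sum>i<k. ck i t) = kick A q t"
  proof -
    have "finite breakpoints" by (simp add: breakpoints_def)
    then have "breakpoints \<in> null_sets lborel" by (rule finite_imp_null_set_lborel)
    from AE_not_in[OF this] show ?thesis by eventually_elim (rule sum_cell_kick)
  qed
  have i: "integrable lborel (\<lambda>t. \<Sum>i<k. ck i t)"
    by (intro Bochner_Integration.integrable_sum crossing.cell_kick_integrable[OF inst]) auto
  have meas: "kick A q \<in> borel_measurable lborel" using borel_measurable_continuous_onI[OF continuous_kick_q] by simp
  show "integrable lborel (kick A q)" by (rule integrable_cong_AE_imp[OF i meas]) (use AE in eventually_elim, simp)
  have "(LINT t|lborel. kick A q t) = (LINT t|lborel. (\<Sum>i<k. ck i t))"
    by (rule integral_cong_AE) (use AE meas i in auto)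
  also have "\<dots> = (\<Sum>i<k. LINT t|lborel. ck i t)"
    by (intro Bochner_Integration.integral_sum crossing.cell_kick_integrable[OF inst]) auto
  also have "\<dots> = (\<Sum>i<k. cellJ A s e i)" unfolding cellJ_def using crossing.J_def[OF inst] by (intro sum.cong) auto
  finally show "(LINT t|lborel. kick A q t) = (\<Sum>i<k. cellJ A s e i)" .
qed

lemma start_bounds:
  assumes "t \<le> \<theta> 0 - 1"
  shows "norm (kick A q t) \<le> 450 * F * exp (- (1/5) * \<bar>t - \<theta> 0\<bar>)" "\<bar>q t\<bar> \<le> 30 * exp (- (1/5) * \<bar>t - \<theta> 0\<bar>)" "\<bar>p t\<bar> \<le> 30 * exp (- (1/5) * \<bar>t - \<theta> 0\<bar>)"
proof -
  have k0: "0 < k" using k by simp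
  have g: "t \<in> gap_dom 0" "t \<in> Lc 0" using assms Lc_eq[OF k0] by (auto simp: gap_dom_def)
  show "norm (kick A q t) \<le> 450 * F * exp (- (1/5) * \<bar>t - \<theta> 0\<bar>)"
    using crossing.kick_bounds(2)[OF inst[OF k0] g(2)] kick_q_gap[of 0 t] g by simp
  show "\<bar>q t\<bar> \<le> 30 * exp (- (1/5) * \<bar>t - \<theta> 0\<bar>)" "\<bar>p t\<bar> \<le> 30 * exp (- (1/5) * \<bar>t - \<theta> 0\<bar>)"
    using crossing.L_facts(6,7)[OF inst[OF k0] g(2)] q_gap[of 0 t] g by simp_all
qed

lemma end_bounds:
  assumes "t \<ge> \<theta> (k - 1) + 1"
  shows "norm (kick A q t) \<le> 450 * F * exp (- (1/5) * \<bar>t - \<theta> (k - 1)\<bar>)"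
    "\<bar>q t - 2 * real k * pi\<bar> \<le> 30 * exp (- (1/5) * \<bar>t - \<theta> (k - 1)\<bar>)" "\<bar>p t\<bar> \<le> 30 * exp (- (1/5) * \<bar>t - \<theta> (k - 1)\<bar>)"
proof -
  have k0: "k - 1 < k" and Sk: "Suc (k - 1) = k" using k by auto
  have g: "t \<in> gap_dom k" "t \<in> Rc (k - 1)" using assms Rc_eq[OF k0] Sk k by (auto simp: gap_dom_def)
  show "norm (kick A q t) \<le> 450 * F * exp (- (1/5) * \<bar>t - \<theta> (k - 1)\<bar>)"
    using crossing.kick_bounds(1)[OF inst[OF k0] g(2)] kick_q_gap[of k t] g Sk by simp
  show "\<bar>q t - 2 * real k * pi\<bar> \<le> 30 * exp (- (1/5) * \<bar>t - \<theta> (k - 1)\<bar>)" "\<bar>p t\<bar> \<le> 30 * exp (- (1/5) * \<bar>t - \<theta> (k - 1)\<bar>)"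
    using crossing.R_facts(6,7)[OF inst[OF k0] g(2)] q_gap[of k t] g Sk by simp_all
qed

text \<open>
  The angles move linearly, and the momentum is the accumulated kick, normalised to be \<open>I0\<close> at \<open>-\<infinity>\<close>.
\<close>

definition orbit :: "real ^ 'n \<Rightarrow> real \<Rightarrow> 'n phase" where
  "orbit I0 t = (t *\<^sub>R \<omega> + A, I0 + \<mu> *\<^sub>R (LINT r:{..t}|lborel. kick A q r), q t, p t)"

lemma orbit_is_orbit: "is_orbit (hamiltonian \<omega> f \<mu>) (orbit I0)"
  unfolding is_orbit_def
proof
  fix t
  have "hamiltonian_field (hamiltonian \<omega> f \<mu>) (orbit I0 t) = (\<omega>, \<mu> *\<^sub>R kick A q t, p t, coef \<mu> A t * sin (q t))"
    unfolding orbit_def hamiltonian_field_explicit[OF diff] by (simp add: kick_def coef_def algebra_simps)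
  moreover have "((\<lambda>t. t *\<^sub>R \<omega> + A) has_vector_derivative \<omega>) (at t)" by (auto intro!: derivative_eq_intros)
  moreover have "((\<lambda>t. I0 + \<mu> *\<^sub>R (LINT r:{..t}|lborel. kick A q r)) has_vector_derivative \<mu> *\<^sub>R kick A q t) (at t)"
    using integral_upto_has_derivative[OF kick_q_integral(1) continuous_kick_q, of t] by (auto intro!: derivative_eq_intros)
  moreover have "(q has_vector_derivative p t) (at t)" "(p has_vector_derivative coef \<mu> A t * sin (q t)) (at t)"
    using qp_deriv[of t] by (simp_all add: has_real_derivative_iff_has_vector_derivative)
  ultimately show "(orbit I0 has_vector_derivative hamiltonian_field (hamiltonian \<omega> f \<mu>) (orbit I0 t)) (at t)"
    unfolding orbit_def[abs_def] by (auto intro!: has_vector_derivative_Pair)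
qed

text \<open>
  Before the first crossing position, velocity and the kick decay exponentially backward in time. The constant depends on \<open>F\<close> only, not on
  \<open>\<mu>\<close> or on the number of crossings, hence the time needed to leave a neighbourhood of the torus is bounded uniformly.
\<close>

lemma orbit_start:
  assumes "t \<le> \<theta> 0 - 1"
  shows "infdist (orbit I0 t) (inv_torus I0) \<le> (60 + 4500 * F) * exp (- (1/5) * \<bar>t - \<theta> 0\<bar>)"
proof -
  have "norm (LINT r:{..t}|lborel. kick A q r) \<le> 10 * (450 * F) * exp (- (1/5) * \<bar>t - \<theta> 0\<bar>)"
    by (rule tail_integral_bound[OF kick_q_integral(1)]) (use assms start_bounds(1) F1 in auto)
  then have "\<mu> * norm (LINT r:{..t}|lborel. kick A q r) \<le> 1 * (10 * (450 * F) * exp (- (1/5) * \<bar>t - \<theta> 0\<bar>))"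
    using mu(1) mu_small(4) by (intro mult_mono) auto
  moreover have "infdist (orbit I0 t) (inv_torus I0) \<le> \<mu> * norm (LINT r:{..t}|lborel. kick A q r) + \<bar>q t\<bar> + \<bar>p t\<bar>"
    using infdist_inv_torus_le[of _ "I0 + \<mu> *\<^sub>R (LINT r:{..t}|lborel. kick A q r)" "q t" "p t" I0 0] mu(1) unfolding orbit_def by simp
  ultimately show ?thesis using start_bounds(2,3)[OF assms] by (simp add: algebra_simps)
qed

lemma orbit_end:
  assumes "t \<ge> \<theta> (k - 1) + 1" and I1: "I1 = I0 + \<mu> *\<^sub>R (\<Sum>i<k. cellJ A s e i)"
  shows "infdist (orbit I0 t) (inv_torus I1) \<le> (60 + 4500 * F) * exp (- (1/5) * \<bar>t - \<theta> (k - 1)\<bar>)"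
proof -
  have si: "set_integrable lborel T (kick A q)" if "T \<in> sets borel" for T
    using kick_q_integral(1) that integrable_mult_indicator[of T lborel "kick A q"] by (simp add: set_integrable_def)
  have U: "{..t} \<union> {t<..} = UNIV" by auto
  have "(LINT r:UNIV|lborel. kick A q r) = (LINT r:{..t}|lborel. kick A q r) + (LINT r:{t<..}|lborel. kick A q r)"
    using set_integral_Un[OF _ si[of "{..t}"] si[of "{t<..}"]] unfolding U by (simp add: disjoint_iff)
  then have "(\<Sum>i<k. cellJ A s e i) = (LINT r:{..t}|lborel. kick A q r) + (LINT r:{t<..}|lborel. kick A q r)"
    using kick_q_integral(2) by (simp add: set_lebesgue_integral_def)
  then have d: "I0 + \<mu> *\<^sub>R (LINT r:{..t}|lborel. kick A q r) - I1 = - (\<mu> *\<^sub>R (LINT r:{t<..}|lborel. kick A q r))"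
    unfolding I1 by (simp add: algebra_simps)
  have "norm (LINT r:{t<..}|lborel. kick A q r) \<le> 10 * (450 * F) * exp (- (1/5) * \<bar>t - \<theta> (k - 1)\<bar>)"
    by (rule tail_integral_bound[OF kick_q_integral(1)]) (use assms(1) end_bounds(1) F1 in auto)
  then have "\<mu> * norm (LINT r:{t<..}|lborel. kick A q r) \<le> 1 * (10 * (450 * F) * exp (- (1/5) * \<bar>t - \<theta> (k - 1)\<bar>))"
    using mu(1) mu_small(4) by (intro mult_mono) auto
  moreover have "infdist (orbit I0 t) (inv_torus I1) \<le> \<mu> * norm (LINT r:{t<..}|lborel. kick A q r) + \<bar>q t - 2 * real k * pi\<bar> + \<bar>p t\<bar>"
    using infdist_inv_torus_le[of _ "I0 + \<mu> *\<^sub>R (LINT r:{..t}|lborel. kick A q r)" "q t" "p t" I1 k] mu(1) unfolding orbit_def d by simp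
  ultimately show ?thesis using end_bounds(2,3)[OF assms(1)] by (simp add: algebra_simps)
qed

lemma orbit_heteroclinic:
  assumes I1: "I1 = I0 + \<mu> *\<^sub>R (\<Sum>i<k. cellJ A s e i)"
  shows "heteroclinic (hamiltonian \<omega> f \<mu>) I0 I1 (orbit I0)"
  unfolding heteroclinic_def
proof (intro conjI orbit_is_orbit)
  let ?C = "60 + 4500 * F"
  have lim: "((\<lambda>t. ?C * exp (- (1/5) * \<bar>t - \<theta> 0\<bar>)) \<longlongrightarrow> 0) at_bot" "((\<lambda>t. ?C * exp (- (1/5) * \<bar>t - \<theta> (k - 1)\<bar>)) \<longlongrightarrow> 0) at_top"
    using tendsto_mult[OF tendsto_const[of ?C] tendsto_exp_abs(2)[of "1/5" "\<theta> 0"]] tendsto_mult[OF tendsto_const[of ?C] tendsto_exp_abs(1)[of "1/5" "\<theta> (k - 1)"]] by simp_all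
  show "((\<lambda>t. infdist (orbit I0 t) (inv_torus I0)) \<longlongrightarrow> 0) at_bot"
  proof (rule Lim_null_comparison[OF _ lim(1)])
    show "\<forall>\<^sub>F t in at_bot. norm (infdist (orbit I0 t) (inv_torus I0)) \<le> ?C * exp (- (1/5) * \<bar>t - \<theta> 0\<bar>)"
      using eventually_le_at_bot[of "\<theta> 0 - 1"] by eventually_elim (use orbit_start in \<open>simp add: infdist_nonneg\<close>)
  qed
  show "((\<lambda>t. infdist (orbit I0 t) (inv_torus I1)) \<longlongrightarrow> 0) at_top"
  proof (rule Lim_null_comparison[OF _ lim(2)])
    show "\<forall>\<^sub>F t in at_top. norm (infdist (orbit I0 t) (inv_torus I1)) \<le> ?C * exp (- (1/5) * \<bar>t - \<theta> (k - 1)\<bar>)"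
      using eventually_ge_at_top[of "\<theta> (k - 1) + 1"] by eventually_elim (use orbit_end[OF _ I1] in \<open>simp add: infdist_nonneg\<close>)
  qed
qed

end

section \<open>Solving the matching equations\<close>

context chain begin

lemma cellJ_close:
  assumes "admissible s e" "i < k"
  shows "norm (cellJ A s e i - melnikov_grad \<omega> f (A + (\<theta> i + s i) *\<^sub>R \<omega>)) \<le> 360 * (30 * c0 + 110 * F) * F * \<mu>"
  using crossing.J_close[OF crossing_instance[OF assms]] crossing.K1_def[OF crossing_instance[OF assms]]
  unfolding cellJ_def by simp

lemma cellEp_sign:
  assumes "admissible s e" "i < k"
  shows "e i = 1 \<Longrightarrow> cellEp A s e i \<ge> 0" "e i = -1 \<Longrightarrow> cellEp A s e i \<le> 0"
  using crossing.Ep_sign[OF crossing_instance[OF assms] c0] unfolding cellEp_def by auto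

text \<open>
  There are \<open>2 * k\<close> energy mismatches and \<open>CARD('n)\<close> momentum equations for the \<open>CARD('n) + 2 * k\<close> unknowns \<open>\<alpha>\<close>, \<open>s i\<close>, \<open>e i\<close>, where
  \<open>A = A0 + \<alpha>\<close>. Near the critical point \<open>A0\<close> the Melnikov gradient is its linearisation \<open>M\<close>, so crossing \<open>i\<close> transfers approximately the momentum
  \<open>\<mu> *\<^sub>R (M *v (\<alpha> + s i *\<^sub>R \<omega>))\<close>. The equations are combined so that each of them is close to one of the unknowns:
  
  \<^item> the mismatch after crossing \<open>i\<close> has the sign of \<open>e i\<close> for \<open>e i = \<plusminus>1\<close>;
  
  \<^item> the energy defect of crossing \<open>i\<close>, which is the difference of its two mismatches, divided by \<open>\<mu> * w\<close>, is close to \<open>h + s i\<close> with \<open>h = \<omega> \<bullet> (M *v \<alpha>) / w\<close>;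
  
  \<^item> \<open>Minv\<close> applied to the mean momentum transfer is close to \<open>\<alpha>\<close> plus the mean of the \<open>s i\<close> times \<open>\<omega>\<close>. Subtracting the mean of the scaled energy defects and adding \<open>h\<close>
  in the direction \<open>\<omega>\<close> leaves \<open>\<alpha>\<close>.
  
  Working with means keeps all the errors independent of \<open>k\<close>. At a common zero the energy defects are all equal and the momentum equation holds. Then
  the energy defects sum to \<open>\<omega> \<bullet> (I1 - I0) = 0\<close>, so they vanish one by one, and with them the mismatches before the crossings.
\<close>

theorem shooting:
  fixes A0 I0 I1 v :: "real ^ 'n" and M Minv :: "real ^ 'n ^ 'n"
  assumes inv: "Minv ** M = mat 1" "M ** Minv = mat 1" and m: "\<And>y. norm (Minv *v y) \<le> m * norm y"
    and w: "w = \<omega> \<bullet> (M *v \<omega>)" "w > 0" and \<rho>: "\<rho> > 0" "\<rho> \<le> 1 / 100"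
    and near: "\<And>\<alpha> s i. i < k \<Longrightarrow> (\<And>j. \<bar>\<alpha> $ j\<bar> \<le> \<rho>) \<Longrightarrow> \<bar>s\<bar> \<le> \<rho> \<Longrightarrow>
      norm (melnikov_grad \<omega> f (A0 + \<alpha> + (\<theta> i + s) *\<^sub>R \<omega>) - M *v (\<alpha> + s *\<^sub>R \<omega>)) \<le> \<epsilon>1"
    and \<epsilon>: "\<epsilon> = \<epsilon>1 + 360 * (30 * c0 + 110 * F) * F * \<mu>"
    and b: "b = (norm \<omega> * \<epsilon> + 2700 * \<mu>) / w" "b \<le> \<rho>" and small: "m * (\<epsilon> + norm v) + b * norm \<omega> \<le> \<rho>"
    and v: "v = (1 / (real k * \<mu>)) *\<^sub>R (I1 - I0)" and res: "\<omega> \<bullet> I0 = \<omega> \<bullet> I1"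
    and m0: "m \<ge> 0"
  shows "\<exists>A s e. matched_chain f \<omega> F \<mu> c0 l k \<theta> A s e \<and> I1 = I0 + \<mu> *\<^sub>R (\<Sum>i<k. cellJ A s e i)"
proof -
  have kp: "real k > 0" using k by simp
  define al where "al x = (\<chi> j. \<rho> * x (Inl j))" for x :: "'n + (nat + nat) \<Rightarrow> real"
  define ss where "ss x i = \<rho> * x (Inr (Inl i))" for x :: "'n + (nat + nat) \<Rightarrow> real" and i
  define ee where "ee x i = x (Inr (Inr i))" for x :: "'n + (nat + nat) \<Rightarrow> real" and i
  define Js where "Js x i = cellJ (A0 + al x) (ss x) (ee x) i" for x i
  define jump where "jump x i = cellEm (A0 + al x) (ss x) (ee x) i - cellEp (A0 + al x) (ss x) (ee x) i" for x i
  define g where "g x i = jump x i / (\<mu> * w)" for x i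
  define h where "h x = (\<omega> \<bullet> (M *v al x)) / w" for x
  define Z where "Z x = Minv *v ((1 / real k) *\<^sub>R (\<Sum>i<k. Js x i) - v) - ((\<Sum>i<k. g x i) / real k) *\<^sub>R \<omega> + h x *\<^sub>R \<omega>" for x
  define Fn where "Fn j x = (case j of Inl j \<Rightarrow> Z x $ j | Inr (Inl i) \<Rightarrow> g x i - h x
    | Inr (Inr i) \<Rightarrow> cellEp (A0 + al x) (ss x) (ee x) i)" for j x
  define Ix :: "('n + (nat + nat)) set" where "Ix = range Inl \<union> Inr ` (Inl ` {..<k} \<union> Inr ` {..<k})"
  have mem: "Inl j \<in> Ix" "Inr (Inl i) \<in> Ix \<longleftrightarrow> i < k" "Inr (Inr i) \<in> Ix \<longleftrightarrow> i < k" for j i by (auto simp: Ix_def)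
  have fin: "finite Ix" by (simp add: Ix_def)
  define inbox where "inbox x \<longleftrightarrow> (\<forall>j\<in>Ix. x j \<in> {-1..1})" for x :: "'n + (nat + nat) \<Rightarrow> real"
  have box: "admissible (ss x) (ee x)" "\<And>j. \<bar>al x $ j\<bar> \<le> \<rho>" "\<And>i. i < k \<Longrightarrow> \<bar>ss x i\<bar> \<le> \<rho>"
    if inb: "inbox x" for x
  proof -
    have x: "x j \<in> {-1..1}" if "j \<in> Ix" for j using inb that by (simp add: inbox_def)
    have sc: "\<bar>\<rho> * y\<bar> \<le> \<rho>" if "y \<in> {-1..1}" for y
      using mult_left_mono[of "\<bar>y\<bar>" 1 \<rho>] that \<rho>(1) by (simp add: abs_mult abs_le_iff)
    show al: "\<And>j. \<bar>al x $ j\<bar> \<le> \<rho>" unfolding al_def using sc x mem by simp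
    show s: "\<And>i. i < k \<Longrightarrow> \<bar>ss x i\<bar> \<le> \<rho>" unfolding ss_def using sc x mem by simp
    have "\<bar>ee x i\<bar> \<le> 1" if "i < k" for i using x[of "Inr (Inr i)"] mem that unfolding ee_def by auto
    then show "admissible (ss x) (ee x)" unfolding admissible_def using s \<rho>(2) by (meson order_trans)
  qed
  \<comment> \<open>The deviation of the momentum transfer from its linear model.\<close>
  define r where "r x i = Js x i - M *v (al x + ss x i *\<^sub>R \<omega>)" for x i
  have r: "norm (r x i) \<le> \<epsilon>" if x: "inbox x" and i: "i < k" for x i
  proof -
    have "r x i = (Js x i - melnikov_grad \<omega> f (A0 + al x + (\<theta> i + ss x i) *\<^sub>R \<omega>))
        + (melnikov_grad \<omega> f (A0 + al x + (\<theta> i + ss x i) *\<^sub>R \<omega>) - M *v (al x + ss x i *\<^sub>R \<omega>))"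
      by (simp add: r_def)
    also have "norm \<dots> \<le> 360 * (30 * c0 + 110 * F) * F * \<mu> + \<epsilon>1"
      unfolding Js_def by (intro norm_triangle_mono cellJ_close near box[OF x] i)
    finally show ?thesis using \<epsilon> by simp
  qed
  have gb: "\<bar>g x i - h x - ss x i\<bar> \<le> b" if x: "inbox x" and i: "i < k" for x i
  proof -
    have "\<bar>jump x i - \<mu> * (\<omega> \<bullet> Js x i)\<bar> \<le> 2700 * \<mu>\<^sup>2"
      unfolding jump_def Js_def by (rule cell_balance[OF box(1)[OF x] i])
    moreover have "\<omega> \<bullet> Js x i = w * h x + ss x i * w + \<omega> \<bullet> r x i"
      using w by (simp add: r_def h_def inner_diff_right inner_add_right matrix_vector_right_distrib matrix_vector_mult_scaleR)
    ultimately have 1: "\<bar>jump x i - \<mu> * (w * h x + ss x i * w + \<omega> \<bullet> r x i)\<bar> \<le> 2700 * \<mu>\<^sup>2" by simp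
    have "\<bar>\<omega> \<bullet> r x i\<bar> \<le> norm \<omega> * \<epsilon>"
      using Cauchy_Schwarz_ineq2[of \<omega> "r x i"] mult_left_mono[OF r[OF x i] norm_ge_zero[of \<omega>]] by simp
    then have 2: "\<bar>\<mu> * (\<omega> \<bullet> r x i)\<bar> \<le> \<mu> * (norm \<omega> * \<epsilon>)" using mu(1) by (simp add: abs_mult)
    have "(\<mu> * w) * (g x i - h x - ss x i) = jump x i - \<mu> * (w * h x + ss x i * w)"
      using mu(1) w(2) by (simp add: g_def field_simps)
    also have "\<dots> = (jump x i - \<mu> * (w * h x + ss x i * w + \<omega> \<bullet> r x i)) + \<mu> * (\<omega> \<bullet> r x i)"
      by (simp add: algebra_simps)
    finally have "\<bar>(\<mu> * w) * (g x i - h x - ss x i)\<bar> \<le> 2700 * \<mu>\<^sup>2 + \<mu> * (norm \<omega> * \<epsilon>)" using 1 2 by linarith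
    moreover have "(\<mu> * w) * b = 2700 * \<mu>\<^sup>2 + \<mu> * (norm \<omega> * \<epsilon>)"
      using w(2) by (simp add: b(1) power2_eq_square field_simps)
    moreover have "\<bar>(\<mu> * w) * (g x i - h x - ss x i)\<bar> = (\<mu> * w) * \<bar>g x i - h x - ss x i\<bar>"
      using mu(1) w(2) by (simp add: abs_mult)
    ultimately have "(\<mu> * w) * \<bar>g x i - h x - ss x i\<bar> \<le> (\<mu> * w) * b" by simp
    moreover have "\<mu> * w > 0" using mu(1) w(2) by simp
    ultimately show ?thesis by (meson mult_le_cancel_left_pos)
  qed
  have Zb: "norm (Z x - al x) \<le> \<rho>" if x: "inbox x" for x
  proof -
    define rr where "rr = (1 / real k) *\<^sub>R (\<Sum>i<k. r x i)"
    define bb where "bb = (\<Sum>i<k. g x i - h x - ss x i) / real k"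
    define sa where "sa = (\<Sum>i<k. ss x i) / real k"
    have "(\<Sum>i<k. Js x i) = (\<Sum>i<k. M *v (al x) + ss x i *\<^sub>R (M *v \<omega>) + r x i)"
      by (intro sum.cong) (auto simp: r_def matrix_vector_right_distrib matrix_vector_mult_scaleR)
    also have "\<dots> = real k *\<^sub>R (M *v al x) + (\<Sum>i<k. ss x i) *\<^sub>R (M *v \<omega>) + (\<Sum>i<k. r x i)"
      by (simp add: sum.distrib scaleR_sum_left sum_constant_scaleR del: sum_constant)
    finally have "(1 / real k) *\<^sub>R (\<Sum>i<k. Js x i) = M *v (al x + sa *\<^sub>R \<omega>) + rr"
      using kp by (simp add: sa_def rr_def matrix_vector_right_distrib matrix_vector_mult_scaleR scaleR_add_right divide_inverse mult.commute)
    then have "Minv *v ((1 / real k) *\<^sub>R (\<Sum>i<k. Js x i) - v) = (Minv ** M) *v (al x + sa *\<^sub>R \<omega>) + Minv *v (rr - v)"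
      by (simp add: matrix_vector_mul_assoc[symmetric] matrix_vector_right_distrib matrix_vector_mult_diff_distrib)
    then have 1: "Minv *v ((1 / real k) *\<^sub>R (\<Sum>i<k. Js x i) - v) = al x + sa *\<^sub>R \<omega> + Minv *v (rr - v)"
      by (simp add: inv)
    have 2: "(\<Sum>i<k. g x i) / real k = bb + h x + sa"
      using kp by (simp add: bb_def sa_def sum_subtractf sum.distrib field_simps)
    have "Z x - al x = Minv *v (rr - v) - bb *\<^sub>R \<omega>" unfolding Z_def 1 2 by (simp add: algebra_simps)
    then have "norm (Z x - al x) \<le> norm (Minv *v (rr - v)) + norm (bb *\<^sub>R \<omega>)" by (simp only: norm_triangle_ineq4)
    moreover have "norm (Minv *v (rr - v)) \<le> m * (\<epsilon> + norm v)"
    proof -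
      have "norm (\<Sum>i<k. r x i) \<le> real k * \<epsilon>"
        using sum_norm_bound[of "{..<k}" "r x" \<epsilon>] r[OF x] by simp
      then have "norm rr \<le> \<epsilon>" using kp by (simp add: rr_def field_simps)
      then have "norm (rr - v) \<le> \<epsilon> + norm v" using norm_triangle_ineq4[of rr v] by linarith
      then show ?thesis using m[of "rr - v"] mult_left_mono[OF _ m0] by (meson order_trans)
    qed
    moreover have "\<bar>bb\<bar> \<le> b"
    proof -
      have "\<bar>\<Sum>i<k. g x i - h x - ss x i\<bar> \<le> real k * b"
        using sum_norm_bound[of "{..<k}" "\<lambda>i. g x i - h x - ss x i" b] gb[OF x] by simp
      then show ?thesis using kp by (simp add: bb_def field_simps)
    qed
    then have "norm (bb *\<^sub>R \<omega>) \<le> b * norm \<omega>" by (simp add: mult_right_mono)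
    ultimately show ?thesis using small by linarith
  qed
  have "\<exists>x. (\<forall>j\<in>Ix. x j \<in> {-1..1}) \<and> (\<forall>i\<in>Ix. Fn i x = 0)"
  proof (rule poincare_miranda[OF fin])
    fix i and Xn :: "nat \<Rightarrow> 'n + (nat + nat) \<Rightarrow> real" and x
    assume i: "i \<in> Ix" and Xn': "\<And>n j. j \<in> Ix \<Longrightarrow> Xn n j \<in> {-1..1}" and lim: "\<And>j. j \<in> Ix \<Longrightarrow> (\<lambda>n. Xn n j) \<longlonglongrightarrow> x j"
    have "x j \<in> {-1..1}" if "j \<in> Ix" for j
      by (rule closed_sequentially[of "{-1..1}" "\<lambda>n. Xn n j" "x j", OF closed_real_atLeastAtMost]) (rule Xn'[OF that], rule lim[OF that])
    then have x: "inbox x" by (simp add: inbox_def)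
    have Xn: "inbox (Xn n)" for n using Xn' by (simp add: inbox_def)
    have all: "(\<lambda>n. al (Xn n)) \<longlonglongrightarrow> al x" unfolding al_def using lim mem by (intro tendsto_vec_lambda tendsto_intros) auto
    have A: "(\<lambda>n. A0 + al (Xn n)) \<longlonglongrightarrow> A0 + al x" by (intro tendsto_intros all)
    have sl: "(\<lambda>n. ss (Xn n) i) \<longlonglongrightarrow> ss x i" if "i < k" for i unfolding ss_def using lim mem that by (intro tendsto_intros) auto
    have el: "(\<lambda>n. ee (Xn n) i) \<longlonglongrightarrow> ee x i" if "i < k" for i unfolding ee_def using lim mem that by auto
    note cl = cell_lim[where An = "\<lambda>n. A0 + al (Xn n)" and sn = "\<lambda>n. ss (Xn n)" and en = "\<lambda>n. ee (Xn n)" and A = "A0 + al x" and s = "ss x" and e = "ee x", OF box(1)[OF x] box(1)[OF Xn] A sl el]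
    have Jl: "(\<lambda>n. Js (Xn n) i) \<longlonglongrightarrow> Js x i" if "i < k" for i unfolding Js_def by (rule cl(3)) (use that in auto)
    have Epl: "(\<lambda>n. cellEp (A0 + al (Xn n)) (ss (Xn n)) (ee (Xn n)) i) \<longlonglongrightarrow> cellEp (A0 + al x) (ss x) (ee x) i" if "i < k" for i
      by (rule cl(1)) (use that in auto)
    have Eml: "(\<lambda>n. cellEm (A0 + al (Xn n)) (ss (Xn n)) (ee (Xn n)) i) \<longlonglongrightarrow> cellEm (A0 + al x) (ss x) (ee x) i" if "i < k" for i
      by (rule cl(2)) (use that in auto)
    have gl: "(\<lambda>n. g (Xn n) i) \<longlonglongrightarrow> g x i" if "i < k" for i
      unfolding g_def jump_def using mu(1) w(2) by (intro tendsto_intros Epl Eml that) auto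
    have hl: "(\<lambda>n. h (Xn n)) \<longlonglongrightarrow> h x"
      unfolding h_def using w(2) by (intro tendsto_intros bounded_linear.tendsto[OF matrix_vector_mul_bounded_linear] all) auto
    have Zl: "(\<lambda>n. Z (Xn n)) \<longlonglongrightarrow> Z x"
      unfolding Z_def using kp by (intro tendsto_intros bounded_linear.tendsto[OF matrix_vector_mul_bounded_linear] Jl gl hl) auto
    show "(\<lambda>n. Fn i (Xn n)) \<longlonglongrightarrow> Fn i x"
    proof (cases i)
      case (Inl j)
      then show ?thesis using tendsto_vec_nth[OF Zl, of j] by (simp add: Fn_def)
    next
      case (Inr y)
      then show ?thesis using i mem gl hl Epl by (cases y) (auto simp: Fn_def intro!: tendsto_diff)
    qed
  next
    fix i and x :: "'n + (nat + nat) \<Rightarrow> real" assume i: "i \<in> Ix" and x': "\<And>j. j \<in> Ix \<Longrightarrow> x j \<in> {-1..1}" and e: "x i = -1"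
    have x: "inbox x" using x' by (simp add: inbox_def)
    show "Fn i x \<le> 0"
    proof (cases i)
      case (Inl j)
      have "al x $ j = - \<rho>" using e Inl by (simp add: al_def)
      then show ?thesis using component_le_norm_cart[of "Z x - al x" j] Zb[OF x] Inl by (simp add: Fn_def abs_le_iff)
    next
      case (Inr y)
      show ?thesis
      proof (cases y)
        case (Inl n)
        have "n < k" using i Inr Inl mem by auto
        moreover have "ss x n = - \<rho>" using e Inr Inl by (simp add: ss_def)
        ultimately show ?thesis using gb[OF x, of n] b(2) Inr Inl by (simp add: Fn_def abs_le_iff)
      next
        case n: (Inr n)
        have "n < k" using i Inr n mem by auto
        then show ?thesis using cellEp_sign(2)[OF box(1)[OF x], of n] e Inr n by (simp add: Fn_def ee_def)
      qed
    qed
  next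
    fix i and x :: "'n + (nat + nat) \<Rightarrow> real" assume i: "i \<in> Ix" and x': "\<And>j. j \<in> Ix \<Longrightarrow> x j \<in> {-1..1}" and e: "x i = 1"
    have x: "inbox x" using x' by (simp add: inbox_def)
    show "0 \<le> Fn i x"
    proof (cases i)
      case (Inl j)
      have "al x $ j = \<rho>" using e Inl by (simp add: al_def)
      then show ?thesis using component_le_norm_cart[of "Z x - al x" j] Zb[OF x] Inl by (simp add: Fn_def abs_le_iff)
    next
      case (Inr y)
      show ?thesis
      proof (cases y)
        case (Inl n)
        have "n < k" using i Inr Inl mem by auto
        moreover have "ss x n = \<rho>" using e Inr Inl by (simp add: ss_def)
        ultimately show ?thesis using gb[OF x, of n] b(2) Inr Inl by (simp add: Fn_def abs_le_iff)
      next
        case n: (Inr n)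
        have "n < k" using i Inr n mem by auto
        then show ?thesis using cellEp_sign(1)[OF box(1)[OF x], of n] e Inr n by (simp add: Fn_def ee_def)
      qed
    qed
  qed
  then obtain x where x: "inbox x" and zero: "\<And>j. j \<in> Ix \<Longrightarrow> Fn j x = 0" unfolding inbox_def by blast
  have Ep0: "cellEp (A0 + al x) (ss x) (ee x) i = 0" if "i < k" for i using zero[of "Inr (Inr i)"] mem that by (simp add: Fn_def)
  have g0: "g x i = h x" if "i < k" for i using zero[of "Inr (Inl i)"] mem that by (simp add: Fn_def)
  have "Z x $ j = 0" for j using zero[OF mem(1)[of j]] by (simp add: Fn_def)
  \<comment> \<open>At the zero the correction terms in the direction \<open>\<omega>\<close> cancel, since all the scaled energy defects equal \<open>h x\<close>.\<close>
  then have Z0: "Z x = 0" by (simp add: vec_eq_iff)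
  have "(\<Sum>i<k. g x i) / real k = h x" using g0 kp by simp
  then have "Minv *v ((1 / real k) *\<^sub>R (\<Sum>i<k. Js x i) - v) = 0" using Z0 by (simp add: Z_def)
  then have "(M ** Minv) *v ((1 / real k) *\<^sub>R (\<Sum>i<k. Js x i) - v) = 0" by (simp add: matrix_vector_mul_assoc[symmetric])
  then have "(1 / real k) *\<^sub>R (\<Sum>i<k. Js x i) = v" by (simp add: inv)
  then have "(real k * \<mu>) *\<^sub>R ((1 / real k) *\<^sub>R (\<Sum>i<k. Js x i)) = (real k * \<mu>) *\<^sub>R v" by simp
  then have S: "\<mu> *\<^sub>R (\<Sum>i<k. Js x i) = I1 - I0" using kp mu(1) by (simp add: v)
  have "(\<Sum>i<k. jump x i) = \<mu> * (\<omega> \<bullet> (\<Sum>i<k. Js x i))" unfolding jump_def Js_def by (rule total_balance[OF box(1)[OF x]])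
  also have "\<dots> = \<omega> \<bullet> (\<mu> *\<^sub>R (\<Sum>i<k. Js x i))" by simp
  also have "\<dots> = 0" unfolding S using res by (simp add: inner_diff_right)
  finally have "(\<Sum>i<k. jump x i) = 0" .
  moreover have j: "jump x i = \<mu> * w * h x" if "i < k" for i using g0[OF that] mu(1) w(2) by (simp add: g_def field_simps)
  ultimately have "real k * (\<mu> * w * h x) = 0" by simp
  then have "h x = 0" using kp mu(1) w(2) by simp
  then have "cellEm (A0 + al x) (ss x) (ee x) i = 0" if "i < k" for i using j[OF that] Ep0[OF that] by (simp add: jump_def)
  then have "matched_chain f \<omega> F \<mu> c0 l k \<theta> (A0 + al x) (ss x) (ee x)"
    using Ep0 box(1)[OF x] by unfold_locales auto
  moreover have "I1 = I0 + \<mu> *\<^sub>R (\<Sum>i<k. cellJ (A0 + al x) (ss x) (ee x) i)" using S unfolding Js_def by simp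
  ultimately show ?thesis by blast
qed

end

section \<open>Choice of the parameters and the diffusion time\<close>

text \<open>
  After the pause \<open>g\<close> the next crossing time is the first suitable return of the linear flow, which costs at most \<open>T\<close> more.
\<close>

lemma crossing_times_exist:
  fixes \<omega> :: "real ^ 'n::finite"
  assumes ret: "\<And>t. \<exists>s\<in>{t..t + T}. \<exists>k. norm (s *\<^sub>R \<omega> - (2 * pi) *\<^sub>R int_vec k) < \<delta>"
  shows "\<exists>\<theta>. \<forall>i. \<theta> i + g \<le> \<theta> (Suc i) \<and> \<theta> i \<le> \<theta> 0 + real i * (g + T) \<and> (\<exists>k. norm (\<theta> i *\<^sub>R \<omega> - (2 * pi) *\<^sub>R int_vec k) < \<delta>)"
proof -
  obtain nx where nx: "\<And>t. nx t \<in> {t..t + T}" "\<And>t. \<exists>k. norm (nx t *\<^sub>R \<omega> - (2 * pi) *\<^sub>R int_vec k) < \<delta>"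
    using ret by metis
  define \<theta> where "\<theta> = rec_nat (nx 0) (\<lambda>_ t. nx (t + g))"
  have S: "\<theta> 0 = nx 0" "\<theta> (Suc i) = nx (\<theta> i + g)" for i by (simp_all add: \<theta>_def)
  have "\<theta> i \<le> \<theta> 0 + real i * (g + T)" for i
  proof (induction i)
    case (Suc i)
    then show ?case using nx(1)[of "\<theta> i + g"] by (simp add: S(2) algebra_simps)
  qed simp
  moreover have "\<theta> i + g \<le> \<theta> (Suc i)" for i using nx(1)[of "\<theta> i + g"] by (simp add: S(2))
  moreover have "\<exists>k. norm (\<theta> i *\<^sub>R \<omega> - (2 * pi) *\<^sub>R int_vec k) < \<delta>" for i by (cases i) (simp_all add: S nx(2))
  ultimately show ?thesis by blast
qed

lemma ln_inverse_gt_1: "0 < \<mu> \<Longrightarrow> \<mu> < 1 / 3 \<Longrightarrow> ln (1 / \<mu> :: real) > 1"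
proof -
  assume mu: "0 < \<mu>" "\<mu> < 1 / 3"
  then have "3 < 1 / \<mu>" by (simp add: field_simps)
  then have "exp 1 < 1 / \<mu>" using exp_le by linarith
  then have "ln (exp 1) < ln (1 / \<mu>)" using mu(1) by (subst ln_less_cancel_iff) auto
  then show ?thesis by simp
qed

lemma diophantine_nonzero:
  assumes "\<gamma> > 0" "diophantine \<omega> \<gamma> \<tau>" shows "\<omega> \<noteq> 0"
proof
  assume 0: "\<omega> = 0"
  define k :: "int ^ 'a" where "k = (\<chi> i. 1)"
  have "k \<noteq> 0" "int_vec k \<noteq> 0" by (simp_all add: k_def int_vec_def vec_eq_iff)
  then have "\<gamma> / norm (int_vec k) powr \<tau> \<le> 0" using assms(2) 0 unfolding diophantine_def by fastforce
  then show False using assms(1) \<open>int_vec k \<noteq> 0\<close> by (simp add: divide_le_0_iff)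
qed

text \<open>
  A heteroclinic orbit together with times \<open>a \<le> b\<close> between which all of its crossings take place, and a quantitative form of
  the approach to the two tori that holds uniformly in \<open>\<mu>\<close>.
\<close>

definition fast_heteroclinic ::
    "real \<Rightarrow> ('n::finite phase \<Rightarrow> real) \<Rightarrow> real ^ 'n \<Rightarrow> real ^ 'n \<Rightarrow> (real \<Rightarrow> 'n phase) \<Rightarrow> real \<Rightarrow> real \<Rightarrow> bool" where
  "fast_heteroclinic D H I0 I1 x a b \<longleftrightarrow> heteroclinic H I0 I1 x \<and> a \<le> b \<and>
    (\<forall>t\<le>a - 1. infdist (x t) (inv_torus I0) \<le> D * exp (- (1/5) * \<bar>t - a\<bar>)) \<and>
    (\<forall>t\<ge>b + 1. infdist (x t) (inv_torus I1) \<le> D * exp (- (1/5) * \<bar>t - b\<bar>))"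

context pendulum begin

text \<open>
  The constants are chosen in the order \<open>\<kappa>\<close>, \<open>\<rho>\<close>, \<open>\<delta>\<close>, \<open>\<mu>0\<close>. Here \<open>\<kappa>\<close> is the relative error that the matching equations tolerate, and \<open>\<rho>\<close> is a
  radius on which the Melnikov gradient is linear up to that relative error. The return precision \<open>\<delta>\<close> makes all the crossing phases equal up to an error of the same kind,
  and the remaining errors are of order \<open>\<mu>\<close>. None of these depends on \<open>I0\<close> or \<open>I1\<close>: a larger momentum difference only increases the number \<open>k\<close> of crossings, which is
  chosen such that the momentum to be transferred per crossing is at most \<open>\<kappa> * \<rho> * \<mu>\<close>. Hence \<open>k\<close> is of order \<open>1 / \<mu>\<close>, and each crossing takes time
  \<open>2 + 2 * l + T\<close> with \<open>l = 5 * ln (1 / \<mu>)\<close>.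
\<close>

theorem drift_orbits:
  assumes min: "nondegenerate_minimum (melnikov \<omega> f) A0" and \<omega>: "\<omega> \<noteq> 0"
  shows "\<exists>\<mu>0>0. \<mu>0 \<le> 1 / 3 \<and> (\<forall>I0 I1. \<omega> \<bullet> I0 = \<omega> \<bullet> I1 \<longrightarrow> (\<exists>C\<ge>0. \<forall>\<mu>\<in>{0<..<\<mu>0}. \<exists>x a b.
    fast_heteroclinic (60 + 4500 * F) (hamiltonian \<omega> f \<mu>) I0 I1 x a b \<and> b - a \<le> C * (1 / \<mu> * ln (1 / \<mu>))))"
proof -
  define G where "G = melnikov_grad \<omega> f"
  have dG: "(melnikov \<omega> f has_derivative (\<lambda>h. G B \<bullet> h)) (at B)" for B
    unfolding G_def by (rule melnikov_has_derivative[OF diff f_le grad_le grad_lip F1])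
  have gG: "grad (melnikov \<omega> f) = G" by (rule ext) (rule grad_eqI[OF dG])
  obtain M where M: "(G has_derivative (\<lambda>h. M *v h)) (at A0)" "invertible M"
    using min unfolding nondegenerate_minimum_def gG by blast
  obtain Minv where inv: "M ** Minv = mat 1" "Minv ** M = mat 1" using M(2) unfolding invertible_def by blast
  have inj: "x = 0" if "M *v x = 0" for x
  proof -
    have "(Minv ** M) *v x = 0" using that by (simp add: matrix_vector_mul_assoc[symmetric])
    then show ?thesis by (simp add: inv)
  qed
  have loc: "\<forall>\<^sub>F B in nhds A0. melnikov \<omega> f A0 \<le> melnikov \<omega> f B" using min by (simp add: nondegenerate_minimum_def)
  note pd = nondegenerate_local_minimum_positive_definite[OF dG M(1) loc inj]
  have GA: "G A0 = 0" using pd(1) by simp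
  define w where "w = \<omega> \<bullet> (M *v \<omega>)"
  have w: "w > 0" unfolding w_def using pd(2) \<omega> by simp
  obtain m where m: "m > 0" "\<And>y. norm (Minv *v y) \<le> m * norm y"
    using bounded_linear.pos_bounded[OF matrix_vector_mul_bounded_linear[of Minv]] by (metis mult.commute)
  define c0 where "c0 = 5000 * (norm \<omega> + 1) * F"
  define K where "K = 360 * (30 * c0 + 110 * F) * F"
  have c0: "c0 \<ge> 0" unfolding c0_def using F1 by simp
  have K: "K > 0" "30 * c0 + 110 * F > 0" using c0 F1 by (auto simp: K_def add_nonneg_pos)
  define B where "B = norm \<omega> / w + 1"
  \<comment> \<open>Errors of relative size \<open>\<kappa>\<close> enter the equations of the \<open>s i\<close> with the factor \<open>B\<close> and those of \<open>\<alpha>\<close> with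
    the factor \<open>2 * m + B * norm \<omega>\<close>; both products have to stay below 1.\<close>
  define \<kappa> where "\<kappa> = 1 / (1 + 2 * m + B * (1 + norm \<omega>))"
  have B: "B > 0" using w by (simp add: B_def add_nonneg_pos)
  have den: "1 + 2 * m + B * (1 + norm \<omega>) > 0" using B m(1) by (intro add_pos_pos mult_pos_pos add_pos_nonneg) auto
  have \<kappa>: "\<kappa> > 0" using den by (simp add: \<kappa>_def)
  have \<kappa>1: "B * \<kappa> \<le> 1" "(2 * m + B * norm \<omega>) * \<kappa> \<le> 1"
    using den B m(1) mult_nonneg_nonneg[of B "norm \<omega>"] unfolding \<kappa>_def by (simp_all add: field_simps)
  \<comment> \<open>A bound for the norm of \<open>\<alpha> + s *\<^sub>R \<omega>\<close> relative to the size of the coordinates.\<close>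
  define N where "N = real CARD('n) + norm \<omega>"
  have N: "N > 0" by (simp add: N_def add_pos_nonneg)
  have "\<exists>d>0. \<forall>y. norm (y - A0) < d \<longrightarrow> norm (G y - G A0 - M *v (y - A0)) \<le> \<kappa> / (3 * N) * norm (y - A0)"
  proof -
    have "\<forall>e>0. \<exists>d>0. \<forall>y. norm (y - A0) < d \<longrightarrow> norm (G y - G A0 - M *v (y - A0)) \<le> e * norm (y - A0)"
      using M(1) unfolding has_derivative_at_alt by blast
    moreover have "\<kappa> / (3 * N) > 0" using \<kappa> N by simp
    ultimately show ?thesis by blast
  qed
  then obtain d where d: "d > 0" "\<And>y. norm (y - A0) < d \<Longrightarrow> norm (G y - M *v (y - A0)) \<le> \<kappa> / (3 * N) * norm (y - A0)"
    unfolding GA by auto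
  define \<rho> where "\<rho> = min (1 / 100) (d / (2 * N))"
  have \<rho>: "\<rho> > 0" "\<rho> \<le> 1 / 100" "\<rho> * N < d"
  proof -
    show "\<rho> > 0" "\<rho> \<le> 1 / 100" using d(1) N by (auto simp: \<rho>_def)
    have "\<rho> * N \<le> d / (2 * N) * N" using N by (intro mult_right_mono) (auto simp: \<rho>_def)
    then show "\<rho> * N < d" using N d(1) by simp
  qed
  define \<delta> where "\<delta> = \<kappa> * \<rho> / (24 * F)"
  have \<delta>: "\<delta> > 0" using \<kappa> \<rho> F1 by (simp add: \<delta>_def)
  obtain T where T: "T > 0" "\<And>t. \<exists>s\<in>{t..t + T}. \<exists>k. norm (s *\<^sub>R \<omega> - (2 * pi) *\<^sub>R int_vec k) < \<delta>"
    using torus_returns[OF \<delta>, of \<omega>] by blast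
  define \<mu>0 where "\<mu>0 = min (1 / 3) (min (1 / (200 * (30 * c0 + 110 * F))) (min (\<kappa> * \<rho> / (3 * K)) (\<kappa> * \<rho> * w / 2700)))"
  have \<mu>0: "\<mu>0 > 0" "\<mu>0 \<le> 1 / 3" using K \<kappa> \<rho> w by (auto simp: \<mu>0_def)
  have near: "norm (G (A0 + \<alpha> + (t + s) *\<^sub>R \<omega>) - M *v (\<alpha> + s *\<^sub>R \<omega>)) \<le> 2 * \<kappa> * \<rho> / 3"
    if t: "\<exists>k. norm (t *\<^sub>R \<omega> - (2 * pi) *\<^sub>R int_vec k) < \<delta>" and \<alpha>: "\<And>j. \<bar>\<alpha> $ j\<bar> \<le> \<rho>" and s: "\<bar>s\<bar> \<le> \<rho>" for \<alpha> s t
  proof -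
    obtain k where k: "norm (t *\<^sub>R \<omega> - (2 * pi) *\<^sub>R int_vec k) < \<delta>" using t by blast
    define y where "y = A0 + (\<alpha> + s *\<^sub>R \<omega>)"
    have "G (A0 + \<alpha> + (t + s) *\<^sub>R \<omega>) = G ((y + (t *\<^sub>R \<omega> - (2 * pi) *\<^sub>R int_vec k)) + (2 * pi) *\<^sub>R int_vec k)"
      by (simp add: y_def algebra_simps)
    also have "\<dots> = G (y + (t *\<^sub>R \<omega> - (2 * pi) *\<^sub>R int_vec k))"
      unfolding G_def by (rule melnikov_grad_periodic[OF torus_periodic_grad[OF periodic diff]])
    finally have 1: "norm (G (A0 + \<alpha> + (t + s) *\<^sub>R \<omega>) - G y) \<le> 8 * F * norm (t *\<^sub>R \<omega> - (2 * pi) *\<^sub>R int_vec k)"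
      using melnikov_grad_lipschitz[OF grad_le grad_lip F1, of \<omega> "y + (t *\<^sub>R \<omega> - (2 * pi) *\<^sub>R int_vec k)" y] unfolding G_def by simp
    have "8 * F * norm (t *\<^sub>R \<omega> - (2 * pi) *\<^sub>R int_vec k) \<le> 8 * F * \<delta>" using k F1 by (intro mult_left_mono) auto
    also have "\<dots> = \<kappa> * \<rho> / 3" using F1 by (simp add: \<delta>_def)
    finally have 2: "norm (G (A0 + \<alpha> + (t + s) *\<^sub>R \<omega>) - G y) \<le> \<kappa> * \<rho> / 3" using 1 by simp
    have "norm \<alpha> \<le> (\<Sum>j\<in>UNIV. \<bar>\<alpha> $ j\<bar>)" by (rule norm_le_l1_cart)
    also have "\<dots> \<le> real CARD('n) * \<rho>" using sum_bounded_above[of UNIV "\<lambda>j. \<bar>\<alpha> $ j\<bar>" \<rho>] \<alpha> by simp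
    finally have "norm (\<alpha> + s *\<^sub>R \<omega>) \<le> real CARD('n) * \<rho> + \<rho> * norm \<omega>"
      using norm_triangle_ineq[of \<alpha> "s *\<^sub>R \<omega>"] mult_right_mono[OF s norm_ge_zero[of \<omega>]] by simp
    then have 3: "norm (\<alpha> + s *\<^sub>R \<omega>) \<le> \<rho> * N" by (simp add: N_def algebra_simps)
    then have "norm (G y - M *v (\<alpha> + s *\<^sub>R \<omega>)) \<le> \<kappa> / (3 * N) * norm (\<alpha> + s *\<^sub>R \<omega>)"
      using d(2)[of y] \<rho>(3) by (simp add: y_def)
    also have "\<dots> \<le> \<kappa> / (3 * N) * (\<rho> * N)" using 3 \<kappa> N by (intro mult_left_mono) auto
    also have "\<dots> = \<kappa> * \<rho> / 3" using N by simp
    finally have 4: "norm (G y - M *v (\<alpha> + s *\<^sub>R \<omega>)) \<le> \<kappa> * \<rho> / 3" .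
    have "norm (G (A0 + \<alpha> + (t + s) *\<^sub>R \<omega>) - M *v (\<alpha> + s *\<^sub>R \<omega>)) \<le> \<kappa> * \<rho> / 3 + \<kappa> * \<rho> / 3"
      using norm_triangle_mono[OF 2 4] by simp
    then show ?thesis by simp
  qed
  have "\<exists>C\<ge>0. \<forall>\<mu>\<in>{0<..<\<mu>0}. \<exists>x a b.
    fast_heteroclinic (60 + 4500 * F) (hamiltonian \<omega> f \<mu>) I0 I1 x a b \<and> b - a \<le> C * (1 / \<mu> * ln (1 / \<mu>))"
    if res: "\<omega> \<bullet> I0 = \<omega> \<bullet> I1" for I0 I1
  proof (intro exI[of _ "(norm (I1 - I0) / (\<kappa> * \<rho>) + 1) * (12 + T)"] conjI ballI)
    show "0 \<le> (norm (I1 - I0) / (\<kappa> * \<rho>) + 1) * (12 + T)" using \<kappa> \<rho> T by simp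
    fix \<mu> assume "\<mu> \<in> {0<..<\<mu>0}"
    then have mu: "0 < \<mu>" "\<mu> < 1 / 3" "\<mu> < 1 / (200 * (30 * c0 + 110 * F))" "\<mu> < \<kappa> * \<rho> / (3 * K)" "\<mu> < \<kappa> * \<rho> * w / 2700"
      by (auto simp: \<mu>0_def)
    \<comment> \<open>With this half gap \<open>exp (-l / 5)\<close> equals \<open>\<mu>\<close>, so the crossings influence each other only at order \<open>\<mu>\<close>.\<close>
    define l where "l = 5 * ln (1 / \<mu>)"
    have ln1: "ln (1 / \<mu>) > 1" using ln_inverse_gt_1 mu(1,2) by simp
    have l: "exp (- l / 5) \<le> \<mu>" "l > 0" using mu(1,2) ln1 by (auto simp: l_def exp_minus ln_div)
    define k where "k = Suc (nat \<lceil>norm (I1 - I0) / (\<kappa> * \<rho> * \<mu>)\<rceil>)"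
    have q0: "norm (I1 - I0) / (\<kappa> * \<rho> * \<mu>) \<ge> 0" using \<kappa> \<rho> mu by simp
    have k: "k \<ge> 1" "real k \<ge> norm (I1 - I0) / (\<kappa> * \<rho> * \<mu>)" "real (k - 1) \<le> norm (I1 - I0) / (\<kappa> * \<rho> * \<mu>) + 1"
      unfolding k_def using q0 by (simp_all, linarith+)
    obtain \<theta> where \<theta>: "\<And>i. \<theta> i + (2 + 2 * l) \<le> \<theta> (Suc i)" "\<And>i. \<theta> i \<le> \<theta> 0 + real i * (2 + 2 * l + T)"
      "\<And>i. \<exists>k. norm (\<theta> i *\<^sub>R \<omega> - (2 * pi) *\<^sub>R int_vec k) < \<delta>"
      using crossing_times_exist[OF T(2), where g = "2 + 2 * l"] by blast
    interpret c: chain f \<omega> F \<mu> c0 l k \<theta>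
    proof unfold_locales
      show "(30 * c0 + 110 * F) * \<mu> \<le> 1 / 200" using mu(3) K(2) by (simp add: field_simps)
      show "\<theta> i + 2 + 2 * l \<le> \<theta> (Suc i)" for i using \<theta>(1)[of i] by simp
    qed (use mu l k in \<open>auto simp: c0_def\<close>)
    define \<epsilon> where "\<epsilon> = 2 * \<kappa> * \<rho> / 3 + 360 * (30 * c0 + 110 * F) * F * \<mu>"
    define b where "b = (norm \<omega> * \<epsilon> + 2700 * \<mu>) / w"
    define v where "v = (1 / (real k * \<mu>)) *\<^sub>R (I1 - I0)"
    have \<epsilon>: "\<epsilon> \<le> \<kappa> * \<rho>"
    proof -
      have "K * \<mu> \<le> \<kappa> * \<rho> / 3" using mu(4) K(1) by (simp add: field_simps)
      then show ?thesis unfolding \<epsilon>_def K_def by argo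
    qed
    have b: "b \<le> B * (\<kappa> * \<rho>)"
    proof -
      have "norm \<omega> * \<epsilon> \<le> norm \<omega> * (\<kappa> * \<rho>)" using \<epsilon> by (intro mult_left_mono) auto
      moreover have "2700 * \<mu> \<le> w * (\<kappa> * \<rho>)" using mu(5) by (simp add: field_simps)
      ultimately have "b \<le> (norm \<omega> * (\<kappa> * \<rho>) + w * (\<kappa> * \<rho>)) / w" unfolding b_def using w by (intro divide_right_mono) auto
      also have "\<dots> = B * (\<kappa> * \<rho>)" using w by (simp add: B_def field_simps)
      finally show ?thesis .
    qed
    have nv: "norm v \<le> \<kappa> * \<rho>"
    proof -
      have "norm (I1 - I0) \<le> real k * (\<kappa> * \<rho> * \<mu>)" using k(2) \<kappa> \<rho> mu(1) by (simp add: pos_divide_le_eq)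
      moreover have "norm v = norm (I1 - I0) / (real k * \<mu>)" using mu(1) by (simp add: v_def)
      ultimately show ?thesis using k(1) mu(1) by (simp add: pos_divide_le_eq mult_ac)
    qed
    have b1: "b \<le> \<rho>"
    proof -
      have "B * (\<kappa> * \<rho>) \<le> 1 * \<rho>" using mult_right_mono[OF \<kappa>1(1), of \<rho>] \<rho> by (simp add: mult.assoc)
      then show ?thesis using b by simp
    qed
    have sm: "m * (\<epsilon> + norm v) + b * norm \<omega> \<le> \<rho>"
    proof -
      have "m * (\<epsilon> + norm v) + b * norm \<omega> \<le> m * (\<kappa> * \<rho> + \<kappa> * \<rho>) + (B * (\<kappa> * \<rho>)) * norm \<omega>"
        using \<epsilon> nv b m(1) by (intro add_mono mult_mono mult_right_mono) (auto simp: \<epsilon>_def intro!: add_nonneg_nonneg mult_nonneg_nonneg less_imp_le[OF \<kappa>] less_imp_le[OF \<rho>(1)] less_imp_le[OF mu(1)] c0 order_trans[OF zero_le_one F1])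
      also have "\<dots> = ((2 * m + B * norm \<omega>) * \<kappa>) * \<rho>" by (simp add: algebra_simps)
      also have "\<dots> \<le> 1 * \<rho>" by (rule mult_right_mono[OF \<kappa>1(2)]) (use \<rho> in simp)
      finally show ?thesis by simp
    qed
    have "\<exists>A s e. matched_chain f \<omega> F \<mu> c0 l k \<theta> A s e \<and> I1 = I0 + \<mu> *\<^sub>R (\<Sum>i<k. c.cellJ A s e i)"
    proof (rule c.shooting[OF inv(2,1) m(2) w_def w \<rho>(1,2) _ \<epsilon>_def b_def b1 sm v_def res])
      show "norm (melnikov_grad \<omega> f (A0 + \<alpha> + (\<theta> i + s) *\<^sub>R \<omega>) - M *v (\<alpha> + s *\<^sub>R \<omega>)) \<le> 2 * \<kappa> * \<rho> / 3"
        if "\<And>j. \<bar>\<alpha> $ j\<bar> \<le> \<rho>" "\<bar>s\<bar> \<le> \<rho>" for \<alpha> s i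
        using near[OF \<theta>(3) that] unfolding G_def .
    qed (use m in auto)
    then obtain A s e where mc: "matched_chain f \<omega> F \<mu> c0 l k \<theta> A s e" and I1: "I1 = I0 + \<mu> *\<^sub>R (\<Sum>i<k. c.cellJ A s e i)" by blast
    interpret o: matched_chain f \<omega> F \<mu> c0 l k \<theta> A s e by (rule mc)
    have span: "\<theta> (k - 1) - \<theta> 0 \<le> (norm (I1 - I0) / (\<kappa> * \<rho>) + 1) * (12 + T) * (1 / \<mu> * ln (1 / \<mu>))"
    proof -
      have "\<theta> (k - 1) - \<theta> 0 \<le> real (k - 1) * (2 + 2 * l + T)" using \<theta>(2)[of "k - 1"] by simp
      also have "\<dots> \<le> ((norm (I1 - I0) / (\<kappa> * \<rho>) + 1) * (1 / \<mu>)) * ((12 + T) * ln (1 / \<mu>))"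
      proof (rule mult_mono)
        have "1 \<le> 1 / \<mu>" using mu by (simp add: field_simps)
        then show "real (k - 1) \<le> (norm (I1 - I0) / (\<kappa> * \<rho>) + 1) * (1 / \<mu>)" using k(3) by (simp add: algebra_simps)
        show "2 + 2 * l + T \<le> (12 + T) * ln (1 / \<mu>)"
          using mult_left_mono[of 1 "ln (1 / \<mu>)" "2 + T"] ln1 T(1) by (simp add: l_def algebra_simps)
      qed (use l T \<kappa> \<rho> mu in auto)
      finally show ?thesis by (simp add: mult_ac)
    qed
    have "fast_heteroclinic (60 + 4500 * F) (hamiltonian \<omega> f \<mu>) I0 I1 (o.orbit I0) (\<theta> 0) (\<theta> (k - 1))"
      unfolding fast_heteroclinic_def
      by (intro conjI allI impI o.orbit_heteroclinic[OF I1] o.orbit_start o.orbit_end[OF _ I1] c.theta_mono)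
        (use k(1) in auto)
    then show "\<exists>x a b. fast_heteroclinic (60 + 4500 * F) (hamiltonian \<omega> f \<mu>) I0 I1 x a b \<and>
      b - a \<le> (norm (I1 - I0) / (\<kappa> * \<rho>) + 1) * (12 + T) * (1 / \<mu> * ln (1 / \<mu>))"
      using span by blast
  qed
  then show ?thesis using \<mu>0 by blast
qed

end

text \<open>
  Two derivatives of \<open>f\<close> give the bounds used above. The orbits, which are obtained for each \<open>\<mu>\<close> separately, are collected into a
  family; only the entry and exit times depend on \<open>\<eta>\<close>.
\<close>

theorem corollary2p1:
  "\<exists>r::nat. \<forall>(f :: real ^ 'n::finite \<Rightarrow> real) (\<omega> :: real ^ 'n) (\<gamma>::real) (\<tau>::real).
     C_k r f \<and> torus_periodic f \<and> \<gamma> > 0 \<and> \<tau> > real CARD('n) \<and> diophantine \<omega> \<gamma> \<tau> \<and>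
     (\<exists>A. nondegenerate_minimum (melnikov \<omega> f) A) \<longrightarrow>
     (\<exists>\<mu>0>0. \<exists>\<eta>0>0. \<forall>I0 I1. \<omega> \<bullet> I0 = \<omega> \<bullet> I1 \<longrightarrow>
       (\<exists>x :: real \<Rightarrow> real \<Rightarrow> 'n phase.
          (\<forall>\<mu>\<in>{0<..<\<mu>0}. heteroclinic (hamiltonian \<omega> f \<mu>) I0 I1 (x \<mu>)) \<and>
          (\<forall>\<eta>\<in>{0<..<\<eta>0}. \<exists>t1 t2 :: real \<Rightarrow> real.
             (\<forall>\<mu>\<in>{0<..<\<mu>0}. t1 \<mu> < t2 \<mu> \<and>
                x \<mu> (t1 \<mu>) \<in> torus_nbhd \<eta> I0 \<and> x \<mu> (t2 \<mu>) \<in> torus_nbhd \<eta> I1) \<and>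
             (\<lambda>\<mu>. t2 \<mu> - t1 \<mu>) \<in> O[at_right 0](\<lambda>\<mu>. 1 / \<mu> * ln (1 / \<mu>)))))"
proof (rule exI[of _ "2::nat"], intro allI impI, elim conjE exE)
  fix f :: "real ^ 'n \<Rightarrow> real" and \<omega> :: "real ^ 'n" and \<gamma> \<tau> :: real and A0
  assume C: "C_k 2 f" and per: "torus_periodic f" and \<gamma>: "\<gamma> > 0" "diophantine \<omega> \<gamma> \<tau>"
    and min: "nondegenerate_minimum (melnikov \<omega> f) A0"
  obtain F where F: "F \<ge> 1" "\<And>x. f differentiable (at x)" "\<And>x. \<bar>f x\<bar> \<le> F" "\<And>x. norm (grad f x) \<le> F"
    "\<And>x y. norm (grad f x - grad f y) \<le> F * norm (x - y)"
    using C_k_2_bounds[OF C per] by blast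
  interpret pendulum f \<omega> F by unfold_locales (use F per in auto)
  define D where "D = 60 + 4500 * F"
  obtain \<mu>0 where \<mu>0: "\<mu>0 > 0" "\<mu>0 \<le> 1 / 3" and drift: "\<And>I0 I1. \<omega> \<bullet> I0 = \<omega> \<bullet> I1 \<Longrightarrow> \<exists>C\<ge>0. \<forall>\<mu>\<in>{0<..<\<mu>0}. \<exists>x a b.
    fast_heteroclinic D (hamiltonian \<omega> f \<mu>) I0 I1 x a b \<and> b - a \<le> C * (1 / \<mu> * ln (1 / \<mu>))"
    using drift_orbits[OF min diophantine_nonzero[OF \<gamma>]] unfolding D_def by blast
  show "\<exists>\<mu>0>0. \<exists>\<eta>0>0. \<forall>I0 I1. \<omega> \<bullet> I0 = \<omega> \<bullet> I1 \<longrightarrow>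
       (\<exists>x :: real \<Rightarrow> real \<Rightarrow> 'n phase.
          (\<forall>\<mu>\<in>{0<..<\<mu>0}. heteroclinic (hamiltonian \<omega> f \<mu>) I0 I1 (x \<mu>)) \<and>
          (\<forall>\<eta>\<in>{0<..<\<eta>0}. \<exists>t1 t2 :: real \<Rightarrow> real.
             (\<forall>\<mu>\<in>{0<..<\<mu>0}. t1 \<mu> < t2 \<mu> \<and>
                x \<mu> (t1 \<mu>) \<in> torus_nbhd \<eta> I0 \<and> x \<mu> (t2 \<mu>) \<in> torus_nbhd \<eta> I1) \<and>
             (\<lambda>\<mu>. t2 \<mu> - t1 \<mu>) \<in> O[at_right 0](\<lambda>\<mu>. 1 / \<mu> * ln (1 / \<mu>))))"
  proof (rule exI[of _ \<mu>0], rule conjI[OF \<mu>0(1)], rule exI[of _ 1], rule conjI[OF zero_less_one], intro allI impI)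
    fix I0 I1 :: "real ^ 'n" assume res: "\<omega> \<bullet> I0 = \<omega> \<bullet> I1"
    obtain C where C: "C \<ge> 0" and "\<forall>\<mu>\<in>{0<..<\<mu>0}. \<exists>x a b.
        fast_heteroclinic D (hamiltonian \<omega> f \<mu>) I0 I1 x a b \<and> b - a \<le> C * (1 / \<mu> * ln (1 / \<mu>))"
      using drift[OF res] by blast
    then obtain x a b where good: "\<And>\<mu>. \<mu> \<in> {0<..<\<mu>0} \<Longrightarrow> fast_heteroclinic D (hamiltonian \<omega> f \<mu>) I0 I1 (x \<mu>) (a \<mu>) (b \<mu>)"
      and len: "\<And>\<mu>. \<mu> \<in> {0<..<\<mu>0} \<Longrightarrow> b \<mu> - a \<mu> \<le> C * (1 / \<mu> * ln (1 / \<mu>))"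
      by metis
    have x: "\<And>\<mu>. \<mu> \<in> {0<..<\<mu>0} \<Longrightarrow> heteroclinic (hamiltonian \<omega> f \<mu>) I0 I1 (x \<mu>)"
      and ab: "\<And>\<mu>. \<mu> \<in> {0<..<\<mu>0} \<Longrightarrow> a \<mu> \<le> b \<mu>"
      and s0: "\<And>\<mu> t. \<mu> \<in> {0<..<\<mu>0} \<Longrightarrow> t \<le> a \<mu> - 1 \<Longrightarrow> infdist (x \<mu> t) (inv_torus I0) \<le> D * exp (- (1/5) * \<bar>t - a \<mu>\<bar>)"
      and s1: "\<And>\<mu> t. \<mu> \<in> {0<..<\<mu>0} \<Longrightarrow> t \<ge> b \<mu> + 1 \<Longrightarrow> infdist (x \<mu> t) (inv_torus I1) \<le> D * exp (- (1/5) * \<bar>t - b \<mu>\<bar>)"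
      using good unfolding fast_heteroclinic_def by simp_all
    have "\<exists>t1 t2 :: real \<Rightarrow> real. (\<forall>\<mu>\<in>{0<..<\<mu>0}. t1 \<mu> < t2 \<mu> \<and>
        x \<mu> (t1 \<mu>) \<in> torus_nbhd \<eta> I0 \<and> x \<mu> (t2 \<mu>) \<in> torus_nbhd \<eta> I1) \<and>
        (\<lambda>\<mu>. t2 \<mu> - t1 \<mu>) \<in> O[at_right 0](\<lambda>\<mu>. 1 / \<mu> * ln (1 / \<mu>))" if \<eta>: "\<eta> \<in> {0<..<1}" for \<eta>
    proof -
      \<comment> \<open>Waiting this long before the first and after the last crossing brings the exponential bound below \<open>\<eta>\<close>. The waiting
        time is independent of \<open>\<mu>\<close>, so it does not affect the order of the diffusion time.\<close>
      define R where "R = 5 * ln (D / \<eta>) + 5"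
      have "D > 1" using F1 by (simp add: D_def)
      then have D\<eta>: "D / \<eta> > 1" using \<eta> by (simp add: field_simps)
      then have R: "R \<ge> 1" by (simp add: R_def)
      have "exp (- (1/5) * R) = exp (-1) * (\<eta> / D)"
      proof -
        have "- (1/5) * R = - 1 + - ln (D / \<eta>)" unfolding R_def by argo
        then have "exp (- (1/5) * R) = exp (-1) * exp (- ln (D / \<eta>))" by (simp only: exp_add)
        then show ?thesis using D\<eta> by (simp add: exp_minus)
      qed
      moreover have "exp (-1::real) < 1" by simp
      moreover have "\<eta> / D > 0" using \<eta> \<open>D > 1\<close> by simp
      ultimately have "exp (- (1/5) * R) < \<eta> / D" using mult_strict_right_mono[of "exp (-1)" 1 "\<eta> / D"] by simp
      then have RD: "D * exp (- (1/5) * R) < \<eta>" using \<open>D > 1\<close> by (simp add: pos_less_divide_eq mult.commute)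
      have near: "x \<mu> (a \<mu> - R) \<in> torus_nbhd \<eta> I0" "x \<mu> (b \<mu> + R) \<in> torus_nbhd \<eta> I1" if "\<mu> \<in> {0<..<\<mu>0}" for \<mu>
        using s0[OF that, of "a \<mu> - R"] s1[OF that, of "b \<mu> + R"] R RD by (simp_all add: torus_nbhd_def)
      have lt: "a \<mu> - R < b \<mu> + R" if "\<mu> \<in> {0<..<\<mu>0}" for \<mu> using ab[OF that] R by linarith
      have O: "(\<lambda>\<mu>. (b \<mu> + R) - (a \<mu> - R)) \<in> O[at_right 0](\<lambda>\<mu>. 1 / \<mu> * ln (1 / \<mu>))"
      proof (rule bigoI[where c = "C + 2 * R"])
        show "\<forall>\<^sub>F \<mu> in at_right 0. norm ((b \<mu> + R) - (a \<mu> - R)) \<le> (C + 2 * R) * norm (1 / \<mu> * ln (1 / \<mu>))"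
          using eventually_at_right_real[OF \<mu>0(1)]
        proof eventually_elim
          case (elim \<mu>)
          have mu: "0 < \<mu>" "\<mu> < 1 / 3" using elim \<mu>0(2) by auto
          have ln1: "ln (1 / \<mu>) > 1" using ln_inverse_gt_1 mu(1,2) by simp
          have "1 * 1 \<le> 1 / \<mu> * ln (1 / \<mu>)" using mu ln1 by (intro mult_mono) (auto simp: field_simps)
          then have u: "1 \<le> 1 / \<mu> * ln (1 / \<mu>)" by simp
          have "norm ((b \<mu> + R) - (a \<mu> - R)) = b \<mu> - a \<mu> + 2 * R" using ab[OF elim] R by simp
          also have "\<dots> \<le> C * (1 / \<mu> * ln (1 / \<mu>)) + 2 * R * (1 / \<mu> * ln (1 / \<mu>))"
            using len[OF elim] mult_left_mono[OF u, of "2 * R"] R by simp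
          also have "\<dots> = (C + 2 * R) * (1 / \<mu> * ln (1 / \<mu>))" by (rule distrib_right[symmetric])
          also have "1 / \<mu> * ln (1 / \<mu>) = norm (1 / \<mu> * ln (1 / \<mu>))" unfolding real_norm_def using u by (subst abs_of_nonneg) auto
          finally show ?case .
        qed
      qed
      show ?thesis
        by (rule exI[of _ "\<lambda>\<mu>. a \<mu> - R"], rule exI[of _ "\<lambda>\<mu>. b \<mu> + R"], intro conjI ballI near lt O)
    qed
    then show "\<exists>x :: real \<Rightarrow> real \<Rightarrow> 'n phase.
          (\<forall>\<mu>\<in>{0<..<\<mu>0}. heteroclinic (hamiltonian \<omega> f \<mu>) I0 I1 (x \<mu>)) \<and>
          (\<forall>\<eta>\<in>{0<..<1}. \<exists>t1 t2 :: real \<Rightarrow> real.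
             (\<forall>\<mu>\<in>{0<..<\<mu>0}. t1 \<mu> < t2 \<mu> \<and>
                x \<mu> (t1 \<mu>) \<in> torus_nbhd \<eta> I0 \<and> x \<mu> (t2 \<mu>) \<in> torus_nbhd \<eta> I1) \<and>
             (\<lambda>\<mu>. t2 \<mu> - t1 \<mu>) \<in> O[at_right 0](\<lambda>\<mu>. 1 / \<mu> * ln (1 / \<mu>)))"
      using x by blast
  qed
qed

end
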